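(* For all integers $k\ge 3$, $1\le \ell<k/2$ and $k-\ell\le d\le k-1$, we have $$h_d^\ell(k)\le t(k,d,\ell).$$
   Context: A $k$-graph $H=(V,E)$ consists of a finite vertex set $V$ and a family $E$ of $k$-element subsets of $V$. For a $d$-set $S\subseteq V$, $\deg_H(S)$ is the number of $(k-d)$-sets $T\subseteq V$ with $T\cup S\in E$, and $\delta_d(H)$ is the minimum of $\deg_H(S)$ over all $d$-sets $S\subseteq V$. For $1\le \ell<k$, a $k$-graph is an $\ell$-cycle if there is a cyclic ordering of its vertices such that every edge consists of $k$ consecutive vertices and any two consecutive edges share exactly $\ell$ vertices (so an $\ell$-cycle on $n$ vertices has exactly $n/(k-\ell)$ edges, and every vertex is in an edge). A $k$-graph on $n$ vertices contains a Hamilton $\ell$-cycle if it contains an $\ell$-cycle as a spanning subhypergraph; this requires $(k-\ell)\mid n$. $h_d^\ell(k,n)$ is the smallest integer $h$ such that every $n$-vertex $k$-graph $H$ with $\delta_d(H)\ge h$ contains a Hamilton $\ell$-cycle, and $$h_d^\ell(k):=\limsup_{n\to\infty}\frac{h_d^\ell(k,n)}{\binom{n}{k-d}},$$ where $n$ ranges over multiples of $k-\ell$. For $k>b\ge 0$, $Y_{k,b}$ is the $k$-graph on $2k-b$ vertices consisting of two edges that intersect in exactly $b$ vertices. A $Y_{k,b}$-tiling in $H$ is a collection of vertex-disjoint copies of $Y_{k,b}$ in $H$ (not necessarily induced). For $\varepsilon>0$, $t_d^\ell(k,n,\varepsilon)$ is the minimum integer $t$ such that every $k$-graph $H$ on $n$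 vertices with $\delta_d(H)\ge t$ contains a $Y_{k,2\ell}$-tiling covering all but at most $\varepsilon n$ vertices of $H$, and $$t(k,d,\ell):=\limsup_{\varepsilon\to 0^+}\ \limsup_{n\to\infty}\frac{t_d^\ell(k,n,\varepsilon)}{\binom{n}{k-d}}.$$ *)

theory Defs
  imports Complex_Main "HOL-Library.Extended_Real"
begin

text \<open>A hypergraph is a pair of a vertex set and a set of edges.\<close>

type_synonym 'a hypergraph = "'a set \<times> 'a set set"

abbreviation verts :: "'a hypergraph \<Rightarrow> 'a set" where
  "verts H \<equiv> fst H"

abbreviation edges :: "'a hypergraph \<Rightarrow> 'a set set" where
  "edges H \<equiv> snd H"

definition k_graph :: "nat \<Rightarrow> 'a hypergraph \<Rightarrow> bool" where
  "k_graph k H \<longleftrightarrow> finite (verts H) \<and> (\<forall>e\<in>edges H. e \<subseteq> verts H \<and> card e = k)"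

definition subhypergraph :: "'a hypergraph \<Rightarrow> 'a hypergraph \<Rightarrow> bool" where
  "subhypergraph F H \<longleftrightarrow> verts F \<subseteq> verts H \<and> edges F \<subseteq> edges H"

definition hdegree :: "nat \<Rightarrow> nat \<Rightarrow> 'a hypergraph \<Rightarrow> 'a set \<Rightarrow> nat" where
  "hdegree k d H S = card {T. T \<subseteq> verts H \<and> card T = k - d \<and> T \<union> S \<in> edges H}"

text \<open>Meaningful when \<open>H\<close> has at least \<open>d\<close> vertices; otherwise the minimum is over the
  empty set. All uses below are asymptotic in the number of vertices.\<close>

definition min_degree :: "nat \<Rightarrow> nat \<Rightarrow> 'a hypergraph \<Rightarrow> nat" where
  "min_degree k d H = Min {hdegree k d H S | S. S \<subseteq> verts H \<and> card S = d}"

text \<open>The cyclic ordering of the vertices is given by the list \<open>vs\<close>, read cyclically; the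
  \<open>k\<close> consecutive vertices starting at position \<open>p\<close> are \<open>set (take k (rotate p vs))\<close>. The
  edges are enumerated in cyclic order by their starting positions \<open>s 0 < \<dots> < s (m - 1)\<close>,
  so the edge following the \<open>i\<close>-th one has index \<open>Suc i mod m\<close>. The last two conjuncts
  are automatic up to degenerate configurations, such as two edges sharing \<open>l\<close> vertices
  in a long cyclic order most of which is left uncovered.\<close>

definition l_cycle :: "nat \<Rightarrow> nat \<Rightarrow> 'a hypergraph \<Rightarrow> bool" where
  "l_cycle k l C \<longleftrightarrow> k_graph k C \<and>
     (\<exists>vs s m. distinct vs \<and> set vs = verts C \<and>
        strict_mono_on {..<m} s \<and> s ` {..<m} \<subseteq> {..<length vs} \<and>
        edges C = (\<lambda>i. set (take k (rotate (s i) vs))) ` {..<m} \<and>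
        (\<forall>i<m. card (set (take k (rotate (s i) vs)) \<inter>
                      set (take k (rotate (s (Suc i mod m)) vs))) = l) \<and>
        card (edges C) * (k - l) = card (verts C) \<and>
        \<Union> (edges C) = verts C)"

definition has_hamilton_l_cycle :: "nat \<Rightarrow> nat \<Rightarrow> 'a hypergraph \<Rightarrow> bool" where
  "has_hamilton_l_cycle k l H \<longleftrightarrow>
     (\<exists>C. l_cycle k l C \<and> subhypergraph C H \<and> verts C = verts H)"

text \<open>Since every finite hypergraph is isomorphic to one on natural numbers, the
  hypergraphs quantified over in the two thresholds have vertices in \<^typ>\<open>nat\<close>.
  Thresholds range over the naturals, minimum degrees being nonnegative.\<close>

definition h_threshold :: "nat \<Rightarrow> nat \<Rightarrow> nat \<Rightarrow> nat \<Rightarrow> nat" where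
  "h_threshold d l k n =
     (LEAST h. \<forall>H :: nat hypergraph. k_graph k H \<longrightarrow> card (verts H) = n \<longrightarrow>
        min_degree k d H \<ge> h \<longrightarrow> has_hamilton_l_cycle k l H)"

definition h_density :: "nat \<Rightarrow> nat \<Rightarrow> nat \<Rightarrow> ereal" where
  "h_density d l k =
     Limsup (inf sequentially (principal {n. (k - l) dvd n}))
       (\<lambda>n. ereal (real (h_threshold d l k n) / real (n choose (k - d))))"

text \<open>The copies of $Y_{k,b}$: two edges meeting in exactly \<open>b\<close> vertices, on \<open>2k - b\<close>
  vertices (so every vertex lies in an edge).\<close>

definition is_Y :: "nat \<Rightarrow> nat \<Rightarrow> 'a hypergraph \<Rightarrow> bool" where
  "is_Y k b F \<longleftrightarrow> k_graph k F \<and> card (verts F) = 2 * k - b \<and>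
     (\<exists>e f. e \<noteq> f \<and> edges F = {e, f} \<and> card (e \<inter> f) = b)"

definition Y_tiling :: "nat \<Rightarrow> nat \<Rightarrow> 'a hypergraph \<Rightarrow> 'a hypergraph set \<Rightarrow> bool" where
  "Y_tiling k b H \<T> \<longleftrightarrow>
     (\<forall>F\<in>\<T>. is_Y k b F \<and> subhypergraph F H) \<and>
     (\<forall>F\<in>\<T>. \<forall>G\<in>\<T>. F \<noteq> G \<longrightarrow> verts F \<inter> verts G = {})"

definition t_threshold :: "nat \<Rightarrow> nat \<Rightarrow> nat \<Rightarrow> nat \<Rightarrow> real \<Rightarrow> nat" where
  "t_threshold d l k n \<epsilon> =
     (LEAST t. \<forall>H :: nat hypergraph. k_graph k H \<longrightarrow> card (verts H) = n \<longrightarrow>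
        min_degree k d H \<ge> t \<longrightarrow>
        (\<exists>\<T>. Y_tiling k (2 * l) H \<T> \<and>
             real (card (verts H - (\<Union>F\<in>\<T>. verts F))) \<le> \<epsilon> * real n))"

definition t_density :: "nat \<Rightarrow> nat \<Rightarrow> nat \<Rightarrow> ereal" where
  "t_density k d l =
     Limsup (at_right 0) (\<lambda>\<epsilon>. limsup (\<lambda>n.
       ereal (real (t_threshold d l k n \<epsilon>) / real (n choose (k - d)))))"

end

theory Submission
  imports Defs "HOL-Library.FuncSet" "HOL-Library.Multiset"
begin

text \<open>The absorbing method, without hypergraph regularity. Since \<open>d \<ge> k - l\<close>, every set of at most
  \<open>k - l\<close> vertices lies in a positive proportion of the edges it could lie in; this makes it possible to connect
  any two \<open>l\<close>-tuples by many short \<open>l\<close>-paths, and to exchange almost any two vertices inside a path by many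
  small gadgets. Chaining such exchanges gives absorbers for almost all \<open>(k - l)\<close>-sets; the few exceptional vertices
  are put on the cycle by hand. A small random-like family of absorbers and a reservoir of connectors are set aside, the
  remaining vertices are almost covered by paths that are long enough for the reservoir to join them all into a cycle,
  and the uncovered vertices are absorbed.

  The path covering is where \<open>t(k, d, l)\<close> enters. Given nonnegative vertex weights, a random sample of
  bounded size still has minimum degree above the tiling threshold, so it contains a copy of \<open>Y\<close> of at most
  average weight. Hence there are densely many light copies of \<open>Y\<close>, and from them a long light path is built
  greedily. If the weight of a vertex measures how fast the potential \<open>\<Sum>\<^sub>S exp (- \<gamma> deg S)\<close>,
  \<open>\<gamma> = sqrt n\<close>, grows when the vertex is deleted, then removing light paths one after another
  keeps all normalised \<open>d\<close>-degrees above the threshold until almost nothing is left.\<close>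

section \<open>Counting tuples and robustly connected kernels\<close>

text \<open>Why \<open>Y\<close> with intersection 2l: arrange its vertices as L A L' B with L and
  L' of length l. Its edges are L A L' and L' B L, so it is a closed walk of two edges. Winding
  through many similar copies gives long l-paths that visit the four blocks equally often, hence of
  nearly the same average weight per vertex as one copy.

  Why \<gamma> = sqrt n: to control each single d-set through the sum, \<gamma> must dominate d ln
  n. The second-order errors have order \<gamma>^2 / n^2 per path, and O(n) paths are removed, so
  \<gamma>^2 must be O(n).

  The degree condition acts through richness of sets of l + 1 \<le> k - l vertices. Such a set
  contains two l-tuples differing in one entry, which gives expansion across cuts of the l-tuples;
  it is also the part of the edge common to both paths of a gadget that is fixed in advance.
  Connections and exchanges both follow from one fact on symmetric kernels: positive density inside
  every subset and across every balanced cut makes almost all points mutually reachable in boundedly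
  many steps, with a positive density of walks.\<close>

definition tup :: "'a set \<Rightarrow> nat \<Rightarrow> 'a list set" where
  "tup V j = {xs. set xs \<subseteq> V \<and> length xs = j}"

lemma tup_iff: "xs \<in> tup V j \<longleftrightarrow> set xs \<subseteq> V \<and> length xs = j"
  by (simp add: tup_def)

lemma finite_tup: "finite V \<Longrightarrow> finite (tup V j)"
  unfolding tup_def by (rule finite_lists_length_eq)

lemma card_tup: "finite V \<Longrightarrow> card (tup V j) = card V ^ j"
  unfolding tup_def by (rule card_lists_length_eq)

lemma tup_0 [simp]: "tup V 0 = {[]}"
  by (auto simp: tup_def)

lemma take_drop_tup: "zs \<in> tup V (i + j) \<Longrightarrow> take i zs \<in> tup V i \<and> drop i zs \<in> tup V j"
  by (auto simp: tup_def dest: in_set_takeD in_set_dropD)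

lemma card_tup_append:
  assumes "finite V"
  shows "card {zs \<in> tup V (i + j). P (take i zs) (drop i zs)} =
    (\<Sum>xs\<in>tup V i. card {ys \<in> tup V j. P xs ys})"
proof -
  have "card {zs \<in> tup V (i + j). P (take i zs) (drop i zs)} =
      card (SIGMA xs:tup V i. {ys \<in> tup V j. P xs ys})"
    by (rule bij_betw_same_card[where f = "\<lambda>zs. (take i zs, drop i zs)"],
        rule bij_betw_byWitness[where f' = "\<lambda>(xs, ys). xs @ ys"])
       (auto simp: take_drop_tup, auto simp: tup_def dest: in_set_takeD in_set_dropD)
  then show ?thesis
    using assms by (simp add: card_SigmaI finite_tup)
qed

lemma card_tup_Cons:
  assumes "finite V"
  shows "card {zs \<in> tup V (Suc j). P (hd zs) (tl zs)} = (\<Sum>x\<in>V. card {ys \<in> tup V j. P x ys})"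
proof -
  have "card {zs \<in> tup V (Suc j). P (hd zs) (tl zs)} =
      card (SIGMA x:V. {ys \<in> tup V j. P x ys})"
    by (rule bij_betw_same_card[where f = "\<lambda>zs. (hd zs, tl zs)"],
        rule bij_betw_byWitness[where f' = "\<lambda>(x, ys). x # ys"])
       (auto simp: tup_def length_Suc_conv)
  then show ?thesis
    using assms by (simp add: card_SigmaI finite_tup)
qed

definition fresh :: "'a set \<Rightarrow> 'a list \<Rightarrow> bool" where
  "fresh F xs \<longleftrightarrow> distinct xs \<and> set xs \<inter> F = {}"

text \<open>Union bound: a tuple that is not fresh has an entry in \<open>F\<close> or two equal
  entries, and each such coincidence concerns a fraction 1 / \<open>card V\<close> of all tuples.
  Multiplying by \<open>card V\<close> keeps the count in the naturals.\<close>

lemma card_not_fresh: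
  assumes "finite V" "finite F"
  shows "card V * card {xs \<in> tup V j. \<not> fresh F xs} \<le> (j * card F + j * j) * card V ^ j"
proof (induction j)
  case 0
  then show ?case by (simp add: fresh_def)
next
  case (Suc j)
  let ?B = "{xs \<in> tup V j. \<not> fresh F xs}"
  have "card {zs \<in> tup V (Suc j). \<not> fresh F zs}
      \<le> card {zs \<in> tup V (Suc j). hd zs \<in> F \<or> hd zs \<in> set (tl zs) \<or> \<not> fresh F (tl zs)}"
    by (rule card_mono[OF finite_subset[OF _ finite_tup[OF assms(1), of "Suc j"]]])
       (auto simp: fresh_def tup_def length_Suc_conv)
  also have "\<dots> = (\<Sum>x\<in>V. card {ys \<in> tup V j. x \<in> F \<or> x \<in> set ys \<or> \<not> fresh F ys})"
    using card_tup_Cons[OF assms(1), of j "\<lambda>x ys. x \<in> F \<or> x \<in> set ys \<or> \<not> fresh F ys"] by simp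
  also have "\<dots> \<le> (\<Sum>x\<in>V. (if x \<in> F then card V ^ j else 0) + card {ys \<in> tup V j. x \<in> set ys} + card ?B)"
  proof (rule sum_mono)
    fix x
    have "{ys \<in> tup V j. x \<in> F \<or> x \<in> set ys \<or> \<not> fresh F ys} \<subseteq>
       (if x \<in> F then tup V j else {}) \<union> {ys \<in> tup V j. x \<in> set ys} \<union> ?B" by auto
    then have "card {ys \<in> tup V j. x \<in> F \<or> x \<in> set ys \<or> \<not> fresh F ys} \<le>
       card ((if x \<in> F then tup V j else {}) \<union> {ys \<in> tup V j. x \<in> set ys} \<union> ?B)"
      by (intro card_mono) (auto simp: finite_tup assms)
    also have "\<dots> \<le> card (if x \<in> F then tup V j else {}) + card {ys \<in> tup V j. x \<in> set ys} + card ?B"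
      by (intro order.trans[OF card_Un_le] add_mono card_Un_le order.refl)
    finally show "card {ys \<in> tup V j. x \<in> F \<or> x \<in> set ys \<or> \<not> fresh F ys} \<le>
      (if x \<in> F then card V ^ j else 0) + card {ys \<in> tup V j. x \<in> set ys} + card ?B"
      by (simp add: card_tup assms split: if_splits)
  qed
  also have "\<dots> = card (V \<inter> F) * card V ^ j + (\<Sum>x\<in>V. card {ys \<in> tup V j. x \<in> set ys}) + card V * card ?B"
    using assms by (simp add: sum.distrib sum.If_cases)
  also have "(\<Sum>x\<in>V. card {ys \<in> tup V j. x \<in> set ys}) = (\<Sum>ys\<in>tup V j. card {x \<in> V. x \<in> set ys})"
    by (rule sum_multicount_gen[where R = "\<lambda>x ys. x \<in> set ys"]) (auto simp: assms finite_tup)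
  also have "\<dots> \<le> (\<Sum>ys\<in>tup V j. j)"
  proof (rule sum_mono)
    fix ys assume "ys \<in> tup V j"
    then have "card {x \<in> V. x \<in> set ys} \<le> card (set ys)" "length ys = j"
      by (auto simp: tup_def intro: card_mono)
    then show "card {x \<in> V. x \<in> set ys} \<le> j"
      using card_length[of ys] by linarith
  qed
  also have "\<dots> = j * card V ^ j"
    by (simp add: card_tup assms)
  finally have "card {zs \<in> tup V (Suc j). \<not> fresh F zs}
     \<le> card (V \<inter> F) * card V ^ j + j * card V ^ j + card V * card ?B" by simp
  also have "\<dots> \<le> card F * card V ^ j + j * card V ^ j + (j * card F + j * j) * card V ^ j"
    using Suc.IH assms by (intro add_mono mult_right_mono card_mono) auto
  finally have "card V * card {zs \<in> tup V (Suc j). \<not> fresh F zs} \<le>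
     card V * ((card F + j + j * card F + j * j) * card V ^ j)"
    by (intro mult_left_mono) (auto simp: algebra_simps)
  also have "\<dots> = (card F + j + j * card F + j * j) * card V ^ Suc j"
    by simp
  also have "\<dots> \<le> (Suc j * card F + Suc j * Suc j) * card V ^ Suc j"
    by (rule mult_right_mono) (auto simp: algebra_simps)
  finally show ?case .
qed

text \<open>The form in which most greedy choices below are made: passing from a dense family of
  tuples to its distinct members outside \<open>F\<close> costs only the density \<theta>.\<close>

lemma card_fresh_ge:
  fixes \<eta> \<theta> :: real
  assumes V: "finite V" and A: "A \<subseteq> tup V j" and F: "finite F"
    and big: "real (card A) \<ge> \<eta> * real (card V) ^ j"
    and small: "real (j * card F + j * j) \<le> \<theta> * card V" and ne: "V \<noteq> {}"
  shows "card {xs \<in> A. fresh F xs} \<ge> (\<eta> - \<theta>) * real (card V) ^ j"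
proof -
  let ?B = "{xs \<in> tup V j. \<not> fresh F xs}"
  have n: "real (card V) > 0" using V ne by (simp add: card_gt_0_iff)
  have "A \<subseteq> {xs \<in> A. fresh F xs} \<union> ?B" using A by auto
  then have "card A \<le> card ({xs \<in> A. fresh F xs} \<union> ?B)"
    by (rule card_mono[rotated]) (use A V finite_tup[OF V, of j] in \<open>auto intro: finite_subset\<close>)
  also have "\<dots> \<le> card {xs \<in> A. fresh F xs} + card ?B" by (rule card_Un_le)
  finally have 1: "real (card A) \<le> card {xs \<in> A. fresh F xs} + card ?B" by linarith
  have "real (card V) * card ?B \<le> real ((j * card F + j * j) * card V ^ j)"
    using card_not_fresh[OF V F, of j] by (metis of_nat_le_iff of_nat_mult)
  also have "\<dots> \<le> \<theta> * card V * real (card V) ^ j"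
    using mult_right_mono[OF small, of "real (card V) ^ j"] by simp
  finally have "real (card V) * card ?B \<le> real (card V) * (\<theta> * real (card V) ^ j)"
    by (simp add: mult_ac)
  then have "card ?B \<le> \<theta> * real (card V) ^ j"
    using n by (simp only: mult_le_cancel_left_pos)
  with 1 big show ?thesis by (simp add: left_diff_distrib)
qed

section \<open>Symmetric kernels: Cauchy-Schwarz, robust cores and reachability\<close>

lemma sum_squared_le:
  fixes f :: "'b \<Rightarrow> real"
  assumes "finite Z"
  shows "(\<Sum>z\<in>Z. f z)\<^sup>2 \<le> card Z * (\<Sum>z\<in>Z. (f z)\<^sup>2)"
proof (cases "Z = {}")
  case False
  let ?n = "real (card Z)" let ?s = "\<Sum>z\<in>Z. f z"
  have n: "?n > 0" using assms False by (simp add: card_gt_0_iff)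
  have "0 \<le> (\<Sum>z\<in>Z. (?n * f z - ?s)\<^sup>2)" by (rule sum_nonneg) simp
  also have "\<dots> = (\<Sum>z\<in>Z. ?n\<^sup>2 * (f z)\<^sup>2 - 2 * ?n * ?s * f z + ?s\<^sup>2)"
    by (rule sum.cong) (auto simp: power2_eq_square algebra_simps)
  also have "\<dots> = ?n\<^sup>2 * (\<Sum>z\<in>Z. (f z)\<^sup>2) - 2 * ?n * ?s * ?s + ?n * ?s\<^sup>2"
    by (simp add: sum.distrib sum_subtractf sum_distrib_left)
  also have "\<dots> = ?n * (?n * (\<Sum>z\<in>Z. (f z)\<^sup>2) - ?s\<^sup>2)"
    by (simp add: power2_eq_square algebra_simps)
  finally show ?thesis using n by (simp add: zero_le_mult_iff)
qed simp

text \<open>For cuts: configurations visible from both sides are counted by the minimum, whereas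
  pairs across the cut are counted by the product.\<close>

lemma sum_min_squared_le:
  fixes \<alpha> \<beta> :: "'b \<Rightarrow> real"
  assumes "finite Z" "\<And>z. z \<in> Z \<Longrightarrow> \<alpha> z \<ge> 0" "\<And>z. z \<in> Z \<Longrightarrow> \<beta> z \<ge> 0"
  shows "(\<Sum>z\<in>Z. min (\<alpha> z) (\<beta> z))\<^sup>2 \<le> card Z * (\<Sum>z\<in>Z. \<alpha> z * \<beta> z)"
proof -
  have "(\<Sum>z\<in>Z. (min (\<alpha> z) (\<beta> z))\<^sup>2) \<le> (\<Sum>z\<in>Z. \<alpha> z * \<beta> z)"
    using assms by (intro sum_mono) (auto simp: min_def power2_eq_square intro: mult_mono)
  then show ?thesis
    using sum_squared_le[OF assms(1), of "\<lambda>z. min (\<alpha> z) (\<beta> z)"]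
    by (meson mult_left_mono of_nat_0_le_iff order.trans)
qed

text \<open>The density of walks from \<open>x\<close> to \<open>y\<close> in the kernel. The index
  is the number of intermediate points, so index 0 is already one step.\<close>

primrec kernel_iterate :: "('x \<Rightarrow> 'x \<Rightarrow> real) \<Rightarrow> 'x set \<Rightarrow> nat \<Rightarrow> 'x \<Rightarrow> 'x \<Rightarrow> real" where
  "kernel_iterate p X 0 x y = p x y"
| "kernel_iterate p X (Suc i) x y = (\<Sum>w\<in>X. p x w * kernel_iterate p X i w y) / card X"

text \<open>The core is a set maximising its inner mass minus a charge of \<open>2 * t\<close> per
  point. Dropping one of its points cannot increase this value, so every row sum inside is at least
  \<open>t\<close>. Taking all of \<open>X\<close> cannot increase it either, so the inner mass of
  the complement is at most linear in its size, whereas \<open>dens\<close> makes it quadratic;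
  hence the complement is small.\<close>

lemma robust_core:
  fixes p :: "'x \<Rightarrow> 'x \<Rightarrow> real" and c1 \<xi> :: real
  assumes fin: "finite X" and sym: "\<And>x y. p x y = p y x" and p0: "\<And>x y. 0 \<le> p x y"
    and dens: "\<And>Q. Q \<subseteq> X \<Longrightarrow> (\<Sum>x\<in>Q. \<Sum>y\<in>Q. p x y) \<ge> c1 * (real (card Q))\<^sup>2"
    and c1: "0 < c1" and \<xi>: "0 < \<xi>"
  obtains X' where "X' \<subseteq> X" "real (card (X - X')) \<le> \<xi> * card X"
    "\<And>x. x \<in> X' \<Longrightarrow> (\<Sum>y\<in>X'. p x y) \<ge> c1 * \<xi> / 4 * card X"
proof -
  define t where "t = c1 * \<xi> / 4 * card X"
  define S where "S A B = (\<Sum>x\<in>A. \<Sum>y\<in>B. p x y)" for A B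
  define F where "F A = S A A - 2 * t * card A" for A
  have S0: "S A B \<ge> 0" for A B unfolding S_def by (intro sum_nonneg p0)
  have "finite (F ` Pow X)" "F ` Pow X \<noteq> {}" using fin by auto
  then have "Max (F ` Pow X) \<in> F ` Pow X" by (rule Max_in)
  then obtain A where A: "A \<subseteq> X" "F A = Max (F ` Pow X)" by auto
  have max: "F B \<le> F A" if "B \<subseteq> X" for B
    using that A fin by (metis Max_ge Pow_iff finite_Pow_iff finite_imageI imageI)
  have finA: "finite A" using A fin finite_subset by blast
  have split: "S X X \<ge> S A A + S (X - A) (X - A)"
  proof -
    have "S X B = S A B + S (X - A) B" for B
      unfolding S_def by (rule sum.subset_diff[OF A(1) fin, THEN trans]) (rule add.commute)
    moreover have "S B X = S B A + S B (X - A)" for B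
      unfolding S_def sum.distrib[symmetric]
      by (rule sum.cong[OF refl], rule sum.subset_diff[OF A(1) fin, THEN trans]) (rule add.commute)
    ultimately show ?thesis using S0[of "X - A" A] S0[of A "X - A"] by simp
  qed
  show ?thesis
  proof (rule that[of A])
    show "A \<subseteq> X" by fact
    let ?q = "real (card (X - A))"
    have "F X \<le> F A" by (rule max) simp
    then have "S (X - A) (X - A) \<le> 2 * t * (real (card X) - real (card A))"
      using split by (simp add: F_def algebra_simps)
    also have "real (card X) - real (card A) = ?q"
      using A fin card_mono[OF fin A(1)] by (simp add: card_Diff_subset finA of_nat_diff)
    finally have "c1 * ?q\<^sup>2 \<le> 2 * t * ?q"
      using dens[of "X - A"] by (simp add: S_def)
    then have "?q = 0 \<or> c1 * ?q \<le> 2 * t"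
      by (cases "?q = 0") (auto simp: power2_eq_square)
    then have "?q = 0 \<or> c1 * ?q \<le> c1 * (\<xi> / 2 * card X)"
      by (simp add: t_def mult_ac)
    then show "?q \<le> \<xi> * card X"
    proof
      assume "c1 * ?q \<le> c1 * (\<xi> / 2 * card X)"
      then have "?q \<le> \<xi> / 2 * card X" using c1 by simp
      also have "\<dots> \<le> \<xi> * card X" using \<xi> by (intro mult_right_mono) auto
      finally show ?thesis .
    qed (use \<xi> in simp)
    fix x assume x: "x \<in> A"
    have "F (A - {x}) \<le> F A" using A by (intro max) auto
    moreover have "card A = Suc (card (A - {x}))" using x finA
      by (metis card_Suc_Diff1)
    ultimately have 1: "2 * t \<le> S A A - S (A - {x}) (A - {x})"
      by (simp add: F_def algebra_simps)
    have "S A A = (\<Sum>y\<in>A. p x y) + S (A - {x}) A"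
      unfolding S_def by (rule sum.remove[OF finA x])
    also have "S (A - {x}) A = (\<Sum>z\<in>A - {x}. p z x) + S (A - {x}) (A - {x})"
      unfolding S_def sum.distrib[symmetric]
      by (rule sum.cong[OF refl], rule sum.remove[OF finA x])
    also have "(\<Sum>z\<in>A - {x}. p z x) \<le> (\<Sum>y\<in>A. p x y)"
      unfolding sym[of _ x] by (rule sum_mono2) (auto simp: finA p0)
    finally show "(\<Sum>y\<in>A. p x y) \<ge> c1 * \<xi> / 4 * card X"
      using 1 by (simp add: t_def mult_ac)
  qed
qed

text \<open>\<open>R\<close> is what has been reached and \<open>G\<close> is what sees
  \<open>R\<close> with weight at least \<theta> * \<open>card X\<close>. The cut condition forces
  many points outside \<open>R\<close> into \<open>G\<close>. Few points of \<open>R\<close> are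
  lost: \<open>R - G\<close> has small row sums inside \<open>R\<close>, so it is small by
  \<open>dens\<close>. If \<open>X - R\<close> is already too small for the cut condition, the loss
  alone is estimated.\<close>

lemma robust_growth:
  fixes p :: "'x \<Rightarrow> 'x \<Rightarrow> real" and c1 \<delta> \<kappa> \<theta> :: real
  assumes fin: "finite X" and p0: "\<And>x y. 0 \<le> p x y" and p1: "\<And>x y. p x y \<le> 1"
    and dens: "\<And>Q. Q \<subseteq> X \<Longrightarrow> (\<Sum>x\<in>Q. \<Sum>y\<in>Q. p x y) \<ge> c1 * (real (card Q))\<^sup>2"
    and cut: "\<And>S. S \<subseteq> X \<Longrightarrow> real (card S) \<ge> \<delta> * card X \<Longrightarrow> real (card (X - S)) \<ge> \<delta> * card X \<Longrightarrow>
       (\<Sum>x\<in>S. \<Sum>y\<in>X - S. p x y) \<ge> \<kappa> * (real (card X))\<^sup>2"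
    and pos: "0 < c1" "0 < \<kappa>" "0 < \<delta>" and R: "R \<subseteq> X" and Rbig: "real (card R) \<ge> \<delta> * card X"
    and th: "0 < \<theta>" "\<theta> \<le> \<kappa> / 4" "\<theta> \<le> \<kappa> * c1 / 4" "\<theta> \<le> \<delta> * c1"
    and G: "G = {x \<in> X. (\<Sum>w\<in>R. p x w) \<ge> \<theta> * card X}"
  shows "real (card G) \<ge> min (1 - 2 * \<delta>) (card R / card X + \<kappa> / 2) * card X"
proof (cases "X = {}")
  case False
  define N where "N = real (card X)"
  have N: "N > 0" using False fin by (simp add: N_def card_gt_0_iff)
  have finR: "finite R" using R fin finite_subset by blast
  have finG: "finite G" and GX: "G \<subseteq> X" using fin by (auto simp: G)
  let ?q = "real (card (R - G))"
  have "(\<Sum>x\<in>R - G. \<Sum>y\<in>R - G. p x y) \<le> (\<Sum>x\<in>R - G. \<theta> * N)"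
  proof (rule sum_mono)
    fix x assume x: "x \<in> R - G"
    have "(\<Sum>y\<in>R - G. p x y) \<le> (\<Sum>y\<in>R. p x y)" by (rule sum_mono2) (auto simp: finR p0)
    also have "\<dots> < \<theta> * N" using x R by (auto simp: G N_def)
    finally show "(\<Sum>y\<in>R - G. p x y) \<le> \<theta> * N" by simp
  qed
  then have "c1 * ?q\<^sup>2 \<le> ?q * (\<theta> * N)"
    using dens[of "R - G"] R by force
  then have q: "c1 * ?q \<le> \<theta> * N"
    using th N by (cases "?q = 0") (auto simp: power2_eq_square)
  have "c1 * ?q \<le> c1 * (\<kappa> / 4 * N)"
    by (rule order.trans[OF q]) (use th(3) N in \<open>simp add: mult_ac mult_left_mono\<close>)
  then have q1: "?q \<le> \<kappa> / 4 * N" using pos by simp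
  have "c1 * ?q \<le> c1 * (\<delta> * N)"
    by (rule order.trans[OF q]) (use th(4) N in \<open>simp add: mult_ac mult_left_mono\<close>)
  then have q2: "?q \<le> \<delta> * N" using pos by simp
  have cR: "real (card R) = card (R \<inter> G) + ?q"
    using card_Diff_subset_Int[of R G] finR by (simp add: of_nat_diff card_mono)
  have cG: "real (card G) = card (R \<inter> G) + card (G - R)"
    using card_Diff_subset_Int[of G R] finG by (simp add: of_nat_diff card_mono Int_commute)
  show ?thesis
  proof (cases "real (card (X - R)) \<ge> \<delta> * N")
    case True
    have "\<kappa> * N\<^sup>2 \<le> (\<Sum>x\<in>R. \<Sum>y\<in>X - R. p x y)"
      unfolding N_def by (rule cut) (use R Rbig True in \<open>auto simp: N_def\<close>)
    define D where "D = (\<Sum>x\<in>X - R. \<Sum>y\<in>R. p x y)"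
    have RR: "X - (X - R) = R" using R by auto
    have "\<kappa> * N\<^sup>2 \<le> D"
      using cut[of "X - R"] RR Rbig True by (auto simp: N_def D_def)
    also have "D \<le> (\<Sum>x\<in>X - R. (if x \<in> G then N else 0) + \<theta> * N)"
      unfolding D_def
    proof (rule sum_mono)
      fix x assume x: "x \<in> X - R"
      show "(\<Sum>y\<in>R. p x y) \<le> (if x \<in> G then N else 0) + \<theta> * N"
      proof (cases "x \<in> G")
        case True
        have "(\<Sum>y\<in>R. p x y) \<le> (\<Sum>y\<in>R. 1)" by (rule sum_mono) (rule p1)
        also have "\<dots> \<le> N" using R fin by (simp add: N_def card_mono)
        finally show ?thesis using True th N by (simp add: add_increasing2)
      next
        case False
        then show ?thesis using x by (auto simp: G N_def)
      qed
    qed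
    also have "\<dots> = real (card (G - R)) * N + real (card (X - R)) * (\<theta> * N)"
    proof -
      have "(X - R) \<inter> {x. x \<in> G} = G - R" using GX by auto
      then show ?thesis using fin by (simp add: sum.distrib sum.If_cases)
    qed
    also have "\<dots> \<le> real (card (G - R)) * N + N * (\<theta> * N)"
      using th N fin by (intro add_left_mono mult_right_mono) (auto simp: N_def card_mono)
    finally have "N * (\<kappa> * N) \<le> N * (card (G - R) + \<theta> * N)"
      by (simp add: algebra_simps power2_eq_square)
    then have "\<kappa> * N \<le> card (G - R) + \<theta> * N" using N by simp
    moreover have "\<theta> * N \<le> \<kappa> / 4 * N" using th N by simp
    ultimately have "real (card G) \<ge> real (card R) + \<kappa> / 2 * N"
      using q1 cR cG by simp
    also have "real (card R) + \<kappa> / 2 * N = (card R / card X + \<kappa> / 2) * card X"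
      using N by (simp add: N_def field_simps)
    finally show ?thesis
      using N by (meson min.cobounded2 mult_right_mono of_nat_0_le_iff order.trans)
  next
    case False
    have "real (card (X - R)) = N - card R"
      using R fin finR by (simp add: N_def card_Diff_subset of_nat_diff card_mono)
    then have "real (card G) \<ge> (1 - 2 * \<delta>) * N"
      using False q2 cR cG by (simp add: algebra_simps)
    then show ?thesis
      using N unfolding N_def by (meson min.cobounded1 mult_right_mono of_nat_0_le_iff order.trans)
  qed
qed simp

definition mixing :: "real \<Rightarrow> real \<Rightarrow> real \<Rightarrow> 'x set \<Rightarrow> ('x \<Rightarrow> 'x \<Rightarrow> real) \<Rightarrow> bool" where
  "mixing c \<delta> \<kappa> X p \<longleftrightarrow> finite X \<and> (\<forall>x y. p x y = p y x) \<and> (\<forall>x y. 0 \<le> p x y \<and> p x y \<le> 1) \<and>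
     (\<forall>Q\<subseteq>X. c * (real (card Q))\<^sup>2 \<le> (\<Sum>x\<in>Q. \<Sum>y\<in>Q. p x y)) \<and>
     (\<forall>S\<subseteq>X. \<delta> * card X \<le> real (card S) \<longrightarrow> \<delta> * card X \<le> real (card (X - S)) \<longrightarrow>
        \<kappa> * (real (card X))\<^sup>2 \<le> (\<Sum>x\<in>S. \<Sum>y\<in>X - S. p x y))"

text \<open>Starting from the points adjacent to \<open>y\<close>, the reached set gains the
  proportion \<kappa> / 2 in each step until it misses at most the proportion 2 * \<delta>. A core
  point \<open>x\<close> has row sum at least 4 * \<delta> * \<open>card X\<close>, so it still sees
  the reached set with weight 2 * \<delta> * \<open>card X\<close>. The constants \<open>L\<close>
  and \<eta> depend on neither \<open>X\<close> nor \<open>p\<close>.\<close>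

lemma robust_reach:
  fixes c1 \<xi> \<kappa> :: real
  assumes c1: "0 < c1" and \<xi>: "0 < \<xi>" and c1\<xi>: "c1 * \<xi> \<le> 1" and \<kappa>: "0 < \<kappa>"
  obtains L \<eta> where "(\<eta>::real) > 0"
    "\<And>(X::'x set) p. mixing c1 (c1 * \<xi> / 16) \<kappa> X p \<Longrightarrow>
      \<exists>X'\<subseteq>X. real (card (X - X')) \<le> \<xi> * card X \<and> (\<forall>x\<in>X'. \<forall>y\<in>X'. kernel_iterate p X L x y \<ge> \<eta>)"
proof -
  define \<delta> where "\<delta> = c1 * \<xi> / 16"
  define \<theta> where "\<theta> = min (min (\<kappa> / 4) (\<kappa> * c1 / 4)) (min (\<delta> * c1) (2 * \<delta>))"
  have \<delta>: "\<delta> > 0" "\<delta> \<le> 1 / 16" using assms by (auto simp: \<delta>_def)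
  have \<theta>: "\<theta> > 0" "\<theta> \<le> \<kappa> / 4" "\<theta> \<le> \<kappa> * c1 / 4" "\<theta> \<le> \<delta> * c1" "\<theta> \<le> 2 * \<delta>"
    using assms \<delta> by (auto simp: \<theta>_def)
  \<comment> \<open>The walk density guaranteed after \<open>i\<close> growth steps; each step
    multiplies it by \<theta>.\<close>
  define e where "e i = 2 * \<delta> * \<theta> ^ i" for i :: nat
  have e0: "e i > 0" for i using \<delta> \<theta> by (simp add: e_def)
  define I where "I = nat \<lceil>2 / \<kappa>\<rceil>"
  have I: "real I * (\<kappa> / 2) \<ge> 1"
  proof -
    have "2 / \<kappa> \<le> real I" by (simp add: I_def real_nat_ceiling_ge)
    then show ?thesis using \<kappa> by (simp add: field_simps)
  qed
  show ?thesis
  proof (rule that[of "e (Suc I)" "Suc I"])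
    show "e (Suc I) > 0" by (rule e0)
    fix X :: "'x set" and p :: "'x \<Rightarrow> 'x \<Rightarrow> real"
    assume "mixing c1 (c1 * \<xi> / 16) \<kappa> X p"
    then have fin: "finite X" and sym: "\<And>x y. p x y = p y x" and p0: "\<And>x y. 0 \<le> p x y" and p1: "\<And>x y. p x y \<le> 1"
      and dens: "\<And>Q. Q \<subseteq> X \<Longrightarrow> (\<Sum>x\<in>Q. \<Sum>y\<in>Q. p x y) \<ge> c1 * (real (card Q))\<^sup>2"
      and cut: "\<And>S. S \<subseteq> X \<Longrightarrow> real (card S) \<ge> \<delta> * card X \<Longrightarrow> real (card (X - S)) \<ge> \<delta> * card X \<Longrightarrow>
       (\<Sum>x\<in>S. \<Sum>y\<in>X - S. p x y) \<ge> \<kappa> * (real (card X))\<^sup>2"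
      by (auto simp: mixing_def \<delta>_def)
    define N where "N = real (card X)"
    have kiter0: "kernel_iterate p X i x y \<ge> 0" for i x y
      by (induction i arbitrary: x) (auto intro!: divide_nonneg_nonneg sum_nonneg mult_nonneg_nonneg p0)
    obtain X' where X': "X' \<subseteq> X" "real (card (X - X')) \<le> \<xi> * card X"
      "\<And>x. x \<in> X' \<Longrightarrow> (\<Sum>y\<in>X'. p x y) \<ge> 4 * \<delta> * N"
      using robust_core[OF fin sym p0 dens c1 \<xi>] by (auto simp: \<delta>_def N_def mult_ac)
    have row: "(\<Sum>y\<in>X. p x y) \<ge> 4 * \<delta> * N" if "x \<in> X'" for x
      using X'(3)[OF that] sum_mono2[OF fin X'(1), of "p x"] p0 by force
    show "\<exists>X'\<subseteq>X. real (card (X - X')) \<le> \<xi> * card X \<and> (\<forall>x\<in>X'. \<forall>y\<in>X'. kernel_iterate p X (Suc I) x y \<ge> e (Suc I))"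
    proof (intro exI[of _ X'] conjI ballI)
      fix x y assume x: "x \<in> X'" and y: "y \<in> X'"
      have N: "N > 0" using x X'(1) fin by (auto simp: N_def card_gt_0_iff)
      define R where "R i = {x \<in> X. kernel_iterate p X i x y \<ge> e i}" for i
      have RX: "R i \<subseteq> X" for i by (auto simp: R_def)
      have finR: "finite (R i)" for i using RX fin finite_subset by blast
      have step: "{x \<in> X. (\<Sum>w\<in>R i. p x w) \<ge> \<theta> * card X} \<subseteq> R (Suc i)" for i
      proof clarsimp
        fix z assume z: "z \<in> X" and *: "(\<Sum>w\<in>R i. p z w) \<ge> \<theta> * card X"
        have "e (Suc i) * N = (\<theta> * N) * e i" by (simp add: e_def mult_ac)
        also have "\<dots> \<le> (\<Sum>w\<in>R i. p z w) * e i"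
          using * e0[of i] by (intro mult_right_mono) (auto simp: N_def)
        also have "\<dots> = (\<Sum>w\<in>R i. p z w * e i)" by (rule sum_distrib_right)
        also have "\<dots> \<le> (\<Sum>w\<in>R i. p z w * kernel_iterate p X i w y)"
          by (intro sum_mono mult_left_mono p0) (auto simp: R_def)
        also have "\<dots> \<le> (\<Sum>w\<in>X. p z w * kernel_iterate p X i w y)"
          by (intro sum_mono2 mult_nonneg_nonneg fin RX p0 kiter0)
        also have "\<dots> = kernel_iterate p X (Suc i) z y * N" using N by (simp add: N_def)
        finally show "z \<in> R (Suc i)" using N z by (simp add: R_def del: kernel_iterate.simps)
      qed
      have R0: "real (card (R 0)) \<ge> 2 * \<delta> * N"
      proof -
        have "4 * \<delta> * N \<le> (\<Sum>x\<in>X. p x y)" using row[OF y] sym[of y] by simp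
        also have "\<dots> \<le> (\<Sum>x\<in>X. (if x \<in> R 0 then 1 else 0) + 2 * \<delta>)"
          using \<delta> p1 by (intro sum_mono) (auto simp: R_def e_def add_increasing2)
        also have "\<dots> = real (card (R 0)) + 2 * \<delta> * N"
        proof -
          have "X \<inter> {x. x \<in> R 0} = R 0" using RX by auto
          then show ?thesis using fin by (simp add: sum.distrib sum.If_cases N_def)
        qed
        finally show ?thesis by (simp add: mult_ac)
      qed
      have R: "real (card (R i)) \<ge> min (1 - 2 * \<delta>) (2 * \<delta> + i * (\<kappa> / 2)) * N" for i
      proof (induction i)
        case 0
        have "min (1 - 2 * \<delta>) (2 * \<delta> + real 0 * (\<kappa> / 2)) * N \<le> 2 * \<delta> * N"
          using N by (intro mult_right_mono) auto
        then show ?case using R0 by simp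
      next
        case (Suc i)
        have "\<delta> * N \<le> min (1 - 2 * \<delta>) (2 * \<delta> + i * (\<kappa> / 2)) * N"
          using \<delta> N \<kappa> by (intro mult_right_mono) (auto intro: add_increasing2)
        then have big: "real (card (R i)) \<ge> \<delta> * card X" using Suc by (simp add: N_def)
        have "card (R (Suc i)) \<ge> card {x \<in> X. (\<Sum>w\<in>R i. p x w) \<ge> \<theta> * card X}"
          using step finR by (intro card_mono) auto
        then have "real (card (R (Suc i))) \<ge> min (1 - 2 * \<delta>) (card (R i) / card X + \<kappa> / 2) * card X"
          using robust_growth[OF fin p0 p1 dens cut c1 \<kappa> \<delta>(1) RX big \<theta>(1-4) refl] by linarith
        moreover have "min (1 - 2 * \<delta>) (2 * \<delta> + Suc i * (\<kappa> / 2)) \<le> min (1 - 2 * \<delta>) (card (R i) / card X + \<kappa> / 2)"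
        proof -
          have "min (1 - 2 * \<delta>) (2 * \<delta> + i * (\<kappa> / 2)) \<le> card (R i) / card X"
            using Suc N by (simp add: N_def field_simps)
          moreover have "real (Suc i) * (\<kappa> / 2) = i * (\<kappa> / 2) + \<kappa> / 2" by (simp add: algebra_simps)
          ultimately show ?thesis using \<kappa> by linarith
        qed
        ultimately show ?case
          using N by (smt (verit, best) N_def mult_right_mono)
      qed
      have "min (1 - 2 * \<delta>) (2 * \<delta> + I * (\<kappa> / 2)) = 1 - 2 * \<delta>"
        using I \<delta> by simp
      then have RI: "real (card (R I)) \<ge> (1 - 2 * \<delta>) * N" using R[of I] by simp
      have "4 * \<delta> * N \<le> (\<Sum>w\<in>X. p x w)" by (rule row[OF x])
      also have "\<dots> = (\<Sum>w\<in>X - R I. p x w) + (\<Sum>w\<in>R I. p x w)"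
        by (rule sum.subset_diff[OF RX fin])
      also have "(\<Sum>w\<in>X - R I. p x w) \<le> (\<Sum>w\<in>X - R I. 1)" by (rule sum_mono) (rule p1)
      also have "\<dots> = N - card (R I)"
        using RX fin finR by (simp add: N_def card_Diff_subset of_nat_diff card_mono)
      also have "\<dots> \<le> 2 * \<delta> * N" using RI by (simp add: algebra_simps)
      finally have "(\<Sum>w\<in>R I. p x w) \<ge> 2 * \<delta> * N" by (simp add: mult_ac)
      moreover have "\<theta> * N \<le> 2 * \<delta> * N" using \<theta> N by (intro mult_right_mono) auto
      ultimately have "x \<in> R (Suc I)"
        using step[of I] x X'(1) by (auto simp: N_def)
      then show "kernel_iterate p X (Suc I) x y \<ge> e (Suc I)" by (simp add: R_def del: kernel_iterate.simps)
    qed (use X' in auto)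
  qed
qed

section \<open>Connecting tuples\<close>

text \<open>Tuples may repeat entries. Tuples that contribute to an edge automatically have distinct entries outside \<open>T\<close>.\<close>

definition rich :: "nat \<Rightarrow> nat \<Rightarrow> real \<Rightarrow> 'a set \<Rightarrow> 'a set set \<Rightarrow> bool" where
  "rich k j c V E \<longleftrightarrow> finite V \<and> V \<noteq> {} \<and> (\<forall>e\<in>E. e \<subseteq> V \<and> card e = k) \<and>
     (\<forall>T. distinct T \<longrightarrow> set T \<subseteq> V \<longrightarrow> length T \<le> j \<longrightarrow>
        c * real (card V) ^ (k - length T) \<le> card {ys \<in> tup V (k - length T). set T \<union> set ys \<in> E})"

lemma richD:
  assumes "rich k j c V E"
  shows "finite V" "V \<noteq> {}" "e \<in> E \<Longrightarrow> e \<subseteq> V" "e \<in> E \<Longrightarrow> card e = k"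
    "distinct T \<Longrightarrow> set T \<subseteq> V \<Longrightarrow> length T \<le> j \<Longrightarrow>
        c * real (card V) ^ (k - length T) \<le> card {ys \<in> tup V (k - length T). set T \<union> set ys \<in> E}"
  using assms by (auto simp: rich_def)

text \<open>A walk of \<open>m\<close> edges, consecutive ones overlapping in \<open>l\<close> vertices; vertices may repeat.\<close>

definition hwalk :: "nat \<Rightarrow> nat \<Rightarrow> 'a set set \<Rightarrow> nat \<Rightarrow> 'a list \<Rightarrow> bool" where
  "hwalk k l E m xs \<longleftrightarrow> length xs = m * (k - l) + l \<and>
     (\<forall>j<m. set (take k (drop (j * (k - l)) xs)) \<in> E)"

lemma hwalk_append:
  assumes us: "hwalk k l E i (us @ X)" and vs: "hwalk k l E j (X @ vs)" and X: "length X = l" and "l < k"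
  shows "hwalk k l E (i + j) (us @ X @ vs)"
  unfolding hwalk_def
proof (intro conjI allI impI)
  have lu: "length us = i * (k - l)" using us X by (simp add: hwalk_def)
  show "length (us @ X @ vs) = (i + j) * (k - l) + l"
    using lu vs by (simp add: hwalk_def algebra_simps)
  fix p assume p: "p < i + j"
  show "set (take k (drop (p * (k - l)) (us @ X @ vs))) \<in> E"
  proof (cases "p < i")
    case True
    have "Suc p * (k - l) \<le> i * (k - l)" using True by (intro mult_right_mono) auto
    then have "p * (k - l) + k \<le> length (us @ X)" using lu X \<open>l < k\<close> by simp
    then have "take k (drop (p * (k - l)) ((us @ X) @ vs)) = take k (drop (p * (k - l)) (us @ X))"
      by simp
    moreover have "set (take k (drop (p * (k - l)) (us @ X))) \<in> E"
      using us True by (simp add: hwalk_def del: drop_append take_append)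
    ultimately show ?thesis by (simp del: drop_append take_append)
  next
    case False
    then have "p * (k - l) = (p - i) * (k - l) + length us"
      using lu by (metis add.commute add_diff_inverse_nat add_mult_distrib)
    then have "drop (p * (k - l)) (us @ X @ vs) = drop ((p - i) * (k - l)) (X @ vs)"
      by simp
    then show ?thesis using vs False p by (simp add: hwalk_def)
  qed
qed

lemma hwalk_1: "l \<le> k \<Longrightarrow> hwalk k l E (Suc 0) xs \<longleftrightarrow> length xs = k \<and> set xs \<in> E"
  by (auto simp: hwalk_def)

text \<open>The length is that of a walk with \<open>m\<close> edges,
  \<open>m * (k - l) + l\<close>, minus the two ends.\<close>

definition conn :: "nat \<Rightarrow> nat \<Rightarrow> 'a set \<Rightarrow> 'a set set \<Rightarrow> nat \<Rightarrow> 'a list \<Rightarrow> 'a list \<Rightarrow> 'a list set" where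
  "conn k l V E m A B = {ys \<in> tup V (m * (k - l) - l). hwalk k l E m (A @ ys @ B)}"

lemma conn_1:
  assumes "2 * l < k" "length A = l" "length B = l"
  shows "conn k l V E (Suc 0) A B = {R \<in> tup V (k - 2 * l). set A \<union> set R \<union> set B \<in> E}"
  using assms by (auto simp: conn_def hwalk_1 tup_def mult_2 Un_assoc)

text \<open>Concatenation through a middle tuple. All lengths are fixed, so the middle tuple can be
  read off the result and nothing is counted twice.\<close>

lemma conn_compose:
  assumes V: "finite V" and l: "1 \<le> l" "2 * l < k" and ij: "1 \<le> i" "1 \<le> j" and A: "length A = l" and B: "length B = l"
    and X: "X \<subseteq> tup V l"
  shows "(\<Sum>C\<in>X. card (conn k l V E i A C) * card (conn k l V E j C B)) \<le> card (conn k l V E (i + j) A B)"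
proof -
  have fin: "finite (conn k l V E m A B)" for m A B
    by (simp add: conn_def finite_tup V)
  have li: "l \<le> m * (k - l)" if "1 \<le> m" for m
    using that l mult_le_mono[of 1 m l "k - l"] by simp
  have "(\<Sum>C\<in>X. card (conn k l V E i A C) * card (conn k l V E j C B)) =
      card (SIGMA C:X. conn k l V E i A C \<times> conn k l V E j C B)"
    using finite_subset[OF X finite_tup[OF V]] by (subst card_SigmaI) (auto simp: fin card_cartesian_product)
  also have "\<dots> \<le> card (conn k l V E (i + j) A B)"
  proof (rule card_inj_on_le[where f = "\<lambda>(C, ys, zs). ys @ C @ zs"])
    show "inj_on (\<lambda>(C, ys, zs). ys @ C @ zs) (SIGMA C:X. conn k l V E i A C \<times> conn k l V E j C B)"
      using X by (auto simp: inj_on_def conn_def tup_def)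
    show "(\<lambda>(C, ys, zs). ys @ C @ zs) ` (SIGMA C:X. conn k l V E i A C \<times> conn k l V E j C B)
       \<subseteq> conn k l V E (i + j) A B"
    proof clarsimp
      fix C ys zs assume C: "C \<in> X" and ys: "ys \<in> conn k l V E i A C" and zs: "zs \<in> conn k l V E j C B"
      have lC: "length C = l" "set C \<subseteq> V" using C X by (auto simp: tup_def)
      have "hwalk k l E (i + j) ((A @ ys) @ C @ (zs @ B))"
        by (rule hwalk_append) (use ys zs lC l in \<open>auto simp: conn_def\<close>)
      moreover have "length (ys @ C @ zs) = (i + j) * (k - l) - l"
        using ys zs lC li[OF ij(1)] li[OF ij(2)] by (simp add: conn_def tup_def add_mult_distrib)
      ultimately show "ys @ C @ zs \<in> conn k l V E (i + j) A B"
        using ys zs lC by (auto simp: conn_def tup_def)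
    qed
  qed (simp add: fin)
  finally show ?thesis .
qed

section \<open>The kernel of two-edge walks between l-tuples\<close>

definition link_count :: "nat \<Rightarrow> nat \<Rightarrow> 'a set \<Rightarrow> 'a set set \<Rightarrow> 'a list \<Rightarrow> 'a list \<Rightarrow> nat" where
  "link_count k l V E A C = card {R \<in> tup V (k - 2 * l). set A \<union> set R \<union> set C \<in> E}"

lemma link_count_le: "finite V \<Longrightarrow> link_count k l V E A C \<le> card V ^ (k - 2 * l)"
  unfolding link_count_def by (subst card_tup[symmetric]) (auto intro: card_mono simp: finite_tup)

lemma link_count_sym: "link_count k l V E A C = link_count k l V E C A"
  by (simp add: link_count_def Un_ac)

lemma link_count_row:
  assumes R: "rich k (k - l) c V E" and l: "1 \<le> l" "2 * l < k" and A: "distinct A" "A \<in> tup V l"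
  shows "c * real (card V) ^ (k - l) \<le> (\<Sum>C\<in>tup V l. real (link_count k l V E A C))"
proof -
  have "c * real (card V) ^ (k - length A) \<le> card {ys \<in> tup V (k - length A). set A \<union> set ys \<in> E}"
    by (rule richD(5)[OF R]) (use A l in \<open>auto simp: tup_def\<close>)
  also have "k - length A = l + (k - 2 * l)" using A l by (simp add: tup_def)
  also have "{ys \<in> tup V (l + (k - 2 * l)). set A \<union> set ys \<in> E} =
     {ys \<in> tup V (l + (k - 2 * l)). set A \<union> set (drop l ys) \<union> set (take l ys) \<in> E}"
  proof -
    have "set A \<union> set ys = set A \<union> set (drop l ys) \<union> set (take l ys)" for ys :: "'a list"
      by (metis append_take_drop_id set_append sup_assoc sup_commute)
    then show ?thesis by (intro Collect_cong conj_cong refl arg_cong[where f = "\<lambda>X. X \<in> E"])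
  qed
  also have "card \<dots> = (\<Sum>C\<in>tup V l. link_count k l V E A C)"
    unfolding link_count_def by (rule card_tup_append) (use R in \<open>auto simp: rich_def\<close>)
  finally show ?thesis using l by (simp add: mult_2)
qed

text \<open>The normalised number of two-edge walks from \<open>A\<close> to \<open>B\<close>, that
  is, the square of the symmetric one-edge count. Being positive semidefinite, it has density inside
  every large set of tuples, whereas the one-edge count may vanish on a set, as in the bipartite
  case.\<close>

definition link_kernel :: "nat \<Rightarrow> nat \<Rightarrow> 'a set \<Rightarrow> 'a set set \<Rightarrow> 'a list \<Rightarrow> 'a list \<Rightarrow> real" where
  "link_kernel k l V E A B = (\<Sum>C\<in>tup V l. real (link_count k l V E A C * link_count k l V E B C)) / real (card V) ^ (2 * (k - 2 * l) + l)"

lemma link_kernel_sym: "link_kernel k l V E A B = link_kernel k l V E B A"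
  by (simp add: link_kernel_def mult.commute)

lemma link_kernel_nonneg: "0 \<le> link_kernel k l V E A B"
  by (simp add: link_kernel_def sum_nonneg divide_nonneg_nonneg)

lemma link_kernel_le_1: "finite V \<Longrightarrow> link_kernel k l V E A B \<le> 1"
proof -
  assume V: "finite V"
  have "(\<Sum>C\<in>tup V l. link_count k l V E A C * link_count k l V E B C) \<le> (\<Sum>C\<in>tup V l. card V ^ (k - 2 * l) * card V ^ (k - 2 * l))"
    by (intro sum_mono mult_le_mono link_count_le V)
  also have "\<dots> = card V ^ (2 * (k - 2 * l) + l)"
    by (simp add: card_tup V power_add mult_2 mult_ac)
  finally have "real (\<Sum>C\<in>tup V l. link_count k l V E A C * link_count k l V E B C) \<le> real (card V) ^ (2 * (k - 2 * l) + l)"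
    by (metis of_nat_le_iff of_nat_power)
  then have "link_kernel k l V E A B \<le> real (card V) ^ (2 * (k - 2 * l) + l) / real (card V) ^ (2 * (k - 2 * l) + l)"
    unfolding link_kernel_def of_nat_sum by (rule divide_right_mono) simp
  also have "\<dots> \<le> 1" by simp
  finally show ?thesis .
qed

lemma link_kernel_sum:
  assumes "finite S" "finite S'"
  shows "(\<Sum>A\<in>S. \<Sum>B\<in>S'. link_kernel k l V E A B) =
    (\<Sum>C\<in>tup V l. (\<Sum>A\<in>S. real (link_count k l V E A C)) * (\<Sum>B\<in>S'. real (link_count k l V E B C))) / real (card V) ^ (2 * (k - 2 * l) + l)"
proof -
  have "(\<Sum>A\<in>S. \<Sum>B\<in>S'. link_kernel k l V E A B) =
     (\<Sum>A\<in>S. \<Sum>B\<in>S'. \<Sum>C\<in>tup V l. real (link_count k l V E A C) * real (link_count k l V E B C)) / real (card V) ^ (2 * (k - 2 * l) + l)"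
    by (simp add: link_kernel_def sum_divide_distrib)
  also have "(\<Sum>A\<in>S. \<Sum>B\<in>S'. \<Sum>C\<in>tup V l. real (link_count k l V E A C) * real (link_count k l V E B C)) =
     (\<Sum>A\<in>S. \<Sum>C\<in>tup V l. \<Sum>B\<in>S'. real (link_count k l V E A C) * real (link_count k l V E B C))"
    by (intro sum.cong refl sum.swap)
  also have "\<dots> = (\<Sum>C\<in>tup V l. \<Sum>A\<in>S. \<Sum>B\<in>S'. real (link_count k l V E A C) * real (link_count k l V E B C))"
    by (rule sum.swap)
  finally show ?thesis by (simp add: sum_product)
qed

text \<open>The mass on pairs from \<open>Q\<close> is a sum of squares over the middle tuple
  \<open>C\<close>. Cauchy-Schwarz bounds it below by the squared total of the rows of
  \<open>Q\<close>, which richness makes large.\<close>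

lemma link_kernel_dens:
  assumes R: "rich k (k - l) c V E" and l: "1 \<le> l" "2 * l < k" and c: "0 < c"
    and Q: "Q \<subseteq> {A \<in> tup V l. distinct A}"
  shows "c\<^sup>2 * (real (card Q))\<^sup>2 \<le> (\<Sum>A\<in>Q. \<Sum>B\<in>Q. link_kernel k l V E A B)"
proof -
  note V = richD(1,2)[OF R]
  define n where "n = real (card V)"
  have n: "n > 0" using V by (simp add: n_def card_gt_0_iff)
  have finQ: "finite Q" using finite_subset[OF Q] V by (simp add: finite_tup)
  have "real (card Q) * (c * n ^ (k - l)) = (\<Sum>A\<in>Q. c * n ^ (k - l))" by simp
  also have "\<dots> \<le> (\<Sum>A\<in>Q. \<Sum>C\<in>tup V l. real (link_count k l V E A C))"
    unfolding n_def using Q by (intro sum_mono link_count_row[OF R l]) auto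
  also have "\<dots> = (\<Sum>C\<in>tup V l. \<Sum>A\<in>Q. real (link_count k l V E A C))" by (rule sum.swap)
  finally have "(real (card Q) * (c * n ^ (k - l)))\<^sup>2 \<le> (\<Sum>C\<in>tup V l. \<Sum>A\<in>Q. real (link_count k l V E A C))\<^sup>2"
    using c n by (intro power_mono) auto
  also have "\<dots> \<le> real (card (tup V l)) * (\<Sum>C\<in>tup V l. (\<Sum>A\<in>Q. real (link_count k l V E A C))\<^sup>2)"
    by (rule sum_squared_le) (simp add: finite_tup V)
  also have "(\<Sum>C\<in>tup V l. (\<Sum>A\<in>Q. real (link_count k l V E A C))\<^sup>2) =
     (\<Sum>A\<in>Q. \<Sum>B\<in>Q. link_kernel k l V E A B) * n ^ (2 * (k - 2 * l) + l)"
    using n by (simp add: link_kernel_sum finQ n_def power2_eq_square)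
  finally have "c\<^sup>2 * (real (card Q))\<^sup>2 * n ^ (2 * (k - l)) \<le>
     (\<Sum>A\<in>Q. \<Sum>B\<in>Q. link_kernel k l V E A B) * (n ^ l * n ^ (2 * (k - 2 * l) + l))"
    by (simp add: card_tup V n_def power_mult_distrib power_mult mult_ac)
  moreover have "n ^ l * n ^ (2 * (k - 2 * l) + l) = n ^ (2 * (k - l))"
    using l by (simp add: power_add[symmetric] diff_mult_distrib2)
  ultimately show ?thesis using n by simp
qed

text \<open>Replacing the coordinates of a tuple in \<open>S\<close> one by one by those of a tuple outside \<open>S\<close>, the tuple leaves \<open>S\<close> at some coordinate \<open>i\<close>. In \<open>zs\<close>, the first two entries are the competing values at \<open>i\<close> and the remaining ones are the common coordinates.\<close>

lemma hybrid_swap: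
  assumes V: "finite V" and l: "1 \<le> l" and S: "S \<subseteq> tup V l" and S': "S' \<subseteq> tup V l" "S \<inter> S' = {}"
  defines "ins i zs x \<equiv> take i (drop 2 zs) @ x # drop (i + 2) zs"
  shows "card S * card S' \<le>
    (\<Sum>i<l. card {zs \<in> tup V (l + 1). ins i zs (zs ! 0) \<in> S \<and> ins i zs (zs ! 1) \<notin> S} * card V ^ (l - 1))"
proof -
  let ?T = "\<lambda>i. {zs \<in> tup V (l + 1). ins i zs (zs ! 0) \<in> S \<and> ins i zs (zs ! 1) \<notin> S}"
  let ?h = "\<lambda>A B i. take i B @ drop i A"
  let ?D = "\<lambda>i. {(A, B) \<in> S \<times> S'. ?h A B i \<in> S \<and> ?h A B (Suc i) \<notin> S}"
  have fin: "finite S" "finite S'" using S S' finite_tup[OF V] finite_subset by blast+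
  have "S \<times> S' \<subseteq> (\<Union>i<l. ?D i)"
  proof clarify
    fix A B assume AB: "A \<in> S" "B \<in> S'"
    then have lAB: "length A = l" "length B = l" using S S' by (auto simp: tup_def)
    have "\<not> (\<forall>i<l. ?h A B i \<in> S \<longrightarrow> ?h A B (Suc i) \<in> S)"
    proof
      assume *: "\<forall>i<l. ?h A B i \<in> S \<longrightarrow> ?h A B (Suc i) \<in> S"
      have "i \<le> l \<longrightarrow> ?h A B i \<in> S" for i
        by (induction i) (use * AB in \<open>auto simp: less_eq_Suc_le\<close>)
      from this[of l] show False using AB lAB S' by auto
    qed
    then show "(A, B) \<in> (\<Union>i<l. ?D i)" using AB by blast
  qed
  then have "card (S \<times> S') \<le> card (\<Union>i<l. ?D i)"
    by (rule card_mono[rotated]) (auto intro!: finite_subset[OF _ finite_cartesian_product[OF fin]])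
  also have "\<dots> \<le> (\<Sum>i<l. card (?D i))" by (rule card_UN_le) simp
  also have "\<dots> \<le> (\<Sum>i<l. card (?T i) * card V ^ (l - 1))"
  proof (rule sum_mono)
    fix i assume i: "i \<in> {..<l}"
    let ?f = "\<lambda>(A, B). (A ! i # B ! i # take i B @ drop (Suc i) A, take i A @ drop (Suc i) B)"
    have "card (?D i) \<le> card (?T i \<times> tup V (l - 1))"
    proof (rule card_inj_on_le[where f = ?f])
      show "finite (?T i \<times> tup V (l - 1))" by (simp add: finite_tup V)
      show "?f ` ?D i \<subseteq> ?T i \<times> tup V (l - 1)"
      proof
        fix u assume "u \<in> ?f ` ?D i"
        then obtain A B where u: "u = ?f (A, B)" and AB: "A \<in> S" "B \<in> S'" "?h A B i \<in> S" "?h A B (Suc i) \<notin> S"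
          by auto
        have lAB: "length A = l" "length B = l" "set A \<subseteq> V" "set B \<subseteq> V" using AB S S' by (auto simp: tup_def)
        have il: "i < l" using i by simp
        have "A ! i \<in> V" "B ! i \<in> V" using lAB il by (auto simp: subset_iff)
        moreover have "take i B @ B ! i # drop (Suc i) A \<notin> S"
          using AB(4) lAB il by (simp add: take_Suc_conv_app_nth)
        moreover have "take i B @ A ! i # drop (Suc i) A \<in> S"
          using AB(3) lAB il by (simp add: Cons_nth_drop_Suc)
        ultimately show "u \<in> ?T i \<times> tup V (l - 1)"
          unfolding u using lAB il
          by (auto simp: tup_def ins_def dest!: in_set_takeD in_set_dropD)
      qed
      show "inj_on ?f (?D i)"
      proof (rule inj_onI)
        fix u v assume u: "u \<in> ?D i" and v: "v \<in> ?D i" and eq: "?f u = ?f v"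
        obtain A B A' B' where uv: "u = (A, B)" "v = (A', B')" by fastforce
        have AB: "A \<in> S" "B \<in> S'" "A' \<in> S" "B' \<in> S'"
          and a: "A ! i = A' ! i" "B ! i = B' ! i"
          and e: "take i B @ drop (Suc i) A = take i B' @ drop (Suc i) A'" "take i A @ drop (Suc i) B = take i A' @ drop (Suc i) B'"
          using u v eq uv by auto
        have len: "length A = l" "length B = l" "length A' = l" "length B' = l" using AB S S' by (auto simp: tup_def)
        have il: "i < l" using i by simp
        have "take i B = take i B'" "drop (Suc i) A = drop (Suc i) A'" "take i A = take i A'" "drop (Suc i) B = drop (Suc i) B'"
          using e len il by auto
        then show "u = v"
          unfolding uv using a len il by (metis id_take_nth_drop)
      qed
    qed
    then show "card (?D i) \<le> card (?T i) * card V ^ (l - 1)"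
      by (simp add: card_cartesian_product card_tup V)
  qed
  finally show ?thesis by (simp add: card_cartesian_product)
qed

text \<open>By \<open>hybrid_swap\<close>, many (l + 1)-tuples contain both an l-tuple of
  \<open>S\<close> and one outside \<open>S\<close>. By richness each of them extends to many edges.
  The added part of such an edge contains a middle tuple \<open>C\<close>, so the same edge links
  \<open>C\<close> to both sides of the cut. This bounds the sum of the minima of the two link
  counts from below, and the bound on the products follows.\<close>

lemma link_kernel_cut:
  assumes R: "rich k (k - l) c V E" and l: "1 \<le> l" "2 * l < k" and c: "0 < c" and \<delta>: "0 < \<delta>"
    and X: "X = {A \<in> tup V l. distinct A}" and S: "S \<subseteq> X"
    and n0: "real ((l + 1) * (l + 1)) \<le> \<delta>\<^sup>2 / (8 * real l) * card V"
    and big: "real (card S) \<ge> \<delta> / 2 * real (card V) ^ l" "real (card (X - S)) \<ge> \<delta> / 2 * real (card V) ^ l"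
  shows "(\<delta>\<^sup>2 / (8 * real l) * c)\<^sup>2 * (real (card X))\<^sup>2 \<le> (\<Sum>A\<in>S. \<Sum>B\<in>X - S. link_kernel k l V E A B)"
proof -
  note V = richD(1,2)[OF R]
  define n where "n = real (card V)"
  have n: "n > 0" using V by (simp add: n_def card_gt_0_iff)
  define ins :: "nat \<Rightarrow> 'a list \<Rightarrow> 'a \<Rightarrow> 'a list" where "ins i zs x = take i (drop 2 zs) @ x # drop (i + 2) zs" for i zs x
  define T where "T i = {zs \<in> tup V (l + 1). ins i zs (zs ! 0) \<in> S \<and> ins i zs (zs ! 1) \<notin> S}" for i
  define \<eta> where "\<eta> = \<delta>\<^sup>2 / (4 * real l)"
  have Xt: "X \<subseteq> tup V l" using X by auto
  have finX: "finite X" using Xt V finite_tup finite_subset by blast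
  \<comment> \<open>Pigeonhole over the \<open>l\<close> coordinates: otherwise the product of the
    sizes of the two sides would be smaller than \<delta>^2 / 4 * n^(2l).\<close>
  have "\<exists>i<l. card (T i) \<ge> \<eta> * n ^ (l + 1)"
  proof (rule ccontr)
    assume "\<not> ?thesis"
    then have *: "card (T i) < \<eta> * n ^ (l + 1)" if "i < l" for i using that by (auto simp: not_le)
    have "card S * card (X - S) \<le> (\<Sum>i<l. card (T i) * card V ^ (l - 1))"
      unfolding T_def ins_def by (rule hybrid_swap[OF V(1) l(1)]) (use S Xt in auto)
    then have "real (card S * card (X - S)) \<le> real (\<Sum>i<l. card (T i) * card V ^ (l - 1))"
      by (simp only: of_nat_le_iff)
    also have "\<dots> = (\<Sum>i<l. card (T i) * n ^ (l - 1))" by (simp add: n_def)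
    also have "\<dots> < (\<Sum>i<l. \<eta> * n ^ (l + 1) * n ^ (l - 1))"
      using * n l by (intro sum_strict_mono mult_strict_right_mono) (auto simp: lessThan_empty_iff)
    also have "\<dots> = \<delta>\<^sup>2 / 4 * (n ^ (l + 1) * n ^ (l - 1))" using l by (simp add: \<eta>_def)
    also have "n ^ (l + 1) * n ^ (l - 1) = n ^ (2 * l)"
      unfolding power_add[symmetric] using l by (intro arg_cong[where f = "(^) n"]) simp
    also have "\<delta>\<^sup>2 / 4 * n ^ (2 * l) = (\<delta> / 2 * n ^ l) * (\<delta> / 2 * n ^ l)"
      by (simp add: power2_eq_square power_mult mult_2 power_add field_simps)
    also have "\<dots> \<le> real (card S) * real (card (X - S))"
      using big \<delta> n by (intro mult_mono) (auto simp: n_def)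
    finally show False by simp
  qed
  then obtain i where i: "i < l" "card (T i) \<ge> \<eta> * n ^ (l + 1)" by auto
  define T' where "T' = {zs \<in> T i. fresh {} zs}"
  have "real (card T') \<ge> (\<eta> - \<eta> / 2) * n ^ (l + 1)"
    unfolding T'_def n_def
    by (rule card_fresh_ge[OF V(1)]) (use i n0 V in \<open>auto simp: T_def n_def \<eta>_def\<close>)
  then have T': "real (card T') \<ge> \<eta> / 2 * n ^ (l + 1)" by (simp add: field_simps)
  have finT': "finite T'" using V by (auto simp: T'_def T_def finite_tup)
  have T'D: "distinct zs" "zs \<in> tup V (l + 1)" "ins i zs (zs ! 0) \<in> S" "ins i zs (zs ! 1) \<notin> S" if "zs \<in> T'" for zs
    using that by (auto simp: T'_def T_def fresh_def)
  have T'X: "ins i zs (zs ! 1) \<in> X - S" "set (ins i zs (zs ! 0)) \<union> {zs ! 1} = set zs"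
    "set (ins i zs (zs ! 1)) \<union> {zs ! 0} = set zs" if zs: "zs \<in> T'" for zs
  proof -
    have "length zs = l + 1" "set zs \<subseteq> V" using T'D(2)[OF zs] by (auto simp: tup_def)
    then obtain a b ws where e: "zs = a # b # ws" "length ws = l - 1"
      using l(1) by (cases zs; cases "tl zs") auto
    have dr: "take i ws @ drop i ws = ws" by simp
    have sw: "set (take i ws) \<union> set (drop i ws) = set ws" by (metis dr set_append)
    have dis: "distinct ws" "a \<notin> set ws" "b \<notin> set ws" "a \<noteq> b" using T'D(1)[OF zs] e by auto
    have "distinct (take i ws @ b # drop i ws)"
      using dis set_take_disj_set_drop_if_distinct[of ws i i] by (auto dest: in_set_takeD in_set_dropD)
    then show "ins i zs (zs ! 1) \<in> X - S"
      using T'D(4)[OF zs] e \<open>set zs \<subseteq> V\<close> sw i by (auto simp: X tup_def ins_def)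
    show "set (ins i zs (zs ! 0)) \<union> {zs ! 1} = set zs" "set (ins i zs (zs ! 1)) \<union> {zs ! 0} = set zs"
      using e sw by (auto simp: ins_def)
  qed
  define \<alpha> where "\<alpha> C = (\<Sum>A\<in>S. real (link_count k l V E A C))" for C
  define \<beta> where "\<beta> C = (\<Sum>A\<in>X - S. real (link_count k l V E A C))" for C
  have inj: "inj_on (\<lambda>(zs, R). (ins i zs (zs ! j), (zs ! (1 - j)) # R)) (T' \<times> U)" if j: "j = 0 \<or> j = 1" for j :: nat and U :: "'a list set"
  proof (rule inj_onI)
    fix u v :: "'a list \<times> 'a list"
    assume u: "u \<in> T' \<times> U" and v: "v \<in> T' \<times> U"
      and eq: "(case u of (zs, R) \<Rightarrow> (ins i zs (zs ! j), (zs ! (1 - j)) # R)) = (case v of (zs, R) \<Rightarrow> (ins i zs (zs ! j), (zs ! (1 - j)) # R))"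
    obtain zs R zs' R' where uv: "u = (zs, R)" "v = (zs', R')" by fastforce
    have zs: "zs \<in> T'" "zs' \<in> T'" and e1: "ins i zs (zs ! j) = ins i zs' (zs' ! j)" and e2: "zs ! (1 - j) = zs' ! (1 - j)" and RR: "R = R'"
      using u v eq uv by auto
    have len: "length zs = l + 1" "length zs' = l + 1" using T'D(2) zs by (auto simp: tup_def)
    obtain a b ws where e: "zs = a # b # ws" "length ws = l - 1"
      using l(1) len by (cases zs; cases "tl zs") auto
    obtain a' b' ws' where e': "zs' = a' # b' # ws'" "length ws' = l - 1"
      using l(1) len by (cases zs'; cases "tl zs'") auto
    have 1: "take i ws = take i ws' \<and> zs ! j = zs' ! j \<and> drop i ws = drop i ws'"
      using e1 e e' by (simp add: ins_def)
    then have "ws = ws'" by (metis append_take_drop_id)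
    moreover have "a = a' \<and> b = b'" using j 1 e2 e e' by auto
    ultimately show "u = v" using e e' uv RR by simp
  qed
  have inS: "ins i zs (zs ! 0) \<in> S" "ins i zs (zs ! 1) \<in> X - S" "zs ! 0 \<in> V" "zs ! 1 \<in> V" if "zs \<in> T'" for zs
  proof -
    have "length zs = l + 1" "set zs \<subseteq> V" using T'D(2)[OF that] by (auto simp: tup_def)
    then show "zs ! 0 \<in> V" "zs ! 1 \<in> V" using l(1) by (auto intro!: subsetD[OF _ nth_mem])
  qed (use T'D[OF that] T'X(1)[OF that] in auto)
  \<comment> \<open>A pair in \<open>M C\<close> forms an edge together with \<open>C\<close>.
    Moving the second entry of \<open>zs\<close> into the link list leaves an l-tuple in
    \<open>S\<close>, moving the first one leaves an l-tuple outside \<open>S\<close>; so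
    \<open>M C\<close> injects into the link counts of both sides.\<close>
  define M where "M C = {(zs, R) \<in> T' \<times> tup V (k - 2 * l - 1). set zs \<union> set R \<union> set C \<in> E}" for C
  have bound: "real (card (M C)) \<le> (\<Sum>A\<in>Y. real (link_count k l V E A C))"
    if j: "j = 0 \<or> j = 1" and Y: "Y \<subseteq> X" "\<And>zs. zs \<in> T' \<Longrightarrow> ins i zs (zs ! j) \<in> Y" for C j Y
  proof -
    have "card (M C) \<le> card (SIGMA A:Y. {R \<in> tup V (k - 2 * l). set A \<union> set R \<union> set C \<in> E})"
    proof (rule card_inj_on_le[where f = "\<lambda>(zs, R). (ins i zs (zs ! j), (zs ! (1 - j)) # R)"])
      show "inj_on (\<lambda>(zs, R). (ins i zs (zs ! j), (zs ! (1 - j)) # R)) (M C)"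
        by (rule inj_on_subset[OF inj[OF j, of "tup V (k - 2 * l - 1)"]]) (auto simp: M_def)
      show "(\<lambda>(zs, R). (ins i zs (zs ! j), (zs ! (1 - j)) # R)) ` M C \<subseteq> (SIGMA A:Y. {R \<in> tup V (k - 2 * l). set A \<union> set R \<union> set C \<in> E})"
      proof clarify
        fix zs R assume "(zs, R) \<in> M C"
        then have zs: "zs \<in> T'" and R: "R \<in> tup V (k - 2 * l - 1)" "set zs \<union> set R \<union> set C \<in> E"
          by (auto simp: M_def)
        have "set (ins i zs (zs ! j)) \<union> {zs ! (1 - j)} = set zs" using j T'X(2,3)[OF zs] by auto
        then have "set (ins i zs (zs ! j)) \<union> set (zs ! (1 - j) # R) \<union> set C = set zs \<union> set R \<union> set C" by auto
        moreover have "zs ! (1 - j) \<in> V" using j inS(3,4)[OF zs] by auto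
        ultimately show "ins i zs (zs ! j) \<in> Y \<and> zs ! (1 - j) # R \<in> {R \<in> tup V (k - 2 * l). set (ins i zs (zs ! j)) \<union> set R \<union> set C \<in> E}"
          using Y(2)[OF zs] R l by (simp add: tup_def)
      qed
      show "finite (SIGMA A:Y. {R \<in> tup V (k - 2 * l). set A \<union> set R \<union> set C \<in> E})"
        using finite_subset[OF Y(1) finX] V by (intro finite_SigmaI) (simp_all add: finite_tup)
    qed
    also have "\<dots> = (\<Sum>A\<in>Y. link_count k l V E A C)"
      using finite_subset[OF Y(1) finX] V by (subst card_SigmaI) (simp_all add: finite_tup link_count_def)
    finally show ?thesis by (simp only: flip: of_nat_sum)
  qed
  have "real (card T') * (c * n ^ (k - (l + 1))) \<le> (\<Sum>zs\<in>T'. real (card {ys \<in> tup V (k - (l + 1)). set zs \<union> set ys \<in> E}))"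
  proof -
    have "c * n ^ (k - (l + 1)) \<le> real (card {ys \<in> tup V (k - (l + 1)). set zs \<union> set ys \<in> E})" if "zs \<in> T'" for zs
      using richD(5)[OF R T'D(1)[OF that]] T'D(2)[OF that] l by (auto simp: tup_def n_def)
    then have "(\<Sum>zs\<in>T'. c * n ^ (k - (l + 1))) \<le> (\<Sum>zs\<in>T'. real (card {ys \<in> tup V (k - (l + 1)). set zs \<union> set ys \<in> E}))"
      by (rule sum_mono)
    then show ?thesis by simp
  qed
  also have "\<dots> = (\<Sum>zs\<in>T'. \<Sum>C\<in>tup V l. real (card {R \<in> tup V (k - 2 * l - 1). set zs \<union> set R \<union> set C \<in> E}))"
  proof (rule sum.cong[OF refl])
    fix zs assume "zs \<in> T'"
    have kl: "k - (l + 1) = l + (k - 2 * l - 1)" using l by simp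
    have "{ys \<in> tup V (k - (l + 1)). set zs \<union> set ys \<in> E} = {ys \<in> tup V (l + (k - 2 * l - 1)). set zs \<union> set (drop l ys) \<union> set (take l ys) \<in> E}"
    proof -
      have "set zs \<union> set ys = set zs \<union> set (drop l ys) \<union> set (take l ys)" for ys :: "'a list"
        by (metis append_take_drop_id set_append sup_assoc sup_commute)
      then show ?thesis unfolding kl by (intro Collect_cong conj_cong refl arg_cong[where f = "\<lambda>X. X \<in> E"])
    qed
    also have "card \<dots> = (\<Sum>C\<in>tup V l. card {R \<in> tup V (k - 2 * l - 1). set zs \<union> set R \<union> set C \<in> E})"
      by (rule card_tup_append[OF V(1)])
    finally show "real (card {ys \<in> tup V (k - (l + 1)). set zs \<union> set ys \<in> E}) = (\<Sum>C\<in>tup V l. real (card {R \<in> tup V (k - 2 * l - 1). set zs \<union> set R \<union> set C \<in> E}))"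
      by simp
  qed
  also have "\<dots> = (\<Sum>C\<in>tup V l. \<Sum>zs\<in>T'. real (card {R \<in> tup V (k - 2 * l - 1). set zs \<union> set R \<union> set C \<in> E}))"
    by (rule sum.swap)
  also have "\<dots> = (\<Sum>C\<in>tup V l. real (card (M C)))"
  proof (rule sum.cong[OF refl])
    fix C
    have "M C = (SIGMA zs:T'. {R \<in> tup V (k - 2 * l - 1). set zs \<union> set R \<union> set C \<in> E})"
      by (auto simp: M_def)
    then show "(\<Sum>zs\<in>T'. real (card {R \<in> tup V (k - 2 * l - 1). set zs \<union> set R \<union> set C \<in> E})) = real (card (M C))"
      using finT' V by (simp add: card_SigmaI finite_tup)
  qed
  also have "\<dots> \<le> (\<Sum>C\<in>tup V l. min (\<alpha> C) (\<beta> C))"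
    unfolding \<alpha>_def \<beta>_def
    by (intro sum_mono min.boundedI bound[where j = 0] bound[where j = 1]) (use S inS in auto)
  finally have 1: "real (card T') * (c * n ^ (k - (l + 1))) \<le> (\<Sum>C\<in>tup V l. min (\<alpha> C) (\<beta> C))" .
  have "\<eta> / 2 * n ^ (l + 1) * (c * n ^ (k - (l + 1))) \<le> real (card T') * (c * n ^ (k - (l + 1)))"
    using T' c n by (intro mult_right_mono) auto
  moreover have "n ^ (l + 1) * n ^ (k - (l + 1)) = n ^ k"
    unfolding power_add[symmetric] using l by simp
  ultimately have "\<eta> / 2 * c * n ^ k \<le> (\<Sum>C\<in>tup V l. min (\<alpha> C) (\<beta> C))"
    using 1 by (simp add: mult_ac)
  then have "(\<eta> / 2 * c * n ^ k)\<^sup>2 \<le> (\<Sum>C\<in>tup V l. min (\<alpha> C) (\<beta> C))\<^sup>2"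
    using c n \<delta> by (intro power_mono) (auto simp: \<eta>_def)
  also have "\<dots> \<le> real (card (tup V l)) * (\<Sum>C\<in>tup V l. \<alpha> C * \<beta> C)"
    by (rule sum_min_squared_le) (auto simp: \<alpha>_def \<beta>_def sum_nonneg finite_tup V)
  also have "(\<Sum>C\<in>tup V l. \<alpha> C * \<beta> C) = (\<Sum>A\<in>S. \<Sum>B\<in>X - S. link_kernel k l V E A B) * n ^ (2 * (k - 2 * l) + l)"
    using finX S n by (subst link_kernel_sum) (auto simp: \<alpha>_def \<beta>_def n_def intro: finite_subset)
  finally have F: "(\<eta> / 2 * c * n ^ k)\<^sup>2 \<le> real (card (tup V l)) * ((\<Sum>A\<in>S. \<Sum>B\<in>X - S. link_kernel k l V E A B) * n ^ (2 * (k - 2 * l) + l))" .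
  have e: "(n ^ k)\<^sup>2 = (n ^ l * n ^ (2 * (k - 2 * l) + l)) * (n ^ l)\<^sup>2"
    unfolding power_mult[symmetric] power_add[symmetric] using l by (intro arg_cong[where f = "(^) n"]) simp
  have "(\<eta> / 2 * c)\<^sup>2 * (n ^ l)\<^sup>2 * (n ^ l * n ^ (2 * (k - 2 * l) + l)) = (\<eta> / 2 * c * n ^ k)\<^sup>2"
    unfolding power_mult_distrib[of "\<eta> / 2 * c"] e by (simp only: mult_ac)
  also note F
  also have "real (card (tup V l)) = n ^ l" by (simp add: card_tup V n_def)
  finally have "(\<eta> / 2 * c)\<^sup>2 * (n ^ l)\<^sup>2 * (n ^ l * n ^ (2 * (k - 2 * l) + l)) \<le> (\<Sum>A\<in>S. \<Sum>B\<in>X - S. link_kernel k l V E A B) * (n ^ l * n ^ (2 * (k - 2 * l) + l))"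
    by (simp only: mult_ac)
  then have "(\<eta> / 2 * c)\<^sup>2 * (n ^ l)\<^sup>2 \<le> (\<Sum>A\<in>S. \<Sum>B\<in>X - S. link_kernel k l V E A B)"
    by (rule mult_right_le_imp_le) (use n in simp)
  moreover have "(\<delta>\<^sup>2 / (8 * real l) * c)\<^sup>2 * (real (card X))\<^sup>2 \<le> (\<eta> / 2 * c)\<^sup>2 * (n ^ l)\<^sup>2"
  proof -
    have h: "\<delta>\<^sup>2 / (8 * real l) = \<eta> / 2" by (simp add: \<eta>_def)
    have "card X \<le> card (tup V l)" using Xt V by (intro card_mono) (auto simp: finite_tup)
    then have "real (card X) \<le> n ^ l" using V by (simp add: card_tup n_def flip: of_nat_power)
    then have "(real (card X))\<^sup>2 \<le> (n ^ l)\<^sup>2" by (intro power_mono) auto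
    then show ?thesis unfolding h by (intro mult_left_mono) auto
  qed
  ultimately show ?thesis by linarith
qed

lemma conn_sub: "conn k l V E m A B \<subseteq> tup V (m * (k - l) - l)"
  by (auto simp: conn_def)

lemma link_count_conn: "2 * l < k \<Longrightarrow> length A = l \<Longrightarrow> length B = l \<Longrightarrow> card (conn k l V E (Suc 0) A B) = link_count k l V E A B"
  by (simp add: conn_1 link_count_def)

text \<open>A kernel step consists of two edges, hence the number \<open>2 * (i + 1)\<close>. The
  averages in the iterated kernel are normalised by \<open>card X\<close>, the walk counts by the
  number of all l-tuples. As \<open>X\<close> contains at least half of these, each of the
  \<open>i\<close> averages costs at most a factor 2.\<close>

lemma conn_kernel_iterate:
  assumes R: "rich k (k - l) c V E" and l: "1 \<le> l" "2 * l < k"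
    and X: "X \<subseteq> tup V l" and Xbig: "real (card X) \<ge> 1 / 2 * real (card V) ^ l"
    and A: "A \<in> X" and B: "B \<in> X"
  shows "(1 / 2) ^ i * kernel_iterate (link_kernel k l V E) X i A B * real (card V) ^ (2 * (i + 1) * (k - l) - l)
    \<le> card (conn k l V E (2 * (i + 1)) A B)"
  using A
proof (induction i arbitrary: A)
  note V = richD(1,2)[OF R]
  define n where "n = real (card V)"
  have n: "n > 0" using V by (simp add: n_def card_gt_0_iff)
  have lX: "length A = l" if "A \<in> X" for A using X that by (auto simp: tup_def)
  have lB: "length B = l" using lX B by auto
  have base: "link_kernel k l V E A B * n ^ (2 * (k - l) - l) \<le> card (conn k l V E 2 A B)"
    if A: "length A = l" and B: "length B = l" for A B
  proof -
    have e: "2 * (k - l) - l = 2 * (k - 2 * l) + l" using l by simp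
    have "link_kernel k l V E A B * n ^ (2 * (k - l) - l) = real (\<Sum>C\<in>tup V l. link_count k l V E A C * link_count k l V E B C)"
      using n unfolding e link_kernel_def by (simp add: n_def)
    also have "(\<Sum>C\<in>tup V l. link_count k l V E A C * link_count k l V E B C) =
       (\<Sum>C\<in>tup V l. card (conn k l V E (Suc 0) A C) * card (conn k l V E (Suc 0) C B))"
      by (intro sum.cong refl) (use A B l in \<open>simp add: link_count_conn tup_iff link_count_sym[of _ _ _ _ B]\<close>)
    also have "\<dots> \<le> card (conn k l V E (Suc 0 + Suc 0) A B)"
      by (rule conn_compose) (use V A B l in auto)
    finally show ?thesis by (simp add: numeral_2_eq_2)
  qed
  {
    case 0
    then show ?case using base[OF lX lB] by (simp add: n_def)
  next
    case (Suc i)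
    let ?len = "2 * (i + 1) * (k - l) - l"
    have "(1 / 2) ^ Suc i * kernel_iterate (link_kernel k l V E) X (Suc i) A B * n ^ (2 * (Suc i + 1) * (k - l) - l) =
       (1 / 2) ^ Suc i * ((\<Sum>w\<in>X. link_kernel k l V E A w * kernel_iterate (link_kernel k l V E) X i w B) / card X) * (n ^ l * (n ^ (2 * (k - l) - l) * n ^ ?len))"
    proof -
      have 1: "l \<le> 2 * (k - l)" "2 * (k - l) * 1 \<le> 2 * (k - l) * (i + 1)" using l by auto
      moreover have "2 * (Suc i + 1) * w = 2 * w + 2 * w * (i + 1)" "2 * (i + 1) * w = 2 * w * (i + 1)" for w :: nat
        by (simp_all add: algebra_simps)
      note this[of "k - l"]
      ultimately have "2 * (Suc i + 1) * (k - l) - l = l + ((2 * (k - l) - l) + ?len)"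
        by linarith
      then show ?thesis by (simp only: power_add kernel_iterate.simps)
    qed
    also have "\<dots> \<le> (1 / 2) ^ Suc i * ((\<Sum>w\<in>X. link_kernel k l V E A w * kernel_iterate (link_kernel k l V E) X i w B) / card X) * (2 * card X * (n ^ (2 * (k - l) - l) * n ^ ?len))"
    proof (intro mult_left_mono mult_right_mono mult_nonneg_nonneg divide_nonneg_nonneg sum_nonneg)
      show "0 \<le> kernel_iterate (link_kernel k l V E) X i w B" for w
        by (induction i arbitrary: w) (auto intro!: divide_nonneg_nonneg sum_nonneg mult_nonneg_nonneg link_kernel_nonneg)
    qed (use Xbig n in \<open>auto simp: link_kernel_nonneg n_def\<close>)
    also have "\<dots> = (1 / 2) ^ i * (\<Sum>w\<in>X. link_kernel k l V E A w * kernel_iterate (link_kernel k l V E) X i w B) * (n ^ (2 * (k - l) - l) * n ^ ?len)"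
    proof -
      have "card X > 0" using Suc.prems finite_subset[OF X finite_tup[OF V(1)]] by (auto simp: card_gt_0_iff)
      then show ?thesis by simp
    qed
    also have "\<dots> = (\<Sum>w\<in>X. (link_kernel k l V E A w * n ^ (2 * (k - l) - l)) * ((1 / 2) ^ i * kernel_iterate (link_kernel k l V E) X i w B * n ^ ?len))"
      by (simp only: sum_distrib_left sum_distrib_right mult_ac)
    also have "\<dots> \<le> (\<Sum>w\<in>X. real (card (conn k l V E 2 A w)) * real (card (conn k l V E (2 * (i + 1)) w B)))"
    proof (intro sum_mono mult_mono')
      fix w assume w: "w \<in> X"
      show "(1 / 2) ^ i * kernel_iterate (link_kernel k l V E) X i w B * n ^ ?len \<le> real (card (conn k l V E (2 * (i + 1)) w B))"
        using Suc.IH[OF w] by (simp add: n_def)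
      have "0 \<le> kernel_iterate (link_kernel k l V E) X i w B" for w
        by (induction i arbitrary: w) (auto intro!: divide_nonneg_nonneg sum_nonneg mult_nonneg_nonneg link_kernel_nonneg)
      then show "0 \<le> (1 / 2) ^ i * kernel_iterate (link_kernel k l V E) X i w B * n ^ ?len" using n by simp
    qed (use Suc.prems lX n in \<open>auto intro: base mult_nonneg_nonneg link_kernel_nonneg\<close>)
    also have "\<dots> = real (\<Sum>w\<in>X. card (conn k l V E 2 A w) * card (conn k l V E (2 * (i + 1)) w B))" by simp
    also have "\<dots> \<le> real (card (conn k l V E (2 + 2 * (i + 1)) A B))"
      unfolding of_nat_le_iff by (rule conn_compose) (use V l lX Suc.prems B X in auto)
    finally show ?case by (simp add: n_def)
  }
qed

text \<open>\<open>robust_reach\<close> joins the tuples of a core \<open>X'\<close> by walks with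
  an even number \<open>M\<close> of edges. An arbitrary distinct tuple reaches the core by one
  edge, since its row sum exceeds what can lie outside the core. One edge at each end, and possibly
  a further one on the left, gives walks with \<open>M + 2\<close> and \<open>M + 3\<close> edges.
  Two consecutive lengths are wanted because absorbers exchange a connector for one with one more
  edge.\<close>

lemma connecting:
  fixes c :: real
  assumes l: "1 \<le> l" "2 * l < k" and c: "0 < c" "c \<le> 1"
  obtains m n0 \<eta> where "1 \<le> m" "(\<eta>::real) > 0"
    "\<And>(V::'a set) E A B. rich k (k - l) c V E \<Longrightarrow> n0 \<le> card V \<Longrightarrow> A \<in> tup V l \<Longrightarrow> B \<in> tup V l \<Longrightarrow>
      distinct A \<Longrightarrow> distinct B \<Longrightarrow>
      \<eta> * real (card V) ^ (m * (k - l) - l) \<le> card (conn k l V E m A B) \<and>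
      \<eta> * real (card V) ^ (Suc m * (k - l) - l) \<le> card (conn k l V E (Suc m) A B)"
proof -
  define \<delta> where "\<delta> = c\<^sup>2 * (c / 4) / 16"
  define \<kappa> where "\<kappa> = (\<delta>\<^sup>2 / (8 * real l) * c)\<^sup>2"
  have \<delta>: "\<delta> > 0" using c by (simp add: \<delta>_def)
  have \<kappa>: "\<kappa> > 0" using c \<delta> l by (simp add: \<kappa>_def)
  have "c\<^sup>2 * (c / 4) \<le> 1 * 1" using c by (intro mult_mono) (auto simp: power_le_one)
  then obtain L \<eta>0 where \<eta>0: "\<eta>0 > 0" and reach:
    "\<And>(X::'a list set) p. mixing (c\<^sup>2) (c\<^sup>2 * (c / 4) / 16) \<kappa> X p \<Longrightarrow>
      \<exists>X'\<subseteq>X. real (card (X - X')) \<le> c / 4 * card X \<and> (\<forall>x\<in>X'. \<forall>y\<in>X'. kernel_iterate p X L x y \<ge> \<eta>0)"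
    using robust_reach[of "c\<^sup>2" "c / 4" \<kappa>, where 'x = "'a list"] c \<kappa> by (smt (verit, best) zero_less_power divide_pos_pos mult_1)
  define M where "M = 2 * (L + 1)"
  define \<eta>1 where "\<eta>1 = (1 / 2) ^ L * \<eta>0"
  define \<eta> where "\<eta> = (c / 2) ^ 3 * \<eta>1"
  have \<eta>1: "\<eta>1 > 0" using \<eta>0 by (simp add: \<eta>1_def)
  define n0 where "n0 = nat \<lceil>real ((l + 1) * (l + 1)) / (\<delta>\<^sup>2 / (8 * real l))\<rceil> + nat \<lceil>real (l * l) / (c / 4)\<rceil>"
  show ?thesis
  proof (rule that[of "Suc (Suc M)" \<eta> n0])
    show "\<eta> > 0" using \<eta>1 c by (simp add: \<eta>_def)
    fix V :: "'a set" and E A B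
    assume R: "rich k (k - l) c V E" and nn: "n0 \<le> card V" and A: "A \<in> tup V l" "distinct A" and B: "B \<in> tup V l" "distinct B"
    note V = richD(1,2)[OF R]
    define n where "n = real (card V)"
    have n: "n > 0" using V by (simp add: n_def card_gt_0_iff)
    have "real ((l + 1) * (l + 1)) / (\<delta>\<^sup>2 / (8 * real l)) \<le> n0" "real (l * l) / (c / 4) \<le> n0"
      unfolding n0_def by linarith+
    then have *: "real ((l + 1) * (l + 1)) / (\<delta>\<^sup>2 / (8 * real l)) \<le> card V" "real (l * l) / (c / 4) \<le> card V"
      using nn by linarith+
    have n1: "real ((l + 1) * (l + 1)) \<le> \<delta>\<^sup>2 / (8 * real l) * card V"
      using *(1) \<delta> l by (subst (asm) pos_divide_le_eq) (auto simp: mult_ac)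
    have n2: "real (l * l) \<le> c / 4 * card V"
      using *(2) c by (subst (asm) pos_divide_le_eq) (auto simp: mult_ac)
    define X where "X = {A \<in> tup V l. distinct A}"
    have Xt: "X \<subseteq> tup V l" and AX: "A \<in> X" "B \<in> X" using A B by (auto simp: X_def)
    have finX: "finite X" using Xt finite_tup[OF V(1)] finite_subset by blast
    have "real (card {xs \<in> tup V l. fresh {} xs}) \<ge> (1 - c / 4) * n ^ l"
      unfolding n_def by (rule card_fresh_ge[OF V(1)]) (use n2 V in \<open>auto simp: card_tup\<close>)
    then have X1: "real (card X) \<ge> (1 - c / 4) * n ^ l" by (simp add: X_def fresh_def)
    have X2: "real (card X) \<ge> 1 / 2 * n ^ l"
      by (rule order.trans[OF _ X1], rule mult_right_mono) (use c n in auto)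
    have Xle: "real (card X) \<le> n ^ l"
      using card_mono[OF finite_tup[OF V(1)] Xt] V by (simp add: card_tup n_def flip: of_nat_power)
    have "mixing (c\<^sup>2) (c\<^sup>2 * (c / 4) / 16) \<kappa> X (link_kernel k l V E)"
      unfolding mixing_def
    proof (intro conjI allI impI)
      show "finite X" "link_kernel k l V E x y = link_kernel k l V E y x" "0 \<le> link_kernel k l V E x y" "link_kernel k l V E x y \<le> 1" for x y
        by (rule finX link_kernel_sym link_kernel_nonneg link_kernel_le_1[OF V(1)])+
      show "c\<^sup>2 * (real (card Q))\<^sup>2 \<le> (\<Sum>x\<in>Q. sum (link_kernel k l V E x) Q)" if "Q \<subseteq> X" for Q
        using link_kernel_dens[OF R l c(1)] that by (simp add: X_def)
      fix S assume S: "S \<subseteq> X" "c\<^sup>2 * (c / 4) / 16 * real (card X) \<le> real (card S)"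
        "c\<^sup>2 * (c / 4) / 16 * real (card X) \<le> real (card (X - S))"
      have "\<delta> * (1 / 2 * n ^ l) \<le> \<delta> * card X" using X2 \<delta> by (intro mult_left_mono) auto
      moreover have "\<delta> * card X \<le> card S" "\<delta> * card X \<le> card (X - S)" using S by (simp_all add: \<delta>_def)
      ultimately have "\<delta> / 2 * n ^ l \<le> card S" "\<delta> / 2 * n ^ l \<le> card (X - S)" by simp_all
      then show "\<kappa> * (real (card X))\<^sup>2 \<le> (\<Sum>x\<in>S. sum (link_kernel k l V E x) (X - S))"
        unfolding \<kappa>_def
        by (intro link_kernel_cut[OF R l c(1) \<delta> X_def S(1) n1]) (simp_all add: n_def)
    qed
    from reach[OF this] obtain X' where X': "X' \<subseteq> X" "real (card (X - X')) \<le> c / 4 * card X"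
      "\<And>x y. x \<in> X' \<Longrightarrow> y \<in> X' \<Longrightarrow> kernel_iterate (link_kernel k l V E) X L x y \<ge> \<eta>0" by blast
    have X't: "X' \<subseteq> tup V l" using X' Xt by auto
    have l': "1 \<le> M" by (simp add: M_def)
    have inner: "\<eta>1 * n ^ (M * (k - l) - l) \<le> card (conn k l V E M C D)" if "C \<in> X'" "D \<in> X'" for C D
    proof -
      have "\<eta>1 * n ^ (M * (k - l) - l) \<le> (1 / 2) ^ L * kernel_iterate (link_kernel k l V E) X L C D * n ^ (M * (k - l) - l)"
        unfolding \<eta>1_def using X'(3)[OF that] n by (intro mult_right_mono mult_left_mono) auto
      also have "\<dots> \<le> card (conn k l V E M C D)"
        unfolding n_def M_def
        by (rule conn_kernel_iterate[OF R l Xt]) (use X2 that X' in \<open>auto simp: n_def\<close>)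
      finally show ?thesis .
    qed
    have "card (tup V l - X') \<le> card (tup V l - X) + card (X - X')"
      by (rule order.trans[OF card_mono card_Un_le]) (use finite_tup[OF V(1)] finX in auto)
    moreover have "real (card (tup V l - X)) = n ^ l - card X"
      using card_Diff_subset[OF finX Xt] card_mono[OF finite_tup[OF V(1)] Xt]
      by (simp add: card_tup V n_def of_nat_diff)
    moreover have "c / 4 * card X \<le> c / 4 * n ^ l" using Xle c by (intro mult_left_mono) auto
    \<comment> \<open>One half of this error is for tuples with repeated entries, the other for
      distinct tuples outside the core.\<close>
    ultimately have bad: "real (card (tup V l - X')) \<le> c / 2 * n ^ l"
      using X1 X'(2) by (simp add: algebra_simps)
    have row: "c / 2 * n ^ (k - l) \<le> (\<Sum>C\<in>X'. real (link_count k l V E A C))" if A: "A \<in> tup V l" "distinct A" for A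
    proof -
      have "c * n ^ (k - l) \<le> (\<Sum>C\<in>tup V l. real (link_count k l V E A C))"
        unfolding n_def by (rule link_count_row[OF R l that(2,1)])
      also have "\<dots> = (\<Sum>C\<in>tup V l - X'. real (link_count k l V E A C)) + (\<Sum>C\<in>X'. real (link_count k l V E A C))"
        by (rule sum.subset_diff[OF X't finite_tup[OF V(1)]])
      also have "(\<Sum>C\<in>tup V l - X'. real (link_count k l V E A C)) \<le> (\<Sum>C\<in>tup V l - X'. n ^ (k - 2 * l))"
        unfolding n_def by (intro sum_mono) (use link_count_le[OF V(1)] in \<open>simp flip: of_nat_power\<close>)
      also have "\<dots> \<le> c / 2 * n ^ l * n ^ (k - 2 * l)"
        using bad n by (simp add: mult_right_mono)
      also have "\<dots> = c / 2 * n ^ (k - l)"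
      proof -
        have "n ^ (k - l) = n ^ l * n ^ (k - 2 * l)"
          unfolding power_add[symmetric] using l by (intro arg_cong[where f = "(^) n"]) simp
        then show ?thesis by simp
      qed
      finally show ?thesis by simp
    qed
    have len: "(Suc i) * (k - l) - l = (k - l) + (i * (k - l) - l)" if "1 \<le> i" for i
    proof -
      have "l \<le> i * (k - l)" using mult_le_mono[OF that, of l "k - l"] l by simp
      then show ?thesis by simp
    qed
    have left: "c / 2 * a * n ^ (Suc i * (k - l) - l) \<le> card (conn k l V E (Suc i) A B)"
      if A: "A \<in> tup V l" "distinct A" and B: "B \<in> tup V l" and i: "1 \<le> i" and a: "a \<ge> 0"
        and h: "\<And>C. C \<in> X' \<Longrightarrow> a * n ^ (i * (k - l) - l) \<le> card (conn k l V E i C B)" for a i A B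
    proof -
      have "c / 2 * a * n ^ (Suc i * (k - l) - l) = (c / 2 * n ^ (k - l)) * (a * n ^ (i * (k - l) - l))"
        by (simp only: len[OF i] power_add mult_ac)
      also have "\<dots> \<le> (\<Sum>C\<in>X'. real (link_count k l V E A C)) * (a * n ^ (i * (k - l) - l))"
        using row[OF A] a n by (intro mult_right_mono) auto
      also have "\<dots> \<le> (\<Sum>C\<in>X'. real (link_count k l V E A C) * card (conn k l V E i C B))"
        unfolding sum_distrib_right using h by (intro sum_mono mult_left_mono) auto
      also have "\<dots> = real (\<Sum>C\<in>X'. card (conn k l V E (Suc 0) A C) * card (conn k l V E i C B))"
        unfolding of_nat_sum of_nat_mult by (intro sum.cong refl) (use A X't l in \<open>auto simp: link_count_conn tup_iff subset_iff\<close>)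
      also have "\<dots> \<le> card (conn k l V E (Suc 0 + i) A B)"
        unfolding of_nat_le_iff by (rule conn_compose[OF V(1) l _ i]) (use A B X't in \<open>auto simp: tup_iff\<close>)
      finally show ?thesis by simp
    qed
    have right: "c / 2 * a * n ^ (Suc i * (k - l) - l) \<le> card (conn k l V E (Suc i) A B)"
      if A: "A \<in> tup V l" and B: "B \<in> tup V l" "distinct B" and i: "1 \<le> i" and a: "a \<ge> 0"
        and h: "\<And>C. C \<in> X' \<Longrightarrow> a * n ^ (i * (k - l) - l) \<le> card (conn k l V E i A C)" for a i A B
    proof -
      have "c / 2 * a * n ^ (Suc i * (k - l) - l) = (c / 2 * n ^ (k - l)) * (a * n ^ (i * (k - l) - l))"
        by (simp only: len[OF i] power_add mult_ac)
      also have "\<dots> \<le> (\<Sum>C\<in>X'. real (link_count k l V E B C)) * (a * n ^ (i * (k - l) - l))"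
        using row[OF B] a n by (intro mult_right_mono) auto
      also have "\<dots> \<le> (\<Sum>C\<in>X'. real (link_count k l V E B C) * card (conn k l V E i A C))"
        unfolding sum_distrib_right using h by (intro sum_mono mult_left_mono) auto
      also have "\<dots> = real (\<Sum>C\<in>X'. card (conn k l V E i A C) * card (conn k l V E (Suc 0) C B))"
        unfolding of_nat_sum of_nat_mult
        by (intro sum.cong refl) (use B X't l in \<open>auto simp: link_count_conn tup_iff subset_iff link_count_sym[of k l V E B]\<close>)
      also have "\<dots> \<le> card (conn k l V E (i + Suc 0) A B)"
        unfolding of_nat_le_iff by (rule conn_compose[OF V(1) l i]) (use A B X't in \<open>auto simp: tup_iff\<close>)
      finally show ?thesis by simp
    qed
    have X'D: "C \<in> tup V l" "distinct C" if "C \<in> X'" for C using that X' by (auto simp: X_def)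
    have s1: "c / 2 * \<eta>1 * n ^ (Suc M * (k - l) - l) \<le> card (conn k l V E (Suc M) A B)"
      if A: "A \<in> tup V l" "distinct A" and B: "B \<in> X'" for A B
      by (rule left[OF A _ l']) (use \<eta>1 inner B X'D in auto)
    have s2: "c / 2 * (c / 2 * \<eta>1) * n ^ (Suc (Suc M) * (k - l) - l) \<le> card (conn k l V E (Suc (Suc M)) A B)"
      if A: "A \<in> tup V l" "distinct A" and B: "B \<in> tup V l" "distinct B" for A B
      by (rule right[OF A(1) B]) (use \<eta>1 c s1[OF A] in auto)
    have s3: "c / 2 * (c / 2 * (c / 2 * \<eta>1)) * n ^ (Suc (Suc (Suc M)) * (k - l) - l) \<le> card (conn k l V E (Suc (Suc (Suc M))) A B)"
      by (rule left[OF A B(1)]) (use \<eta>1 c s2[OF _ _ B] X'D in auto)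
    have \<eta>eq: "\<eta> = c / 2 * (c / 2 * (c / 2 * \<eta>1))" by (simp add: \<eta>_def power3_eq_cube)
    moreover have "c / 2 * (c / 2 * (c / 2 * \<eta>1)) \<le> 1 * (c / 2 * (c / 2 * \<eta>1))"
      using c \<eta>1 by (intro mult_right_mono) auto
    ultimately have "\<eta> \<le> c / 2 * (c / 2 * \<eta>1)" by linarith
    then have "\<eta> * n ^ (Suc (Suc M) * (k - l) - l) \<le> c / 2 * (c / 2 * \<eta>1) * n ^ (Suc (Suc M) * (k - l) - l)"
      by (rule mult_right_mono) (use n in simp)
    from order.trans[OF this s2[OF A B]] s3[folded \<eta>eq]
    show "\<eta> * real (card V) ^ (Suc (Suc M) * (k - l) - l) \<le> card (conn k l V E (Suc (Suc M)) A B) \<and>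
      \<eta> * real (card V) ^ (Suc (Suc (Suc M)) * (k - l) - l) \<le> card (conn k l V E (Suc (Suc (Suc M))) A B)"
      unfolding n_def by blast
  qed simp
qed

section \<open>Exchanging one vertex for another\<close>

text \<open>With \<open>J\<close> the first \<open>l - 1\<close> entries of \<open>D\<close> and \<open>Z\<close> the others, the lists \<open>M b J a u Z\<close> and \<open>M a J b v Z\<close> are paths of two edges with the same ends: a gadget trades \<open>u\<close> for \<open>v\<close>.\<close>

definition gadgets :: "nat \<Rightarrow> nat \<Rightarrow> 'a set \<Rightarrow> 'a set set \<Rightarrow> 'a \<Rightarrow> 'a \<Rightarrow> 'a list set" where
  "gadgets k l V E u v = {a # b # D @ M | a b D M. a \<in> V \<and> b \<in> V \<and> D \<in> tup V (k - 2) \<and> M \<in> tup V (k - l - 1) \<and>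
     insert u (insert a (set D)) \<in> E \<and> insert v (insert b (set D)) \<in> E \<and>
     insert a (insert b (set (take (l - 1) D) \<union> set M)) \<in> E}"

text \<open>Exchanging \<open>a\<close> and \<open>b\<close> trades in the opposite direction; this
  is the symmetry of the gadget kernel.\<close>

lemma gadgets_swap: "gadgets k l V E v u = (\<lambda>g. g ! 1 # g ! 0 # drop 2 g) ` gadgets k l V E u v"
proof
  have sub: "(\<lambda>g. g ! 1 # g ! 0 # drop 2 g) ` gadgets k l V E u v \<subseteq> gadgets k l V E v u" for u v
    unfolding gadgets_def by (auto simp: insert_commute) blast
  then show "(\<lambda>g. g ! 1 # g ! 0 # drop 2 g) ` gadgets k l V E u v \<subseteq> gadgets k l V E v u" .
  show "gadgets k l V E v u \<subseteq> (\<lambda>g. g ! 1 # g ! 0 # drop 2 g) ` gadgets k l V E u v"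
  proof
    fix g assume g: "g \<in> gadgets k l V E v u"
    then have "g ! 1 # g ! 0 # drop 2 g \<in> gadgets k l V E u v" using sub by blast
    moreover have "g = (\<lambda>g. g ! 1 # g ! 0 # drop 2 g) (g ! 1 # g ! 0 # drop 2 g)"
      using g by (auto simp: gadgets_def)
    ultimately show "g \<in> (\<lambda>g. g ! 1 # g ! 0 # drop 2 g) ` gadgets k l V E u v" by blast
  qed
qed

lemma gadgets_tup: "1 \<le> l \<Longrightarrow> 2 * l < k \<Longrightarrow> gadgets k l V E u v \<subseteq> tup V (2 * k - l - 1)"
  by (auto simp: gadgets_def tup_def)

lemma finite_gadgets: "finite V \<Longrightarrow> 1 \<le> l \<Longrightarrow> 2 * l < k \<Longrightarrow> finite (gadgets k l V E u v)"
  using gadgets_tup finite_tup finite_subset by metis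

lemma card_gadgets_sym: "finite V \<Longrightarrow> 1 \<le> l \<Longrightarrow> 2 * l < k \<Longrightarrow> card (gadgets k l V E u v) = card (gadgets k l V E v u)"
proof -
  assume V: "finite V" and l: "1 \<le> l" "2 * l < k"
  have "card (gadgets k l V E u v) \<le> card (gadgets k l V E v u)" for u v
    by (subst gadgets_swap) (rule card_image_le[OF finite_gadgets[OF V l]])
  from antisym[OF this this] show ?thesis .
qed

definition extensions :: "'a set \<Rightarrow> 'a set set \<Rightarrow> 'a list \<Rightarrow> 'a \<Rightarrow> 'a set" where
  "extensions V E D u = {a \<in> V. insert u (insert a (set D)) \<in> E}"

text \<open>A gadget is found by choosing \<open>D\<close>, then vertices \<open>a\<close> and
  \<open>b\<close> that complete \<open>D\<close> together with \<open>u\<close> and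
  \<open>v\<close>, and finally \<open>M\<close> by richness of the l + 1 vertices \<open>a\<close>,
  \<open>b\<close> and the initial entries of \<open>D\<close>. Richness applies to distinct
  entries, so the pairs with a = b are discarded; they account for the subtracted term.\<close>

lemma card_gadgets_ge:
  assumes R: "rich k (k - l) c V E" and l: "1 \<le> l" "2 * l < k" and c: "0 < c"
  shows "c * real (card V) ^ (k - l - 1) * ((\<Sum>D\<in>tup V (k - 2). real (card (extensions V E D u)) * card (extensions V E D v)) - real (card V) ^ (k - 1))
    \<le> card (gadgets k l V E u v)"
proof -
  note V = richD(1,2)[OF R]
  define n where "n = real (card V)"
  have n: "n > 0" using V by (simp add: n_def card_gt_0_iff)
  define P where "P D = {(a, b). a \<in> extensions V E D u \<and> b \<in> extensions V E D v \<and> a \<noteq> b}" for D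
  define K where "K D ab = {M \<in> tup V (k - l - 1). insert (fst ab) (insert (snd ab) (set (take (l - 1) D) \<union> set M)) \<in> E}" for D ab
  have finn: "finite (extensions V E D u)" for D u using V by (simp add: extensions_def)
  have finP: "finite (P D)" for D by (rule finite_subset[of _ "extensions V E D u \<times> extensions V E D v"]) (auto simp: P_def finn)
  have finK: "finite (K D ab)" for D ab using V by (simp add: K_def finite_tup)
  have "card (SIGMA D:tup V (k - 2). SIGMA ab:P D. K D ab) \<le> card (gadgets k l V E u v)"
  proof (rule card_inj_on_le[where f = "\<lambda>(D, (a, b), M). a # b # D @ M"])
    show "inj_on (\<lambda>(D, (a, b), M). a # b # D @ M) (SIGMA D:tup V (k - 2). SIGMA ab:P D. K D ab)"
      by (auto simp: inj_on_def tup_def)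
    show "(\<lambda>(D, (a, b), M). a # b # D @ M) ` (SIGMA D:tup V (k - 2). SIGMA ab:P D. K D ab) \<subseteq> gadgets k l V E u v"
      by (fastforce simp: gadgets_def P_def K_def extensions_def)
  qed (rule finite_gadgets[OF V(1) l])
  moreover have "card (SIGMA D:tup V (k - 2). SIGMA ab:P D. K D ab) = (\<Sum>D\<in>tup V (k - 2). \<Sum>ab\<in>P D. card (K D ab))"
    using V finP finK by (simp add: card_SigmaI finite_tup finite_SigmaI)
  ultimately have 1: "(\<Sum>D\<in>tup V (k - 2). \<Sum>ab\<in>P D. real (card (K D ab))) \<le> card (gadgets k l V E u v)"
    by (simp flip: of_nat_sum)
  have K: "c * n ^ (k - l - 1) \<le> real (card (K D ab))" if D: "D \<in> tup V (k - 2)" and ab: "ab \<in> P D" for D ab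
  proof -
    obtain a b where [simp]: "ab = (a, b)" by fastforce
    have e: "insert u (insert a (set D)) \<in> E" "insert v (insert b (set D)) \<in> E" "a \<noteq> b" "a \<in> V" "b \<in> V"
      using ab by (auto simp: P_def extensions_def)
    have lD: "length D = k - 2" "set D \<subseteq> V" using D by (auto simp: tup_def)
    have cD: "card (set D) \<le> k - 2" using card_length[of D] lD by simp
    \<comment> \<open>An edge has exactly \<open>k\<close> vertices, so the entries that form it
      cannot repeat.\<close>
    have k: "card (insert u (insert a (set D))) = k" "card (insert v (insert b (set D))) = k"
      using e richD(4)[OF R] by auto
    have "a \<notin> set D" "b \<notin> set D" "card (set D) = k - 2"
      using k cD l by (auto simp: card_insert_if insert_absorb split: if_splits)
    then have "distinct D" using lD by (simp add: card_distinct)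
    have "c * n ^ (k - length (a # b # take (l - 1) D)) \<le> card {ys \<in> tup V (k - length (a # b # take (l - 1) D)). set (a # b # take (l - 1) D) \<union> set ys \<in> E}"
      unfolding n_def
    proof (rule richD(5)[OF R])
      show "distinct (a # b # take (l - 1) D)"
        using \<open>distinct D\<close> \<open>a \<notin> set D\<close> \<open>b \<notin> set D\<close> \<open>a \<noteq> b\<close> by (auto dest: in_set_takeD)
      show "set (a # b # take (l - 1) D) \<subseteq> V" using e lD by (auto dest: in_set_takeD)
      show "length (a # b # take (l - 1) D) \<le> k - l" using l lD by simp
    qed
    moreover have "k - length (a # b # take (l - 1) D) = k - l - 1" using l lD by simp
    ultimately show ?thesis by (simp add: K_def)
  qed
  have P: "real (card (extensions V E D u)) * card (extensions V E D v) - n \<le> card (P D)" for D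
  proof -
    have "extensions V E D u \<times> extensions V E D v \<subseteq> P D \<union> (\<lambda>a. (a, a)) ` V" by (auto simp: P_def extensions_def)
    then have "card (extensions V E D u \<times> extensions V E D v) \<le> card (P D \<union> (\<lambda>a. (a, a)) ` V)"
      by (rule card_mono[rotated]) (use finP V in auto)
    also have "\<dots> \<le> card (P D) + card V"
      by (rule order.trans[OF card_Un_le add_left_mono[OF card_image_le[OF V(1)]]])
    finally show ?thesis by (simp add: card_cartesian_product n_def flip: of_nat_mult of_nat_add)
  qed
  have "(\<Sum>D\<in>tup V (k - 2). real (card (extensions V E D u)) * card (extensions V E D v)) - n ^ (k - 1) =
     (\<Sum>D\<in>tup V (k - 2). real (card (extensions V E D u)) * card (extensions V E D v) - n)"
  proof -
    have "n ^ (k - 1) = n ^ (k - 2) * n" using l by (simp flip: power_Suc2 add: Suc_diff_Suc numeral_2_eq_2)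
    then show ?thesis by (simp add: sum_subtractf card_tup V n_def)
  qed
  also have "\<dots> \<le> (\<Sum>D\<in>tup V (k - 2). real (card (P D)))" by (rule sum_mono) (rule P)
  finally have "c * n ^ (k - l - 1) * ((\<Sum>D\<in>tup V (k - 2). real (card (extensions V E D u)) * card (extensions V E D v)) - n ^ (k - 1))
     \<le> c * n ^ (k - l - 1) * (\<Sum>D\<in>tup V (k - 2). real (card (P D)))"
    using c n by (intro mult_left_mono) auto
  also have "\<dots> = (\<Sum>D\<in>tup V (k - 2). \<Sum>ab\<in>P D. c * n ^ (k - l - 1))"
    by (simp add: sum_distrib_left mult_ac)
  also have "\<dots> \<le> (\<Sum>D\<in>tup V (k - 2). \<Sum>ab\<in>P D. real (card (K D ab)))"
    by (intro sum_mono K)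
  finally show ?thesis using 1 by (simp add: n_def)
qed

section \<open>Mixing of the gadget kernel and chains of gadgets\<close>

definition gadget_kernel :: "nat \<Rightarrow> nat \<Rightarrow> 'a set \<Rightarrow> 'a set set \<Rightarrow> 'a \<Rightarrow> 'a \<Rightarrow> real" where
  "gadget_kernel k l V E u v = card (gadgets k l V E u v) / real (card V) ^ (2 * k - l - 1)"

lemma gadget_kernel_sum_ge:
  assumes R: "rich k (k - l) c V E" and l: "1 \<le> l" "2 * l < k" and c: "0 < c"
    and S: "finite S" "finite S'"
  shows "c * ((\<Sum>D\<in>tup V (k - 2). (\<Sum>u\<in>S. real (card (extensions V E D u))) * (\<Sum>v\<in>S'. real (card (extensions V E D v)))) / real (card V) ^ k
      - card S * card S' / card V) \<le> (\<Sum>u\<in>S. \<Sum>v\<in>S'. gadget_kernel k l V E u v)"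
proof -
  note V = richD(1,2)[OF R]
  define n where "n = real (card V)"
  have n: "n > 0" using V by (simp add: n_def card_gt_0_iff)
  let ?h = "\<lambda>u v. \<Sum>D\<in>tup V (k - 2). real (card (extensions V E D u)) * card (extensions V E D v)"
  have ek: "n ^ (2 * k - l - 1) = n ^ (k - l - 1) * n ^ k" "n ^ k = n ^ (k - 1) * n"
    unfolding power_add[symmetric] power_Suc2[symmetric] using l by (intro arg_cong[where f = "(^) n"]; simp)+
  have one: "c * (?h u v / n ^ k - 1 / n) \<le> gadget_kernel k l V E u v" for u v
  proof -
    have "c * (?h u v / n ^ k - 1 / n) * n ^ (2 * k - l - 1) = c * n ^ (k - l - 1) * (?h u v - n ^ (k - 1))"
    proof -
      have 1: "(?h u v / n ^ k - 1 / n) * n ^ k = ?h u v - n ^ (k - 1)"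
        using n ek(2) by (simp add: left_diff_distrib)
      have "c * (?h u v / n ^ k - 1 / n) * n ^ (2 * k - l - 1) = c * n ^ (k - l - 1) * ((?h u v / n ^ k - 1 / n) * n ^ k)"
        unfolding ek(1) by (simp only: mult_ac)
      then show ?thesis unfolding 1 .
    qed
    also have "\<dots> \<le> card (gadgets k l V E u v)" unfolding n_def by (rule card_gadgets_ge[OF R l c])
    finally show ?thesis using n by (simp add: gadget_kernel_def n_def pos_le_divide_eq)
  qed
  have sw: "(\<Sum>u\<in>S. \<Sum>v\<in>S'. ?h u v) = (\<Sum>D\<in>tup V (k - 2). (\<Sum>u\<in>S. real (card (extensions V E D u))) * (\<Sum>v\<in>S'. real (card (extensions V E D v))))"
  proof -
    have "(\<Sum>u\<in>S. \<Sum>v\<in>S'. ?h u v) = (\<Sum>u\<in>S. \<Sum>D\<in>tup V (k - 2). \<Sum>v\<in>S'. real (card (extensions V E D u)) * card (extensions V E D v))"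
      by (intro sum.cong refl sum.swap)
    also have "\<dots> = (\<Sum>D\<in>tup V (k - 2). \<Sum>u\<in>S. \<Sum>v\<in>S'. real (card (extensions V E D u)) * card (extensions V E D v))"
      by (rule sum.swap)
    finally show ?thesis by (simp add: sum_product)
  qed
  have "c * ((\<Sum>u\<in>S. \<Sum>v\<in>S'. ?h u v) / n ^ k - card S * card S' / n) = (\<Sum>u\<in>S. \<Sum>v\<in>S'. c * (?h u v / n ^ k - 1 / n))"
    by (simp add: sum_subtractf right_diff_distrib flip: sum_distrib_left sum_divide_distrib)
  also have "\<dots> \<le> (\<Sum>u\<in>S. \<Sum>v\<in>S'. gadget_kernel k l V E u v)" by (intro sum_mono one)
  finally show ?thesis unfolding sw by (simp add: n_def)
qed

text \<open>Up to the loss from a = b, the kernel is bounded below by a sum over \<open>D\<close> of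
  products of extension counts, so density inside \<open>Q\<close> is Cauchy-Schwarz as for links.
  For a cut, a pair with \<open>x\<close> in \<open>S\<close> and \<open>y\<close> outside lies in
  an edge with many \<open>D\<close>. Seen from \<open>x\<close> this edge is an extension by
  \<open>y\<close>, seen from \<open>y\<close> an extension by \<open>x\<close>; so the number of
  such edges is at most the sum of the minima for the two sides.\<close>

lemma gadget_kernel_mixing:
  assumes R: "rich k (k - l) c V E" and l: "1 \<le> l" "2 * l < k" and c: "0 < c" and \<delta>: "0 < \<delta>" "\<delta> \<le> 1"
    and big: "1 / card V \<le> c\<^sup>2 * \<delta> ^ 4 / 2"
  shows "mixing (c ^ 3 / 2) \<delta> (c ^ 3 * \<delta> ^ 4 / 2) V (gadget_kernel k l V E)"
  unfolding mixing_def
proof (intro conjI allI impI)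
  note V = richD(1,2)[OF R]
  define n where "n = real (card V)"
  have n: "n > 0" using V by (simp add: n_def card_gt_0_iff)
  show "finite V" by fact
  show "gadget_kernel k l V E x y = gadget_kernel k l V E y x" for x y
    by (simp add: gadget_kernel_def card_gadgets_sym[OF V(1) l, of E x y])
  show "0 \<le> gadget_kernel k l V E x y" for x y by (simp add: gadget_kernel_def)
  show "gadget_kernel k l V E x y \<le> 1" for x y
  proof -
    have "card (gadgets k l V E x y) \<le> card V ^ (2 * k - l - 1)"
      using card_mono[OF finite_tup[OF V(1)] gadgets_tup[OF l]] V by (simp add: card_tup)
    then have "real (card (gadgets k l V E x y)) \<le> n ^ (2 * k - l - 1)" by (simp add: n_def flip: of_nat_power)
    then show ?thesis using n by (simp add: gadget_kernel_def n_def)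
  qed
  have e1: "n ^ (k - 2) * n ^ k = (n ^ (k - 1))\<^sup>2" "n ^ k = n\<^sup>2 * n ^ (k - 2)"
    unfolding power_mult[symmetric] power_add[symmetric] using l by (intro arg_cong[where f = "(^) n"]; simp)+
  {
    fix Q assume Q: "Q \<subseteq> V"
    have finQ: "finite Q" using Q V finite_subset by blast
    let ?a = "\<lambda>D. \<Sum>u\<in>Q. real (card (extensions V E D u))"
    have row: "c * n ^ (k - 1) \<le> (\<Sum>D\<in>tup V (k - 2). real (card (extensions V E D u)))" if u: "u \<in> Q" for u
    proof -
      have "c * n ^ (k - length [u]) \<le> card {ys \<in> tup V (k - length [u]). set [u] \<union> set ys \<in> E}"
        unfolding n_def by (rule richD(5)[OF R]) (use u Q l in auto)
      moreover have "k - length [u] = (k - 2) + 1" using l by simp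
      moreover have "{ys \<in> tup V ((k - 2) + 1). set [u] \<union> set ys \<in> E} = {ys \<in> tup V ((k - 2) + 1). insert u (set (drop (k - 2) ys) \<union> set (take (k - 2) ys)) \<in> E}"
      proof -
        have "set [u] \<union> set ys = insert u (set (drop (k - 2) ys) \<union> set (take (k - 2) ys))" for ys
          by (metis append_take_drop_id insert_is_Un list.simps(15) list.set(1) set_append sup_commute)
        then show ?thesis by simp
      qed
      moreover have "card {ys \<in> tup V ((k - 2) + 1). insert u (set (drop (k - 2) ys) \<union> set (take (k - 2) ys)) \<in> E} =
         (\<Sum>D\<in>tup V (k - 2). card {ys \<in> tup V 1. insert u (set ys \<union> set D) \<in> E})"
        by (rule card_tup_append[OF V(1)])
      moreover have "card {ys \<in> tup V 1. insert u (set ys \<union> set D) \<in> E} = card (extensions V E D u)" for D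
        by (rule bij_betw_same_card[where f = hd], rule bij_betw_byWitness[where f' = "\<lambda>a. [a]"])
           (auto simp: tup_def extensions_def length_Suc_conv)
      ultimately show ?thesis by simp
    qed
    have "real (card Q) * (c * n ^ (k - 1)) = (\<Sum>u\<in>Q. c * n ^ (k - 1))" by simp
    also have "\<dots> \<le> (\<Sum>u\<in>Q. \<Sum>D\<in>tup V (k - 2). real (card (extensions V E D u)))" by (intro sum_mono row)
    also have "\<dots> = (\<Sum>D\<in>tup V (k - 2). ?a D)" by (rule sum.swap)
    finally have "(real (card Q) * (c * n ^ (k - 1)))\<^sup>2 \<le> (\<Sum>D\<in>tup V (k - 2). ?a D)\<^sup>2"
      using c n by (intro power_mono) auto
    also have "\<dots> \<le> real (card (tup V (k - 2))) * (\<Sum>D\<in>tup V (k - 2). (?a D)\<^sup>2)"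
      by (rule sum_squared_le) (simp add: finite_tup V)
    also have "\<dots> = n ^ (k - 2) * (\<Sum>D\<in>tup V (k - 2). ?a D * ?a D)"
      by (simp add: card_tup V n_def power2_eq_square)
    also have "(real (card Q) * (c * n ^ (k - 1)))\<^sup>2 = (c\<^sup>2 * (real (card Q))\<^sup>2 * n ^ k) * n ^ (k - 2)"
      unfolding power_mult_distrib e1(1)[symmetric] by (simp only: mult_ac)
    finally have "(c\<^sup>2 * (real (card Q))\<^sup>2 * n ^ k) * n ^ (k - 2) \<le> (\<Sum>D\<in>tup V (k - 2). ?a D * ?a D) * n ^ (k - 2)"
      by (simp only: mult_ac)
    then have "c\<^sup>2 * (real (card Q))\<^sup>2 * n ^ k \<le> (\<Sum>D\<in>tup V (k - 2). ?a D * ?a D)"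
      by (rule mult_right_le_imp_le) (use n in simp)
    then have "c\<^sup>2 * (real (card Q))\<^sup>2 \<le> (\<Sum>D\<in>tup V (k - 2). ?a D * ?a D) / n ^ k"
      using n by (simp add: pos_le_divide_eq)
    moreover have "card Q * card Q / n \<le> c\<^sup>2 / 2 * (real (card Q))\<^sup>2"
    proof -
      have "1 / n \<le> c\<^sup>2 * \<delta> ^ 4 / 2" using big by (simp add: n_def)
      also have "\<dots> \<le> c\<^sup>2 * 1 / 2" using \<delta> by (intro divide_right_mono mult_left_mono power_le_one) auto
      finally have "(real (card Q))\<^sup>2 * (1 / n) \<le> (real (card Q))\<^sup>2 * (c\<^sup>2 / 2)" by (intro mult_left_mono) auto
      then show ?thesis by (simp add: power2_eq_square mult_ac)
    qed
    ultimately have "c\<^sup>2 / 2 * (real (card Q))\<^sup>2 \<le> (\<Sum>D\<in>tup V (k - 2). ?a D * ?a D) / n ^ k - card Q * card Q / n" by linarith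
    then have "c * (c\<^sup>2 / 2 * (real (card Q))\<^sup>2) \<le> c * ((\<Sum>D\<in>tup V (k - 2). ?a D * ?a D) / n ^ k - card Q * card Q / n)"
      using c by (intro mult_left_mono) auto
    also have "\<dots> \<le> (\<Sum>x\<in>Q. \<Sum>y\<in>Q. gadget_kernel k l V E x y)"
      unfolding n_def by (rule gadget_kernel_sum_ge[OF R l c finQ finQ])
    finally show "c ^ 3 / 2 * (real (card Q))\<^sup>2 \<le> (\<Sum>x\<in>Q. \<Sum>y\<in>Q. gadget_kernel k l V E x y)"
      by (simp add: power3_eq_cube power2_eq_square mult_ac)
  }
  fix S assume S: "S \<subseteq> V" "\<delta> * card V \<le> real (card S)" "\<delta> * card V \<le> real (card (V - S))"
  let ?T = "V - S"
  have fin: "finite S" "finite ?T" using S V finite_subset by auto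
  let ?a = "\<lambda>D. \<Sum>u\<in>S. real (card (extensions V E D u))" and ?b = "\<lambda>D. \<Sum>u\<in>?T. real (card (extensions V E D u))"
  let ?st = "real (card S) * real (card ?T)"
  have st: "\<delta>\<^sup>2 * n\<^sup>2 \<le> ?st"
  proof -
    have "(\<delta> * n) * (\<delta> * n) \<le> ?st" using S n \<delta> by (intro mult_mono) (auto simp: n_def)
    then show ?thesis by (simp add: power2_eq_square mult_ac)
  qed
  have pair: "c * n ^ (k - 2) \<le> (\<Sum>D\<in>tup V (k - 2). if insert x (insert y (set D)) \<in> E then 1 else 0)" if "x \<in> S" "y \<in> ?T" for x y
  proof -
    have "c * n ^ (k - length [x, y]) \<le> card {ys \<in> tup V (k - length [x, y]). set [x, y] \<union> set ys \<in> E}"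
      unfolding n_def by (rule richD(5)[OF R]) (use that S l in auto)
    then show ?thesis using V by (simp add: sum.If_cases finite_tup Int_def numeral_2_eq_2)
  qed
  have "?st * (c * n ^ (k - 2)) = (\<Sum>x\<in>S. \<Sum>y\<in>?T. c * n ^ (k - 2))" by simp
  also have "\<dots> \<le> (\<Sum>x\<in>S. \<Sum>y\<in>?T. \<Sum>D\<in>tup V (k - 2). if insert x (insert y (set D)) \<in> E then 1 else 0)"
    by (intro sum_mono pair)
  also have "\<dots> = (\<Sum>x\<in>S. \<Sum>D\<in>tup V (k - 2). \<Sum>y\<in>?T. if insert x (insert y (set D)) \<in> E then 1 else 0)"
    by (intro sum.cong refl sum.swap)
  also have "\<dots> = (\<Sum>D\<in>tup V (k - 2). \<Sum>x\<in>S. \<Sum>y\<in>?T. if insert x (insert y (set D)) \<in> E then 1 else 0)"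
    by (rule sum.swap)
  also have "\<dots> \<le> (\<Sum>D\<in>tup V (k - 2). min (?a D) (?b D))"
  proof (rule sum_mono, rule min.boundedI)
    fix D
    have le: "(\<Sum>y\<in>W. if insert x (insert y (set D)) \<in> E then 1 else 0) \<le> real (card (extensions V E D x))" if W: "W \<subseteq> V" for x W
    proof -
      have "finite W" using W V finite_subset by blast
      then have "(\<Sum>y\<in>W. if insert x (insert y (set D)) \<in> E then 1 else 0) = real (card {y \<in> W. insert x (insert y (set D)) \<in> E})"
        by (simp add: sum.If_cases Int_def)
      also have "\<dots> \<le> card (extensions V E D x)" using W V by (auto simp: extensions_def intro!: card_mono)
      finally show ?thesis .
    qed
    show "(\<Sum>x\<in>S. \<Sum>y\<in>?T. if insert x (insert y (set D)) \<in> E then 1 else 0) \<le> ?a D"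
      by (intro sum_mono le) auto
    have "(\<Sum>x\<in>S. \<Sum>y\<in>?T. if insert x (insert y (set D)) \<in> E then 1 else 0) = (\<Sum>y\<in>?T. \<Sum>x\<in>S. if insert y (insert x (set D)) \<in> E then 1 else (0::real))"
      by (subst sum.swap) (simp add: insert_commute)
    also have "\<dots> \<le> ?b D" by (intro sum_mono le S)
    finally show "(\<Sum>x\<in>S. \<Sum>y\<in>?T. if insert x (insert y (set D)) \<in> E then 1 else 0) \<le> ?b D" .
  qed
  finally have "(?st * (c * n ^ (k - 2)))\<^sup>2 \<le> (\<Sum>D\<in>tup V (k - 2). min (?a D) (?b D))\<^sup>2"
    using c n by (intro power_mono) auto
  also have "\<dots> \<le> real (card (tup V (k - 2))) * (\<Sum>D\<in>tup V (k - 2). ?a D * ?b D)"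
    by (rule sum_min_squared_le) (auto simp: finite_tup V sum_nonneg)
  also have "\<dots> = n ^ (k - 2) * (\<Sum>D\<in>tup V (k - 2). ?a D * ?b D)"
    by (simp add: card_tup V n_def)
  finally have "((?st * c)\<^sup>2 * n ^ (k - 2)) * n ^ (k - 2) \<le> (\<Sum>D\<in>tup V (k - 2). ?a D * ?b D) * n ^ (k - 2)"
    by (simp add: power_mult_distrib power2_eq_square mult_ac)
  then have "(?st * c)\<^sup>2 * n ^ (k - 2) \<le> (\<Sum>D\<in>tup V (k - 2). ?a D * ?b D)"
    by (rule mult_right_le_imp_le) (use n in simp)
  then have "(?st * c)\<^sup>2 * n ^ (k - 2) / n ^ k \<le> (\<Sum>D\<in>tup V (k - 2). ?a D * ?b D) / n ^ k"
    using n by (intro divide_right_mono) auto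
  also have "(?st * c)\<^sup>2 * n ^ (k - 2) / n ^ k = (?st * c)\<^sup>2 / n\<^sup>2" using n e1(2) by simp
  finally have h1: "(?st * c)\<^sup>2 / n\<^sup>2 \<le> (\<Sum>D\<in>tup V (k - 2). ?a D * ?b D) / n ^ k" .
  have "c\<^sup>2 * \<delta> ^ 4 * n\<^sup>2 = (\<delta>\<^sup>2 * n\<^sup>2 * c)\<^sup>2 / n\<^sup>2"
    using n by (simp add: power_mult_distrib power2_eq_square power4_eq_xxxx)
  also have "\<dots> \<le> (?st * c)\<^sup>2 / n\<^sup>2"
    using st c by (intro divide_right_mono power_mono mult_right_mono) auto
  finally have h2: "c\<^sup>2 * \<delta> ^ 4 * n\<^sup>2 \<le> (\<Sum>D\<in>tup V (k - 2). ?a D * ?b D) / n ^ k" using h1 by simp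
  have h3: "card S * card ?T / n \<le> (c\<^sup>2 * \<delta> ^ 4 * n\<^sup>2) / 2"
  proof -
    have "real (card S) \<le> n" "real (card ?T) \<le> n" using S(1) V by (auto simp: n_def intro!: card_mono)
    then have "?st * (1 / n) \<le> (n * n) * (c\<^sup>2 * \<delta> ^ 4 / 2)"
      using big by (intro mult_mono) (auto simp: n_def)
    then show ?thesis by (simp add: power2_eq_square mult_ac)
  qed
  have half: "a / 2 \<le> b - e" if "e \<le> a / 2" "a \<le> b" for a b e :: real
    using that by simp
  have "c\<^sup>2 * \<delta> ^ 4 / 2 * n\<^sup>2 \<le> (\<Sum>D\<in>tup V (k - 2). ?a D * ?b D) / n ^ k - card S * card ?T / n"
    using half[OF h3 h2] by (simp only: times_divide_eq_left)
  then have "c * (c\<^sup>2 * \<delta> ^ 4 / 2 * n\<^sup>2) \<le> c * ((\<Sum>D\<in>tup V (k - 2). ?a D * ?b D) / n ^ k - card S * card ?T / n)"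
    using c by (intro mult_left_mono) auto
  also have "\<dots> \<le> (\<Sum>x\<in>S. \<Sum>y\<in>?T. gadget_kernel k l V E x y)"
    unfolding n_def by (rule gadget_kernel_sum_ge[OF R l c fin])
  finally show "c ^ 3 * \<delta> ^ 4 / 2 * (real (card V))\<^sup>2 \<le> (\<Sum>x\<in>S. \<Sum>y\<in>?T. gadget_kernel k l V E x y)"
    by (simp add: n_def power3_eq_cube power2_eq_square mult_ac)
qed

text \<open>A chain of gadgets that trades \<open>u\<close> for \<open>v\<close>. The intermediate
  vertex \<open>w\<close> belongs to the list: it sits in the later segments while the chain is idle
  and moves into the first segment when the trade is made.\<close>

primrec exchange_tuples :: "nat \<Rightarrow> nat \<Rightarrow> 'a set \<Rightarrow> 'a set set \<Rightarrow> nat \<Rightarrow> 'a \<Rightarrow> 'a \<Rightarrow> 'a list set" where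
  "exchange_tuples k l V E 0 u v = gadgets k l V E u v"
| "exchange_tuples k l V E (Suc i) u v = {g @ w # c | g w c. w \<in> V \<and> g \<in> gadgets k l V E u w \<and> c \<in> exchange_tuples k l V E i w v}"

definition exchange_length :: "nat \<Rightarrow> nat \<Rightarrow> nat \<Rightarrow> nat" where
  "exchange_length k l i = Suc i * (2 * k - l - 1) + i"

lemma exchange_tuples_tup: "1 \<le> l \<Longrightarrow> 2 * l < k \<Longrightarrow> exchange_tuples k l V E i u v \<subseteq> tup V (exchange_length k l i)"
proof (induction i arbitrary: u)
  case 0
  then show ?case using gadgets_tup[OF 0] by (simp add: exchange_length_def)
next
  case (Suc i)
  show ?case
  proof
    fix x assume "x \<in> exchange_tuples k l V E (Suc i) u v"
    then obtain g w c where "x = g @ w # c" "w \<in> V" "g \<in> gadgets k l V E u w" "c \<in> exchange_tuples k l V E i w v"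
      by auto
    then show "x \<in> tup V (exchange_length k l (Suc i))"
      using gadgets_tup[OF Suc.prems] Suc.IH[OF Suc.prems] by (fastforce simp: tup_def exchange_length_def)
  qed
qed

lemma exchange_tuples_kernel_iterate:
  assumes V: "finite V" "V \<noteq> {}" and l: "1 \<le> l" "2 * l < k"
  shows "kernel_iterate (gadget_kernel k l V E) V i u v * real (card V) ^ exchange_length k l i \<le> card (exchange_tuples k l V E i u v)"
proof (induction i arbitrary: u)
  define n where "n = real (card V)"
  have n: "n > 0" using V by (simp add: n_def card_gt_0_iff)
  have fin: "finite (exchange_tuples k l V E i u v)" for i u
    using exchange_tuples_tup[OF l] finite_tup[OF V(1)] finite_subset by metis
  {
    case 0
    then show ?case using n by (simp add: gadget_kernel_def exchange_length_def n_def)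
  next
    case (Suc i)
    have "kernel_iterate (gadget_kernel k l V E) V (Suc i) u v * n ^ exchange_length k l (Suc i) =
       (\<Sum>w\<in>V. (gadget_kernel k l V E u w * n ^ (2 * k - l - 1)) * (kernel_iterate (gadget_kernel k l V E) V i w v * n ^ exchange_length k l i))"
    proof -
      have "n ^ exchange_length k l (Suc i) = n * (n ^ (2 * k - l - 1) * n ^ exchange_length k l i)"
        unfolding power_add[symmetric] power_Suc[symmetric] by (intro arg_cong[where f = "(^) n"]) (simp add: exchange_length_def)
      then have "kernel_iterate (gadget_kernel k l V E) V (Suc i) u v * n ^ exchange_length k l (Suc i) =
        (\<Sum>w\<in>V. gadget_kernel k l V E u w * kernel_iterate (gadget_kernel k l V E) V i w v) * (n ^ (2 * k - l - 1) * n ^ exchange_length k l i)"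
        using n by (simp add: n_def)
      then show ?thesis by (simp only: sum_distrib_left sum_distrib_right mult_ac)
    qed
    also have "\<dots> \<le> (\<Sum>w\<in>V. real (card (gadgets k l V E u w)) * card (exchange_tuples k l V E i w v))"
    proof (intro sum_mono mult_mono)
      show "0 \<le> kernel_iterate (gadget_kernel k l V E) V i w v * n ^ exchange_length k l i" for w
      proof -
        have "0 \<le> kernel_iterate (gadget_kernel k l V E) V i w v"
          by (induction i arbitrary: w) (auto intro!: divide_nonneg_nonneg sum_nonneg mult_nonneg_nonneg simp: gadget_kernel_def)
        then show ?thesis using n by simp
      qed
    next
      show "gadget_kernel k l V E u w * n ^ (2 * k - l - 1) \<le> real (card (gadgets k l V E u w))" for w
        using n by (simp add: gadget_kernel_def n_def)
      show "kernel_iterate (gadget_kernel k l V E) V i w v * n ^ exchange_length k l i \<le> real (card (exchange_tuples k l V E i w v))" for w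
        using Suc.IH[of w] by (simp add: n_def)
    qed simp
    also have "\<dots> = card (SIGMA w:V. gadgets k l V E u w \<times> exchange_tuples k l V E i w v)"
      using V by (subst card_SigmaI) (auto simp: finite_gadgets[OF V(1) l] fin card_cartesian_product)
    also have "\<dots> \<le> card (exchange_tuples k l V E (Suc i) u v)"
      unfolding of_nat_le_iff
    proof (rule card_inj_on_le[where f = "\<lambda>(w, g, c). g @ w # c"])
      show "inj_on (\<lambda>(w, g, c). g @ w # c) (SIGMA w:V. gadgets k l V E u w \<times> exchange_tuples k l V E i w v)"
      proof (rule inj_onI)
        fix x y assume x: "x \<in> (SIGMA w:V. gadgets k l V E u w \<times> exchange_tuples k l V E i w v)"
          and y: "y \<in> (SIGMA w:V. gadgets k l V E u w \<times> exchange_tuples k l V E i w v)"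
          and e: "(case x of (w, g, c) \<Rightarrow> g @ w # c) = (case y of (w, g, c) \<Rightarrow> g @ w # c)"
        obtain w g c w' g' c' where xy: "x = (w, g, c)" "y = (w', g', c')" by (cases x, cases y) auto
        have "length g = 2 * k - l - 1" "length g' = 2 * k - l - 1"
          using x y gadgets_tup[OF l] unfolding xy by (fastforce simp: tup_def)+
        then show "x = y" using e unfolding xy by simp
      qed
      show "(\<lambda>(w, g, c). g @ w # c) ` (SIGMA w:V. gadgets k l V E u w \<times> exchange_tuples k l V E i w v) \<subseteq> exchange_tuples k l V E (Suc i) u v"
        by auto
    qed (rule fin)
    finally show ?case by (simp add: n_def del: kernel_iterate.simps exchange_tuples.simps)
  }
qed

text \<open>Reachability in the gadget kernel, with \<open>Q\<close> the complement of the core. The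
  chain length \<open>L\<close> depends on \<xi> but not on the hypergraph, so all absorbers built
  from it have the same size.\<close>

lemma exchange:
  fixes c \<xi> :: real
  assumes l: "1 \<le> l" "2 * l < k" and c: "0 < c" "c \<le> 1" and \<xi>: "0 < \<xi>" "\<xi> \<le> 1"
  obtains L n0 \<eta> where "(\<eta>::real) > 0"
    "\<And>(V::'a set) E. rich k (k - l) c V E \<Longrightarrow> n0 \<le> card V \<Longrightarrow>
      \<exists>Q\<subseteq>V. real (card Q) \<le> \<xi> * card V \<and>
        (\<forall>u\<in>V - Q. \<forall>v\<in>V - Q. \<eta> * real (card V) ^ exchange_length k l L \<le> card (exchange_tuples k l V E L u v))"
proof -
  define \<delta> where "\<delta> = c ^ 3 / 2 * \<xi> / 16"
  define \<kappa> where "\<kappa> = c ^ 3 * \<delta> ^ 4 / 2"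
  have c3: "c ^ 3 / 2 > 0" "c ^ 3 / 2 \<le> 1" using c power_le_one[of c 3] by auto
  have \<delta>: "\<delta> > 0" using c3 \<xi> by (simp add: \<delta>_def)
  have le1: "c ^ 3 / 2 * \<xi> \<le> 1" using mult_mono[OF c3(2) \<xi>(2)] c3 \<xi> by simp
  then have \<delta>1: "\<delta> \<le> 1" unfolding \<delta>_def by simp
  have \<kappa>: "\<kappa> > 0" using c \<delta> by (simp add: \<kappa>_def)
  obtain L \<eta> where \<eta>: "\<eta> > 0" and reach:
    "\<And>(X::'a set) p. mixing (c ^ 3 / 2) (c ^ 3 / 2 * \<xi> / 16) \<kappa> X p \<Longrightarrow>
      \<exists>X'\<subseteq>X. real (card (X - X')) \<le> \<xi> * card X \<and> (\<forall>x\<in>X'. \<forall>y\<in>X'. kernel_iterate p X L x y \<ge> \<eta>)"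
    using robust_reach[OF c3(1) \<xi>(1) le1 \<kappa>, where 'x = 'a] by metis
  show ?thesis
  proof (rule that[of \<eta> "nat \<lceil>1 / (c\<^sup>2 * \<delta> ^ 4 / 2)\<rceil>" L])
    fix V :: "'a set" and E
    assume R: "rich k (k - l) c V E" and nn: "nat \<lceil>1 / (c\<^sup>2 * \<delta> ^ 4 / 2)\<rceil> \<le> card V"
    note V = richD(1,2)[OF R]
    define n where "n = real (card V)"
    have n: "n > 0" using V by (simp add: n_def card_gt_0_iff)
    have "1 / (c\<^sup>2 * \<delta> ^ 4 / 2) \<le> n" using nn unfolding n_def by linarith
    then have "1 / n \<le> c\<^sup>2 * \<delta> ^ 4 / 2" using n c \<delta> by (simp add: field_simps)
    then have "mixing (c ^ 3 / 2) \<delta> \<kappa> V (gadget_kernel k l V E)"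
      unfolding \<kappa>_def n_def by (rule gadget_kernel_mixing[OF R l c(1) \<delta> \<delta>1])
    then obtain X' where X': "X' \<subseteq> V" "real (card (V - X')) \<le> \<xi> * card V"
      "\<And>x y. x \<in> X' \<Longrightarrow> y \<in> X' \<Longrightarrow> kernel_iterate (gadget_kernel k l V E) V L x y \<ge> \<eta>"
      using reach[of V "gadget_kernel k l V E"] by (auto simp: \<delta>_def)
    show "\<exists>Q\<subseteq>V. real (card Q) \<le> \<xi> * card V \<and>
        (\<forall>u\<in>V - Q. \<forall>v\<in>V - Q. \<eta> * real (card V) ^ exchange_length k l L \<le> card (exchange_tuples k l V E L u v))"
    proof (intro exI[of _ "V - X'"] conjI ballI)
      fix u v assume "u \<in> V - (V - X')" "v \<in> V - (V - X')"
      then have "\<eta> * n ^ exchange_length k l L \<le> kernel_iterate (gadget_kernel k l V E) V L u v * n ^ exchange_length k l L"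
        using X' n by (intro mult_right_mono) auto
      then show "\<eta> * real (card V) ^ exchange_length k l L \<le> card (exchange_tuples k l V E L u v)"
        using exchange_tuples_kernel_iterate[OF V l, of E L u v] by (simp add: n_def)
    qed (use X' in auto)
  qed (rule \<eta>)
qed

section \<open>Absorbers\<close>

definition lpath :: "nat \<Rightarrow> nat \<Rightarrow> 'a set set \<Rightarrow> 'a list \<Rightarrow> bool" where
  "lpath k l E xs \<longleftrightarrow> distinct xs \<and> (\<exists>m\<ge>1. hwalk k l E m xs)"

definition ends :: "nat \<Rightarrow> 'a list \<Rightarrow> 'a list \<times> 'a list" where
  "ends l xs = (take l xs, drop (length xs - l) xs)"

text \<open>Connectors see only the two ends of a segment, so segments that are alike can replace
  each other inside a linked cycle.\<close>

definition alike :: "nat \<Rightarrow> nat \<Rightarrow> 'a set set \<Rightarrow> 'a list \<Rightarrow> 'a list \<Rightarrow> bool" where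
  "alike k l E s s' \<longleftrightarrow> lpath k l E s \<and> lpath k l E s' \<and> ends l s = ends l s'"

text \<open>For g = a # b # D @ M this is M b J a u Z, where J and Z are the two parts of
  \<open>D\<close>. Reading it off by position makes it a total function of the list;
  \<open>drop k g\<close> is M because \<open>D\<close> has \<open>k - 2\<close> entries.\<close>

definition gadget_segment :: "nat \<Rightarrow> nat \<Rightarrow> 'a list \<Rightarrow> 'a \<Rightarrow> 'a list" where
  "gadget_segment k l g u = drop k g @ g ! 1 # take (l - 1) (drop 2 g) @ g ! 0 # u # drop (l - 1) (take (k - 2) (drop 2 g))"

lemma gadget_segment_eq:
  assumes "length D = k - 2" "1 \<le> l" "2 * l < k"
  shows "gadget_segment k l (a # b # D @ M) u = M @ b # take (l - 1) D @ a # u # drop (l - 1) D"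
proof -
  obtain k' where k': "k = Suc (Suc k')" using assms by (metis Suc_diff_Suc Suc_leI less_imp_Suc_add add_Suc_right mult_2 One_nat_def Suc_le_lessD add_gr_0 plus_1_eq_Suc)
  then show ?thesis using assms by (simp add: gadget_segment_def)
qed

lemma ends_append:
  assumes "l \<le> length ys" "l \<le> length zs"
  shows "ends l (ys @ ws @ zs) = (take l ys, drop (length zs - l) zs)"
proof -
  have "length (ys @ ws @ zs) - l = length (ys @ ws) + (length zs - l)" using assms by simp
  then show ?thesis using assms by (simp add: ends_def)
qed

text \<open>The two edges are M b J a and J a u Z, overlapping in J a. Exchanging \<open>a\<close>
  and \<open>b\<close> keeps the first edge as a set. The ends lie within M and Z, which have k - l
  - 1 \<ge> l entries each, so they do not change.\<close>

lemma gadget_segment_props: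
  assumes l: "1 \<le> l" "2 * l < k" and g: "g \<in> gadgets k l V E u v" and d: "distinct (u # g)" "distinct (v # g)"
  shows "alike k l E (gadget_segment k l g u) (gadget_segment k l (g ! 1 # g ! 0 # drop 2 g) v)"
    "mset (gadget_segment k l g u) = add_mset u (mset g)" "mset (gadget_segment k l (g ! 1 # g ! 0 # drop 2 g) v) = add_mset v (mset g)"
proof -
  from g obtain a b D M where g_eq: "g = a # b # D @ M" and D: "D \<in> tup V (k - 2)" and M: "M \<in> tup V (k - l - 1)" and
     e: "insert u (insert a (set D)) \<in> E" "insert v (insert b (set D)) \<in> E" "insert a (insert b (set (take (l - 1) D) \<union> set M)) \<in> E"
    by (auto simp: gadgets_def)
  have len: "length D = k - 2" "length M = k - l - 1" using D M by (auto simp: tup_def)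
  have mm: "mset (gadget_segment k l (a # b # D @ M) u) = add_mset u (mset (a # b # D @ M))" for a b u
  proof -
    have "mset D = mset (take (l - 1) D) + mset (drop (l - 1) D)" by (metis append_take_drop_id mset_append)
    then show ?thesis by (simp add: gadget_segment_eq[OF len(1) l])
  qed
  have path: "lpath k l E (gadget_segment k l (a # b # D @ M) u)"
    if d: "distinct (u # a # b # D @ M)" and e: "insert u (insert a (set D)) \<in> E" "insert a (insert b (set (take (l - 1) D) \<union> set M)) \<in> E" for a b u
    unfolding lpath_def
  proof (intro conjI exI[of _ 2])
    show "distinct (gadget_segment k l (a # b # D @ M) u)"
      using d mset_eq_imp_distinct_iff[of "gadget_segment k l (a # b # D @ M) u" "u # a # b # D @ M"] mm by simp
    let ?J = "take (l - 1) D" and ?Z = "drop (l - 1) D"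
    have w: "gadget_segment k l (a # b # D @ M) u = (M @ [b]) @ ?J @ [a] @ u # ?Z" using gadget_segment_eq[OF len(1) l] by simp
    have "hwalk k l E (Suc 0) ((M @ [b]) @ (?J @ [a]))"
      using e(2) len l by (subst hwalk_1) (auto simp: insert_commute Un_commute)
    moreover have "hwalk k l E (Suc 0) ((?J @ [a]) @ (u # ?Z))"
    proof (subst hwalk_1)
      have "set ?J \<union> set ?Z = set D" by (metis append_take_drop_id set_append)
      then have "set ((?J @ [a]) @ (u # ?Z)) = insert u (insert a (set D))" by auto
      then show "length ((?J @ [a]) @ (u # ?Z)) = k \<and> set ((?J @ [a]) @ (u # ?Z)) \<in> E"
        using e(1) len l by simp
    qed (use l in simp)
    ultimately have "hwalk k l E (Suc 0 + Suc 0) ((M @ [b]) @ (?J @ [a]) @ (u # ?Z))"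
      by (rule hwalk_append) (use len l in auto)
    then show "hwalk k l E 2 (gadget_segment k l (a # b # D @ M) u)" unfolding w by (simp add: numeral_2_eq_2)
  qed simp
  have en: "ends l (gadget_segment k l (a # b # D @ M) u) = (take l M, drop (length (drop (l - 1) D) - l) (drop (l - 1) D))" for a b u
  proof -
    have "l \<le> length M" "l \<le> length (drop (l - 1) D)" using len l by auto
    then show ?thesis
      using ends_append[of l M "drop (l - 1) D" "b # take (l - 1) D @ [a, u]"] by (simp add: gadget_segment_eq[OF len(1) l])
  qed
  have sw: "g ! 1 # g ! 0 # drop 2 g = b # a # D @ M" by (simp add: g_eq)
  have e3: "insert b (insert a (set (take (l - 1) D) \<union> set M)) \<in> E" using e(3) by (simp add: insert_commute)
  show "mset (gadget_segment k l g u) = add_mset u (mset g)" unfolding g_eq by (rule mm)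
  show "mset (gadget_segment k l (g ! 1 # g ! 0 # drop 2 g) v) = add_mset v (mset g)"
    unfolding sw mm by (simp add: g_eq add_mset_commute)
  show "alike k l E (gadget_segment k l g u) (gadget_segment k l (g ! 1 # g ! 0 # drop 2 g) v)"
    unfolding alike_def sw
    using path[OF _ e(1,3)] path[OF _ e(2) e3] d en unfolding g_eq by auto
qed

primrec idle_segments :: "nat \<Rightarrow> nat \<Rightarrow> nat \<Rightarrow> 'a \<Rightarrow> 'a list \<Rightarrow> 'a list list" where
  "idle_segments k l 0 u xs = [gadget_segment k l xs u]"
| "idle_segments k l (Suc i) u xs = gadget_segment k l (take (2 * k - l - 1) xs) u # idle_segments k l i (xs ! (2 * k - l - 1)) (drop (2 * k - l) xs)"

text \<open>The trade telescopes: each gadget gives up its own vertex of the chain and takes the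
  next one, so that in total \<open>u\<close> leaves and \<open>v\<close> enters, while every
  intermediate vertex appears once in either state.\<close>

lemma exchange_tuples_idle_segments:
  assumes l: "1 \<le> l" "2 * l < k"
  shows "c \<in> exchange_tuples k l V E i u v \<Longrightarrow> distinct (u # c) \<Longrightarrow> distinct (v # c) \<Longrightarrow>
   \<exists>segs. list_all2 (alike k l E) (idle_segments k l i u c) segs \<and> mset (concat (idle_segments k l i u c)) = add_mset u (mset c) \<and>
     mset (concat segs) = add_mset v (mset c)"
proof (induction i arbitrary: u c)
  case 0
  then show ?case
    using gadget_segment_props[OF l, of c V E u v]
    by (intro exI[of _ "[gadget_segment k l (c ! 1 # c ! 0 # drop 2 c) v]"]) simp
next
  case (Suc i)
  from Suc.prems(1) obtain g w c' where c: "c = g @ w # c'" and g: "g \<in> gadgets k l V E u w" and c': "c' \<in> exchange_tuples k l V E i w v"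
    by auto
  have lg: "length g = 2 * k - l - 1" using gadgets_tup[OF l] g by (fastforce simp: tup_def)
  then have lg': "2 * k - l = Suc (length g)" using l by simp
  have "take (length g) c = g" "c ! length g = w" "drop (Suc (length g)) c = c'" by (simp_all add: c)
  then have o: "idle_segments k l (Suc i) u c = gadget_segment k l g u # idle_segments k l i w c'"
    by (simp only: idle_segments.simps lg' diff_Suc_1)
  obtain segs where segs: "list_all2 (alike k l E) (idle_segments k l i w c') segs" "mset (concat (idle_segments k l i w c')) = add_mset w (mset c')"
     "mset (concat segs) = add_mset v (mset c')"
    using Suc.IH[OF c'] Suc.prems(2,3) by (auto simp: c)
  have "distinct (u # g)" "distinct (w # g)" using Suc.prems(2) by (auto simp: c)
  then show ?case
    using gadget_segment_props[OF l g] segs unfolding o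
    by (intro exI[of _ "gadget_segment k l (g ! 1 # g ! 0 # drop 2 g) w # segs"]) (simp add: c)
qed

section \<open>Trading whole lists of vertices, and absorbers\<close>

primrec exchange_lists :: "nat \<Rightarrow> nat \<Rightarrow> 'a set \<Rightarrow> 'a set set \<Rightarrow> nat \<Rightarrow> ('a \<times> 'a) list \<Rightarrow> 'a list set" where
  "exchange_lists k l V E L [] = {[]}"
| "exchange_lists k l V E L (p # ps) = {c @ cs | c cs. c \<in> exchange_tuples k l V E L (fst p) (snd p) \<and> cs \<in> exchange_lists k l V E L ps}"

primrec idle_segments_list :: "nat \<Rightarrow> nat \<Rightarrow> nat \<Rightarrow> 'a list \<Rightarrow> 'a list \<Rightarrow> 'a list list" where
  "idle_segments_list k l L [] xs = []"
| "idle_segments_list k l L (u # us) xs = idle_segments k l L u (take (exchange_length k l L) xs) @ idle_segments_list k l L us (drop (exchange_length k l L) xs)"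

lemma exchange_lists_tup:
  assumes l: "1 \<le> l" "2 * l < k"
  shows "exchange_lists k l V E L ps \<subseteq> tup V (length ps * exchange_length k l L)"
proof (induction ps)
  case (Cons p ps)
  then show ?case using exchange_tuples_tup[OF l] by (fastforce simp: tup_def)
qed (simp add: tup_def)

lemma card_exchange_lists:
  assumes V: "finite V" and l: "1 \<le> l" "2 * l < k" and \<eta>: "\<eta> \<ge> 0"
    and ps: "\<And>p. p \<in> set ps \<Longrightarrow> \<eta> * real (card V) ^ exchange_length k l L \<le> card (exchange_tuples k l V E L (fst p) (snd p))"
  shows "\<eta> ^ length ps * real (card V) ^ (length ps * exchange_length k l L) \<le> card (exchange_lists k l V E L ps)"
  using ps
proof (induction ps)
  case (Cons p ps)
  have fin: "finite (exchange_lists k l V E L ps)" "finite (exchange_tuples k l V E L (fst p) (snd p))" "finite (exchange_lists k l V E L (p # ps))"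
    using exchange_lists_tup[OF l] exchange_tuples_tup[OF l] finite_tup[OF V] finite_subset by metis+
  have "card (exchange_tuples k l V E L (fst p) (snd p) \<times> exchange_lists k l V E L ps) \<le> card (exchange_lists k l V E L (p # ps))"
  proof (rule card_inj_on_le[where f = "\<lambda>(c, cs). c @ cs"])
    show "inj_on (\<lambda>(c, cs). c @ cs) (exchange_tuples k l V E L (fst p) (snd p) \<times> exchange_lists k l V E L ps)"
    proof (rule inj_onI)
      fix x y assume x: "x \<in> exchange_tuples k l V E L (fst p) (snd p) \<times> exchange_lists k l V E L ps"
        and y: "y \<in> exchange_tuples k l V E L (fst p) (snd p) \<times> exchange_lists k l V E L ps"
        and e: "(case x of (c, cs) \<Rightarrow> c @ cs) = (case y of (c, cs) \<Rightarrow> c @ cs)"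
      obtain c cs c' cs' where xy: "x = (c, cs)" "y = (c', cs')" by (cases x, cases y) auto
      have "length c = exchange_length k l L" "length c' = exchange_length k l L"
        using x y exchange_tuples_tup[OF l] unfolding xy by (fastforce simp: tup_def)+
      then show "x = y" using e unfolding xy by simp
    qed
  qed (use fin in auto)
  then have "real (card (exchange_tuples k l V E L (fst p) (snd p))) * real (card (exchange_lists k l V E L ps)) \<le> card (exchange_lists k l V E L (p # ps))"
    by (simp add: card_cartesian_product del: exchange_lists.simps flip: of_nat_mult)
  moreover have "\<eta> ^ length (p # ps) * real (card V) ^ (length (p # ps) * exchange_length k l L) =
     (\<eta> * real (card V) ^ exchange_length k l L) * (\<eta> ^ length ps * real (card V) ^ (length ps * exchange_length k l L))"
    by (simp add: power_add)
  moreover have "\<dots> \<le> real (card (exchange_tuples k l V E L (fst p) (snd p))) * real (card (exchange_lists k l V E L ps))"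
    using Cons \<eta> by (intro mult_mono) auto
  ultimately show ?case by linarith
qed simp

lemma exchange_lists_idle_segments_list:
  assumes l: "1 \<le> l" "2 * l < k"
  shows "length us = length vs \<Longrightarrow> cs \<in> exchange_lists k l V E L (zip us vs) \<Longrightarrow> distinct (us @ cs) \<Longrightarrow> distinct (vs @ cs) \<Longrightarrow>
   \<exists>segs. list_all2 (alike k l E) (idle_segments_list k l L us cs) segs \<and> mset (concat (idle_segments_list k l L us cs)) = mset us + mset cs \<and>
     mset (concat segs) = mset vs + mset cs"
proof (induction us vs arbitrary: cs rule: list_induct2)
  case (Cons u us v vs)
  from Cons.prems(1) obtain c cs' where cs: "cs = c @ cs'" and c: "c \<in> exchange_tuples k l V E L u v" and cs': "cs' \<in> exchange_lists k l V E L (zip us vs)"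
    by auto
  have lc: "length c = exchange_length k l L" using exchange_tuples_tup[OF l] c by (fastforce simp: tup_def)
  obtain s1 where s1: "list_all2 (alike k l E) (idle_segments k l L u c) s1" "mset (concat (idle_segments k l L u c)) = add_mset u (mset c)"
     "mset (concat s1) = add_mset v (mset c)"
    using exchange_tuples_idle_segments[OF l c] Cons.prems(2,3) by (auto simp: cs)
  obtain s2 where s2: "list_all2 (alike k l E) (idle_segments_list k l L us cs') s2" "mset (concat (idle_segments_list k l L us cs')) = mset us + mset cs'"
     "mset (concat s2) = mset vs + mset cs'"
    using Cons.IH[OF cs'] Cons.prems(2,3) by (auto simp: cs)
  show ?case
    using s1 s2 lc by (intro exI[of _ "s1 @ s2"]) (auto simp: cs intro: list_all2_appendI)
qed simp

text \<open>\<open>off T\<close> cuts \<open>T\<close> into the segments that the cycle uses when \<open>T\<close> absorbs nothing. It does not depend on \<open>S\<close>, so the segments can be linked before it is known which set each absorber will take in.\<close>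

definition absorbs :: "nat \<Rightarrow> nat \<Rightarrow> 'a set set \<Rightarrow> ('a list \<Rightarrow> 'a list list) \<Rightarrow> 'a list \<Rightarrow> 'a list \<Rightarrow> bool" where
  "absorbs k l E off S T \<longleftrightarrow> fresh (set S) T \<and> mset (concat (off T)) = mset T \<and>
     (\<exists>segs. list_all2 (alike k l E) (off T) segs \<and> mset (concat segs) = mset T + mset S)"

lemma conn_lpath:
  assumes "U \<in> conn k l V E m I J" "1 \<le> m" "distinct (I @ U @ J)"
  shows "lpath k l E (I @ U @ J)"
  using assms by (auto simp: lpath_def conn_def)

text \<open>An absorber is T = I U1 J U2 cs, where U1 and U2 are interiors of connectors from I to J
  with m and m + 1 edges, so that U2 has k - l more entries. In the idle state the path is I U1 J
  and the exchange segments hold U2. To absorb \<open>S\<close>, the path becomes I U2 J and the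
  exchange segments trade U2 for U1 and \<open>S\<close>. The traded vertices are those of U1, U2
  and \<open>S\<close>, which therefore avoid the exceptional set \<open>Q\<close>.\<close>

lemma absorbers:
  fixes c \<xi>0 :: real
  assumes l: "1 \<le> l" "2 * l < k" and c: "0 < c" "c \<le> 1" and \<xi>0: "0 < \<xi>0"
  obtains b n0 \<eta> off where "(\<eta>::real) > 0" "1 \<le> b"
    "\<And>(V::'a set) E. rich k (k - l) c V E \<Longrightarrow> n0 \<le> card V \<Longrightarrow>
      \<exists>Q\<subseteq>V. real (card Q) \<le> \<xi>0 * card V \<and>
        (\<forall>S\<in>tup (V - Q) (k - l). distinct S \<longrightarrow> \<eta> * real (card V) ^ b \<le> card {T \<in> tup V b. absorbs k l E off S T})"
proof -
  obtain m n1 \<eta>1 where m: "1 \<le> m" and \<eta>1: "(\<eta>1::real) > 0" and con: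
    "\<And>(V::'a set) E A B. rich k (k - l) c V E \<Longrightarrow> n1 \<le> card V \<Longrightarrow> A \<in> tup V l \<Longrightarrow> B \<in> tup V l \<Longrightarrow>
      distinct A \<Longrightarrow> distinct B \<Longrightarrow>
      \<eta>1 * real (card V) ^ (m * (k - l) - l) \<le> card (conn k l V E m A B) \<and>
      \<eta>1 * real (card V) ^ (Suc m * (k - l) - l) \<le> card (conn k l V E (Suc m) A B)"
    using connecting[OF l c, where 'a = 'a] by metis
  define b1 where "b1 = m * (k - l) - l"
  define b2 where "b2 = Suc m * (k - l) - l"
  have "l * 1 \<le> m * (k - l)" using m l mult_le_mono[of 1 m l "k - l"] by simp
  then have b12: "b2 = b1 + (k - l)" "1 \<le> b2" using l by (auto simp: b1_def b2_def)
  \<comment> \<open>\<open>Q\<close> must be so small that a positive proportion of the connectors,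
    with at most \<open>b2\<close> inner vertices, avoids it.\<close>
  define \<xi> where "\<xi> = min (min \<xi>0 1) (\<eta>1 / (4 * b2))"
  have \<xi>: "0 < \<xi>" "\<xi> \<le> 1" "\<xi> \<le> \<xi>0" "b2 * \<xi> \<le> \<eta>1 / 4"
  proof -
    have "\<xi> \<le> \<eta>1 / (4 * b2)" by (simp add: \<xi>_def)
    then show "b2 * \<xi> \<le> \<eta>1 / 4" using b12 by (simp add: field_simps)
  qed (use \<xi>0 \<eta>1 b12 in \<open>auto simp: \<xi>_def\<close>)
  obtain L n2 \<eta>2 where \<eta>2: "(\<eta>2::real) > 0" and exc:
    "\<And>(V::'a set) E. rich k (k - l) c V E \<Longrightarrow> n2 \<le> card V \<Longrightarrow>
      \<exists>Q\<subseteq>V. real (card Q) \<le> \<xi> * card V \<and>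
        (\<forall>u\<in>V - Q. \<forall>v\<in>V - Q. \<eta>2 * real (card V) ^ exchange_length k l L \<le> card (exchange_tuples k l V E L u v))"
    using exchange[OF l c \<xi>(1,2), where 'a = 'a] by metis
  define e where "e = exchange_length k l L"
  define b where "b = l + (b1 + (l + (b2 + b2 * e)))"
  \<comment> \<open>The factors are the densities of I, J, the two connectors and the exchange
    lists; the final half is lost to coincidences within \<open>T\<close> and with
    \<open>S\<close>.\<close>
  define \<eta> where "\<eta> = (1 / 2 * (\<eta>1 / 2 * (1 / 2 * (\<eta>1 / 2 * \<eta>2 ^ b2)))) / 2"
  have \<eta>: "\<eta> > 0" using \<eta>1 \<eta>2 by (simp add: \<eta>_def)
  define off where "off T = take (l + (b1 + l)) T # idle_segments_list k l L (take b2 (drop (l + (b1 + l)) T)) (drop (l + (b1 + (l + b2))) T)" for T :: "'a list"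
  define n0 where "n0 = Suc (n1 + n2 + nat \<lceil>real (b2 * b2) / (\<eta>1 / 4)\<rceil> + 2 * (l * l) + nat \<lceil>real (b * (k - l) + b * b) / \<eta>\<rceil>)"
  show ?thesis
  proof (rule that[of \<eta> b n0 off])
    show "\<eta> > 0" by fact
    show "1 \<le> b" using l by (simp add: b_def)
    fix V :: "'a set" and E
    assume R: "rich k (k - l) c V E" and nn: "n0 \<le> card V"
    note V = richD(1,2)[OF R]
    define n where "n = real (card V)"
    have n: "n > 0" using V by (simp add: n_def card_gt_0_iff)
    have "real (b2 * b2) / (\<eta>1 / 4) \<le> n" "real (b * (k - l) + b * b) / \<eta> \<le> n" "2 * real (l * l) \<le> n"
      using nn unfolding n0_def n_def by linarith+
    then have nb: "real (b2 * b2) \<le> \<eta>1 / 4 * n" "real (b * (k - l) + b * b) \<le> \<eta> * n" "real (l * l) \<le> 1 / 2 * n"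
      using \<eta>1 \<eta> by (auto simp: divide_le_eq mult_ac)
    obtain Q where Q: "Q \<subseteq> V" "real (card Q) \<le> \<xi> * n"
       "\<And>u v. u \<in> V - Q \<Longrightarrow> v \<in> V - Q \<Longrightarrow> \<eta>2 * n ^ e \<le> card (exchange_tuples k l V E L u v)"
      using exc[OF R] nn unfolding n0_def n_def e_def by auto
    have finQ: "finite Q" using Q V finite_subset by blast
    define X where "X = {A \<in> tup V l. fresh {} A}"
    have X: "1 / 2 * n ^ l \<le> real (card X)"
    proof -
      have "(1 - 1 / 2) * n ^ l \<le> real (card X)"
        unfolding X_def n_def by (rule card_fresh_ge[OF V(1)]) (use nb V in \<open>auto simp: card_tup n_def\<close>)
      then show ?thesis by simp
    qed
    have XD: "A \<in> tup V l" "distinct A" if "A \<in> X" for A using that by (auto simp: X_def fresh_def)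
    have small: "real (j * card Q + j * j) \<le> \<eta>1 / 2 * card V" if "j \<le> b2" for j
    proof -
      have "real (j * card Q + j * j) \<le> real (b2 * card Q + b2 * b2)"
        unfolding of_nat_le_iff using that by (intro add_mono mult_le_mono) auto
      also have "\<dots> \<le> b2 * (\<xi> * n) + \<eta>1 / 4 * n"
        using Q(2) nb(1) by (simp add: add_mono mult_left_mono)
      also have "b2 * (\<xi> * n) \<le> \<eta>1 / 4 * n" using mult_right_mono[OF \<xi>(4), of n] n by simp
      finally show ?thesis by (simp add: n_def)
    qed
    define C1 where "C1 I J = {U \<in> conn k l V E m I J. fresh Q U}" for I J
    define C2 where "C2 I J = {U \<in> conn k l V E (Suc m) I J. fresh Q U}" for I J
    have C1: "\<eta>1 / 2 * n ^ b1 \<le> real (card (C1 I J))" and C2: "\<eta>1 / 2 * n ^ b2 \<le> real (card (C2 I J))"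
      if I: "I \<in> X" and J: "J \<in> X" for I J
    proof -
      have cc: "\<eta>1 * n ^ b1 \<le> card (conn k l V E m I J)" "\<eta>1 * n ^ b2 \<le> card (conn k l V E (Suc m) I J)"
        using con[OF R _ XD(1)[OF I] XD(1)[OF J] XD(2)[OF I] XD(2)[OF J]] nn unfolding n0_def n_def b1_def b2_def by auto
      have s1: "conn k l V E m I J \<subseteq> tup V b1" unfolding b1_def by (rule conn_sub)
      have s2: "conn k l V E (Suc m) I J \<subseteq> tup V b2" unfolding b2_def by (rule conn_sub)
      have "b1 \<le> b2" using b12 by simp
      have "(\<eta>1 - \<eta>1 / 2) * n ^ b1 \<le> real (card (C1 I J))"
        using card_fresh_ge[OF V(1) s1 finQ cc(1)[unfolded n_def] small[OF \<open>b1 \<le> b2\<close>] V(2)] by (simp add: C1_def n_def)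
      moreover have "(\<eta>1 - \<eta>1 / 2) * n ^ b2 \<le> real (card (C2 I J))"
        using card_fresh_ge[OF V(1) s2 finQ cc(2)[unfolded n_def] small[OF order.refl] V(2)] by (simp add: C2_def n_def)
      ultimately show "\<eta>1 / 2 * n ^ b1 \<le> real (card (C1 I J))" "\<eta>1 / 2 * n ^ b2 \<le> real (card (C2 I J))" by simp_all
    qed
    have C1D: "U \<in> tup (V - Q) b1" "U \<in> conn k l V E m I J" if "U \<in> C1 I J" for U I J
      using that conn_sub[of k l V E m I J] by (auto simp: C1_def fresh_def tup_def b1_def)
    have C2D: "U \<in> tup (V - Q) b2" "U \<in> conn k l V E (Suc m) I J" if "U \<in> C2 I J" for U I J
      using that conn_sub[of k l V E "Suc m" I J] by (auto simp: C2_def fresh_def tup_def b2_def)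
    show "\<exists>Q\<subseteq>V. real (card Q) \<le> \<xi>0 * card V \<and>
        (\<forall>S\<in>tup (V - Q) (k - l). distinct S \<longrightarrow> \<eta> * real (card V) ^ b \<le> card {T \<in> tup V b. absorbs k l E off S T})"
    proof (intro exI[of _ Q] conjI ballI impI)
      show "Q \<subseteq> V" by fact
      have "\<xi> * n \<le> \<xi>0 * n" using \<xi> n by (intro mult_right_mono) auto
      then show "real (card Q) \<le> \<xi>0 * card V" using Q(2) by (simp add: n_def)
      fix S assume S: "S \<in> tup (V - Q) (k - l)" "distinct S"
      define D where "D = (SIGMA I:X. SIGMA J:X. SIGMA U1:C1 I J. SIGMA U2:C2 I J. exchange_lists k l V E L (zip U2 (U1 @ S)))"
      define f where "f = (\<lambda>(I, J, U1, U2, cs). I @ U1 @ J @ U2 @ (cs :: 'a list))"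
      define A where "A = f ` D"
      have len: "length U2 = length (U1 @ S)" if "U1 \<in> C1 I J" "U2 \<in> C2 I J" for U1 U2 I J
        using C1D(1)[OF that(1)] C2D(1)[OF that(2)] S b12 by (auto simp: tup_def)
      have mex: "cs \<in> tup V (b2 * e)" if "U1 \<in> C1 I J" "U2 \<in> C2 I J" "cs \<in> exchange_lists k l V E L (zip U2 (U1 @ S))" for U1 U2 I J cs
      proof -
        have "length (zip U2 (U1 @ S)) = b2" using len[OF that(1,2)] C2D(1)[OF that(2)] by (simp add: tup_def)
        then show ?thesis using exchange_lists_tup[OF l, of V E L "zip U2 (U1 @ S)"] that(3) by (auto simp: e_def)
      qed
      have cmex: "\<eta>2 ^ b2 * n ^ (b2 * e) \<le> real (card (exchange_lists k l V E L (zip U2 (U1 @ S))))" if "U1 \<in> C1 I J" "U2 \<in> C2 I J" for U1 U2 I J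
      proof -
        have lz: "length (zip U2 (U1 @ S)) = b2" using len[OF that] C2D(1)[OF that(2)] by (simp add: tup_def)
        have "\<eta>2 * n ^ e \<le> card (exchange_tuples k l V E L (fst p) (snd p))" if p: "p \<in> set (zip U2 (U1 @ S))" for p
        proof (rule Q(3))
          show "fst p \<in> V - Q" "snd p \<in> V - Q"
            using p set_zip_leftD[of "fst p" "snd p" U2 "U1 @ S"] set_zip_rightD[of "fst p" "snd p" U2 "U1 @ S"]
              C1D(1)[OF \<open>U1 \<in> C1 I J\<close>] C2D(1)[OF \<open>U2 \<in> C2 I J\<close>] S by (auto simp: tup_def)
        qed
        then show ?thesis
          using card_exchange_lists[OF V(1) l, of \<eta>2 "zip U2 (U1 @ S)" L E] \<eta>2 lz by (simp add: n_def e_def)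
      qed
      have finC: "finite X" "finite (C1 I J)" "finite (C2 I J)" "finite (exchange_lists k l V E L ps)" for I J ps
        using finite_subset[OF exchange_lists_tup[OF l] finite_tup[OF V(1)]]
        by (simp_all add: X_def C1_def C2_def finite_tup[OF V(1)] finite_subset[OF conn_sub finite_tup[OF V(1)]])
      have cD: "card D = (\<Sum>I\<in>X. \<Sum>J\<in>X. \<Sum>U1\<in>C1 I J. \<Sum>U2\<in>C2 I J. card (exchange_lists k l V E L (zip U2 (U1 @ S))))"
        unfolding D_def using finC by (simp add: card_SigmaI finite_SigmaI)
      have sum_ge: "x * real (card Y) \<le> (\<Sum>y\<in>Y. g y)" if "\<And>y. y \<in> Y \<Longrightarrow> x \<le> g y" for x Y and g :: "'z \<Rightarrow> real"
        using sum_mono[OF that, of Y "\<lambda>y. y"] by (simp add: mult.commute)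
      have chain: "x * (a * n ^ i) \<le> (\<Sum>y\<in>Y. g y)" if "a * n ^ i \<le> real (card Y)" "0 \<le> x" "\<And>y. y \<in> Y \<Longrightarrow> x \<le> g y" for x a i Y and g :: "'a list \<Rightarrow> real"
      proof -
        have "x * (a * n ^ i) \<le> x * real (card Y)" using that by (intro mult_left_mono) auto
        also have "\<dots> = (\<Sum>y\<in>Y. x)" by simp
        also have "\<dots> \<le> (\<Sum>y\<in>Y. g y)" using that by (intro sum_mono) auto
        finally show ?thesis .
      qed
      have "\<eta>2 ^ b2 * n ^ (b2 * e) * (\<eta>1 / 2 * n ^ b2) * (\<eta>1 / 2 * n ^ b1) * (1 / 2 * n ^ l) * (1 / 2 * n ^ l) \<le> real (card D)"
        unfolding cD of_nat_sum using \<eta>1 \<eta>2 n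
        by (intro chain X C1 C2 cmex) auto
      moreover have "\<eta>2 ^ b2 * n ^ (b2 * e) * (\<eta>1 / 2 * n ^ b2) * (\<eta>1 / 2 * n ^ b1) * (1 / 2 * n ^ l) * (1 / 2 * n ^ l) = 2 * \<eta> * n ^ b"
        unfolding b_def \<eta>_def by (simp add: power_add)
      moreover have "inj_on f D"
      proof (rule inj_onI)
        fix x y assume x: "x \<in> D" and y: "y \<in> D" and e: "f x = f y"
        obtain I J U1 U2 cs I' J' U1' U2' cs' where xy: "x = (I, J, U1, U2, cs)" "y = (I', J', U1', U2', cs')"
          by (cases x, cases y) auto
        have 1: "I \<in> X" "J \<in> X" "U1 \<in> C1 I J" "U2 \<in> C2 I J" "I' \<in> X" "J' \<in> X" "U1' \<in> C1 I' J'" "U2' \<in> C2 I' J'"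
          using x y by (auto simp: D_def xy)
        have "length I = l" "length J = l" "length U1 = b1" "length U2 = b2" "length I' = l" "length J' = l" "length U1' = b1" "length U2' = b2"
          using XD(1)[OF 1(1)] XD(1)[OF 1(2)] C1D(1)[OF 1(3)] C2D(1)[OF 1(4)] XD(1)[OF 1(5)] XD(1)[OF 1(6)] C1D(1)[OF 1(7)] C2D(1)[OF 1(8)]
          by (simp_all add: tup_def)
        then show "x = y" using e by (simp add: xy f_def)
      qed
      ultimately have cA: "2 * \<eta> * n ^ b \<le> real (card A)" by (simp add: A_def card_image)
      have At: "A \<subseteq> tup V b"
      proof
        fix T assume "T \<in> A"
        then obtain I J U1 U2 cs where T: "T = I @ U1 @ J @ U2 @ cs" "I \<in> X" "J \<in> X" "U1 \<in> C1 I J" "U2 \<in> C2 I J"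
            "cs \<in> exchange_lists k l V E L (zip U2 (U1 @ S))"
          by (auto simp: A_def D_def f_def)
        show "T \<in> tup V b"
          using XD(1)[OF T(2)] XD(1)[OF T(3)] C1D(1)[OF T(4)] C2D(1)[OF T(5)] mex[OF T(4,5,6)]
          unfolding T(1) b_def by (auto simp: tup_def)
      qed
      have "(2 * \<eta> - \<eta>) * n ^ b \<le> real (card {T \<in> A. fresh (set S) T})"
        unfolding n_def
      proof (rule card_fresh_ge[OF V(1) At])
        have "card (set S) \<le> k - l" using card_length[of S] S by (simp add: tup_def)
        then have "b * card (set S) + b * b \<le> b * (k - l) + b * b" by simp
        then have "real (b * card (set S) + b * b) \<le> real (b * (k - l) + b * b)" by (simp only: of_nat_le_iff)
        then show "real (b * card (set S) + b * b) \<le> \<eta> * card V" using nb(2) by (simp add: n_def)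
      qed (use cA V in \<open>auto simp: n_def\<close>)
      moreover have "card {T \<in> A. fresh (set S) T} \<le> card {T \<in> tup V b. absorbs k l E off S T}"
      proof (intro card_mono subsetI CollectI conjI)
        show "finite {T \<in> tup V b. absorbs k l E off S T}" using V by (simp add: finite_tup)
        fix T assume "T \<in> {T \<in> A. fresh (set S) T}"
        then have TA: "T \<in> A" and fr: "fresh (set S) T" by auto
        show "T \<in> tup V b" using TA At by blast
        from TA obtain I J U1 U2 cs where T: "T = I @ U1 @ J @ U2 @ cs" "I \<in> X" "J \<in> X" "U1 \<in> C1 I J" "U2 \<in> C2 I J"
            "cs \<in> exchange_lists k l V E L (zip U2 (U1 @ S))"
          by (auto simp: A_def D_def f_def)
        have lens: "length I = l" "length J = l" "length U1 = b1" "length U2 = b2"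
          using XD(1)[OF T(2)] XD(1)[OF T(3)] C1D(1)[OF T(4)] C2D(1)[OF T(5)] by (simp_all add: tup_def)
        have dT: "distinct T" "set S \<inter> set T = {}" using fr by (auto simp: fresh_def)
        obtain segs where segs: "list_all2 (alike k l E) (idle_segments_list k l L U2 cs) segs" "mset (concat (idle_segments_list k l L U2 cs)) = mset U2 + mset cs"
           "mset (concat segs) = mset (U1 @ S) + mset cs"
        proof -
          have "distinct (U2 @ cs)" "distinct ((U1 @ S) @ cs)" using dT S(2) unfolding T(1) by auto
          from exchange_lists_idle_segments_list[OF l len[OF T(4,5)] T(6) this] show ?thesis using that by blast
        qed
        have p1: "lpath k l E (I @ U1 @ J)"
          by (rule conn_lpath[OF C1D(2)[OF T(4)] m]) (use dT in \<open>auto simp: T(1)\<close>)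
        have p2: "lpath k l E (I @ U2 @ J)"
          by (rule conn_lpath[OF C2D(2)[OF T(5)]]) (use dT in \<open>auto simp: T(1)\<close>)
        have al: "alike k l E (I @ U1 @ J) (I @ U2 @ J)"
          unfolding alike_def using p1 p2 lens by (simp add: ends_append)
        have off: "off T = (I @ U1 @ J) # idle_segments_list k l L U2 cs"
          unfolding off_def T(1) using lens by simp
        show "absorbs k l E off S T"
          unfolding absorbs_def off
        proof (intro conjI exI[of _ "(I @ U2 @ J) # segs"])
          show "fresh (set S) T" by fact
        qed (use al segs in \<open>simp_all add: T(1)\<close>)
      qed
      ultimately show "\<eta> * real (card V) ^ b \<le> card {T \<in> tup V b. absorbs k l E off S T}"
        by (simp add: n_def)
    qed
  qed
qed

section \<open>Disjoint selection and linking of segments\<close>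

text \<open>Greedy derandomisation: each new tuple is chosen so that the sum over \<open>i\<close> of \<open>2\<close> to the minus number of hits of \<open>A i\<close> drops by a factor \<open>1 - \<eta> / 4\<close>.\<close>

lemma disjoint_selection:
  fixes \<eta> :: real and A :: "'i \<Rightarrow> 'a list set"
  assumes V: "finite V" "V \<noteq> {}" and I: "finite I" "I \<noteq> {}" and \<eta>: "0 < \<eta>"
    and A: "\<And>i. i \<in> I \<Longrightarrow> A i \<subseteq> tup V b" "\<And>i. i \<in> I \<Longrightarrow> \<eta> * real (card V) ^ b \<le> card (A i)"
    and F: "finite F" and small: "real (b * (card F + t * b) + b * b) \<le> \<eta> / 2 * card V"
    and cI: "real (card I) \<le> exp (\<eta> * t / 8)"
  obtains Ts where "length Ts = t" "set Ts \<subseteq> (\<Union>i\<in>I. A i)" "distinct (concat Ts)" "set (concat Ts) \<inter> F = {}"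
    "\<And>i. i \<in> I \<Longrightarrow> \<eta> * t / 8 \<le> length (filter (\<lambda>T. T \<in> A i) Ts)"
proof -
  define n where "n = real (card V)"
  have n: "n > 0" using V by (simp add: n_def card_gt_0_iff)
  define w where "w Ts i = (1 / 2 :: real) ^ length (filter (\<lambda>T. T \<in> A i) Ts)" for Ts i
  have wpos: "w Ts i > 0" for Ts i by (simp add: w_def)
  have \<eta>1: "\<eta> \<le> 1"
  proof -
    obtain i where i: "i \<in> I" using I by blast
    have "\<eta> * n ^ b \<le> card (A i)" unfolding n_def by (rule A(2)[OF i])
    also have "\<dots> \<le> n ^ b" using card_mono[OF finite_tup[OF V(1)] A(1)[OF i]] by (simp add: card_tup V n_def flip: of_nat_power)
    finally show ?thesis using n by simp
  qed
  have "\<exists>Ts. length Ts = s \<and> set Ts \<subseteq> (\<Union>i\<in>I. A i) \<and> distinct (concat Ts) \<and> set (concat Ts) \<inter> F = {} \<and>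
     (\<Sum>i\<in>I. w Ts i) \<le> card I * (1 - \<eta> / 4) ^ s" if "s \<le> t" for s
    using that
  proof (induction s)
    case 0
    then show ?case by (auto simp: w_def)
  next
    case (Suc s)
    then obtain Ts where Ts: "length Ts = s" "set Ts \<subseteq> (\<Union>i\<in>I. A i)" "distinct (concat Ts)" "set (concat Ts) \<inter> F = {}"
      "(\<Sum>i\<in>I. w Ts i) \<le> card I * (1 - \<eta> / 4) ^ s" by auto
    define W where "W = (\<Sum>i\<in>I. w Ts i)"
    have W: "W > 0" unfolding W_def by (rule sum_pos) (use I wpos in auto)
    define F' where "F' = F \<union> set (concat Ts)"
    have "length (concat Ts) = s * b"
    proof -
      have "\<And>T. T \<in> set Ts \<Longrightarrow> length T = b" using Ts(2) A(1) by (fastforce simp: tup_def)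
      then have "map length Ts = map (\<lambda>_. b) Ts" by simp
      then have "length (concat Ts) = sum_list (map (\<lambda>_. b) Ts)" by (simp only: length_concat)
      then show ?thesis using Ts(1) by (simp add: sum_list_triv)
    qed
    then have "card F' \<le> card F + s * b"
      unfolding F'_def using card_Un_le[of F "set (concat Ts)"] card_length[of "concat Ts"] by linarith
    also have "\<dots> \<le> card F + t * b" using Suc.prems by (intro add_left_mono mult_right_mono) auto
    finally have "b * card F' + b * b \<le> b * (card F + t * b) + b * b" by simp
    then have "real (b * card F' + b * b) \<le> real (b * (card F + t * b) + b * b)" by (simp only: of_nat_le_iff)
    then have sm: "real (b * card F' + b * b) \<le> \<eta> / 2 * card V" using small by linarith
    have fr: "\<eta> / 2 * n ^ b \<le> card {T \<in> A i. fresh F' T}" if "i \<in> I" for i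
      using card_fresh_ge[OF V(1) A(1)[OF that] _ A(2)[OF that] sm V(2)] F by (simp add: F'_def n_def)
    define G where "G = {T \<in> tup V b. fresh F' T}"
    have finG: "finite G" using V by (simp add: G_def finite_tup)
    define g where "g T = (\<Sum>i\<in>I. if T \<in> A i then w Ts i else 0)" for T
    have "\<eta> / 2 * n ^ b * W = (\<Sum>i\<in>I. \<eta> / 2 * n ^ b * w Ts i)" by (simp add: W_def sum_distrib_left)
    also have "\<dots> \<le> (\<Sum>i\<in>I. real (card {T \<in> A i. fresh F' T}) * w Ts i)"
      using fr wpos by (intro sum_mono mult_right_mono) (auto intro: less_imp_le)
    also have "\<dots> = (\<Sum>i\<in>I. \<Sum>T\<in>G. if T \<in> A i then w Ts i else 0)"
    proof (rule sum.cong[OF refl])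
      fix i assume i: "i \<in> I"
      have "G \<inter> {T. T \<in> A i} = {T \<in> A i. fresh F' T}" using A(1)[OF i] by (auto simp: G_def)
      then show "real (card {T \<in> A i. fresh F' T}) * w Ts i = (\<Sum>T\<in>G. if T \<in> A i then w Ts i else 0)"
        using finG by (simp add: sum.If_cases)
    qed
    also have "\<dots> = (\<Sum>T\<in>G. g T)" unfolding g_def by (rule sum.swap)
    finally have big: "\<eta> / 2 * n ^ b * W \<le> (\<Sum>T\<in>G. g T)" .
    \<comment> \<open>Averaging over all tuples of length \<open>b\<close>: \<open>g T\<close> is
      the part of the current weight that belongs to the families hit by \<open>T\<close>, and this
      part will be halved.\<close>
    have "\<exists>T\<in>G. \<eta> / 2 * W \<le> g T"
    proof (rule ccontr)
      assume "\<not> ?thesis"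
      then have less: "\<And>T. T \<in> G \<Longrightarrow> g T < \<eta> / 2 * W" by force
      have pos: "0 < \<eta> / 2 * n ^ b * W" using n W \<eta> by simp
      then have "G \<noteq> {}" using big by auto
      then have "(\<Sum>T\<in>G. g T) < (\<Sum>T\<in>G. \<eta> / 2 * W)" using less finG by (intro sum_strict_mono) auto
      also have "\<dots> = card G * (\<eta> / 2 * W)" by simp
      also have "\<dots> \<le> n ^ b * (\<eta> / 2 * W)"
      proof (rule mult_right_mono)
        have "card G \<le> card (tup V b)" by (rule card_mono) (use V in \<open>auto simp: G_def finite_tup\<close>)
        then show "real (card G) \<le> n ^ b" by (simp add: card_tup V n_def flip: of_nat_power)
      qed (use \<eta> W in simp)
      finally show False using big by (simp add: mult_ac)
    qed
    then obtain T where T: "T \<in> G" "\<eta> / 2 * W \<le> g T" by blast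
    have "\<exists>i\<in>I. T \<in> A i"
    proof (rule ccontr)
      assume "\<not> ?thesis"
      then have "g T = 0" by (auto simp: g_def intro: sum.neutral)
      then show False using T(2) \<eta> W by (simp add: mult_le_0_iff)
    qed
    moreover have "(\<Sum>i\<in>I. w (T # Ts) i) = W - g T / 2"
    proof -
      have "(\<Sum>i\<in>I. w (T # Ts) i) = (\<Sum>i\<in>I. w Ts i - (if T \<in> A i then w Ts i else 0) / 2)"
        by (rule sum.cong) (auto simp: w_def)
      then show ?thesis by (simp add: sum_subtractf W_def g_def flip: sum_divide_distrib)
    qed
    moreover have "W - g T / 2 \<le> W * (1 - \<eta> / 4)" using T(2) by (simp add: field_simps)
    moreover have "W * (1 - \<eta> / 4) \<le> card I * (1 - \<eta> / 4) ^ s * (1 - \<eta> / 4)"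
      using Ts(5) \<eta>1 by (intro mult_right_mono) (auto simp: W_def)
    ultimately show ?case
      using Ts T(1) by (intro exI[of _ "T # Ts"]) (auto simp: G_def fresh_def F'_def mult_ac)
  qed
  from this[of t] obtain Ts where Ts: "length Ts = t" "set Ts \<subseteq> (\<Union>i\<in>I. A i)" "distinct (concat Ts)" "set (concat Ts) \<inter> F = {}"
      "(\<Sum>i\<in>I. w Ts i) \<le> card I * (1 - \<eta> / 4) ^ t" by auto
  show ?thesis
  proof (rule that[OF Ts(1-4)])
    fix i assume i: "i \<in> I"
    let ?X = "length (filter (\<lambda>T. T \<in> A i) Ts)"
    have "exp (- real ?X) \<le> w Ts i"
    proof -
      have "exp (- 1) \<le> (1 / 2 :: real)"
        using exp_ge_add_one_self[of "1 :: real"] by (simp add: exp_minus field_simps)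
      then have "exp (- 1) ^ ?X \<le> (1 / 2 :: real) ^ ?X" by (intro power_mono) auto
      then show ?thesis by (simp add: w_def flip: exp_of_nat_mult)
    qed
    also have "w Ts i \<le> (\<Sum>i\<in>I. w Ts i)"
      by (rule member_le_sum[OF i]) (use I wpos in \<open>auto intro: less_imp_le\<close>)
    also have "\<dots> \<le> card I * (1 - \<eta> / 4) ^ t" by fact
    \<comment> \<open>Half of the decay exp (- \<eta> * t / 4) pays for the number of families; the
      other half becomes the lower bound on the hits.\<close>
    also have "\<dots> \<le> exp (\<eta> * t / 8) * exp (- (\<eta> / 4)) ^ t"
      using cI \<eta>1 exp_ge_add_one_self[of "- (\<eta> / 4)"] by (intro mult_mono power_mono) auto
    also have "\<dots> = exp (- (\<eta> * t / 8))"
      by (simp add: exp_add[symmetric] exp_of_nat_mult[symmetric])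
    finally show "\<eta> * t / 8 \<le> ?X" by simp
  qed
qed

lemma length_concat_disjoint_representatives:
  "list_all2 (\<lambda>A T. T \<in> A) As Ts \<Longrightarrow> \<forall>A\<in>set As. A \<subseteq> tup V b \<Longrightarrow> length (concat Ts) = length As * b"
proof (induction rule: list_all2_induct)
  case (Cons A As T Ts)
  then have "T \<in> tup V b" by (meson in_mono list.set_intros(1))
  then show ?case using Cons by (simp add: tup_def)
qed simp

text \<open>Greedy choice: the tuples chosen so far contain at most \<open>N * b\<close> vertices,
  and avoiding these together with \<open>F\<close> spoils at most half of the guaranteed size of
  each family.\<close>

lemma disjoint_representatives:
  fixes \<eta> :: real
  assumes V: "finite V" "V \<noteq> {}" and \<eta>: "0 < \<eta>" and F: "finite F"
    and small: "real (b * (card F + N * b) + b * b) \<le> \<eta> / 2 * card V"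
  shows "length As \<le> N \<Longrightarrow> (\<And>A. A \<in> set As \<Longrightarrow> A \<subseteq> tup V b \<and> \<eta> * real (card V) ^ b \<le> card A) \<Longrightarrow>
    \<exists>Ts. list_all2 (\<lambda>A T. T \<in> A) As Ts \<and> distinct (concat Ts) \<and> set (concat Ts) \<inter> F = {}"
proof (induction As)
  case (Cons A As)
  have "\<exists>Ts. list_all2 (\<lambda>A T. T \<in> A) As Ts \<and> distinct (concat Ts) \<and> set (concat Ts) \<inter> F = {}"
  proof (rule Cons.IH)
    show "length As \<le> N" using Cons.prems(1) by simp
    show "A' \<subseteq> tup V b \<and> \<eta> * real (card V) ^ b \<le> card A'" if "A' \<in> set As" for A'
      by (rule Cons.prems(2)) (use that in simp)
  qed
  then obtain Ts where Ts: "list_all2 (\<lambda>A T. T \<in> A) As Ts" "distinct (concat Ts)" "set (concat Ts) \<inter> F = {}"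
    by blast
  define F' where "F' = F \<union> set (concat Ts)"
  have "\<forall>A\<in>set As. A \<subseteq> tup V b"
    using Cons.prems(2) by (meson list.set_intros(2))
  then have "length (concat Ts) = length As * b" by (rule length_concat_disjoint_representatives[OF Ts(1)])
  then have "card F' \<le> card F + length As * b"
    unfolding F'_def using card_Un_le[of F "set (concat Ts)"] card_length[of "concat Ts"] by linarith
  also have "\<dots> \<le> card F + N * b" using Cons.prems by (intro add_left_mono mult_right_mono) auto
  finally have "b * card F' + b * b \<le> b * (card F + N * b) + b * b" by simp
  then have "real (b * card F' + b * b) \<le> real (b * (card F + N * b) + b * b)" by (simp only: of_nat_le_iff)
  then have sm: "real (b * card F' + b * b) \<le> \<eta> / 2 * card V" using small by linarith
  have "\<eta> / 2 * real (card V) ^ b \<le> card {T \<in> A. fresh F' T}"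
  proof -
    have A: "A \<subseteq> tup V b" "\<eta> * real (card V) ^ b \<le> card A" using Cons.prems(2)[of A] by simp_all
    have "finite F'" using F by (simp add: F'_def)
    from card_fresh_ge[OF V(1) A(1) this A(2) sm V(2)] show ?thesis by simp
  qed
  moreover have "0 < \<eta> / 2 * real (card V) ^ b" using \<eta> V by (simp add: card_gt_0_iff)
  ultimately have "card {T \<in> A. fresh F' T} \<noteq> 0" by linarith
  then have "{T \<in> A. fresh F' T} \<noteq> {}" by (metis card.empty)
  then obtain T where "T \<in> A" "fresh F' T" by blast
  then show ?case using Ts by (intro exI[of _ "T # Ts"]) (auto simp: fresh_def F'_def)
qed simp

lemma distinct_representatives:
  "(\<And>B. B \<in> set Bs \<Longrightarrow> finite B \<and> length Bs \<le> card B) \<Longrightarrow> \<exists>xs. list_all2 (\<lambda>B x. x \<in> B) Bs xs \<and> distinct xs"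
proof (induction Bs)
  case (Cons B Bs)
  have "\<exists>xs. list_all2 (\<lambda>B x. x \<in> B) Bs xs \<and> distinct xs"
  proof (rule Cons.IH)
    fix B' assume "B' \<in> set Bs"
    then show "finite B' \<and> length Bs \<le> card B'" using Cons.prems[of B'] by simp
  qed
  then obtain xs where xs: "list_all2 (\<lambda>B x. x \<in> B) Bs xs" "distinct xs" by blast
  then have "card (set xs) < card B"
    using Cons.prems[of B] card_length[of xs] list_all2_lengthD[OF xs(1)] by simp
  then obtain x where "x \<in> B" "x \<notin> set xs"
    by (meson List.finite_set card_mono leD subsetI)
  then show ?case using xs by (intro exI[of _ "x # xs"]) auto
qed simp

text \<open>A pair \<open>(s, y)\<close> is a segment and the connector following it; \<open>z\<close> is the initial \<open>l\<close>-tuple of the segment coming after the last one.\<close>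

fun linked :: "nat \<Rightarrow> nat \<Rightarrow> 'a set set \<Rightarrow> ('a list \<times> 'a list) list \<Rightarrow> 'a list \<Rightarrow> bool" where
  "linked k l E [] z \<longleftrightarrow> True"
| "linked k l E ((s, y) # ps) z \<longleftrightarrow> (\<exists>m\<ge>1. hwalk k l E m s) \<and>
     (\<exists>m\<ge>1. hwalk k l E m (drop (length s - l) s @ y @ (case ps of [] \<Rightarrow> z | p # _ \<Rightarrow> take l (fst p)))) \<and> linked k l E ps z"

definition flatten :: "('a list \<times> 'a list) list \<Rightarrow> 'a list" where
  "flatten ps = concat (map (\<lambda>(s, y). s @ y) ps)"

lemma linked_hwalk:
  assumes "l < k"
  shows "linked k l E ps z \<Longrightarrow> ps \<noteq> [] \<Longrightarrow> length z = l \<Longrightarrow> \<exists>m\<ge>1. hwalk k l E m (flatten ps @ z)"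
proof (induction ps)
  case (Cons p ps)
  obtain s y where p: "p = (s, y)" by fastforce
  let ?X = "drop (length s - l) s" and ?us = "take (length s - l) s"
  from Cons.prems obtain m1 m2 where m: "1 \<le> m1" "hwalk k l E m1 s" "1 \<le> m2"
    "hwalk k l E m2 (?X @ y @ (case ps of [] \<Rightarrow> z | p # _ \<Rightarrow> take l (fst p)))" and ps: "linked k l E ps z"
    by (auto simp: p)
  have lX: "length ?X = l" using m(2) by (simp add: hwalk_def)
  have s: "?us @ ?X @ W = s @ W" for W by (metis append_assoc append_take_drop_id)
  show ?case
  proof (cases ps)
    case Nil
    have "hwalk k l E (m1 + m2) (?us @ ?X @ (y @ z))"
      by (rule hwalk_append) (use m lX assms Nil in auto)
    moreover have "flatten (p # ps) @ z = s @ y @ z" by (simp add: flatten_def p Nil)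
    ultimately show ?thesis using m(1) unfolding s by (intro exI[of _ "m1 + m2"]) simp
  next
    case (Cons q qs)
    obtain s' y' where q: "q = (s', y')" by fastforce
    from Cons.IH[OF ps] Cons.prems(3) Cons obtain m3 where m3: "hwalk k l E m3 (flatten ps @ z)" by auto
    obtain m4 where "hwalk k l E m4 s'" using ps by (auto simp: Cons q)
    then have l': "l \<le> length s'" by (simp add: hwalk_def)
    then have f: "flatten ps @ z = take l s' @ (drop l s' @ y' @ flatten qs @ z)" by (simp add: flatten_def Cons q)
    have "hwalk k l E (m2 + m3) ((?X @ y) @ take l s' @ (drop l s' @ y' @ flatten qs @ z))"
      by (rule hwalk_append) (use m m3 f l' assms Cons q in auto)
    then have "hwalk k l E (m2 + m3) (?X @ (y @ flatten ps @ z))" using f by simp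
    then have "hwalk k l E (m1 + (m2 + m3)) (?us @ ?X @ (y @ flatten ps @ z))"
      by (rule hwalk_append[rotated]) (use m lX assms in auto)
    moreover have "flatten (p # ps) @ z = s @ y @ flatten ps @ z" by (simp add: flatten_def p)
    ultimately show ?thesis using m(1) unfolding s by (intro exI[of _ "m1 + (m2 + m3)"]) simp
  qed
qed simp

text \<open>The pairs of l-tuples to be joined, the last one leading to \<open>z\<close>. They are
  kept apart from \<open>linked\<close> because connectors are chosen for these pairs alone and so
  survive every replacement of segments by segments with the same ends
  (\<open>needs_alike\<close>).\<close>

fun needs :: "nat \<Rightarrow> 'a list list \<Rightarrow> 'a list \<Rightarrow> ('a list \<times> 'a list) list" where
  "needs l [] z = []"
| "needs l (s # ss) z = (drop (length s - l) s, case ss of [] \<Rightarrow> z | s' # _ \<Rightarrow> take l s') # needs l ss z"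

lemma length_needs [simp]: "length (needs l ss z) = length ss"
  by (induction ss) auto

lemma needs_append: "needs l (us @ s # vs) z = needs l us (take l s) @ needs l (s # vs) z"
  by (induction us) (auto split: list.splits simp: Cons_eq_append_conv neq_Nil_conv)

lemma linked_needs:
  "list_all2 (\<lambda>(A, B) y. \<exists>m\<ge>1. hwalk k l E m (A @ y @ B)) (needs l ss z) ys \<Longrightarrow> list_all (lpath k l E) ss \<Longrightarrow>
   linked k l E (zip ss ys) z"
proof (induction ss arbitrary: ys)
  case (Cons s ss)
  then obtain y ys' where ys: "ys = y # ys'" by (auto simp: list_all2_Cons1)
  have l: "length ss = length ys'" using list_all2_lengthD[OF Cons.prems(1)] by (simp add: ys)
  have "(case zip ss ys' of [] \<Rightarrow> z | p # _ \<Rightarrow> take l (fst p)) = (case ss of [] \<Rightarrow> z | s' # _ \<Rightarrow> take l s')"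
    using l by (cases ss; cases ys') auto
  then show ?case using Cons l by (auto simp: ys lpath_def)
qed simp

lemma needs_alike:
  "list_all2 (alike k l E) ss ss' \<Longrightarrow> needs l ss z = needs l ss' z"
proof (induction rule: list_all2_induct)
  case (Cons s ss s' ss')
  then show ?case by (cases ss; cases ss') (auto simp: alike_def ends_def)
qed simp

lemma mset_flatten_zip: "length ss = length ys \<Longrightarrow> mset (flatten (zip ss ys)) = mset (concat ss) + mset (concat ys)"
  by (induction ss ys rule: list_induct2) (auto simp: flatten_def)

text \<open>The closed walk is written as one period \<open>vs\<close> followed by its initial
  \<open>l\<close> vertices again. With at least three edges, cyclically consecutive edges meet in
  one place only; two edges would meet in 2l vertices.\<close>

lemma hamilton_cycleI:
  fixes V :: "'a set"
  assumes H: "k_graph k (V, E)" and l: "1 \<le> l" "2 * l < k" and vs: "distinct vs" "set vs = V"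
    and walk: "hwalk k l E m (vs @ take l vs)" and m: "3 \<le> m"
  shows "has_hamilton_l_cycle k l (V, E)"
proof -
  define w where "w = k - l"
  have w: "l < w" "k = w + l" using l by (auto simp: w_def)
  have N: "length vs = m * w"
  proof -
    have "length vs + min (length vs) l = m * w + l" using walk by (simp add: hwalk_def w_def)
    moreover have "l \<le> m * w" using w m mult_le_mono[of 1 m l w] by simp
    ultimately show ?thesis by (simp add: min_def split: if_splits)
  qed
  \<comment> \<open>The positions of edge \<open>i\<close> in \<open>vs\<close>: only the last edge
    wraps around, and only with its final \<open>l\<close> vertices.\<close>
  define Pos where "Pos i = (if Suc i < m then {i * w..<i * w + k} else {i * w..<m * w} \<union> {..<l})" for i
  define e where "e i = set (take k (rotate (i * w) vs))" for i
  have N3: "3 * w \<le> m * w" using m by simp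
  have kN: "k \<le> m * w" using w N3 by linarith
  have pN: "i * w < m * w" "i * w + w \<le> m * w" if "i < m" for i
  proof -
    have "Suc i * w \<le> m * w" using that by (intro mult_le_mono) auto
    then show le: "i * w + w \<le> m * w" by simp
    show "i * w < m * w" using le w by linarith
  qed
  have e: "e i = (!) vs ` Pos i" if i: "i < m" for i
  proof -
    have "e i = (\<lambda>q. vs ! ((i * w + q) mod (m * w))) ` {..<k}"
    proof -
      have "set (take k xs) = (!) xs ` {..<k}" if "k \<le> length xs" for xs :: "'a list"
        using nth_image[OF that] by (simp add: lessThan_atLeast0)
      then have "e i = (!) (rotate (i * w) vs) ` {..<k}" using kN N by (simp add: e_def)
      also have "\<dots> = (\<lambda>q. vs ! ((i * w + q) mod (m * w))) ` {..<k}"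
        by (rule image_cong[OF refl]) (use kN N in \<open>simp add: nth_rotate add.commute\<close>)
      finally show ?thesis .
    qed
    also have "\<dots> = (!) vs ` ((\<lambda>q. (i * w + q) mod (m * w)) ` {..<k})" by (simp add: image_image)
    also have "(\<lambda>q. (i * w + q) mod (m * w)) ` {..<k} = Pos i"
    proof (cases "Suc i < m")
      case True
      have "i * w + k \<le> m * w" using pN(2)[OF True] w by simp
      then have "(\<lambda>q. (i * w + q) mod (m * w)) ` {..<k} = (\<lambda>q. i * w + q) ` {..<k}"
        by (intro image_cong) auto
      also have "\<dots> = {i * w..<i * w + k}" by (simp add: lessThan_atLeast0 add.commute)
      finally show ?thesis using True by (simp add: Pos_def)
    next
      case False
      then have im: "Suc i = m" using i by simp
      have mw: "m * w = i * w + w" using im by auto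
      have "{..<k} = {..<w} \<union> {w..<w + l}" using w by auto
      then have "(\<lambda>q. (i * w + q) mod (m * w)) ` {..<k} = (\<lambda>q. (i * w + q) mod (m * w)) ` {..<w} \<union> (\<lambda>q. (i * w + q) mod (m * w)) ` {w..<w + l}"
        by (metis image_Un)
      also have "(\<lambda>q. (i * w + q) mod (m * w)) ` {..<w} = (\<lambda>q. i * w + q) ` {..<w}"
        by (intro image_cong) (auto simp: mw)
      also have "\<dots> = {i * w..<m * w}" by (simp add: lessThan_atLeast0 add.commute mw)
      also have "(\<lambda>q. (i * w + q) mod (m * w)) ` {w..<w + l} = (\<lambda>q. q - w) ` {w..<w + l}"
      proof (intro image_cong refl)
        fix q assume "q \<in> {w..<w + l}"
        then have "i * w + q = (q - w) + m * w" "q - w < m * w" using mw w by auto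
        then show "(i * w + q) mod (m * w) = q - w" by (metis mod_add_self2 mod_less)
      qed
      also have "(\<lambda>q. q - w) ` {w..<w + l} = {..<l}"
      proof
        show "{..<l} \<subseteq> (\<lambda>q. q - w) ` {w..<w + l}"
        proof
          fix x assume "x \<in> {..<l}"
          then show "x \<in> (\<lambda>q. q - w) ` {w..<w + l}" by (intro image_eqI[of _ _ "x + w"]) auto
        qed
      qed auto
      finally show ?thesis using False by (simp add: Pos_def)
    qed
    finally show ?thesis .
  qed
  have PosN: "Pos i \<subseteq> {..<m * w}" if i: "i < m" for i
    using pN(2)[of "Suc i"] w kN l i by (auto simp: Pos_def)
  have injvs: "inj_on ((!) vs) {..<m * w}" using vs(1) N by (simp add: inj_on_nth)
  have eE: "e i \<in> E" if i: "i < m" for i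
  proof -
    have "take k (rotate (i * w) vs) = take k (drop (i * w) (vs @ take l vs))"
    proof -
      have "rotate (i * w) vs = drop (i * w) vs @ take (i * w) vs"
        using pN(1)[OF i] N by (simp add: rotate_drop_take)
      moreover have "take (k - (m * w - i * w)) (take (i * w) vs) = take (k - (m * w - i * w)) (take l vs)"
      proof (cases "Suc i < m")
        case True
        have "k - (m * w - i * w) = 0" using pN(2)[OF True] w by simp
        then show ?thesis by simp
      next
        case False
        then have "m = Suc i" using i by simp
        then have "k - (m * w - i * w) = l" "l \<le> i * w" using m w mult_le_mono[of 1 i l w] by auto
        then show ?thesis by simp
      qed
      ultimately show ?thesis using N pN(1)[OF i] by simp
    qed
    then show ?thesis using walk i by (simp add: e_def hwalk_def w_def)
  qed
  have inj: "inj_on e {..<m}"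
  proof (rule inj_onI)
    \<comment> \<open>Position \<open>i * w + l\<close> is the initial one of edge \<open>i\<close>
      that the preceding edge misses, and as l < w it comes before the following edge. A private
      position makes the edges distinct.\<close>
    have priv: "i * w + l \<in> Pos i" "j < m \<Longrightarrow> j \<noteq> i \<Longrightarrow> i * w + l \<notin> Pos j" if i: "i < m" for i j
    proof -
      show "i * w + l \<in> Pos i" using pN(2)[OF i] w l by (auto simp: Pos_def)
      assume j: "j < m" "j \<noteq> i"
      show "i * w + l \<notin> Pos j"
      proof (cases "j < i")
        case True
        then have "Suc j * w \<le> i * w" by (intro mult_le_mono) auto
        then show ?thesis using True i w by (auto simp: Pos_def)
      next
        case False
        then have "Suc i * w \<le> j * w" using j by (intro mult_le_mono) auto
        then show ?thesis using w by (auto simp: Pos_def)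
      qed
    qed
    fix i j assume ij: "i \<in> {..<m}" "j \<in> {..<m}" "e i = e j"
    then have "(!) vs ` Pos i = (!) vs ` Pos j" using e by simp
    then have "Pos i = Pos j" using ij PosN injvs by (simp add: inj_on_image_eq_iff)
    then show "i = j" using priv ij by (metis lessThan_iff)
  qed
  have inter: "card (e i \<inter> e (Suc i mod m)) = l" if i: "i < m" for i
  proof -
    have sm: "Suc i mod m < m" using m by simp
    have "e i \<inter> e (Suc i mod m) = (!) vs ` (Pos i \<inter> Pos (Suc i mod m))"
      using e[OF i] e[OF sm] PosN[OF i] PosN[OF sm] injvs by (simp add: inj_on_image_Int)
    also have "card \<dots> = card (Pos i \<inter> Pos (Suc i mod m))"
      by (rule card_image) (use injvs PosN[OF i] in \<open>auto intro: inj_on_subset\<close>)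
    also have "\<dots> = l"
    proof (cases "Suc i < m")
      case True
      have s: "Suc i mod m = Suc i" using True by simp
      have "Pos i \<inter> Pos (Suc i) = {Suc i * w..<Suc i * w + l}"
      proof (cases "Suc (Suc i) < m")
        case True
        then show ?thesis using w by (auto simp: Pos_def)
      next
        case False
        then have mi: "m = Suc (Suc i)" using True by simp
        then have "1 * w \<le> i * w" using m by (intro mult_le_mono) auto
        then have "l < i * w" using w by linarith
        then show ?thesis using w by (auto simp: Pos_def mi)
      qed
      then show ?thesis unfolding s by simp
    next
      case False
      then have mi: "m = Suc i" using i by simp
      then have "2 * w \<le> i * w" using m by (intro mult_le_mono) auto
      then have "k < i * w" using w by linarith
      then have "Pos i \<inter> Pos 0 = {..<l}" using w m by (auto simp: Pos_def mi)
      then show ?thesis unfolding mi by simp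
    qed
    finally show ?thesis .
  qed
  have Un: "\<Union> (e ` {..<m}) = V"
  proof
    show "\<Union> (e ` {..<m}) \<subseteq> V" using eE H by (auto simp: k_graph_def)
    show "V \<subseteq> \<Union> (e ` {..<m})"
    proof
      fix v assume "v \<in> V"
      then obtain p where p: "p < m * w" "v = vs ! p" using vs(2) N by (auto simp: in_set_conv_nth)
      let ?i = "p div w"
      have i: "?i < m" using p w by (simp add: less_mult_imp_div_less)
      have "?i * w \<le> p" "p < ?i * w + w" using w dividend_less_div_times[of w p] by (auto simp: add.commute)
      then have "p \<in> Pos ?i" using p w by (auto simp: Pos_def)
      then show "v \<in> \<Union> (e ` {..<m})" using e[OF i] i p by blast
    qed
  qed
  define C where "C = (V, e ` {..<m})"
  have kC: "k_graph k C" using H eE by (auto simp: k_graph_def C_def)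
  have "l_cycle k l C"
    unfolding l_cycle_def
  proof (intro conjI exI[of _ vs] exI[of _ "\<lambda>i. i * w"] exI[of _ m])
    show "strict_mono_on {..<m} (\<lambda>i. i * w)" using w by (auto simp: strict_mono_on_def)
    show "(\<lambda>i. i * w) ` {..<m} \<subseteq> {..<length vs}" using pN N by auto
    show "edges C = (\<lambda>i. set (take k (rotate (i * w) vs))) ` {..<m}" by (simp add: C_def e_def)
    show "\<forall>i<m. card (set (take k (rotate (i * w) vs)) \<inter> set (take k (rotate ((Suc i mod m) * w) vs))) = l"
      using inter by (simp add: e_def)
    have "card V = m * w" using vs N distinct_card by metis
    then show "card (edges C) * (k - l) = card (verts C)"
      using inj by (simp add: C_def card_image w_def)
    show "\<Union> (edges C) = verts C" using Un by (simp add: C_def)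
  qed (use kC vs in \<open>auto simp: C_def\<close>)
  moreover have "subhypergraph C (V, E)" using eE by (auto simp: subhypergraph_def C_def)
  ultimately show ?thesis by (auto simp: has_hamilton_l_cycle_def C_def)
qed

section \<open>Concentration for random samples\<close>

lemma exp_le_quadratic:
  fixes z :: real
  assumes "\<bar>z\<bar> \<le> 1"
  shows "exp z \<le> 1 + z + z\<^sup>2"
proof (cases "z \<ge> 0")
  case True
  then show ?thesis using exp_bound[of z] assms by simp
next
  case False
  define w where "w = - z"
  have w: "0 < w" "w \<le> 1" using False assms by (auto simp: w_def)
  have "1 \<le> (1 - w + w\<^sup>2) * (1 + w)"
    using w by (simp add: power2_eq_square algebra_simps)
  also have "\<dots> \<le> (1 - w + w\<^sup>2) * exp w"
    using w exp_ge_add_one_self[of w] by (intro mult_left_mono) (auto simp: add_nonneg_nonneg)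
  finally have "exp (- w) \<le> 1 - w + w\<^sup>2"
    by (simp add: exp_minus field_simps)
  then show ?thesis by (simp add: w_def)
qed

lemma sum_PiE_insert:
  "i \<notin> I \<Longrightarrow> sum h (PiE (insert i I) A) = (\<Sum>a\<in>A i. \<Sum>x\<in>PiE I A. h (x(i := a)))"
proof -
  assume "i \<notin> I"
  then have "sum h (PiE (insert i I) A) = sum (h \<circ> (\<lambda>(y, g). g(i := y))) (A i \<times> PiE I A)"
    unfolding PiE_insert_eq by (intro sum.reindex inj_combinator)
  also have "\<dots> = (\<Sum>(a, x)\<in>A i \<times> PiE I A. h (x(i := a)))"
    by (rule sum.cong) auto
  finally show ?thesis by (simp add: sum.cartesian_product)
qed

lemma finite_PiE_const: "finite I \<Longrightarrow> finite V \<Longrightarrow> finite (I \<rightarrow>\<^sub>E V)"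
  by (rule finite_PiE)

text \<open>The bounded differences inequality in exponential form, for uniform samples counted in a
  function space. Induction on the coordinates: averaging over all coordinates but the new one
  \<open>i\<close> leaves a function of the value at \<open>i\<close> that stays within
  \<open>D\<close> of its mean. The linear term of the exponential cancels in the mean, and the
  quadratic term gives the factor exp ((\<gamma> * D)^2).\<close>

lemma mcdiarmid:
  fixes f :: "('i \<Rightarrow> 'a) \<Rightarrow> real" and \<gamma> D :: real
  assumes I: "finite I" and V: "finite V" "V \<noteq> {}" and \<gamma>: "0 \<le> \<gamma>" "\<gamma> * D \<le> 1" and D: "0 \<le> D"
    and bd: "\<And>x i a. x \<in> I \<rightarrow>\<^sub>E V \<Longrightarrow> i \<in> I \<Longrightarrow> a \<in> V \<Longrightarrow> \<bar>f (x(i := a)) - f x\<bar> \<le> D"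
  shows "(\<Sum>x\<in>I \<rightarrow>\<^sub>E V. exp (\<gamma> * ((\<Sum>x\<in>I \<rightarrow>\<^sub>E V. f x) / card (I \<rightarrow>\<^sub>E V) - f x)))
    \<le> card (I \<rightarrow>\<^sub>E V) * exp (card I * (\<gamma> * D)\<^sup>2)"
  using I bd
proof (induction I arbitrary: f rule: finite_induct)
  case (insert i I)
  let ?P = "I \<rightarrow>\<^sub>E V"
  define p where "p = real (card ?P)"
  define n where "n = real (card V)"
  have P: "finite ?P" "?P \<noteq> {}" using insert.hyps(1) V by (auto simp: PiE_eq_empty_iff finite_PiE_const)
  have pn: "p > 0" "n > 0" using P V by (auto simp: p_def n_def card_gt_0_iff)
  define \<mu>a where "\<mu>a a = (\<Sum>x\<in>?P. f (x(i := a))) / p" for a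
  define \<mu> where "\<mu> = (\<Sum>a\<in>V. \<mu>a a) / n"
  have card_ins: "real (card (insert i I \<rightarrow>\<^sub>E V)) = n * p"
    using sum_PiE_insert[OF insert.hyps(2), of "\<lambda>_. 1 :: real" "\<lambda>_. V"] by (simp add: n_def p_def)
  have \<mu>: "(\<Sum>x\<in>insert i I \<rightarrow>\<^sub>E V. f x) / card (insert i I \<rightarrow>\<^sub>E V) = \<mu>"
    unfolding card_ins sum_PiE_insert[OF insert.hyps(2)] \<mu>_def \<mu>a_def
    by (simp add: sum_divide_distrib[symmetric] mult.commute)
  have diff: "\<mu>a a - \<mu>a b \<le> D" if a: "a \<in> V" and b: "b \<in> V" for a b
  proof -
    have "(\<Sum>x\<in>?P. f (x(i := a)) - f (x(i := b))) \<le> (\<Sum>x\<in>?P. D)"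
    proof (rule sum_mono)
      fix x assume x: "x \<in> ?P"
      have "x(i := b) \<in> insert i I \<rightarrow>\<^sub>E V" using PiE_fun_upd[OF b x] .
      from insert.prems[OF this insertI1 a] show "f (x(i := a)) - f (x(i := b)) \<le> D"
        unfolding fun_upd_upd by linarith
    qed
    then have "\<mu>a a * p - \<mu>a b * p \<le> p * D" using pn by (simp add: sum_subtractf \<mu>a_def p_def)
    then have "p * (\<mu>a a - \<mu>a b) \<le> p * D" by (simp add: algebra_simps)
    then show ?thesis using pn by simp
  qed
  have dev: "\<bar>\<mu> - \<mu>a a\<bar> \<le> D" if a: "a \<in> V" for a
  proof -
    have "n * (\<mu> - \<mu>a a) = (\<Sum>b\<in>V. \<mu>a b - \<mu>a a)" using pn by (simp add: \<mu>_def sum_subtractf n_def algebra_simps)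
    moreover have "(\<Sum>b\<in>V. \<mu>a b - \<mu>a a) \<le> (\<Sum>b\<in>V. D)" by (intro sum_mono diff a)
    moreover have "(\<Sum>b\<in>V. \<mu>a a - \<mu>a b) \<le> (\<Sum>b\<in>V. D)" by (intro sum_mono diff a)
    moreover have "(\<Sum>b\<in>V. \<mu>a a - \<mu>a b) = - (\<Sum>b\<in>V. \<mu>a b - \<mu>a a)" by (simp add: sum_subtractf)
    ultimately have "n * (\<mu> - \<mu>a a) \<le> n * D" "n * (- (\<mu> - \<mu>a a)) \<le> n * D"
      unfolding mult_minus_right by (simp_all add: n_def)
    then have "\<mu> - \<mu>a a \<le> D" "- (\<mu> - \<mu>a a) \<le> D" using pn by (simp_all only: mult_le_cancel_left_pos)
    then show ?thesis by linarith
  qed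
  let ?e = "exp (card I * (\<gamma> * D)\<^sup>2)"
  have IH: "(\<Sum>x\<in>?P. exp (\<gamma> * (\<mu>a a - f (x(i := a))))) \<le> p * ?e" if a: "a \<in> V" for a
    unfolding \<mu>a_def p_def
  proof (rule insert.IH)
    fix x j b assume x: "x \<in> ?P" and j: "j \<in> I" and b: "b \<in> V"
    have "x(i := a) \<in> insert i I \<rightarrow>\<^sub>E V" using PiE_fun_upd[OF a x] .
    from insert.prems[OF this _ b, of j] j have "\<bar>f (x(i := a, j := b)) - f (x(i := a))\<bar> \<le> D"
      by (simp add: fun_upd_def)
    moreover have "x(i := a, j := b) = x(j := b, i := a)" using j insert.hyps(2) by (auto simp: fun_upd_twist)
    ultimately show "\<bar>f (x(j := b, i := a)) - f (x(i := a))\<bar> \<le> D" by simp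
  qed
  have "(\<Sum>x\<in>insert i I \<rightarrow>\<^sub>E V. exp (\<gamma> * (\<mu> - f x))) = (\<Sum>a\<in>V. \<Sum>x\<in>?P. exp (\<gamma> * (\<mu> - \<mu>a a)) * exp (\<gamma> * (\<mu>a a - f (x(i := a)))))"
    unfolding sum_PiE_insert[OF insert.hyps(2)] by (simp add: exp_add[symmetric] algebra_simps)
  also have "\<dots> \<le> (\<Sum>a\<in>V. exp (\<gamma> * (\<mu> - \<mu>a a)) * (p * ?e))"
    unfolding sum_distrib_left[symmetric] by (intro sum_mono mult_left_mono IH) auto
  also have "\<dots> = (\<Sum>a\<in>V. exp (\<gamma> * (\<mu> - \<mu>a a))) * (p * ?e)" by (simp add: sum_distrib_right)
  also have "\<dots> \<le> (n * exp ((\<gamma> * D)\<^sup>2)) * (p * ?e)"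
  proof (rule mult_right_mono)
    have "(\<Sum>a\<in>V. exp (\<gamma> * (\<mu> - \<mu>a a))) \<le> (\<Sum>a\<in>V. 1 + \<gamma> * (\<mu> - \<mu>a a) + (\<gamma> * D)\<^sup>2)"
    proof (rule sum_mono)
      fix a assume a: "a \<in> V"
      have b: "\<bar>\<gamma> * (\<mu> - \<mu>a a)\<bar> \<le> \<gamma> * D" using dev[OF a] \<gamma> by (simp add: abs_mult mult_left_mono)
      then have "exp (\<gamma> * (\<mu> - \<mu>a a)) \<le> 1 + \<gamma> * (\<mu> - \<mu>a a) + (\<gamma> * (\<mu> - \<mu>a a))\<^sup>2"
        using \<gamma> by (intro exp_le_quadratic) auto
      also have "(\<gamma> * (\<mu> - \<mu>a a))\<^sup>2 \<le> (\<gamma> * D)\<^sup>2" using b by (rule power2_le_iff_abs_le[THEN iffD2, rotated]) (use \<gamma> D in auto)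
      finally show "exp (\<gamma> * (\<mu> - \<mu>a a)) \<le> 1 + \<gamma> * (\<mu> - \<mu>a a) + (\<gamma> * D)\<^sup>2" by simp
    qed
    also have "\<dots> = n * (1 + (\<gamma> * D)\<^sup>2) + \<gamma> * (n * \<mu> - (\<Sum>a\<in>V. \<mu>a a))"
      by (simp add: sum.distrib sum_distrib_left[symmetric] sum_subtractf n_def algebra_simps)
    also have "n * \<mu> - (\<Sum>a\<in>V. \<mu>a a) = 0" using pn by (simp add: \<mu>_def)
    also have "n * (1 + (\<gamma> * D)\<^sup>2) + \<gamma> * 0 \<le> n * exp ((\<gamma> * D)\<^sup>2)"
      using pn exp_ge_add_one_self[of "(\<gamma> * D)\<^sup>2"] by simp
    finally show "(\<Sum>a\<in>V. exp (\<gamma> * (\<mu> - \<mu>a a))) \<le> n * exp ((\<gamma> * D)\<^sup>2)" .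
  qed (use pn in simp)
  also have "\<dots> = card (insert i I \<rightarrow>\<^sub>E V) * exp (card (insert i I) * (\<gamma> * D)\<^sup>2)"
    unfolding card_ins using insert.hyps by (simp add: exp_add[symmetric] algebra_simps)
  finally show ?case unfolding \<mu> .
qed simp

lemma mcdiarmid_tail:
  fixes f :: "('i \<Rightarrow> 'a) \<Rightarrow> real" and \<gamma> D \<mu> s :: real
  assumes I: "finite I" and V: "finite V" "V \<noteq> {}" and \<gamma>: "0 \<le> \<gamma>" "\<gamma> * D \<le> 1" and D: "0 \<le> D"
    and bd: "\<And>x i a. x \<in> I \<rightarrow>\<^sub>E V \<Longrightarrow> i \<in> I \<Longrightarrow> a \<in> V \<Longrightarrow> \<bar>f (x(i := a)) - f x\<bar> \<le> D"
    and \<mu>: "\<mu> * card (I \<rightarrow>\<^sub>E V) \<le> (\<Sum>x\<in>I \<rightarrow>\<^sub>E V. f x)"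
  shows "card {x \<in> I \<rightarrow>\<^sub>E V. f x \<le> \<mu> - s} \<le> card (I \<rightarrow>\<^sub>E V) * exp (card I * (\<gamma> * D)\<^sup>2 - \<gamma> * s)"
proof -
  let ?P = "I \<rightarrow>\<^sub>E V"
  have P: "finite ?P" "?P \<noteq> {}" using I V by (auto simp: PiE_eq_empty_iff finite_PiE_const)
  then have p: "real (card ?P) > 0" by (simp add: card_gt_0_iff)
  let ?m = "(\<Sum>x\<in>?P. f x) / card ?P"
  have m: "\<mu> \<le> ?m" using \<mu> p by (simp add: pos_le_divide_eq)
  have "card {x \<in> ?P. f x \<le> \<mu> - s} * exp (\<gamma> * s) = (\<Sum>x\<in>{x \<in> ?P. f x \<le> \<mu> - s}. exp (\<gamma> * s))" by simp
  also have "\<dots> \<le> (\<Sum>x\<in>{x \<in> ?P. f x \<le> \<mu> - s}. exp (\<gamma> * (?m - f x)))"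
    using m \<gamma> by (intro sum_mono) (auto intro!: mult_left_mono)
  also have "\<dots> \<le> (\<Sum>x\<in>?P. exp (\<gamma> * (?m - f x)))" by (rule sum_mono2) (use P in auto)
  also have "\<dots> \<le> card ?P * exp (card I * (\<gamma> * D)\<^sup>2)" by (rule mcdiarmid[OF I V \<gamma> D bd])
  finally have "card {x \<in> ?P. f x \<le> \<mu> - s} * exp (\<gamma> * s) * exp (- (\<gamma> * s)) \<le> card ?P * exp (card I * (\<gamma> * D)\<^sup>2) * exp (- (\<gamma> * s))"
    by (rule mult_right_mono) simp
  then show ?thesis by (simp add: mult.assoc exp_add[symmetric] exp_minus_inverse)
qed

lemma card_PiE_const: "finite I \<Longrightarrow> card (I \<rightarrow>\<^sub>E V) = card V ^ card I"
  by (rule card_funcsetE)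

section \<open>The degree of a set into a random sample\<close>

lemma card_PiE_image:
  assumes J: "finite J" and V: "finite V" and P: "P \<subseteq> J" "card P = r"
  shows "card V ^ (card J - r) * card {ys \<in> tup V r. Q (set ys)} \<le> card {x \<in> J \<rightarrow>\<^sub>E V. Q (x ` P)}"
proof -
  have finP: "finite P" using P J finite_subset by blast
  then obtain h where h: "bij_betw h {..<r} P" using P ex_bij_betw_nat_finite[OF finP] by (metis lessThan_atLeast0)
  define g where "g = inv_into {..<r} h"
  have g: "g j < r" "h (g j) = j" if "j \<in> P" for j
    using that h bij_betw_inv_into_right[OF h that] bij_betw_apply[OF bij_betw_inv_into[OF h] that] by (auto simp: g_def)
  have gh: "g (h q) = q" "h q \<in> P" if "q < r" for q
    using that h by (auto simp: g_def bij_betw_inv_into_left bij_betw_apply)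
  define F where "F = (\<lambda>(ys, z) j. if j \<in> P then ys ! g j else z j :: 'b)"
  have "card ({ys \<in> tup V r. Q (set ys)} \<times> ((J - P) \<rightarrow>\<^sub>E V)) \<le> card {x \<in> J \<rightarrow>\<^sub>E V. Q (x ` P)}"
  proof (rule card_inj_on_le[where f = F])
    show "finite {x \<in> J \<rightarrow>\<^sub>E V. Q (x ` P)}" using J V by (simp add: finite_PiE_const)
    show "F ` ({ys \<in> tup V r. Q (set ys)} \<times> ((J - P) \<rightarrow>\<^sub>E V)) \<subseteq> {x \<in> J \<rightarrow>\<^sub>E V. Q (x ` P)}"
    proof
      fix x assume "x \<in> F ` ({ys \<in> tup V r. Q (set ys)} \<times> ((J - P) \<rightarrow>\<^sub>E V))"
      then obtain ys z where x: "x = F (ys, z)" and ys: "ys \<in> tup V r" "Q (set ys)" and z: "z \<in> (J - P) \<rightarrow>\<^sub>E V" by auto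
      have lys: "length ys = r" "set ys \<subseteq> V" using ys by (auto simp: tup_def)
      have "x ` P = set ys"
      proof
        show "x ` P \<subseteq> set ys" using g lys by (auto simp: x F_def)
        show "set ys \<subseteq> x ` P"
        proof
          fix v assume "v \<in> set ys"
          then obtain q where "q < r" "v = ys ! q" using lys by (auto simp: in_set_conv_nth)
          then show "v \<in> x ` P" using gh[of q] by (intro image_eqI[of _ _ "h q"]) (auto simp: x F_def)
        qed
      qed
      moreover have "x \<in> J \<rightarrow>\<^sub>E V"
      proof (rule PiE_I)
        fix j assume "j \<in> J"
        then show "x j \<in> V" using z g lys by (auto simp: x F_def PiE_iff subset_iff)
      next
        fix j assume "j \<notin> J"
        then show "x j = undefined" using z P by (auto simp: x F_def PiE_iff extensional_def)
      qed
      ultimately show "x \<in> {x \<in> J \<rightarrow>\<^sub>E V. Q (x ` P)}" using ys by simp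
    qed
    show "inj_on F ({ys \<in> tup V r. Q (set ys)} \<times> ((J - P) \<rightarrow>\<^sub>E V))"
    proof (rule inj_onI)
      fix u v assume u: "u \<in> {ys \<in> tup V r. Q (set ys)} \<times> ((J - P) \<rightarrow>\<^sub>E V)"
        and v: "v \<in> {ys \<in> tup V r. Q (set ys)} \<times> ((J - P) \<rightarrow>\<^sub>E V)" and eq: "F u = F v"
      obtain ys z ys' z' where uv: "u = (ys, z)" "v = (ys', z')" by (cases u, cases v) auto
      have len: "length ys = r" "length ys' = r" and z: "z \<in> (J - P) \<rightarrow>\<^sub>E V" "z' \<in> (J - P) \<rightarrow>\<^sub>E V"
        using u v by (auto simp: uv tup_def)
      have "ys ! q = ys' ! q" if "q < r" for q
        using fun_cong[OF eq, of "h q"] gh[OF that] by (simp add: F_def uv)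
      then have "ys = ys'" using len by (simp add: list_eq_iff_nth_eq)
      moreover have "z = z'"
      proof (rule PiE_ext[OF z])
        fix j assume "j \<in> J - P"
        then show "z j = z' j" using fun_cong[OF eq, of j] by (simp add: F_def uv)
      qed
      ultimately show "u = v" by (simp add: uv)
    qed
  qed
  moreover have "card (J - P) = card J - r" using finP P by (simp add: card_Diff_subset)
  ultimately show ?thesis using J by (simp add: card_cartesian_product card_PiE_const mult.commute)
qed

text \<open>Counting index sets \<open>P\<close> instead of vertex sets gives a sensible function
  also for samples with repetitions. Changing one sample point affects only the \<open>P\<close>
  containing it, at most D = M^(r - 1) of them. With \<gamma> = \<alpha> / D the deviation term is
  at least \<alpha> * \<sigma> * M / r^r, by the lower bound on binomial coefficients; \<alpha> is
  chosen so that the quadratic term \<alpha>^2 * M is at most half of this, and \<beta> is the other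
  half per sample point.\<close>

lemma sample_low_degree:
  fixes \<rho> \<sigma> :: real
  assumes r: "1 \<le> r" and \<sigma>: "0 < \<sigma>"
  obtains \<beta> :: real where "\<beta> > 0"
    "\<And>(V::'a set) E S (J::'i set). finite V \<Longrightarrow> V \<noteq> {} \<Longrightarrow> finite J \<Longrightarrow> r \<le> card J \<Longrightarrow>
      \<rho> * real (card V) ^ r \<le> card {ys \<in> tup V r. S \<union> set ys \<in> E} \<Longrightarrow>
      card {x \<in> J \<rightarrow>\<^sub>E V. card {P. P \<subseteq> J \<and> card P = r \<and> S \<union> x ` P \<in> E} \<le> (\<rho> - \<sigma>) * (card J choose r)}
        \<le> real (card V) ^ card J * exp (- \<beta> * card J)"
proof -
  define \<alpha> where "\<alpha> = min 1 (\<sigma> / (2 * real r ^ r))"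
  have \<alpha>: "\<alpha> > 0" "\<alpha> \<le> 1" "\<alpha> \<le> \<sigma> / (2 * real r ^ r)" using \<sigma> r by (auto simp: \<alpha>_def)
  show ?thesis
  proof (rule that[of "\<alpha> * \<sigma> / (2 * real r ^ r)"])
    show "\<alpha> * \<sigma> / (2 * real r ^ r) > 0" using \<alpha> \<sigma> r by simp
    fix V :: "'a set" and E S and J :: "'i set"
    assume V: "finite V" "V \<noteq> {}" and J: "finite J" "r \<le> card J"
      and deg: "\<rho> * real (card V) ^ r \<le> card {ys \<in> tup V r. S \<union> set ys \<in> E}"
    define M where "M = card J"
    define n where "n = real (card V)"
    have n: "n > 0" using V by (simp add: n_def card_gt_0_iff)
    have M: "1 \<le> M" "r \<le> M" using r J by (auto simp: M_def)
    define PP where "PP = {P. P \<subseteq> J \<and> card P = r}"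
    have finPP: "finite PP" using J by (auto simp: PP_def intro: finite_subset[of _ "Pow J"])
    have cPP: "card PP = M choose r" unfolding PP_def M_def by (rule n_subsets[OF J(1)])
    define f where "f x = real (card {P \<in> PP. S \<union> x ` P \<in> E})" for x :: "'i \<Rightarrow> 'a"
    define D where "D = real M ^ (r - 1)"
    define \<gamma> where "\<gamma> = \<alpha> / D"
    have D: "D > 0" using M by (simp add: D_def)
    have cP: "card (J \<rightarrow>\<^sub>E V) = card V ^ M" using J by (simp add: card_PiE_const M_def)
    have bd: "\<bar>f (x(i := a)) - f x\<bar> \<le> D" if i: "i \<in> J" for x i a
    proof -
      define Pi where "Pi = {P \<in> PP. i \<in> P}"
      have finPi: "finite Pi" using finPP by (simp add: Pi_def)
      have "card Pi \<le> card {P. P \<subseteq> J \<and> card P = r - 1}"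
      proof (rule card_inj_on_le[where f = "\<lambda>P. P - {i}"])
        show "inj_on (\<lambda>P. P - {i}) Pi" by (auto simp: inj_on_def Pi_def)
        show "(\<lambda>P. P - {i}) ` Pi \<subseteq> {P. P \<subseteq> J \<and> card P = r - 1}"
          using J by (auto simp: Pi_def PP_def card_Diff_singleton)
      qed (use J in \<open>auto intro: finite_subset[of _ "Pow J"]\<close>)
      also have "\<dots> = M choose (r - 1)" unfolding M_def by (rule n_subsets[OF J(1)])
      also have "\<dots> \<le> M ^ (r - 1)" using M by (intro binomial_le_pow) simp
      finally have cPi: "real (card Pi) \<le> D" by (simp add: D_def flip: of_nat_power)
      have "f y \<le> f z + card Pi" if yz: "\<And>j. j \<noteq> i \<Longrightarrow> y j = z j" for y z
      proof -
        have "{P \<in> PP. S \<union> y ` P \<in> E} \<subseteq> {P \<in> PP. S \<union> z ` P \<in> E} \<union> Pi"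
        proof
          fix P assume P: "P \<in> {P \<in> PP. S \<union> y ` P \<in> E}"
          show "P \<in> {P \<in> PP. S \<union> z ` P \<in> E} \<union> Pi"
          proof (cases "i \<in> P")
            case False
            then have "y ` P = z ` P" by (intro image_cong refl yz) auto
            then show ?thesis using P by auto
          qed (use P in \<open>simp add: Pi_def\<close>)
        qed
        then have "card {P \<in> PP. S \<union> y ` P \<in> E} \<le> card ({P \<in> PP. S \<union> z ` P \<in> E} \<union> Pi)"
          by (rule card_mono[rotated]) (use finPP finPi in auto)
        also have "\<dots> \<le> card {P \<in> PP. S \<union> z ` P \<in> E} + card Pi" by (rule card_Un_le)
        finally show ?thesis by (simp add: f_def flip: of_nat_add)
      qed
      from this[of "x(i := a)" x] this[of x "x(i := a)"] show ?thesis using cPi by auto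
    qed
    have mean: "\<rho> * (M choose r) * card (J \<rightarrow>\<^sub>E V) \<le> (\<Sum>x\<in>J \<rightarrow>\<^sub>E V. f x)"
    proof -
      have finJ: "finite (J \<rightarrow>\<^sub>E V)" using J V by (simp add: finite_PiE_const)
      have "(\<Sum>x\<in>J \<rightarrow>\<^sub>E V. card {P \<in> PP. S \<union> x ` P \<in> E}) = (\<Sum>P\<in>PP. card {x \<in> J \<rightarrow>\<^sub>E V. S \<union> x ` P \<in> E})"
        by (rule sum_multicount_gen) (use finPP finJ in auto)
      then have "(\<Sum>x\<in>J \<rightarrow>\<^sub>E V. f x) = (\<Sum>P\<in>PP. real (card {x \<in> J \<rightarrow>\<^sub>E V. S \<union> x ` P \<in> E}))"
        unfolding f_def of_nat_sum[symmetric] by simp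
      moreover have "(\<Sum>P\<in>PP. \<rho> * n ^ M) \<le> (\<Sum>P\<in>PP. real (card {x \<in> J \<rightarrow>\<^sub>E V. S \<union> x ` P \<in> E}))"
      proof (rule sum_mono)
        fix P assume "P \<in> PP"
        then have P: "P \<subseteq> J" "card P = r" by (auto simp: PP_def)
        have "\<rho> * n ^ M = n ^ (M - r) * (\<rho> * n ^ r)"
          using M by (simp add: power_add[symmetric])
        also have "\<dots> \<le> n ^ (M - r) * card {ys \<in> tup V r. S \<union> set ys \<in> E}"
          using deg n by (intro mult_left_mono) (auto simp: n_def)
        also have "\<dots> = real (card V ^ (card J - r) * card {ys \<in> tup V r. S \<union> set ys \<in> E})"
          by (simp add: n_def M_def)
        also have "\<dots> \<le> card {x \<in> J \<rightarrow>\<^sub>E V. S \<union> x ` P \<in> E}"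
          unfolding of_nat_le_iff by (rule card_PiE_image[OF J(1) V(1) P])
        finally show "\<rho> * n ^ M \<le> card {x \<in> J \<rightarrow>\<^sub>E V. S \<union> x ` P \<in> E}" .
      qed
      ultimately show ?thesis by (simp add: cPP cP n_def mult_ac)
    qed
    have "card {x \<in> J \<rightarrow>\<^sub>E V. f x \<le> \<rho> * (M choose r) - \<sigma> * (M choose r)}
        \<le> card (J \<rightarrow>\<^sub>E V) * exp (card J * (\<gamma> * D)\<^sup>2 - \<gamma> * (\<sigma> * (M choose r)))"
      by (rule mcdiarmid_tail[OF J(1) V _ _ _ bd mean]) (use \<alpha> D in \<open>auto simp: \<gamma>_def\<close>)
    also have "\<dots> \<le> n ^ M * exp (- (\<alpha> * \<sigma> / (2 * real r ^ r)) * M)"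
    proof -
      have "(real M / real r) ^ r \<le> real (M choose r)" by (rule binomial_ge_n_over_k_pow_k) (rule M)
      moreover have "(real M / real r) ^ r = D * M / real r ^ r"
      proof -
        have "real M ^ r = D * M" using r unfolding D_def by (metis One_nat_def Suc_diff_le diff_Suc_1 power_Suc2 Suc_le_D)
        then show ?thesis by (simp add: power_divide)
      qed
      ultimately have "\<gamma> * \<sigma> * (D * M / real r ^ r) \<le> \<gamma> * \<sigma> * real (M choose r)"
        using \<alpha> \<sigma> D by (intro mult_left_mono) (auto simp: \<gamma>_def)
      moreover have "\<gamma> * \<sigma> * (D * M / real r ^ r) = \<alpha> * (\<sigma> / real r ^ r) * M" using D by (simp add: \<gamma>_def)
      moreover have "card J * (\<gamma> * D)\<^sup>2 \<le> \<alpha> * (\<sigma> / (2 * real r ^ r)) * M"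
      proof -
        have "(\<gamma> * D)\<^sup>2 = \<alpha> * \<alpha>" using D by (simp add: \<gamma>_def power2_eq_square)
        also have "\<dots> \<le> \<alpha> * (\<sigma> / (2 * real r ^ r))" using \<alpha> by (intro mult_left_mono) auto
        finally have "(\<gamma> * D)\<^sup>2 * real M \<le> \<alpha> * (\<sigma> / (2 * real r ^ r)) * real M"
          by (rule mult_right_mono) simp
        then show ?thesis by (simp only: M_def mult.commute[of "real (card J)"])
      qed
      moreover have "\<alpha> * (\<sigma> / real r ^ r) * M = 2 * (\<alpha> * (\<sigma> / (2 * real r ^ r)) * M)"
        "- (\<alpha> * \<sigma> / (2 * real r ^ r)) * M = - (\<alpha> * (\<sigma> / (2 * real r ^ r)) * M)"
        "\<gamma> * (\<sigma> * (M choose r)) = \<gamma> * \<sigma> * real (M choose r)"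
        by simp_all
      ultimately have "card J * (\<gamma> * D)\<^sup>2 - \<gamma> * (\<sigma> * (M choose r)) \<le> - (\<alpha> * \<sigma> / (2 * real r ^ r)) * M"
        by linarith
      then show ?thesis unfolding cP using n by (simp add: n_def)
    qed
    finally show "card {x \<in> J \<rightarrow>\<^sub>E V. card {P. P \<subseteq> J \<and> card P = r \<and> S \<union> x ` P \<in> E} \<le> (\<rho> - \<sigma>) * (card J choose r)}
        \<le> real (card V) ^ card J * exp (- (\<alpha> * \<sigma> / (2 * real r ^ r)) * card J)"
      by (simp add: f_def PP_def n_def M_def left_diff_distrib conj_assoc)
  qed
qed

section \<open>Light copies of Y\<close>

lemma min_degree_le:
  assumes "finite (verts H)" "S \<subseteq> verts H" "card S = d"
  shows "min_degree k d H \<le> hdegree k d H S"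
proof -
  have "{hdegree k d H S | S. S \<subseteq> verts H \<and> card S = d} \<subseteq> hdegree k d H ` Pow (verts H)" by auto
  then have "finite {hdegree k d H S | S. S \<subseteq> verts H \<and> card S = d}"
    by (rule finite_subset) (use assms in simp)
  then show ?thesis unfolding min_degree_def by (rule Min_le) (use assms in blast)
qed

lemma min_degree_attained:
  assumes "finite (verts H)" "d \<le> card (verts H)"
  obtains S where "S \<subseteq> verts H" "card S = d" "min_degree k d H = hdegree k d H S"
proof -
  let ?D = "{hdegree k d H S | S. S \<subseteq> verts H \<and> card S = d}"
  have "?D \<subseteq> hdegree k d H ` Pow (verts H)" by auto
  then have "finite ?D" by (rule finite_subset) (use assms in simp)
  moreover obtain S where "S \<subseteq> verts H" "card S = d" using obtain_subset_with_card_n[OF assms(2)] by metis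
  then have "?D \<noteq> {}" by blast
  ultimately have "Min ?D \<in> ?D" by (rule Min_in)
  then show ?thesis using that by (auto simp: min_degree_def)
qed

text \<open>The tiling property for a single order \<open>m\<close> and a real density \<theta>. The
  sampling argument works with one large \<open>m\<close>, which is why it asks for arbitrarily
  large orders with this property and not for all of them.\<close>

definition tilable :: "nat \<Rightarrow> nat \<Rightarrow> nat \<Rightarrow> real \<Rightarrow> real \<Rightarrow> nat \<Rightarrow> bool" where
  "tilable k d l \<theta> \<epsilon> m \<longleftrightarrow> (\<forall>H :: nat hypergraph. k_graph k H \<longrightarrow> card (verts H) = m \<longrightarrow>
     \<theta> * real (m choose (k - d)) \<le> real (min_degree k d H) \<longrightarrow>
     (\<exists>\<T>. Y_tiling k (2 * l) H \<T> \<and> real (card (verts H - (\<Union>F\<in>\<T>. verts F))) \<le> \<epsilon> * real m))"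

lemma tilableD:
  fixes H :: "nat hypergraph"
  assumes "tilable k d l \<theta> \<epsilon> m" "k_graph k H" "card (verts H) = m" "\<theta> * real (m choose (k - d)) \<le> real (min_degree k d H)"
  shows "\<exists>\<T>. Y_tiling k (2 * l) H \<T> \<and> real (card (verts H - (\<Union>F\<in>\<T>. verts F))) \<le> \<epsilon> * real m"
  using assms unfolding tilable_def by blast

text \<open>The encoding L A L' B, with blocks of sizes l, k - 2 * l, l, k - 2 * l. The block
  \<open>take l ts\<close> is both the start of the edge L A L' and the end of the edge L' B L, so
  tuples can be chained at either overlap.\<close>

definition ytuples :: "nat \<Rightarrow> nat \<Rightarrow> 'a set \<Rightarrow> 'a set set \<Rightarrow> 'a list set" where
  "ytuples k l V E = {ts \<in> tup V (2 * k - 2 * l). distinct ts \<and> set (take k ts) \<in> E \<and> set (drop (k - l) ts) \<union> set (take l ts) \<in> E}"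

lemma is_Y_tuple:
  assumes F: "is_Y k (2 * l) F" and l: "1 \<le> l" "2 * l < k"
  obtains ts where "ts \<in> ytuples k l (verts F) (edges F)" "set ts = verts F"
proof -
  from F obtain e f where ef: "edges F = {e, f}" "card (e \<inter> f) = 2 * l" and kF: "k_graph k F" and cF: "card (verts F) = 2 * k - 2 * l"
    by (auto simp: is_Y_def)
  have e: "e \<subseteq> verts F" "card e = k" "f \<subseteq> verts F" "card f = k" and fin: "finite (verts F)"
    using kF ef by (auto simp: k_graph_def)
  have fe: "finite e" "finite f" using e fin finite_subset by blast+
  obtain L A B where L: "set L = e \<inter> f" "distinct L" and A: "set A = e - f" "distinct A" and B: "set B = f - e" "distinct B"
    using finite_distinct_list fe by (metis finite_Diff finite_Int)
  have len: "length L = 2 * l" "length A = k - 2 * l" "length B = k - 2 * l"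
  proof -
    show "length L = 2 * l" using L ef distinct_card by metis
    have "card (e - f) = k - 2 * l" "card (f - e) = k - 2 * l"
      using e ef fe card_Diff_subset_Int[of e f] card_Diff_subset_Int[of f e] by (simp_all add: Int_commute)
    then show "length A = k - 2 * l" "length B = k - 2 * l" using A B distinct_card by metis+
  qed
  have sL: "set (take l L) \<union> set (drop l L) = e \<inter> f" "set (take l L) \<inter> set (drop l L) = {}"
    using L by (metis append_take_drop_id set_append) (metis L(2) set_take_disj_set_drop_if_distinct order.refl)
  define ts where "ts = take l L @ A @ drop l L @ B"
  have "card (e \<union> f) = 2 * k - 2 * l" using card_Un_Int[OF fe] e ef by simp
  then have ev: "e \<union> f = verts F" using e cF fin by (intro card_subset_eq) auto
  have st: "set ts = verts F" using sL A B ev by (auto simp: ts_def)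
  have tk: "take k ts = take l L @ A @ drop l L"
    using len l by (simp add: ts_def)
  have dk: "drop (k - l) ts = drop l L @ B"
    using len l by (simp add: ts_def)
  have tl: "take l ts = take l L" using len l by (simp add: ts_def)
  have "distinct ts"
    using L A B sL by (auto simp: ts_def dest: in_set_takeD in_set_dropD)
  moreover have "length ts = 2 * k - 2 * l" using len l by (simp add: ts_def)
  moreover have "set (take k ts) = e" "set (drop (k - l) ts) \<union> set (take l ts) = f"
    unfolding tk dk tl using sL A B by auto
  ultimately have "ts \<in> ytuples k l (verts F) (edges F)"
    using st ef by (auto simp: ytuples_def tup_def)
  then show ?thesis using that st by blast
qed

text \<open>Averaging over the vertex-disjoint copies of \<open>Y\<close>.\<close>

lemma light_tile:
  assumes kH: "k_graph k H" and l: "1 \<le> l" "2 * l < k" and m: "card (verts H) = m" "1 \<le> m" and \<epsilon>: "\<epsilon> < (1::real)"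
    and T: "Y_tiling k (2 * l) H \<T>" "real (card (verts H - (\<Union>F\<in>\<T>. verts F))) \<le> \<epsilon> * real m"
    and y: "\<And>v. v \<in> verts H \<Longrightarrow> 0 \<le> y v" and A: "(\<Sum>v\<in>verts H. y v) \<le> (A::real)"
  obtains ts where "ts \<in> ytuples k l (verts H) (edges H)"
    "sum_list (map y ts) * ((1 - \<epsilon>) * m) \<le> real (2 * k - 2 * l) * A"
proof -
  let ?M = "verts H" and ?n = "2 * k - 2 * l"
  have fin: "finite ?M" using kH by (simp add: k_graph_def)
  have TD: "is_Y k (2 * l) F" "verts F \<subseteq> ?M" "edges F \<subseteq> edges H" if "F \<in> \<T>" for F
    using T(1) that by (auto simp: Y_tiling_def subhypergraph_def)
  have disj: "verts F \<inter> verts G = {}" if "F \<in> \<T>" "G \<in> \<T>" "F \<noteq> G" for F G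
    using T(1) that by (auto simp: Y_tiling_def)
  have cF: "card (verts F) = ?n" if "F \<in> \<T>" for F using TD(1)[OF that] by (simp add: is_Y_def)
  have n0: "?n > 0" using l by simp
  have "inj_on verts \<T>"
  proof (rule inj_onI, rule ccontr)
    fix F G assume FG: "F \<in> \<T>" "G \<in> \<T>" "verts F = verts G" "F \<noteq> G"
    then have "verts F = {}" using disj[OF FG(1,2,4)] by simp
    then show False using cF[OF FG(1)] n0 by simp
  qed
  moreover have "finite (verts ` \<T>)" by (rule finite_subset[of _ "Pow ?M"]) (use TD(2) fin in blast)+
  ultimately have finT: "finite \<T>" using finite_imageD by blast
  have finF: "finite (verts F)" if "F \<in> \<T>" for F using TD(2)[OF that] fin finite_subset by blast
  let ?U = "\<Union>F\<in>\<T>. verts F"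
  have cU: "card ?U = card \<T> * ?n"
    using card_UN_disjoint[OF finT, of verts] finF disj cF by simp
  have UM: "?U \<subseteq> ?M" using TD(2) by (rule UN_least)
  have "real (card (?M - ?U)) = real m - card ?U"
    using card_Diff_subset[OF finite_subset[OF UM fin] UM] card_mono[OF fin UM] m by (simp add: of_nat_diff)
  moreover have "real (card ?U) = real (card \<T>) * real ?n" unfolding cU by (rule of_nat_mult)
  moreover have "(1 - \<epsilon>) * m = real m - \<epsilon> * m" by (simp add: left_diff_distrib)
  ultimately have big: "(1 - \<epsilon>) * m \<le> real (card \<T>) * ?n" using T(2) by linarith
  have pm: "0 < (1 - \<epsilon>) * m" using \<epsilon> m by simp
  then have "\<T> \<noteq> {}" using big by auto
  have "0 \<le> (\<Sum>v\<in>?M. y v)" by (rule sum_nonneg) (rule y)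
  then have A0: "0 \<le> A" using A by linarith
  have sumU: "(\<Sum>F\<in>\<T>. \<Sum>v\<in>verts F. y v) \<le> A"
  proof -
    have "(\<Sum>F\<in>\<T>. \<Sum>v\<in>verts F. y v) = (\<Sum>v\<in>?U. y v)"
      by (rule sum.UNION_disjoint[symmetric]) (use finT finF disj in auto)
    also have "\<dots> \<le> (\<Sum>v\<in>?M. y v)" by (rule sum_mono2) (use fin UM y in auto)
    finally show ?thesis using A by simp
  qed
  have "\<exists>F\<in>\<T>. (\<Sum>v\<in>verts F. y v) * ((1 - \<epsilon>) * m) \<le> ?n * A"
  proof (rule ccontr)
    assume "\<not> ?thesis"
    then have "(\<Sum>F\<in>\<T>. ?n * A) < (\<Sum>F\<in>\<T>. (\<Sum>v\<in>verts F. y v) * ((1 - \<epsilon>) * m))"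
      using finT \<open>\<T> \<noteq> {}\<close> by (intro sum_strict_mono) (auto simp: not_le)
    also have "\<dots> \<le> A * ((1 - \<epsilon>) * m)"
      unfolding sum_distrib_right[symmetric] using sumU pm by (intro mult_right_mono) auto
    also have "\<dots> \<le> A * (real (card \<T>) * ?n)" using big A0 by (rule mult_left_mono)
    finally show False by (simp add: mult_ac)
  qed
  then obtain F where F: "F \<in> \<T>" "(\<Sum>v\<in>verts F. y v) * ((1 - \<epsilon>) * m) \<le> ?n * A" by blast
  obtain ts where ts: "ts \<in> ytuples k l (verts F) (edges F)" "set ts = verts F"
    using is_Y_tuple[OF TD(1)[OF F(1)] l] by blast
  have "ts \<in> ytuples k l ?M (edges H)"
    using ts TD(2,3)[OF F(1)] by (auto simp: ytuples_def tup_def)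
  moreover have "sum_list (map y ts) = (\<Sum>v\<in>verts F. y v)"
    using ts by (simp add: ytuples_def sum_list_distinct_conv_sum_set)
  ultimately show ?thesis using that F(2) l by (simp add: of_nat_diff)
qed

section \<open>Random samples of bounded size contain light tiles\<close>

lemma binomial_diff_ge:
  assumes "1 \<le> r" "1 \<le> m" "d \<le> m"
  shows "(1 - real (d * r) / m) * (m choose r) \<le> real ((m - d) choose r)"
proof -
  have step: "m choose r \<le> ((m - d) choose r) + d * ((m - 1) choose (r - 1))"
    using assms(3)
  proof (induction d)
    case (Suc d)
    have e: "m - d = Suc (m - Suc d)" using Suc.prems by simp
    obtain r' where r': "r = Suc r'" using assms by (cases r) auto
    have "(m - d) choose r = ((m - Suc d) choose (r - 1)) + ((m - Suc d) choose r)"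
      unfolding e r' by simp
    moreover have "(m - Suc d) choose (r - 1) \<le> (m - 1) choose (r - 1)"
      using Suc.prems by (intro binomial_right_mono) auto
    ultimately show ?case using Suc.IH Suc.prems by (simp add: algebra_simps)
  qed simp
  have ab: "r * (m choose r) = m * ((m - 1) choose (r - 1))"
    using binomial_absorption[of "r - 1" m] assms by simp
  have "real m * (m choose r) \<le> real m * ((m - d) choose r) + d * (real m * ((m - 1) choose (r - 1)))"
    using step by (simp add: algebra_simps flip: of_nat_mult of_nat_add) (metis add_mult_distrib2 mult.left_commute mult_le_mono2)
  also have "real m * ((m - 1) choose (r - 1)) = r * (m choose r)" using ab by (metis of_nat_mult)
  finally have "(real m - d * r) * (m choose r) \<le> real m * ((m - d) choose r)" by (simp add: algebra_simps)
  then have "(real m - d * r) * (m choose r) / m \<le> real ((m - d) choose r)" using assms by (simp add: divide_le_eq mult.commute)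
  moreover have "(real m - d * r) * (m choose r) / m = (1 - real (d * r) / m) * (m choose r)"
    using assms by (simp add: field_simps)
  ultimately show ?thesis by simp
qed

lemma ex_large_sample:
  fixes \<beta> \<tau> :: real
  assumes "0 < \<beta>" "0 < \<tau>"
  obtains m0 where "\<And>m. m0 \<le> m \<Longrightarrow> real m ^ d * exp (- \<beta> * (real m - d)) \<le> \<tau>"
proof -
  have "((\<lambda>x. x ^ d / exp x) \<longlongrightarrow> (0::real)) at_top" by (rule tendsto_power_div_exp_0)
  moreover have "filterlim (\<lambda>m. \<beta> * real m) at_top sequentially"
    using assms by (intro filterlim_tendsto_pos_mult_at_top[OF tendsto_const] filterlim_real_sequentially)
  ultimately have "((\<lambda>m. (\<beta> * real m) ^ d / exp (\<beta> * real m)) \<longlongrightarrow> 0) sequentially"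
    by (rule filterlim_compose)
  then have "eventually (\<lambda>m. (\<beta> * real m) ^ d / exp (\<beta> * real m) < \<tau> * \<beta> ^ d * exp (- (\<beta> * d))) sequentially"
    by (rule order_tendstoD) (use assms in simp)
  then obtain m0 where m0: "\<And>m. m0 \<le> m \<Longrightarrow> (\<beta> * real m) ^ d / exp (\<beta> * real m) < \<tau> * \<beta> ^ d * exp (- (\<beta> * d))"
    by (auto simp: eventually_sequentially)
  show ?thesis
  proof (rule that[of m0])
    fix m assume "m0 \<le> m"
    from m0[OF this] have "\<beta> ^ d * (real m ^ d * exp (- (\<beta> * m))) < \<beta> ^ d * (\<tau> * exp (- (\<beta> * d)))"
      by (simp add: power_mult_distrib exp_minus divide_inverse mult_ac)
    then have "real m ^ d * exp (- (\<beta> * m)) < \<tau> * exp (- (\<beta> * d))" using assms by simp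
    then have "real m ^ d * exp (- (\<beta> * m)) * exp (\<beta> * d) < \<tau> * exp (- (\<beta> * d)) * exp (\<beta> * d)" by simp
    then show "real m ^ d * exp (- \<beta> * (real m - d)) \<le> \<tau>"
      by (simp add: mult.assoc exp_add[symmetric] algebra_simps)
  qed
qed

text \<open>A uniform sample of fixed size \<open>m\<close> may fail to be injective
  (\<open>B1\<close>) or to keep the degrees of its d-sets (\<open>B2\<close>), each with
  probability at most \<tau> / 8. By Markov's inequality its weight is at most (1 + \<tau>) * m * a
  with probability at least \<tau> / 2. So a proportion \<tau> / 4 of the samples passes all tests
  and contains a light tile. The degree density falls from \<rho> to \<rho> - \<sigma> by
  concentration, and to \<rho> - 2 * \<sigma> because only \<open>m - d\<close> positions are left
  for the rest of an edge.\<close>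

lemma dense_light_ytuples:
  fixes \<rho> \<sigma> \<tau> \<epsilon> :: real
  assumes l: "1 \<le> l" "2 * l < k" and d: "d < k" and \<sigma>: "0 < \<sigma>" "\<sigma> \<le> \<rho>" "\<rho> \<le> 1" and \<tau>: "0 < \<tau>" "\<tau> \<le> 1"
    and \<epsilon>: "0 \<le> \<epsilon>" "\<epsilon> < 1" and til: "\<And>m0. \<exists>m\<ge>m0. tilable k d l (\<rho> - 2 * \<sigma>) \<epsilon> m"
  obtains n0 and \<alpha> :: real where "\<alpha> > 0"
    "\<And>(V :: nat set) E (y :: nat \<Rightarrow> real) (a :: real). finite V \<Longrightarrow> n0 \<le> card V \<Longrightarrow> (\<And>e. e \<in> E \<Longrightarrow> e \<subseteq> V \<and> card e = k) \<Longrightarrow>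
      (\<And>S. S \<subseteq> V \<Longrightarrow> card S = d \<Longrightarrow> \<rho> * real (card V) ^ (k - d) \<le> card {ys \<in> tup V (k - d). S \<union> set ys \<in> E}) \<Longrightarrow>
      (\<And>v. v \<in> V \<Longrightarrow> 0 \<le> y v) \<Longrightarrow> (\<Sum>v\<in>V. y v) = a * card V \<Longrightarrow> 0 < a \<Longrightarrow>
      \<alpha> * real (card V) ^ (2 * k - 2 * l) \<le>
        card {ts \<in> ytuples k l V E. sum_list (map y ts) \<le> real (2 * k - 2 * l) * a * (1 + \<tau>) / (1 - \<epsilon>)}"
proof -
  define r where "r = k - d"
  define Yn where "Yn = 2 * k - 2 * l"
  have r: "1 \<le> r" using d by (simp add: r_def)
  show ?thesis
  proof (rule sample_low_degree[OF r \<sigma>(1), where 'a = nat and 'i = nat, of \<rho>])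
    fix \<beta> :: real
    assume \<beta>: "\<beta> > 0" and low:
      "\<And>(V::nat set) E S (J::nat set). finite V \<Longrightarrow> V \<noteq> {} \<Longrightarrow> finite J \<Longrightarrow> r \<le> card J \<Longrightarrow>
        \<rho> * real (card V) ^ r \<le> card {ys \<in> tup V r. S \<union> set ys \<in> E} \<Longrightarrow>
        card {x \<in> J \<rightarrow>\<^sub>E V. card {P. P \<subseteq> J \<and> card P = r \<and> S \<union> x ` P \<in> E} \<le> (\<rho> - \<sigma>) * (card J choose r)}
          \<le> real (card V) ^ card J * exp (- \<beta> * card J)"
    obtain m1 where m1: "\<And>m. m1 \<le> m \<Longrightarrow> real m ^ d * exp (- \<beta> * (real m - d)) \<le> \<tau> / 8"
      using ex_large_sample[OF \<beta>, of "\<tau> / 8" d] \<tau> by auto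
    define m0 where "m0 = m1 + k + Yn + nat \<lceil>real (d * r) / \<sigma>\<rceil> + 1"
    obtain m where m: "m0 \<le> m" "tilable k d l (\<rho> - 2 * \<sigma>) \<epsilon> m" using til by blast
    have mm: "m1 \<le> m" "k \<le> m" "Yn \<le> m" "1 \<le> m" "real (d * r) / \<sigma> \<le> m"
      using m(1) unfolding m0_def by linarith+
    have mdr: "real (d * r) / m \<le> \<sigma>" using mm \<sigma> by (simp add: divide_le_eq mult.commute)
    define I where "I = {..<m}"
    have I: "finite I" "card I = m" by (auto simp: I_def)
    \<comment> \<open>The good samples are shared among the at most \<open>m ^ Yn\<close> ways in
      which a tile can sit on the sample positions.\<close>
    define \<alpha> where "\<alpha> = \<tau> / 4 / real m ^ Yn"
    show ?thesis
    proof (rule that[of \<alpha> "nat \<lceil>real (m * m) / (\<tau> / 8)\<rceil> + 1"])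
      show "\<alpha> > 0" using \<tau> mm by (simp add: \<alpha>_def)
      fix V :: "nat set" and E and y :: "nat \<Rightarrow> real" and a :: real
      assume V: "finite V" and nn: "nat \<lceil>real (m * m) / (\<tau> / 8)\<rceil> + 1 \<le> card V"
        and E: "\<And>e. e \<in> E \<Longrightarrow> e \<subseteq> V \<and> card e = k"
        and deg: "\<And>S. S \<subseteq> V \<Longrightarrow> card S = d \<Longrightarrow> \<rho> * real (card V) ^ (k - d) \<le> card {ys \<in> tup V (k - d). S \<union> set ys \<in> E}"
        and y: "\<And>v. v \<in> V \<Longrightarrow> 0 \<le> y v" and ya: "(\<Sum>v\<in>V. y v) = a * card V" and a: "0 < a"
      define n where "n = real (card V)"
      have Vne: "V \<noteq> {}" using nn by auto
      have n: "n > 0" using V Vne by (simp add: n_def card_gt_0_iff)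
      have "real (m * m) / (\<tau> / 8) \<le> n" using nn unfolding n_def by linarith
      then have nm: "real (m * m) \<le> \<tau> / 8 * n" using \<tau> by (simp add: divide_le_eq mult.commute)
      define W where "W = I \<rightarrow>\<^sub>E V"
      have finW: "finite W" using I V by (simp add: W_def finite_PiE_const)
      have cW: "real (card W) = n ^ m" using I by (simp add: W_def card_PiE_const n_def)
      have WV: "x i \<in> V" if "x \<in> W" "i \<in> I" for x i using that by (auto simp: W_def)
      define B1 where "B1 = {x \<in> W. \<not> inj_on x I}"
      \<comment> \<open>The positions in \<open>Q\<close> carry the d-set, and the degree is counted
        over the other positions, which are independent of them. Requiring \<open>d\<close> distinct
        images makes the degree hypothesis applicable.\<close>
      define bad where "bad Q x \<longleftrightarrow> card (x ` Q) = d \<and>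
         card {P. P \<subseteq> I - Q \<and> card P = r \<and> x ` Q \<union> x ` P \<in> E} \<le> (\<rho> - \<sigma>) * ((m - d) choose r)" for Q and x :: "nat \<Rightarrow> nat"
      define QQ where "QQ = {Q. Q \<subseteq> I \<and> card Q = d}"
      define B2 where "B2 = (\<Union>Q\<in>QQ. {x \<in> W. bad Q x})"
      define B3 where "B3 = {x \<in> W. (1 + \<tau>) * (m * a) < (\<Sum>i\<in>I. y (x i))}"
      define Good where "Good = W - B1 - B2 - B3"
      have c1: "real (card B1) \<le> \<tau> / 8 * n ^ m"
      proof -
        have "card B1 \<le> card {xs \<in> tup V m. \<not> fresh {} xs}"
        proof (rule card_inj_on_le[where f = "\<lambda>x. map x [0..<m]"])
          show "inj_on (\<lambda>x. map x [0..<m]) B1"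
          proof (rule inj_onI)
            fix x z assume xz: "x \<in> B1" "z \<in> B1" "map x [0..<m] = map z [0..<m]"
            show "x = z"
              by (rule PiE_ext[of x I "\<lambda>_. V"]) (use xz in \<open>auto simp: B1_def W_def I_def\<close>)
          qed
          show "(\<lambda>x. map x [0..<m]) ` B1 \<subseteq> {xs \<in> tup V m. \<not> fresh {} xs}"
            using WV by (auto simp: B1_def tup_def fresh_def I_def distinct_map lessThan_atLeast0)
        qed (use V in \<open>simp add: finite_tup\<close>)
        then have "n * card B1 \<le> n * card {xs \<in> tup V m. \<not> fresh {} xs}" using n by simp
        also have "\<dots> = real (card V * card {xs \<in> tup V m. \<not> fresh {} xs})" by (simp add: n_def)
        also have "\<dots> \<le> real ((m * card ({}::nat set) + m * m) * card V ^ m)"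
          unfolding of_nat_le_iff by (rule card_not_fresh[OF V]) simp
        also have "\<dots> = real (m * m) * n ^ m" by (simp add: n_def)
        also have "\<dots> \<le> \<tau> / 8 * n * n ^ m" using nm n by (intro mult_right_mono) auto
        finally have "n * card B1 \<le> n * (\<tau> / 8 * n ^ m)" by (simp add: mult_ac)
        then show ?thesis using n by (simp only: mult_le_cancel_left_pos)
      qed
      have c2: "real (card B2) \<le> \<tau> / 8 * n ^ m"
      proof -
        let ?e = "exp (- \<beta> * (real m - d))"
        have one: "real (card {x \<in> W. bad Q x}) \<le> n ^ m * ?e" if Q: "Q \<in> QQ" for Q
        proof -
          have Q': "Q \<subseteq> I" "card Q = d" "finite Q" using Q I finite_subset by (auto simp: QQ_def)
          have dm: "d \<le> m" "r \<le> m - d" using d mm by (auto simp: r_def)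
          have cJ: "card (I - Q) = m - d" using Q' I by (simp add: card_Diff_subset)
          define Z where "Z s = {z \<in> (I - Q) \<rightarrow>\<^sub>E V. card {P. P \<subseteq> I - Q \<and> card P = r \<and> s ` Q \<union> z ` P \<in> E} \<le> (\<rho> - \<sigma>) * (card (I - Q) choose r)}" for s :: "nat \<Rightarrow> nat"
          define SS where "SS = {s \<in> Q \<rightarrow>\<^sub>E V. card (s ` Q) = d}"
          have finZ: "finite (Z s)" for s using I V by (simp add: Z_def finite_PiE_const)
          have finS: "finite SS" using Q' V by (simp add: SS_def finite_PiE_const)
          have "card {x \<in> W. bad Q x} \<le> card (SIGMA s:SS. Z s)"
          proof (rule card_inj_on_le[where f = "\<lambda>x. (restrict x Q, restrict x (I - Q))"])
            show "inj_on (\<lambda>x. (restrict x Q, restrict x (I - Q))) {x \<in> W. bad Q x}"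
            proof (rule inj_onI)
              fix x z assume xz: "x \<in> {x \<in> W. bad Q x}" "z \<in> {x \<in> W. bad Q x}"
                and eq: "(restrict x Q, restrict x (I - Q)) = (restrict z Q, restrict z (I - Q))"
              show "x = z"
              proof (rule PiE_ext[of x I "\<lambda>_. V"])
                fix i assume "i \<in> I"
                then show "x i = z i" using eq by (cases "i \<in> Q") (metis Diff_iff prod.inject restrict_apply')+
              qed (use xz in \<open>auto simp: W_def\<close>)
            qed
            show "(\<lambda>x. (restrict x Q, restrict x (I - Q))) ` {x \<in> W. bad Q x} \<subseteq> (SIGMA s:SS. Z s)"
            proof clarify
              fix x assume x: "x \<in> W" "bad Q x"
              have i1: "restrict x Q ` Q = x ` Q" by (rule image_cong) auto
              have i2: "restrict x (I - Q) ` P = x ` P" if "P \<subseteq> I - Q" for P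
                by (rule image_cong) (use that in auto)
              have eqc: "{P. P \<subseteq> I - Q \<and> card P = r \<and> x ` Q \<union> restrict x (I - Q) ` P \<in> E} = {P. P \<subseteq> I - Q \<and> card P = r \<and> x ` Q \<union> x ` P \<in> E}"
                by (rule Collect_cong, rule conj_cong[OF refl], rule conj_cong[OF refl]) (simp only: i2)
              have "restrict x Q \<in> SS" using x WV Q' by (auto simp: SS_def bad_def i1)
              moreover have "restrict x (I - Q) \<in> Z (restrict x Q)"
                unfolding Z_def
              proof (intro CollectI conjI)
                show "restrict x (I - Q) \<in> (I - Q) \<rightarrow>\<^sub>E V" using x WV by auto
                show "real (card {P. P \<subseteq> I - Q \<and> card P = r \<and> restrict x Q ` Q \<union> restrict x (I - Q) ` P \<in> E}) \<le> (\<rho> - \<sigma>) * real (card (I - Q) choose r)"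
                  unfolding i1 eqc cJ using x(2) by (simp add: bad_def)
              qed
              ultimately show "restrict x Q \<in> SS \<and> restrict x (I - Q) \<in> Z (restrict x Q)" by blast
            qed
            show "finite (SIGMA s:SS. Z s)" using finS finZ by simp
          qed
          then have "real (card {x \<in> W. bad Q x}) \<le> (\<Sum>s\<in>SS. real (card (Z s)))"
            using finS finZ by (simp add: card_SigmaI flip: of_nat_sum)
          also have "\<dots> \<le> (\<Sum>s\<in>SS. n ^ (m - d) * ?e)"
          proof (rule sum_mono)
            fix s assume s: "s \<in> SS"
            have "s ` Q \<subseteq> V" "card (s ` Q) = d" using s by (auto simp: SS_def)
            from deg[OF this] have "\<rho> * real (card V) ^ r \<le> card {ys \<in> tup V r. s ` Q \<union> set ys \<in> E}" by (simp add: r_def)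
            from low[OF V Vne _ _ this, of "I - Q"] show "real (card (Z s)) \<le> n ^ (m - d) * ?e"
              using I cJ dm by (simp add: Z_def n_def of_nat_diff)
          qed
          also have "\<dots> = card SS * (n ^ (m - d) * ?e)" by simp
          also have "\<dots> \<le> n ^ d * (n ^ (m - d) * ?e)"
          proof (rule mult_right_mono)
            have "card SS \<le> card (Q \<rightarrow>\<^sub>E V)" by (rule card_mono) (use Q' V in \<open>auto simp: SS_def finite_PiE_const\<close>)
            then show "real (card SS) \<le> n ^ d" using Q' by (simp add: card_PiE_const n_def flip: of_nat_power)
          qed (use n in simp)
          also have "\<dots> = n ^ m * ?e" using dm by (simp add: mult.assoc[symmetric] power_add[symmetric])
          finally show ?thesis .
        qed
        have finQQ: "finite QQ" using I by (auto simp: QQ_def intro: finite_subset[of _ "Pow I"])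
        have "card B2 \<le> (\<Sum>Q\<in>QQ. card {x \<in> W. bad Q x})" unfolding B2_def by (rule card_UN_le[OF finQQ])
        then have "real (card B2) \<le> (\<Sum>Q\<in>QQ. real (card {x \<in> W. bad Q x}))" by (simp flip: of_nat_sum)
        also have "\<dots> \<le> (\<Sum>Q\<in>QQ. n ^ m * ?e)" by (intro sum_mono one)
        also have "\<dots> = real (m choose d) * (n ^ m * ?e)"
          using n_subsets[OF I(1), of d] I by (simp add: QQ_def)
        also have "\<dots> \<le> real m ^ d * (n ^ m * ?e)"
          using binomial_le_pow[of d m] d mm n by (intro mult_right_mono) (auto simp flip: of_nat_power)
        also have "\<dots> = (real m ^ d * ?e) * n ^ m" by simp
        also have "\<dots> \<le> \<tau> / 8 * n ^ m" using m1[OF mm(1)] n by (intro mult_right_mono) auto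
        finally show ?thesis .
      qed
      have c3: "real (card B3) \<le> (1 - \<tau> / 2) * n ^ m"
      proof -
        have s1: "(\<Sum>x\<in>W. y (x i)) = a * n ^ m" if i: "i \<in> I" for i
        proof -
          have Ii: "insert i (I - {i}) = I" using i by auto
          have "(\<Sum>x\<in>W. y (x i)) = (\<Sum>v\<in>V. \<Sum>x\<in>(I - {i}) \<rightarrow>\<^sub>E V. y ((x(i := v)) i))"
            using sum_PiE_insert[of i "I - {i}" "\<lambda>x. y (x i)" "\<lambda>_. V"] Ii by (simp add: W_def)
          also have "\<dots> = (\<Sum>v\<in>V. y v) * real (card ((I - {i}) \<rightarrow>\<^sub>E V))" by (simp add: sum_distrib_right mult.commute)
          also have "real (card ((I - {i}) \<rightarrow>\<^sub>E V)) = n ^ (m - 1)" using I i by (simp add: card_PiE_const n_def)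
          also have "(\<Sum>v\<in>V. y v) * n ^ (m - 1) = a * (n * n ^ (m - 1))" by (simp add: ya n_def)
          also have "n * n ^ (m - 1) = n ^ m" using mm by (simp flip: power_Suc)
          finally show ?thesis .
        qed
        have "real (card B3) * ((1 + \<tau>) * (m * a)) = (\<Sum>x\<in>B3. (1 + \<tau>) * (m * a))" by simp
        also have "\<dots> \<le> (\<Sum>x\<in>B3. \<Sum>i\<in>I. y (x i))" by (rule sum_mono) (auto simp: B3_def)
        also have "\<dots> \<le> (\<Sum>x\<in>W. \<Sum>i\<in>I. y (x i))"
          by (rule sum_mono2) (use finW WV y in \<open>auto simp: B3_def intro!: sum_nonneg\<close>)
        also have "\<dots> = (\<Sum>i\<in>I. \<Sum>x\<in>W. y (x i))" by (rule sum.swap)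
        also have "\<dots> = n ^ m * (m * a)" using s1 I by simp
        finally have "(m * a) * (real (card B3) * (1 + \<tau>)) \<le> (m * a) * n ^ m" by (simp add: mult_ac)
        then have c: "real (card B3) * (1 + \<tau>) \<le> n ^ m" using mm a by simp
        have "1 \<le> (1 - \<tau> / 2) * (1 + \<tau>)"
        proof -
          have "0 \<le> \<tau> * (1 - \<tau>) / 2" using \<tau> by simp
          also have "\<tau> * (1 - \<tau>) / 2 = (1 - \<tau> / 2) * (1 + \<tau>) - 1" by (simp add: field_simps)
          finally show ?thesis by simp
        qed
        then have "n ^ m * 1 \<le> n ^ m * ((1 - \<tau> / 2) * (1 + \<tau>))" using n by (intro mult_left_mono) auto
        then have "real (card B3) * (1 + \<tau>) \<le> ((1 - \<tau> / 2) * n ^ m) * (1 + \<tau>)" using c by (simp add: mult_ac)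
        then show ?thesis by (rule mult_right_le_imp_le) (use \<tau> in simp)
      qed
      have cG: "\<tau> / 4 * n ^ m \<le> real (card Good)"
      proof -
        have finB: "finite B1" "finite B2" "finite B3" "finite Good"
          using finW by (auto simp: B1_def B2_def B3_def Good_def intro: finite_subset[of _ W])
        have "W \<subseteq> Good \<union> (B1 \<union> (B2 \<union> B3))" by (auto simp: Good_def)
        then have "card W \<le> card (Good \<union> (B1 \<union> (B2 \<union> B3)))" by (rule card_mono[rotated]) (use finB in simp)
        also have "\<dots> \<le> card Good + (card B1 + (card B2 + card B3))"
          by (intro order.trans[OF card_Un_le] add_mono order.refl card_Un_le)
        finally have "n ^ m \<le> real (card Good) + (card B1 + (card B2 + card B3))" unfolding cW[symmetric] by simp
        then show ?thesis using c1 c2 c3 by (simp add: algebra_simps)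
      qed
      define B where "B = real (2 * k - 2 * l) * a * (1 + \<tau>) / (1 - \<epsilon>)"
      define LL where "LL = {ts \<in> ytuples k l V E. sum_list (map y ts) \<le> B}"
      have LLt: "LL \<subseteq> tup V Yn" by (auto simp: LL_def ytuples_def Yn_def)
      have good: "\<exists>ps\<in>tup I Yn. map x ps \<in> LL" if x: "x \<in> Good" for x
      proof -
        have xW: "x \<in> W" and inj: "inj_on x I" and nb: "\<And>Q. Q \<in> QQ \<Longrightarrow> \<not> bad Q x" and sy: "(\<Sum>i\<in>I. y (x i)) \<le> (1 + \<tau>) * (m * a)"
          using x by (auto simp: Good_def B1_def B2_def B3_def)
        define M where "M = x ` I"
        define H where "H = (M, {e \<in> E. e \<subseteq> M})"
        have M: "finite M" "card M = m" "M \<subseteq> V" using I inj WV[OF xW] by (auto simp: M_def card_image)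
        have kH: "k_graph k H" using E M by (auto simp: k_graph_def H_def)
        have dM: "d \<le> card (verts H)" using M mm d by (simp add: H_def)
        obtain S where S: "S \<subseteq> M" "card S = d" "min_degree k d H = hdegree k d H S"
          using min_degree_attained[OF _ dM, of k] M by (auto simp: H_def)
        \<comment> \<open>\<open>S\<close> attains the minimum degree of the sampled hypergraph; by
          injectivity it is carried by exactly \<open>d\<close> positions, to which the absence of
          bad position sets applies.\<close>
        define Q where "Q = {i \<in> I. x i \<in> S}"
        have xQ: "x ` Q = S" using S(1) by (auto simp: Q_def M_def)
        have "card Q = card (x ` Q)" by (rule card_image[symmetric]) (use inj in \<open>auto simp: Q_def intro: inj_on_subset\<close>)
        then have Q: "Q \<in> QQ" using S xQ by (auto simp: QQ_def Q_def)
        define PS where "PS = {P. P \<subseteq> I - Q \<and> card P = r \<and> x ` Q \<union> x ` P \<in> E}"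
        have "(\<rho> - 2 * \<sigma>) * (m choose r) \<le> (\<rho> - \<sigma>) * ((1 - real (d * r) / m) * (m choose r))"
        proof -
          have "\<rho> - 2 * \<sigma> \<le> (\<rho> - \<sigma>) * (1 - real (d * r) / m)"
          proof -
            have "(\<rho> - \<sigma>) * (real (d * r) / m) \<le> 1 * \<sigma>" using mdr \<sigma> by (intro mult_mono) auto
            then show ?thesis by (simp add: algebra_simps)
          qed
          then show ?thesis by (simp add: mult.assoc[symmetric] mult_right_mono)
        qed
        also have "\<dots> \<le> (\<rho> - \<sigma>) * ((m - d) choose r)"
          using binomial_diff_ge[OF r, of m d] mm d \<sigma> by (intro mult_left_mono) auto
        also have "\<dots> < card PS"
          using nb[OF Q] xQ S(2) by (auto simp: bad_def PS_def)
        also have "real (card PS) \<le> real (hdegree k d H S)"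
          unfolding hdegree_def of_nat_le_iff
        proof (rule card_inj_on_le[where f = "\<lambda>P. x ` P"])
          show "inj_on (\<lambda>P. x ` P) PS"
          proof (rule inj_onI)
            fix P P' assume "P \<in> PS" "P' \<in> PS" "x ` P = x ` P'"
            then show "P = P'" using inj_on_image_eq_iff[OF inj, of P P'] by (auto simp: PS_def)
          qed
          show "(\<lambda>P. x ` P) ` PS \<subseteq> {T. T \<subseteq> verts H \<and> card T = k - d \<and> T \<union> S \<in> edges H}"
          proof
            fix T assume "T \<in> (\<lambda>P. x ` P) ` PS"
            then obtain P where P: "T = x ` P" "P \<subseteq> I - Q" "card P = r" "x ` Q \<union> x ` P \<in> E" by (auto simp: PS_def)
            have "card T = r" using P inj by (metis Diff_subset card_image inj_on_subset order.trans)
            moreover have "T \<subseteq> M" using P by (auto simp: M_def)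
            ultimately show "T \<in> {T. T \<subseteq> verts H \<and> card T = k - d \<and> T \<union> S \<in> edges H}"
              using P xQ S(1) by (auto simp: H_def r_def Un_commute)
          qed
          show "finite {T. T \<subseteq> verts H \<and> card T = k - d \<and> T \<union> S \<in> edges H}"
            by (rule finite_subset[of _ "Pow M"]) (use M in \<open>auto simp: H_def\<close>)
        qed
        finally have mdH: "(\<rho> - 2 * \<sigma>) * (m choose (k - d)) \<le> min_degree k d H" using S(3) by (simp add: r_def)
        have vH: "card (verts H) = m" using M by (simp add: H_def)
        obtain \<T> where T: "Y_tiling k (2 * l) H \<T>" "real (card (verts H - (\<Union>F\<in>\<T>. verts F))) \<le> \<epsilon> * real m"
          using tilableD[OF m(2) kH vH mdH] by blast
        have yM: "(\<Sum>v\<in>verts H. y v) \<le> (1 + \<tau>) * (m * a)"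
          using sy sum.reindex[OF inj, of y] by (simp add: H_def M_def)
        obtain ts where ts: "ts \<in> ytuples k l (verts H) (edges H)"
            "sum_list (map y ts) * ((1 - \<epsilon>) * m) \<le> real (2 * k - 2 * l) * ((1 + \<tau>) * (m * a))"
        proof (rule light_tile[OF kH l vH mm(4) \<epsilon>(2) T _ yM])
          show "0 \<le> y v" if "v \<in> verts H" for v using y M(3) that by (auto simp: H_def)
        qed
        have "sum_list (map y ts) * (1 - \<epsilon>) * m \<le> real (2 * k - 2 * l) * a * (1 + \<tau>) * m"
          using ts(2) by (simp add: mult_ac)
        then have "sum_list (map y ts) * (1 - \<epsilon>) \<le> real (2 * k - 2 * l) * a * (1 + \<tau>)"
          by (rule mult_right_le_imp_le) (use mm in simp)
        then have "sum_list (map y ts) \<le> B" using \<epsilon> by (simp add: B_def pos_le_divide_eq)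
        then have "ts \<in> LL" using ts(1) M by (auto simp: LL_def ytuples_def tup_def H_def)
        moreover have tsM: "set ts \<subseteq> x ` I" "length ts = Yn" using ts(1) by (auto simp: ytuples_def tup_def H_def M_def Yn_def)
        define ps where "ps = map (inv_into I x) ts"
        have "map x ps = ts" using tsM by (auto simp: ps_def f_inv_into_f subset_iff intro!: map_idI)
        moreover have "ps \<in> tup I Yn" using tsM by (auto simp: ps_def tup_def inv_into_into subset_iff)
        ultimately show ?thesis by metis
      qed
      have "\<exists>ps\<in>tup I Yn. \<alpha> * n ^ m \<le> real (card {x \<in> W. map x ps \<in> LL})"
      proof (rule ccontr)
        assume "\<not> ?thesis"
        then have less: "real (card {x \<in> W. map x ps \<in> LL}) < \<alpha> * n ^ m" if "ps \<in> tup I Yn" for ps using that by force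
        have ct: "card (tup I Yn) = m ^ Yn" using I by (simp add: card_tup)
        have "Good \<subseteq> (\<Union>ps\<in>tup I Yn. {x \<in> W. map x ps \<in> LL})" using good by (auto simp: Good_def)
        then have "card Good \<le> card (\<Union>ps\<in>tup I Yn. {x \<in> W. map x ps \<in> LL})"
          by (rule card_mono[rotated]) (use finW I in \<open>auto simp: finite_tup\<close>)
        also have "\<dots> \<le> (\<Sum>ps\<in>tup I Yn. card {x \<in> W. map x ps \<in> LL})" by (rule card_UN_le) (simp add: I finite_tup)
        finally have "real (card Good) \<le> (\<Sum>ps\<in>tup I Yn. real (card {x \<in> W. map x ps \<in> LL}))" by (simp flip: of_nat_sum)
        also have "\<dots> < (\<Sum>ps\<in>tup I Yn. \<alpha> * n ^ m)"
        proof (rule sum_strict_mono)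
          show "tup I Yn \<noteq> {}" using ct mm by (metis card.empty not_one_le_zero power_eq_0_iff)
        qed (use less I in \<open>auto simp: finite_tup\<close>)
        also have "\<dots> = \<tau> / 4 * n ^ m" using mm by (simp add: ct \<alpha>_def)
        finally show False using cG by simp
      qed
      then obtain ps where ps: "ps \<in> tup I Yn" "\<alpha> * n ^ m \<le> real (card {x \<in> W. map x ps \<in> LL})" by blast
      have "\<alpha> * n ^ m > 0" using n \<tau> mm by (simp add: \<alpha>_def)
      then have "card {x \<in> W. map x ps \<in> LL} \<noteq> 0" using ps(2) by auto
      then have "{x \<in> W. map x ps \<in> LL} \<noteq> {}" by (metis card.empty)
      then obtain x0 where "map x0 ps \<in> LL" by blast
      \<comment> \<open>A repeated position would repeat a vertex in every tuple read off at
        \<open>ps\<close>, but tile tuples are distinct. Hence exactly \<open>m - Yn\<close>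
        positions remain free.\<close>
      then have dps: "distinct ps" by (auto simp: LL_def ytuples_def distinct_map)
      have pI: "set ps \<subseteq> I" "card (set ps) = Yn" using ps(1) dps distinct_card[OF dps] by (auto simp: tup_def)
      have finLL: "finite LL" using LLt V by (auto intro: finite_subset simp: finite_tup)
      have "card {x \<in> W. map x ps \<in> LL} \<le> card (LL \<times> ((I - set ps) \<rightarrow>\<^sub>E V))"
      proof (rule card_inj_on_le[where f = "\<lambda>x. (map x ps, restrict x (I - set ps))"])
        show "inj_on (\<lambda>x. (map x ps, restrict x (I - set ps))) {x \<in> W. map x ps \<in> LL}"
        proof (rule inj_onI)
          fix x z assume xz: "x \<in> {x \<in> W. map x ps \<in> LL}" "z \<in> {x \<in> W. map x ps \<in> LL}"
            and eq: "(map x ps, restrict x (I - set ps)) = (map z ps, restrict z (I - set ps))"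
          show "x = z"
          proof (rule PiE_ext[of x I "\<lambda>_. V"])
            fix i assume i: "i \<in> I"
            show "x i = z i"
            proof (cases "i \<in> set ps")
              case False
              then have "restrict x (I - set ps) i = restrict z (I - set ps) i" using eq by simp
              then show ?thesis using False i by simp
            qed (use eq in auto)
          qed (use xz in \<open>auto simp: W_def\<close>)
        qed
        show "(\<lambda>x. (map x ps, restrict x (I - set ps))) ` {x \<in> W. map x ps \<in> LL} \<subseteq> LL \<times> ((I - set ps) \<rightarrow>\<^sub>E V)"
        proof (rule image_subsetI)
          fix x assume "x \<in> {x \<in> W. map x ps \<in> LL}"
          then show "(map x ps, restrict x (I - set ps)) \<in> LL \<times> ((I - set ps) \<rightarrow>\<^sub>E V)"
            using WV by (simp add: Pi_iff)
        qed
      qed (use finLL I V in \<open>simp add: finite_PiE_const\<close>)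
      also have "\<dots> = card LL * card V ^ (m - Yn)"
        using I pI by (simp add: card_cartesian_product card_PiE_const card_Diff_subset)
      finally have "real (card {x \<in> W. map x ps \<in> LL}) \<le> real (card LL) * n ^ (m - Yn)"
        unfolding n_def by (metis of_nat_le_iff of_nat_mult of_nat_power)
      then have "\<alpha> * n ^ m \<le> real (card LL) * n ^ (m - Yn)" using ps(2) by linarith
      moreover have "n ^ m = n ^ Yn * n ^ (m - Yn)" using mm by (simp flip: power_add)
      ultimately have "(\<alpha> * n ^ Yn) * n ^ (m - Yn) \<le> real (card LL) * n ^ (m - Yn)" by (simp add: mult_ac)
      then have "\<alpha> * n ^ Yn \<le> real (card LL)" by (rule mult_right_le_imp_le) (use n in simp)
      then show "\<alpha> * real (card V) ^ (2 * k - 2 * l) \<le>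
          card {ts \<in> ytuples k l V E. sum_list (map y ts) \<le> real (2 * k - 2 * l) * a * (1 + \<tau>) / (1 - \<epsilon>)}"
        by (simp add: n_def Yn_def LL_def B_def)
    qed
  qed
qed

section \<open>Tiling with long paths\<close>

lemma min_degree_subfamily:
  fixes F :: "'x set" and f :: "'x \<Rightarrow> 'y" and g :: "'x \<Rightarrow> 'z" and c N :: real
  assumes F: "finite F" and c: "0 \<le> c" and N: "real (card (f ` F)) \<le> N" "real (card (g ` F)) \<le> N" "2 * c * N < card F"
  obtains G where "G \<subseteq> F" "G \<noteq> {}" "\<And>x. x \<in> G \<Longrightarrow> c \<le> card {z \<in> G. f z = f x}"
    "\<And>x. x \<in> G \<Longrightarrow> c \<le> card {z \<in> G. g z = g x}"
proof -
  \<comment> \<open>a maximiser of this functional has no sparse fibre: deleting one would increase the value\<close>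
  define val where "val A = real (card A) - c * (real (card (f ` A)) + real (card (g ` A)))" for A
  have "finite (val ` Pow F)" "val ` Pow F \<noteq> {}" using F by auto
  then have "Max (val ` Pow F) \<in> val ` Pow F" by (rule Max_in)
  then obtain G where G: "G \<subseteq> F" "val G = Max (val ` Pow F)" by auto
  have max: "val B \<le> val G" if "B \<subseteq> F" for B
    using that G F by (metis Max_ge Pow_iff finite_Pow_iff finite_imageI imageI)
  have finG: "finite G" using G F finite_subset by blast
  have "c * (real (card (f ` F)) + real (card (g ` F))) \<le> c * (N + N)"
    using N c by (intro mult_left_mono) auto
  then have "0 < val F" using N(3) by (simp add: val_def)
  then have "0 < val G" using max[of F] by simp
  then have ne: "G \<noteq> {}" by (auto simp: val_def)
  have im_g: "real (card (g ` B)) \<le> real (card (g ` G))" "real (card (f ` B)) \<le> real (card (f ` G))" if "B \<subseteq> G" for B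
    using that finG by (simp_all add: card_mono image_mono)
  have im1_f: "real (card (f ` B)) \<le> real (card (f ` G)) - 1" if "B \<subseteq> G" "x \<in> G" "f x \<notin> f ` B" for B x
  proof -
    have "f ` B \<subset> f ` G" using that by blast
    then have "card (f ` B) < card (f ` G)" using finG by (intro psubset_card_mono) auto
    then show ?thesis by linarith
  qed
  have im1_g: "real (card (g ` B)) \<le> real (card (g ` G)) - 1" if "B \<subseteq> G" "x \<in> G" "g x \<notin> g ` B" for B x
  proof -
    have "g ` B \<subset> g ` G" using that by blast
    then have "card (g ` B) < card (g ` G)" using finG by (intro psubset_card_mono) auto
    then show ?thesis by linarith
  qed
  show ?thesis
  proof (rule that[OF G(1) ne])
    fix x assume x: "x \<in> G"
    show "c \<le> card {z \<in> G. f z = f x}"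
    proof -
      let ?C = "{z \<in> G. f z = f x}"
      have "val (G - ?C) \<le> val G" by (rule max) (use G in auto)
      moreover have "real (card (G - ?C)) = real (card G) - card ?C"
        using finG card_mono[OF finG, of ?C] by (simp add: card_Diff_subset of_nat_diff)
      moreover have "c * (real (card (f ` (G - ?C))) + real (card (g ` (G - ?C)))) \<le> c * (real (card (f ` G)) - 1 + real (card (g ` G)))"
      proof (intro mult_left_mono add_mono)
        have "f x \<notin> f ` (G - ?C)" using x by auto
        then show "real (card (f ` (G - ?C))) \<le> real (card (f ` G)) - 1" using im1_f[OF _ x] by blast
        show "real (card (g ` (G - ?C))) \<le> real (card (g ` G))" by (rule im_g) auto
      qed (rule c)
      ultimately show ?thesis by (simp add: val_def algebra_simps)
    qed
    show "c \<le> card {z \<in> G. g z = g x}"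
    proof -
      let ?C = "{z \<in> G. g z = g x}"
      have "val (G - ?C) \<le> val G" by (rule max) (use G in auto)
      moreover have "real (card (G - ?C)) = real (card G) - card ?C"
        using finG card_mono[OF finG, of ?C] by (simp add: card_Diff_subset of_nat_diff)
      moreover have "c * (real (card (f ` (G - ?C))) + real (card (g ` (G - ?C)))) \<le> c * (real (card (f ` G)) + (real (card (g ` G)) - 1))"
      proof (intro mult_left_mono add_mono)
        have "g x \<notin> g ` (G - ?C)" using x by auto
        then show "real (card (g ` (G - ?C))) \<le> real (card (g ` G)) - 1" using im1_g[OF _ x] by blast
        show "real (card (f ` (G - ?C))) \<le> real (card (f ` G))" by (rule im_g) auto
      qed (rule c)
      ultimately show ?thesis by (simp add: val_def algebra_simps)
    qed
  qed
qed

lemma fresh_exists: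
  fixes \<theta> :: real
  assumes V: "finite V" "V \<noteq> {}" and A: "A \<subseteq> tup V j" "\<theta> * real (card V) ^ j \<le> card A" and \<theta>: "0 < \<theta>"
    and F: "finite F" and small: "real (j * card F + j * j) \<le> \<theta> / 2 * card V"
  obtains xs where "xs \<in> A" "fresh F xs"
proof -
  have "(\<theta> - \<theta> / 2) * real (card V) ^ j \<le> card {xs \<in> A. fresh F xs}"
    by (rule card_fresh_ge[OF V(1) A(1) F A(2) small V(2)])
  moreover have "0 < (\<theta> - \<theta> / 2) * real (card V) ^ j" using \<theta> V by (simp add: card_gt_0_iff)
  ultimately have "card {xs \<in> A. fresh F xs} \<noteq> 0" by linarith
  then have "{xs \<in> A. fresh F xs} \<noteq> {}" by (metis card.empty)
  then show ?thesis using that by blast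
qed

text \<open>Each round starts at a block L1. It takes some z in \<open>G\<close> beginning with L1,
  whose edge L A L' leads to a block L2, and then some z' in \<open>G\<close> with the same third
  block L2, whose other edge leads to the initial block of z'. The fibre conditions keep both
  choices available outside the walk built so far. A round costs one first half and one second half,
  at most c1 + c2, although these belong to different tiles. The current end block is charged in the
  next round and is therefore kept apart from \<open>xs\<close>.\<close>

lemma long_walk:
  fixes \<theta> c1 c2 :: real and y :: "'a \<Rightarrow> real"
  assumes V: "finite V" "V \<noteq> {}" and l: "1 \<le> l" "2 * l < k" and \<theta>: "0 < \<theta>"
    and G: "G \<subseteq> ytuples k l V E" "G \<noteq> {}"
    and deg1: "\<And>x. x \<in> G \<Longrightarrow> \<theta> * real (card V) ^ (2 * k - 3 * l) \<le> card {z \<in> G. take l z = take l x}"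
    and deg2: "\<And>x. x \<in> G \<Longrightarrow> \<theta> * real (card V) ^ (2 * k - 3 * l) \<le> card {z \<in> G. take l (drop (k - l) z) = take l (drop (k - l) x)}"
    and w: "\<And>x. x \<in> G \<Longrightarrow> sum_list (map y (take (k - l) x)) \<le> c1" "\<And>x. x \<in> G \<Longrightarrow> sum_list (map y (drop (k - l) x)) \<le> c2"
    and small: "real ((2 * k - 3 * l) * (2 * P * (k - l) + l) + (2 * k - 3 * l) * (2 * k - 3 * l)) \<le> \<theta> / 2 * card V"
  shows "p \<le> P \<Longrightarrow> \<exists>xs. \<exists>ts\<in>G. hwalk k l E (2 * p) (xs @ take l ts) \<and> distinct (xs @ take l ts) \<and>
    set (xs @ take l ts) \<subseteq> V \<and> sum_list (map y xs) \<le> p * (c1 + c2)"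
proof (induction p)
  case 0
  obtain ts where "ts \<in> G" using G by blast
  moreover from this have "length ts = 2 * k - 2 * l" "distinct ts" "set ts \<subseteq> V" using G by (auto simp: ytuples_def tup_def)
  ultimately show ?case using l
    by (intro exI[of _ "[]"] bexI[of _ ts]) (auto simp: hwalk_def dest: in_set_takeD)
next
  case (Suc p)
  let ?j = "2 * k - 3 * l"
  have GD: "length z = 2 * k - 2 * l" "distinct z" "set z \<subseteq> V" "set (take k z) \<in> E" "set (drop (k - l) z) \<union> set (take l z) \<in> E" if "z \<in> G" for z
    using that G by (auto simp: ytuples_def tup_def)
  have finG: "finite G" using finite_subset[OF G(1)] finite_subset[of "ytuples k l V E" "tup V (2 * k - 2 * l)"] finite_tup[OF V(1)]
    by (auto simp: ytuples_def)
  from Suc obtain xs ts where xs: "ts \<in> G" "hwalk k l E (2 * p) (xs @ take l ts)" "distinct (xs @ take l ts)"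
    "set (xs @ take l ts) \<subseteq> V" "sum_list (map y xs) \<le> p * (c1 + c2)" by auto
  have lx: "length (xs @ take l ts) = 2 * p * (k - l) + l" using xs(2) by (simp add: hwalk_def)
  have lL: "length (take l ts) = l" using GD(1)[OF xs(1)] l by simp
  have pP: "2 * p * (k - l) + l + (k - l) \<le> 2 * P * (k - l) + l"
  proof -
    have "(2 * p + 1) * (k - l) \<le> 2 * P * (k - l)" using Suc.prems by (intro mult_right_mono) auto
    then show ?thesis by (simp add: algebra_simps)
  qed
  have sm: "real (?j * c + ?j * ?j) \<le> \<theta> / 2 * card V" if "c \<le> 2 * P * (k - l) + l" for c
  proof -
    have "?j * c + ?j * ?j \<le> ?j * (2 * P * (k - l) + l) + ?j * ?j" using that by simp
    then have "real (?j * c + ?j * ?j) \<le> real (?j * (2 * P * (k - l) + l) + ?j * ?j)" by (simp only: of_nat_le_iff)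
    then show ?thesis using small by linarith
  qed
  define C1 where "C1 = {z \<in> G. take l z = take l ts}"
  have "card (drop l ` C1) = card C1"
  proof (rule card_image, rule inj_onI)
    fix a b assume "a \<in> C1" "b \<in> C1" "drop l a = drop l b"
    then show "a = b" by (metis (mono_tags, lifting) C1_def append_take_drop_id mem_Collect_eq)
  qed
  then have c1: "\<theta> * real (card V) ^ ?j \<le> card (drop l ` C1)" using deg1[OF xs(1)] by (simp add: C1_def)
  have "drop l ` C1 \<subseteq> tup V ?j"
  proof (rule image_subsetI)
    fix a assume a: "a \<in> C1"
    then have "a \<in> G" by (simp add: C1_def)
    from GD(1)[OF this] GD(3)[OF this] show "drop l a \<in> tup V ?j" using l by (auto simp: tup_def dest: in_set_dropD)
  qed
  then obtain v where v: "v \<in> drop l ` C1" "fresh (set (xs @ take l ts)) v"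
  proof (rule fresh_exists[OF V _ c1 \<theta>])
    have "card (set (xs @ take l ts)) \<le> 2 * p * (k - l) + l" using card_length[of "xs @ take l ts"] lx by linarith
    then show "real (?j * card (set (xs @ take l ts)) + ?j * ?j) \<le> \<theta> / 2 * card V" using pP by (intro sm) linarith
  qed auto
  then obtain z where z: "z \<in> G" "take l z = take l ts" "v = drop l z" by (auto simp: C1_def)
  define L1 where "L1 = take l z"
  define M where "M = take (k - 2 * l) (drop l z)"
  define L2 where "L2 = take l (drop (k - l) z)"
  have lz: "length z = 2 * k - 2 * l" by (rule GD(1)[OF z(1)])
  have len: "length L1 = l" "length M = k - 2 * l" "length L2 = l" using lz l by (auto simp: L1_def M_def L2_def)
  have kl: "k - l = l + (k - 2 * l)" "k = (k - l) + l" using l by auto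
  have tkl: "take (k - l) z = L1 @ M" unfolding L1_def M_def by (subst kl(1)) (rule take_add)
  have tk: "take k z = L1 @ M @ L2"
  proof -
    have "take k z = take (k - l) z @ L2" unfolding L2_def by (subst (1) kl(2)) (rule take_add)
    then show ?thesis by (simp add: tkl)
  qed
  have ML2: "set (M @ L2) \<subseteq> set v" "distinct (M @ L2)"
  proof -
    have "drop l (take k z) = M @ L2" using tk len by simp
    then have "M @ L2 = take (k - l) v" using z(3) by (simp add: drop_take)
    then show "set (M @ L2) \<subseteq> set v" "distinct (M @ L2)" using v(2) by (auto simp: fresh_def set_take_subset)
  qed
  have xs': "xs @ take l ts = xs @ L1" using z by (simp add: L1_def)
  have w1: "hwalk k l E (2 * p + Suc 0) (xs @ L1 @ (M @ L2))"
  proof (rule hwalk_append)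
    show "hwalk k l E (2 * p) (xs @ L1)" using xs(2) xs' by simp
    show "hwalk k l E (Suc 0) (L1 @ M @ L2)" using GD(4)[OF z(1)] tk len l by (subst hwalk_1) auto
  qed (use len l in auto)
  define xs1 where "xs1 = xs @ L1 @ M"
  have d1: "distinct (xs1 @ L2)" "set (xs1 @ L2) \<subseteq> V"
  proof -
    have "set v \<subseteq> V" using GD(3)[OF z(1)] z(3) set_drop_subset[of l z] by auto
    then show "distinct (xs1 @ L2)" "set (xs1 @ L2) \<subseteq> V"
      using xs(3,4) v(2) ML2 unfolding xs' by (auto simp: xs1_def fresh_def)
  qed
  have lx1: "length (xs1 @ L2) = 2 * p * (k - l) + l + (k - l)"
    using lx len l unfolding xs' by (simp add: xs1_def)
  define C2 where "C2 = {z' \<in> G. take l (drop (k - l) z') = L2}"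
  \<comment> \<open>The entries of a candidate outside the shared block, which have to be new; L2
    itself is already on the walk.\<close>
  let ?f = "\<lambda>z. take (k - l) z @ drop k z"
  have split: "z' = take (k - l) z' @ L2 @ drop k z'" "drop (k - l) z' = L2 @ drop k z'" if "z' \<in> C2" for z'
  proof -
    have "drop (k - l) z' = take l (drop (k - l) z') @ drop l (drop (k - l) z')" by (rule append_take_drop_id[symmetric])
    then show "drop (k - l) z' = L2 @ drop k z'" using that l by (simp add: C2_def)
    then show "z' = take (k - l) z' @ L2 @ drop k z'" by (metis append_take_drop_id)
  qed
  have "card (?f ` C2) = card C2"
  proof (rule card_image, rule inj_onI)
    fix a b assume ab: "a \<in> C2" "b \<in> C2" "?f a = ?f b"
    have "length (take (k - l) a) = length (take (k - l) b)" using ab GD(1) by (simp add: C2_def)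
    then have "take (k - l) a = take (k - l) b" "drop k a = drop k b" using ab(3) by auto
    then show "a = b" using split(1)[OF ab(1)] split(1)[OF ab(2)] by metis
  qed
  then have c2: "\<theta> * real (card V) ^ ?j \<le> card (?f ` C2)" using deg2[OF z(1)] by (simp add: C2_def L2_def)
  have "?f ` C2 \<subseteq> tup V ?j"
  proof (rule image_subsetI)
    fix a assume a: "a \<in> C2"
    then have "a \<in> G" by (simp add: C2_def)
    from GD(1)[OF this] GD(3)[OF this] show "?f a \<in> tup V ?j" using l by (auto simp: tup_def dest: in_set_takeD in_set_dropD)
  qed
  then obtain v' where v': "v' \<in> ?f ` C2" "fresh (set (xs1 @ L2)) v'"
  proof (rule fresh_exists[OF V _ c2 \<theta>])
    have "card (set (xs1 @ L2)) \<le> 2 * p * (k - l) + l + (k - l)" using card_length[of "xs1 @ L2"] lx1 by linarith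
    then show "real (?j * card (set (xs1 @ L2)) + ?j * ?j) \<le> \<theta> / 2 * card V" using pP by (intro sm) linarith
  qed auto
  then obtain z' where z': "z' \<in> C2" "v' = ?f z'" by auto
  have z'G: "z' \<in> G" using z' by (simp add: C2_def)
  have lz': "length z' = 2 * k - 2 * l" by (rule GD(1)[OF z'G])
  have ll: "length (drop k z') = k - 2 * l" "length (take l z') = l" using lz' l by auto
  have "l \<le> k - l" using l by simp
  then have tt: "take l z' = take l (take (k - l) z')" by (simp add: min_absorb1)
  have w2: "hwalk k l E (2 * p + Suc 0 + Suc 0) (xs1 @ L2 @ (drop k z' @ take l z'))"
  proof (rule hwalk_append)
    show "hwalk k l E (2 * p + Suc 0) (xs1 @ L2)" using w1 by (simp add: xs1_def)
    show "hwalk k l E (Suc 0) (L2 @ drop k z' @ take l z')"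
      using GD(5)[OF z'G] split(2)[OF z'(1)] ll len l by (subst hwalk_1) (auto simp: Un_assoc)
  qed (use len l in auto)
  have fr: "distinct (take (k - l) z' @ drop k z')" "set (take (k - l) z' @ drop k z') \<inter> set (xs1 @ L2) = {}"
    using v'(2) z'(2) by (auto simp: fresh_def)
  have d2: "distinct ((xs1 @ L2) @ (drop k z' @ take l z'))"
  proof -
    have "set (take l z') \<subseteq> set (take (k - l) z')" "distinct (take l z')"
      unfolding tt using fr(1) by (simp_all only: set_take_subset distinct_take distinct_append)
    then show ?thesis using d1(1) fr unfolding distinct_append set_append by blast
  qed
  have s2: "set (drop k z') \<union> set (take l z') \<subseteq> V" using GD(3)[OF z'G] by (auto dest: in_set_takeD in_set_dropD)
  have "sum_list (map y (xs1 @ L2 @ drop k z')) = sum_list (map y xs) + sum_list (map y (take (k - l) z)) + sum_list (map y (drop (k - l) z'))"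
    unfolding tkl split(2)[OF z'(1)] xs1_def by simp
  also have "\<dots> \<le> p * (c1 + c2) + c1 + c2" using xs(5) w(1)[OF z(1)] w(2)[OF z'G] by simp
  finally have s: "sum_list (map y (xs1 @ L2 @ drop k z')) \<le> real (Suc p) * (c1 + c2)" by (simp add: algebra_simps)
  show ?case
    by (intro exI[of _ "xs1 @ L2 @ drop k z'"] bexI[of _ z'])
       (use w2 d2 d1 s2 s z'G in auto)
qed

text \<open>Tiles of weight at most \<open>B\<close> may split their weight differently between
  their halves, so halves of different tiles cannot be combined freely. The tiles are sorted into
  \<open>K + 1\<close> classes by the weight of the first half, in steps of \<tau> * B; within one
  class the bounds for the two halves add up to B * (1 + \<tau>). The last summand \<open>B\<close>
  pays for the end block of the walk.\<close>

lemma light_path: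
  fixes \<alpha> \<tau> :: real
  assumes l: "1 \<le> l" "2 * l < k" and \<alpha>: "0 < \<alpha>" and \<tau>: "0 < \<tau>"
  obtains n0 where
    "\<And>(V :: 'a set) E (y :: 'a \<Rightarrow> real) (B :: real). finite V \<Longrightarrow> n0 \<le> card V \<Longrightarrow> 0 < B \<Longrightarrow> (\<And>v. v \<in> V \<Longrightarrow> 0 \<le> y v) \<Longrightarrow>
      \<alpha> * real (card V) ^ (2 * k - 2 * l) \<le> card {ts \<in> ytuples k l V E. sum_list (map y ts) \<le> B} \<Longrightarrow>
      \<exists>xs. hwalk k l E (2 * P) xs \<and> distinct xs \<and> set xs \<subseteq> V \<and> sum_list (map y xs) \<le> P * (B * (1 + \<tau>)) + B"
proof -
  define K where "K = nat \<lfloor>1 / \<tau>\<rfloor>"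
  \<comment> \<open>Some class has density at least \<alpha> / (K + 1) = 4 * \<theta>, and more than
    2 * \<theta> is required for cleaning it so that both overlap maps have large fibres.\<close>
  define \<theta> where "\<theta> = \<alpha> / (4 * (K + 1))"
  have \<theta>: "\<theta> > 0" using \<alpha> by (simp add: \<theta>_def)
  define j where "j = 2 * k - 3 * l"
  define q where "q = j * (2 * P * (k - l) + l) + j * j"
  show ?thesis
  proof (rule that[of "nat \<lceil>real q / (\<theta> / 2)\<rceil> + 1"])
    fix V :: "'a set" and E and y :: "'a \<Rightarrow> real" and B :: real
    assume V: "finite V" and nn: "nat \<lceil>real q / (\<theta> / 2)\<rceil> + 1 \<le> card V" and B: "0 < B" and y: "\<And>v. v \<in> V \<Longrightarrow> 0 \<le> y v"
      and big: "\<alpha> * real (card V) ^ (2 * k - 2 * l) \<le> card {ts \<in> ytuples k l V E. sum_list (map y ts) \<le> B}"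
    define n where "n = real (card V)"
    have Vne: "V \<noteq> {}" using nn by auto
    have n: "n > 0" using V Vne by (simp add: n_def card_gt_0_iff)
    have "real q / (\<theta> / 2) \<le> n" using nn unfolding n_def by linarith
    then have small: "real q \<le> \<theta> / 2 * n" using \<theta> by (simp add: divide_le_eq mult.commute)
    define F where "F = {ts \<in> ytuples k l V E. sum_list (map y ts) \<le> B}"
    have Ft: "F \<subseteq> tup V (2 * k - 2 * l)" by (auto simp: F_def ytuples_def)
    have finF: "finite F" using Ft V finite_tup finite_subset by blast
    define w where "w xs = sum_list (map y xs)" for xs
    have w0: "0 \<le> w xs" if "set xs \<subseteq> V" for xs
      using that y unfolding w_def by (intro sum_list_nonneg) (auto simp: subset_iff)
    define col where "col ts = nat \<lfloor>w (take (k - l) ts) / (\<tau> * B)\<rfloor>" for ts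
    have wsplit: "w ts = w (take (k - l) ts) + w (drop (k - l) ts)" for ts
      unfolding w_def by (metis append_take_drop_id map_append sum_list_append)
    have FD: "set ts \<subseteq> V" "w ts \<le> B" "0 \<le> w (take (k - l) ts)" "0 \<le> w (drop (k - l) ts)" if "ts \<in> F" for ts
    proof -
      show "set ts \<subseteq> V" "w ts \<le> B" using that by (auto simp: F_def ytuples_def tup_def w_def)
      then show "0 \<le> w (take (k - l) ts)" "0 \<le> w (drop (k - l) ts)"
        using w0 by (meson set_take_subset set_drop_subset order.trans)+
    qed
    have \<tau>B: "\<tau> * B > 0" using \<tau> B by simp
    have colK: "col ts \<in> {..K}" if "ts \<in> F" for ts
    proof -
      have "w (take (k - l) ts) / (\<tau> * B) \<le> B / (\<tau> * B)"
        using FD[OF that] wsplit[of ts] \<tau>B by (intro divide_right_mono) auto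
      also have "\<dots> = 1 / \<tau>" using B by simp
      finally show ?thesis by (auto simp: col_def K_def intro: nat_mono floor_mono)
    qed
    have "\<exists>c\<in>{..K}. \<alpha> / (K + 1) * n ^ (2 * k - 2 * l) \<le> card {ts \<in> F. col ts = c}"
    proof (rule ccontr)
      assume "\<not> ?thesis"
      then have less: "\<And>c. c \<in> {..K} \<Longrightarrow> real (card {ts \<in> F. col ts = c}) < \<alpha> / (K + 1) * n ^ (2 * k - 2 * l)" by force
      have "F \<subseteq> (\<Union>c\<in>{..K}. {ts \<in> F. col ts = c})" using colK by auto
      then have "card F \<le> card (\<Union>c\<in>{..K}. {ts \<in> F. col ts = c})" by (rule card_mono[rotated]) (use finF in auto)
      also have "\<dots> \<le> (\<Sum>c\<in>{..K}. card {ts \<in> F. col ts = c})" by (rule card_UN_le) simp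
      finally have "real (card F) \<le> (\<Sum>c\<in>{..K}. real (card {ts \<in> F. col ts = c}))" by (simp flip: of_nat_sum)
      also have "\<dots> < (\<Sum>c\<in>{..K}. \<alpha> / (K + 1) * n ^ (2 * k - 2 * l))" using less by (intro sum_strict_mono) auto
      also have "\<dots> = \<alpha> * n ^ (2 * k - 2 * l)" by simp
      finally show False using big by (simp add: F_def n_def)
    qed
    then obtain c where c: "\<alpha> / (K + 1) * n ^ (2 * k - 2 * l) \<le> card {ts \<in> F. col ts = c}" by blast
    define Fc where "Fc = {ts \<in> F. col ts = c}"
    have FcF: "Fc \<subseteq> F" by (auto simp: Fc_def)
    have finFc: "finite Fc" using finF by (simp add: Fc_def)
    have tupl: "take l ` Fc \<subseteq> tup V l" "(\<lambda>z. take l (drop (k - l) z)) ` Fc \<subseteq> tup V l"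
      using Ft FcF l by (auto simp: tup_def subset_iff dest!: in_set_takeD in_set_dropD)
    have cl: "real (card (take l ` Fc)) \<le> n ^ l" "real (card ((\<lambda>z. take l (drop (k - l) z)) ` Fc)) \<le> n ^ l"
      using card_mono[OF finite_tup[OF V] tupl(1)] card_mono[OF finite_tup[OF V] tupl(2)]
      by (simp_all add: card_tup V n_def flip: of_nat_power)
    have "n ^ (2 * k - 2 * l) = n ^ j * n ^ l" unfolding power_add[symmetric] using l by (intro arg_cong[where f = "(^) n"]) (simp add: j_def)
    moreover have "\<alpha> / (K + 1) = 4 * \<theta>" by (simp add: \<theta>_def field_simps)
    ultimately have e: "\<alpha> / (K + 1) * n ^ (2 * k - 2 * l) = 4 * (\<theta> * n ^ j * n ^ l)" by simp
    have "0 < \<theta> * n ^ j * n ^ l" using \<theta> n by simp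
    then have lt: "2 * (\<theta> * n ^ j) * n ^ l < card Fc" using c e unfolding Fc_def by linarith
    have "0 \<le> \<theta> * n ^ j" using \<theta> n by simp
    then obtain G where G: "G \<subseteq> Fc" "G \<noteq> {}" "\<And>x. x \<in> G \<Longrightarrow> \<theta> * n ^ j \<le> card {z \<in> G. take l z = take l x}"
       "\<And>x. x \<in> G \<Longrightarrow> \<theta> * n ^ j \<le> card {z \<in> G. take l (drop (k - l) z) = take l (drop (k - l) x)}"
      using min_degree_subfamily[OF finFc _ cl lt] by blast
    have GF: "x \<in> F" "col x = c" if "x \<in> G" for x using that G by (auto simp: Fc_def)
    have w1: "w (take (k - l) x) \<le> (c + 1) * (\<tau> * B)" "w (drop (k - l) x) \<le> B - c * (\<tau> * B)" if "x \<in> G" for x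
    proof -
      let ?a = "w (take (k - l) x) / (\<tau> * B)"
      have "0 \<le> ?a" using FD(3)[OF GF(1)[OF that]] \<tau>B by simp
      then have "real c \<le> ?a" "?a \<le> real c + 1" using GF(2)[OF that] unfolding col_def by linarith+
      then have "real c * (\<tau> * B) \<le> w (take (k - l) x)" "w (take (k - l) x) \<le> (real c + 1) * (\<tau> * B)"
        using \<tau>B by (simp_all only: pos_le_divide_eq pos_divide_le_eq)
      then show "w (take (k - l) x) \<le> (c + 1) * (\<tau> * B)" "w (drop (k - l) x) \<le> B - c * (\<tau> * B)"
        using wsplit[of x] FD(2)[OF GF(1)[OF that]] by (simp_all add: add.commute)
    qed
    have Gy: "G \<subseteq> ytuples k l V E" using G(1) FcF by (auto simp: F_def)
    have "\<exists>xs. \<exists>ts\<in>G. hwalk k l E (2 * P) (xs @ take l ts) \<and> distinct (xs @ take l ts) \<and>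
       set (xs @ take l ts) \<subseteq> V \<and> sum_list (map y xs) \<le> P * ((c + 1) * (\<tau> * B) + (B - c * (\<tau> * B)))"
      by (rule long_walk[OF V Vne l \<theta> Gy G(2)])
         (use G(3,4) w1 small in \<open>auto simp: n_def j_def q_def w_def\<close>)
    then obtain xs ts where xs: "ts \<in> G" "hwalk k l E (2 * P) (xs @ take l ts)" "distinct (xs @ take l ts)"
      "set (xs @ take l ts) \<subseteq> V" "w xs \<le> P * ((c + 1) * (\<tau> * B) + (B - c * (\<tau> * B)))" by (auto simp: w_def)
    have "w (take l ts) \<le> B"
    proof -
      have "w ts = w (take l ts) + w (drop l ts)" unfolding w_def by (metis append_take_drop_id map_append sum_list_append)
      moreover have "0 \<le> w (drop l ts)" using w0 FD(1)[OF GF(1)[OF xs(1)]] by (meson set_drop_subset order.trans)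
      ultimately show ?thesis using FD(2)[OF GF(1)[OF xs(1)]] by simp
    qed
    moreover have "(c + 1) * (\<tau> * B) + (B - c * (\<tau> * B)) = B * (1 + \<tau>)" by (simp add: algebra_simps)
    ultimately have "w (xs @ take l ts) \<le> P * (B * (1 + \<tau>)) + B" using xs(5) by (simp add: w_def)
    then show "\<exists>xs. hwalk k l E (2 * P) xs \<and> distinct xs \<and> set xs \<subseteq> V \<and> sum_list (map y xs) \<le> P * (B * (1 + \<tau>)) + B"
      using xs by (intro exI[of _ "xs @ take l ts"]) (auto simp: w_def)
  qed
qed

section \<open>The exponential potential of the degrees and the deletion of light paths\<close>

definition ordered_degree :: "nat \<Rightarrow> 'a set set \<Rightarrow> 'a set \<Rightarrow> 'a set \<Rightarrow> nat" where
  "ordered_degree r E U S = card {ys \<in> tup U r. S \<union> set ys \<in> E}"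

definition ordered_degree_at :: "nat \<Rightarrow> 'a set set \<Rightarrow> 'a set \<Rightarrow> 'a set \<Rightarrow> 'a \<Rightarrow> nat" where
  "ordered_degree_at r E U S v = card {ys \<in> tup U r. S \<union> set ys \<in> E \<and> v \<in> set ys}"

text \<open>A soft minimum of the normalised degrees: a d-set of density at most \<rho> alone
  contributes at least exp (- \<gamma> * \<rho>), so a smaller potential excludes such sets.\<close>

definition potential :: "real \<Rightarrow> nat \<Rightarrow> nat \<Rightarrow> 'a set set \<Rightarrow> 'a set \<Rightarrow> real" where
  "potential \<gamma> d r E U = (\<Sum>S\<in>{S. S \<subseteq> U \<and> card S = d}. exp (- \<gamma> * (ordered_degree r E U S / real (card U) ^ r)))"

lemma ordered_degree_at_sum_le:
  assumes "finite U"
  shows "(\<Sum>v\<in>U. ordered_degree_at r E U S v) \<le> r * ordered_degree r E U S" "1 \<le> r \<Longrightarrow> ordered_degree r E U S \<le> (\<Sum>v\<in>U. ordered_degree_at r E U S v)"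
proof -
  let ?A = "{ys \<in> tup U r. S \<union> set ys \<in> E}"
  have fA: "finite ?A" using assms by (simp add: finite_tup)
  have "(\<Sum>v\<in>U. ordered_degree_at r E U S v) = (\<Sum>v\<in>U. card {ys \<in> ?A. v \<in> set ys})"
    unfolding ordered_degree_at_def by (intro sum.cong refl arg_cong[where f = card]) auto
  also have "\<dots> = (\<Sum>ys\<in>?A. card {v \<in> U. v \<in> set ys})"
    by (rule sum_multicount_gen) (use assms fA in auto)
  finally have e: "(\<Sum>v\<in>U. ordered_degree_at r E U S v) = (\<Sum>ys\<in>?A. card {v \<in> U. v \<in> set ys})" .
  have s: "{v \<in> U. v \<in> set ys} = set ys" "length ys = r" if "ys \<in> ?A" for ys using that by (auto simp: tup_def)
  have "(\<Sum>ys\<in>?A. card {v \<in> U. v \<in> set ys}) \<le> (\<Sum>ys\<in>?A. r)"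
  proof (rule sum_mono)
    fix ys assume ys: "ys \<in> ?A"
    show "card {v \<in> U. v \<in> set ys} \<le> r" using s[OF ys] card_length[of ys] by simp
  qed
  then show "(\<Sum>v\<in>U. ordered_degree_at r E U S v) \<le> r * ordered_degree r E U S" unfolding e by (simp add: ordered_degree_def mult.commute)
  assume r: "1 \<le> r"
  have "(\<Sum>ys\<in>?A. 1) \<le> (\<Sum>ys\<in>?A. card {v \<in> U. v \<in> set ys})"
  proof (rule sum_mono)
    fix ys assume ys: "ys \<in> ?A"
    show "1 \<le> card {v \<in> U. v \<in> set ys}" using s[OF ys] r by (simp add: Suc_le_eq card_gt_0_iff) auto
  qed
  then show "ordered_degree r E U S \<le> (\<Sum>v\<in>U. ordered_degree_at r E U S v)" unfolding e by (simp add: ordered_degree_def)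
qed

text \<open>The weight \<open>y v\<close> is the first-order change of the potential caused by deleting \<open>v\<close>. Renormalising by \<open>card (U - P)\<close> compensates the loss exactly when \<open>P\<close> has average weight.\<close>

lemma potential_step:
  fixes \<gamma> \<tau> u q h :: real and E :: "'a set set" and U P :: "'a set" and d r :: nat and y :: "'a \<Rightarrow> real"
  assumes U: "finite U" and P: "P \<subseteq> U" "card P < card U" and r: "1 \<le> r" and \<gamma>: "1 \<le> \<gamma>" and \<tau>: "0 \<le> \<tau>"
  defines "u \<equiv> real (card U)" and "q \<equiv> real (card P)"
  defines "h \<equiv> q * (r * (r + 1)) / u"
  defines "y \<equiv> (\<lambda>v. \<Sum>S\<in>{S. S \<subseteq> U \<and> card S = d}. exp (- \<gamma> * (ordered_degree r E U S / u ^ r)) * (ordered_degree_at r E U S v / u ^ r))"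
  assumes h: "2 * \<gamma> * h \<le> 1" and light: "(\<Sum>v\<in>P. y v) \<le> (1 + \<tau>) * q * ((\<Sum>v\<in>U. y v) / u)"
  shows "potential \<gamma> d r E (U - P) \<le> potential \<gamma> d r E U * exp (\<gamma> * \<tau> * h + 5 * \<gamma>\<^sup>2 * h\<^sup>2)"
proof -
  have u: "u > 0" using P(2) by (simp add: u_def)
  have finP: "finite P" using P U finite_subset by blast
  \<comment> \<open>\<open>g\<close> is the first-order gain from dividing by (u - q)^r instead of
    u^r. The quantity \<open>h\<close> bounds \<open>g\<close> as well as \<open>x S\<close>, the
    bound on the proportion of tuples that are lost.\<close>
  define g where "g = q * r / u"
  have q0: "0 \<le> q" by (simp add: q_def)
  have g0: "0 \<le> g" using q0 u by (simp add: g_def)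
  have hg: "h = g * (r + 1)" by (simp add: h_def g_def algebra_simps)
  have gh: "g \<le> h" unfolding hg using g0 mult_left_mono[of 1 "real (r + 1)" g] by simp
  have h0: "0 \<le> h" using g0 gh by linarith
  have h1: "h \<le> 1"
  proof -
    have "2 * 1 * h \<le> 2 * \<gamma> * h" using \<gamma> h0 by (intro mult_right_mono) auto
    then show ?thesis using h by linarith
  qed
  define SS where "SS A = {S. S \<subseteq> A \<and> card S = d}" for A :: "'a set"
  have finS: "finite (SS U)" unfolding SS_def using U by (auto intro: finite_subset[of _ "Pow U"])
  define rho where "rho S = ordered_degree r E U S / u ^ r" for S
  define e where "e S = exp (- \<gamma> * rho S)" for S
  define x where "x S = (\<Sum>v\<in>P. ordered_degree_at r E U S v / u ^ r)" for S
  have rho01: "0 \<le> rho S" "rho S \<le> 1" for S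
  proof -
    have "ordered_degree r E U S \<le> card U ^ r"
      unfolding ordered_degree_def by (subst card_tup[OF U, symmetric]) (rule card_mono[OF finite_tup[OF U]], auto)
    then have "real (ordered_degree r E U S) \<le> u ^ r" by (simp add: u_def flip: of_nat_power)
    then show "0 \<le> rho S" "rho S \<le> 1" using u by (simp_all add: rho_def)
  qed
  have x0: "0 \<le> x S" for S using u by (simp add: x_def sum_nonneg)
  have xh: "x S \<le> h" for S
  proof -
    have "ordered_degree_at r E U S v / u ^ r \<le> r * (r + 1) / u" for v
    proof -
      have "ordered_degree_at r E U S v \<le> card {ys \<in> tup U r. \<not> fresh {v} ys}"
        unfolding ordered_degree_at_def by (rule card_mono) (use U in \<open>auto simp: finite_tup fresh_def\<close>)
      then have "card U * ordered_degree_at r E U S v \<le> card U * card {ys \<in> tup U r. \<not> fresh {v} ys}" by simp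
      also have "\<dots> \<le> (r * card {v} + r * r) * card U ^ r" by (rule card_not_fresh[OF U]) simp
      finally have "card U * ordered_degree_at r E U S v \<le> (r * (r + 1)) * card U ^ r" by (simp add: algebra_simps)
      then have "u * ordered_degree_at r E U S v \<le> (r * (r + 1)) * u ^ r" unfolding u_def by (metis of_nat_le_iff of_nat_mult of_nat_power)
      then show ?thesis using u by (simp add: field_simps)
    qed
    then have "x S \<le> (\<Sum>v\<in>P. r * (r + 1) / u)" unfolding x_def by (intro sum_mono)
    also have "\<dots> = h" by (simp add: h_def q_def)
    finally show ?thesis .
  qed
  have cUP: "real (card (U - P)) = u - q" using card_Diff_subset[OF finP P(1)] P by (simp add: u_def q_def of_nat_diff)
  have uq: "u - q > 0" using P(2) by (simp add: u_def q_def)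
  have new: "rho S - x S + g * rho S - h\<^sup>2 \<le> ordered_degree r E (U - P) S / (u - q) ^ r" for S
  proof -
    have "{ys \<in> tup U r. S \<union> set ys \<in> E} \<subseteq> {ys \<in> tup (U - P) r. S \<union> set ys \<in> E} \<union> (\<Union>v\<in>P. {ys \<in> tup U r. S \<union> set ys \<in> E \<and> v \<in> set ys})"
      by (auto simp: tup_def)
    then have "ordered_degree r E U S \<le> card ({ys \<in> tup (U - P) r. S \<union> set ys \<in> E} \<union> (\<Union>v\<in>P. {ys \<in> tup U r. S \<union> set ys \<in> E \<and> v \<in> set ys}))"
      unfolding ordered_degree_def by (rule card_mono[rotated]) (use U finP in \<open>auto simp: finite_tup\<close>)
    also have "\<dots> \<le> ordered_degree r E (U - P) S + (\<Sum>v\<in>P. ordered_degree_at r E U S v)"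
      unfolding ordered_degree_def ordered_degree_at_def by (intro order.trans[OF card_Un_le] add_left_mono card_UN_le finP)
    finally have "real (ordered_degree r E U S) \<le> ordered_degree r E (U - P) S + (\<Sum>v\<in>P. real (ordered_degree_at r E U S v))" by (simp flip: of_nat_sum of_nat_add)
    moreover have "rho S - x S = (ordered_degree r E U S - (\<Sum>v\<in>P. real (ordered_degree_at r E U S v))) / u ^ r"
      by (simp add: rho_def x_def sum_divide_distrib diff_divide_distrib)
    ultimately have D: "(rho S - x S) * u ^ r \<le> ordered_degree r E (U - P) S" using u by simp
    have "rho S - x S + g * rho S - h\<^sup>2 \<le> (rho S - x S) * (1 + g)"
    proof -
      have "g * x S \<le> h * h" using gh xh x0 g0 h0 by (intro mult_mono) auto
      then show ?thesis by (simp add: algebra_simps power2_eq_square)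
    qed
    also have "\<dots> \<le> ordered_degree r E (U - P) S / (u - q) ^ r"
    proof (cases "rho S - x S \<le> 0")
      case True
      then have "(rho S - x S) * (1 + g) \<le> 0" using g0 by (simp add: mult_nonpos_nonneg)
      also have "0 \<le> ordered_degree r E (U - P) S / (u - q) ^ r" using uq by simp
      finally show ?thesis .
    next
      case False
      have "(u - q) ^ r * (1 + g) \<le> u ^ r"
      proof -
        have "1 + g \<le> (1 + q / u) ^ r"
          using Bernoulli_inequality[of "q / u" r] q0 u by (simp add: g_def field_simps)
        then have "(u - q) ^ r * (1 + g) \<le> (u - q) ^ r * (1 + q / u) ^ r" using uq by (intro mult_left_mono) auto
        also have "\<dots> = ((u - q) * (1 + q / u)) ^ r" by (simp add: power_mult_distrib)
        also have "\<dots> \<le> u ^ r"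
        proof (rule power_mono)
          have "(u - q) * (1 + q / u) = u - q * q / u" using u by (simp add: field_simps)
          then show "(u - q) * (1 + q / u) \<le> u" using u q0 by simp
          show "0 \<le> (u - q) * (1 + q / u)" using uq q0 u by simp
        qed
        finally show ?thesis .
      qed
      then have "(rho S - x S) * ((u - q) ^ r * (1 + g)) \<le> (rho S - x S) * u ^ r" using False by (intro mult_left_mono) auto
      then have "(rho S - x S) * (1 + g) * (u - q) ^ r \<le> ordered_degree r E (U - P) S" using D by (simp add: mult_ac)
      then show ?thesis using uq by (simp add: pos_le_divide_eq)
    qed
    finally show ?thesis .
  qed
  \<comment> \<open>An upper bound for the change of the exponent of \<open>S\<close>; the summand
    h^2 covers the mixed term \<open>g * x S\<close>.\<close>
  define z where "z S = \<gamma> * (x S - g * rho S + h\<^sup>2)" for S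
  have zabs: "\<bar>z S\<bar> \<le> 2 * \<gamma> * h" for S
  proof -
    have "h\<^sup>2 \<le> h" using h0 h1 by (simp add: power2_eq_square mult_left_le)
    moreover have "0 \<le> g * rho S" "g * rho S \<le> h" using g0 gh rho01[of S] mult_left_le[of "rho S" g] by auto
    ultimately have "\<bar>x S - g * rho S + h\<^sup>2\<bar> \<le> 2 * h" using x0[of S] xh[of S] h0 by (simp add: abs_le_iff) (smt (verit) zero_le_power2)
    then have "\<gamma> * \<bar>x S - g * rho S + h\<^sup>2\<bar> \<le> \<gamma> * (2 * h)" using \<gamma> by (intro mult_left_mono) auto
    then show ?thesis using \<gamma> by (simp add: z_def abs_mult)
  qed
  have "potential \<gamma> d r E (U - P) = (\<Sum>S\<in>SS (U - P). exp (- \<gamma> * (ordered_degree r E (U - P) S / (u - q) ^ r)))"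
    by (simp add: potential_def SS_def cUP)
  also have "\<dots> \<le> (\<Sum>S\<in>SS (U - P). e S * exp (z S))"
  proof (rule sum_mono)
    fix S
    have "- \<gamma> * (ordered_degree r E (U - P) S / (u - q) ^ r) \<le> - \<gamma> * (rho S - x S + g * rho S - h\<^sup>2)"
      using mult_left_mono[OF new[of S], of \<gamma>] \<gamma> by (simp only: mult_minus_left neg_le_iff_le)
    also have "\<dots> = - \<gamma> * rho S + z S" by (simp add: z_def algebra_simps)
    finally show "exp (- \<gamma> * (ordered_degree r E (U - P) S / (u - q) ^ r)) \<le> e S * exp (z S)"
      by (simp add: e_def flip: exp_add)
  qed
  also have "\<dots> \<le> (\<Sum>S\<in>SS U. e S * exp (z S))"
    by (rule sum_mono2[OF finS]) (auto simp: SS_def e_def)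
  also have "\<dots> \<le> (\<Sum>S\<in>SS U. e S * (1 + z S + 4 * \<gamma>\<^sup>2 * h\<^sup>2))"
  proof (intro sum_mono mult_left_mono)
    fix S
    have "exp (z S) \<le> 1 + z S + (z S)\<^sup>2" using zabs[of S] h by (intro exp_le_quadratic) linarith
    also have "(z S)\<^sup>2 \<le> (2 * \<gamma> * h)\<^sup>2" using zabs[of S] \<gamma> h0 by (intro power2_le_iff_abs_le[THEN iffD2]) auto
    finally show "exp (z S) \<le> 1 + z S + 4 * \<gamma>\<^sup>2 * h\<^sup>2" by (simp add: power_mult_distrib)
  qed (simp add: e_def)
  also have "\<dots> = (1 + \<gamma> * h\<^sup>2 + 4 * \<gamma>\<^sup>2 * h\<^sup>2) * (\<Sum>S\<in>SS U. e S) + \<gamma> * ((\<Sum>S\<in>SS U. e S * x S) - g * (\<Sum>S\<in>SS U. e S * rho S))"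
    by (simp add: z_def algebra_simps sum.distrib sum_subtractf sum_distrib_left sum_distrib_right)
  also have "\<dots> \<le> (1 + \<gamma> * h\<^sup>2 + 4 * \<gamma>\<^sup>2 * h\<^sup>2) * (\<Sum>S\<in>SS U. e S) + \<gamma> * (\<tau> * h * (\<Sum>S\<in>SS U. e S))"
  proof -
    have "(\<Sum>S\<in>SS U. e S * x S) = (\<Sum>v\<in>P. y v)"
      unfolding x_def y_def sum_distrib_left by (subst sum.swap) (simp add: SS_def e_def rho_def)
    also have "\<dots> \<le> (1 + \<tau>) * q * ((\<Sum>v\<in>U. y v) / u)" by fact
    \<comment> \<open>A tuple has at most \<open>r\<close> distinct entries, so \<open>q\<close>
      times the average weight is at most \<open>g\<close> times the weighted sum of
      \<open>rho\<close>, which is what renormalising gains. Of the first-order terms only the share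
      \<tau> survives.\<close>
    also have "(\<Sum>v\<in>U. y v) \<le> r * (\<Sum>S\<in>SS U. e S * rho S)"
    proof -
      have "(\<Sum>v\<in>U. y v) = (\<Sum>S\<in>SS U. e S * ((\<Sum>v\<in>U. real (ordered_degree_at r E U S v)) / u ^ r))"
        unfolding y_def by (subst sum.swap) (simp add: SS_def e_def rho_def sum_distrib_left sum_divide_distrib)
      also have "\<dots> \<le> (\<Sum>S\<in>SS U. e S * (r * rho S))"
      proof (intro sum_mono mult_left_mono)
        fix S
        have "(\<Sum>v\<in>U. real (ordered_degree_at r E U S v)) \<le> r * ordered_degree r E U S"
          using ordered_degree_at_sum_le(1)[OF U, of r E S] by (simp flip: of_nat_sum of_nat_mult)
        then have "(\<Sum>v\<in>U. real (ordered_degree_at r E U S v)) / u ^ r \<le> r * ordered_degree r E U S / u ^ r" using u by (intro divide_right_mono) auto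
        then show "(\<Sum>v\<in>U. real (ordered_degree_at r E U S v)) / u ^ r \<le> r * rho S" by (simp add: rho_def)
      qed (simp add: e_def)
      finally show ?thesis by (simp add: sum_distrib_left mult_ac)
    qed
    then have "(1 + \<tau>) * q * ((\<Sum>v\<in>U. y v) / u) \<le> (1 + \<tau>) * q * (r * (\<Sum>S\<in>SS U. e S * rho S) / u)"
      using \<tau> q0 u by (intro mult_left_mono divide_right_mono) auto
    also have "\<dots> = (1 + \<tau>) * g * (\<Sum>S\<in>SS U. e S * rho S)" by (simp add: g_def)
    finally have 1: "(\<Sum>S\<in>SS U. e S * x S) - g * (\<Sum>S\<in>SS U. e S * rho S) \<le> \<tau> * g * (\<Sum>S\<in>SS U. e S * rho S)"
      by (simp add: algebra_simps)
    have "(\<Sum>S\<in>SS U. e S * rho S) \<le> (\<Sum>S\<in>SS U. e S * 1)"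
      by (intro sum_mono mult_left_mono rho01) (simp add: e_def)
    then have "\<tau> * g * (\<Sum>S\<in>SS U. e S * rho S) \<le> \<tau> * h * (\<Sum>S\<in>SS U. e S)"
      using \<tau> g0 gh rho01 by (intro mult_mono) (auto intro!: sum_nonneg simp: e_def)
    with 1 have "(\<Sum>S\<in>SS U. e S * x S) - g * (\<Sum>S\<in>SS U. e S * rho S) \<le> \<tau> * h * (\<Sum>S\<in>SS U. e S)" by linarith
    then show ?thesis using \<gamma> by (intro add_left_mono mult_left_mono) auto
  qed
  also have "\<dots> = (\<Sum>S\<in>SS U. e S) * (1 + (\<gamma> * \<tau> * h + (\<gamma> * h\<^sup>2 + 4 * \<gamma>\<^sup>2 * h\<^sup>2)))" by (simp add: algebra_simps)
  also have "\<dots> \<le> (\<Sum>S\<in>SS U. e S) * exp (\<gamma> * \<tau> * h + 5 * \<gamma>\<^sup>2 * h\<^sup>2)"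
  proof (rule mult_left_mono)
    have "\<gamma> * h\<^sup>2 \<le> \<gamma>\<^sup>2 * h\<^sup>2" using \<gamma> by (intro mult_right_mono) (auto simp: power2_eq_square)
    then have "1 + (\<gamma> * \<tau> * h + (\<gamma> * h\<^sup>2 + 4 * \<gamma>\<^sup>2 * h\<^sup>2)) \<le> 1 + (\<gamma> * \<tau> * h + 5 * \<gamma>\<^sup>2 * h\<^sup>2)" by simp
    also have "\<dots> \<le> exp (\<gamma> * \<tau> * h + 5 * \<gamma>\<^sup>2 * h\<^sup>2)" by (rule exp_ge_add_one_self)
    finally show "1 + (\<gamma> * \<tau> * h + (\<gamma> * h\<^sup>2 + 4 * \<gamma>\<^sup>2 * h\<^sup>2)) \<le> exp (\<gamma> * \<tau> * h + 5 * \<gamma>\<^sup>2 * h\<^sup>2)" .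
  qed (simp add: sum_nonneg e_def)
  also have "(\<Sum>S\<in>SS U. e S) = potential \<gamma> d r E U" by (simp add: potential_def SS_def e_def rho_def u_def)
  finally show ?thesis .
qed

lemma root_dominates_ln:
  fixes C \<gamma>0 :: real
  assumes "0 < \<gamma>0" "0 \<le> C"
  obtains n0 where "\<And>n. n0 \<le> n \<Longrightarrow> real d * ln (real n) + C \<le> \<gamma>0 * sqrt (real n)"
proof -
  define K where "K = max 1 ((4 * d + C) / \<gamma>0)"
  show ?thesis
  proof (rule that[of "nat \<lceil>K ^ 4\<rceil>"])
    fix n assume "nat \<lceil>K ^ 4\<rceil> \<le> n"
    then have nK: "K ^ 4 \<le> real n" by linarith
    have K: "1 \<le> K" "(4 * d + C) / \<gamma>0 \<le> K" by (auto simp: K_def)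
    define s where "s = sqrt (sqrt (real n))"
    have s2: "s\<^sup>2 = sqrt (real n)" by (simp add: s_def)
    have s4: "s ^ 4 = real n"
    proof -
      have "s ^ 4 = (s\<^sup>2)\<^sup>2" by (simp flip: power_mult)
      then show ?thesis by (simp add: s2)
    qed
    have s0: "0 \<le> s" by (simp add: s_def)
    have "K \<le> s" by (rule power_le_imp_le_base[of _ 3]) (use nK s4 s0 in simp_all)
    then have s: "1 \<le> s" "(4 * d + C) / \<gamma>0 \<le> s" using K by auto
    have "ln (real n) = 4 * ln s" using s by (simp add: s4[symmetric] ln_realpow)
    also have "\<dots> \<le> 4 * s" using s ln_bound[of s] by simp
    finally have "real d * ln (real n) + C \<le> real d * (4 * s) + C * s"
      using s assms mult_left_mono[of 1 s C] by (intro add_mono mult_left_mono) auto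
    also have "\<dots> = (4 * d + C) * s" by (simp add: algebra_simps)
    also have "\<dots> \<le> (\<gamma>0 * s) * s" using s assms by (intro mult_right_mono) (auto simp: divide_le_eq mult.commute)
    also have "\<dots> = \<gamma>0 * sqrt (real n)" by (simp add: s2[symmetric] power2_eq_square)
    finally show "real d * ln (real n) + C \<le> \<gamma>0 * sqrt (real n)" .
  qed
qed

lemma length_concat_const: "(\<And>p. p \<in> set ps \<Longrightarrow> length p = q) \<Longrightarrow> length (concat ps) = length ps * q"
  by (induction ps) auto

text \<open>While more than \<epsilon>0 * n vertices remain, deleting a light path multiplies the
  potential by at most exp A, and at most n / q disjoint paths fit into \<open>V\<close>. By
  \<open>total\<close> the potential never exceeds exp (- \<gamma> * \<rho>), so every d-set of the
  remainder keeps density \<rho> and the next light path exists. The surplus \<gamma>0 in the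
  degrees pays for the number of d-sets and for all these factors.\<close>

lemma path_tiling:
  fixes \<rho> \<sigma> \<gamma>0 \<epsilon>0 :: real
  assumes l: "1 \<le> l" "2 * l < k" and d: "d < k" and \<sigma>: "0 < \<sigma>" "\<sigma> \<le> \<rho>" "\<rho> \<le> 1"
    and til: "\<And>\<epsilon> m0. 0 < \<epsilon> \<Longrightarrow> \<exists>m\<ge>m0. tilable k d l (\<rho> - 2 * \<sigma>) \<epsilon> m"
    and pos: "0 < \<gamma>0" "0 < \<epsilon>0"
  obtains P n0 where "Pmin \<le> P"
    "\<And>(V :: nat set) E. finite V \<Longrightarrow> n0 \<le> card V \<Longrightarrow> (\<And>e. e \<in> E \<Longrightarrow> e \<subseteq> V \<and> card e = k) \<Longrightarrow>
      (\<And>S. S \<subseteq> V \<Longrightarrow> card S = d \<Longrightarrow> (\<rho> + \<gamma>0) * real (card V) ^ (k - d) \<le> ordered_degree (k - d) E V S) \<Longrightarrow>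
      \<exists>ps. (\<forall>p\<in>set ps. hwalk k l E (2 * P) p) \<and> distinct (concat ps) \<and> set (concat ps) \<subseteq> V \<and>
        real (card (V - set (concat ps))) \<le> \<epsilon>0 * card V"
proof -
  define r where "r = k - d"
  have r: "1 \<le> r" using d by (simp add: r_def)
  define R where "R = real (r * (r + 1))"
  have R: "1 \<le> R" using r 
  proof -
    have "1 * 1 \<le> r * (r + 1)" using r by (intro mult_le_mono) auto
    then have "real 1 \<le> real (r * (r + 1))" by (simp only: of_nat_le_iff)
    then show ?thesis by (simp add: R_def)
  qed
  \<comment> \<open>The linear drift \<gamma> * \<tau> * H, summed over n / q paths, is \<gamma> *
    \<tau> * R / \<epsilon>0; it may use up a quarter of \<gamma> * \<gamma>0.\<close>
  define \<tau> where "\<tau> = min 1 (\<epsilon>0 * \<gamma>0 / (4 * R))"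
  have \<tau>: "0 < \<tau>" "\<tau> \<le> 1" "\<tau> * R / \<epsilon>0 \<le> \<gamma>0 / 4"
  proof -
    show "0 < \<tau>" "\<tau> \<le> 1" using pos R by (auto simp: \<tau>_def)
    have "\<tau> \<le> \<epsilon>0 * \<gamma>0 / (4 * R)" by (simp add: \<tau>_def)
    then have "\<tau> * (4 * R) \<le> \<epsilon>0 * \<gamma>0" using R by (simp add: pos_le_divide_eq)
    then show "\<tau> * R / \<epsilon>0 \<le> \<gamma>0 / 4" using pos by (simp add: divide_le_eq mult_ac)
  qed
  \<comment> \<open>All losses go into \<tau>: sampling and the uncovered part of a tiling give (1 +
    x) / (1 - x), the uneven halves and the end block give 1 + 2 * x. For x \<le> 1 / 8 the product
    is at most 1 + 8 * x.\<close>
  define x where "x = \<tau> / 8"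
  have x: "0 < x" "x \<le> 1 / 8" "8 * x = \<tau>" using \<tau> by (auto simp: x_def)
  define P where "P = Pmin + nat \<lceil>1 / x\<rceil>"
  have P: "Pmin \<le> P" "1 \<le> P * x"
  proof -
    have "1 / x \<le> real P" unfolding P_def by linarith
    then show "1 \<le> P * x" using x by (simp add: divide_le_eq)
  qed (simp add: P_def)
  define q where "q = 2 * P * (k - l) + l"
  have q: "1 \<le> q" using l by (simp add: q_def)
  have xs: "0 < x" "x \<le> 1" "0 \<le> x" "x < 1" using x by auto
  show ?thesis
  proof (rule dense_light_ytuples[OF l d \<sigma> xs til[OF x(1)]])
    fix n1 and \<alpha> :: real
    assume \<alpha>: "\<alpha> > 0" and dense: "\<And>(V :: nat set) E (y :: nat \<Rightarrow> real) (a :: real). finite V \<Longrightarrow> n1 \<le> card V \<Longrightarrow> (\<And>e. e \<in> E \<Longrightarrow> e \<subseteq> V \<and> card e = k) \<Longrightarrow>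
      (\<And>S. S \<subseteq> V \<Longrightarrow> card S = d \<Longrightarrow> \<rho> * real (card V) ^ (k - d) \<le> card {ys \<in> tup V (k - d). S \<union> set ys \<in> E}) \<Longrightarrow>
      (\<And>v. v \<in> V \<Longrightarrow> 0 \<le> y v) \<Longrightarrow> (\<Sum>v\<in>V. y v) = a * card V \<Longrightarrow> 0 < a \<Longrightarrow>
      \<alpha> * real (card V) ^ (2 * k - 2 * l) \<le>
        card {ts \<in> ytuples k l V E. sum_list (map y ts) \<le> real (2 * k - 2 * l) * a * (1 + x) / (1 - x)}"
    show ?thesis
    proof (rule light_path[OF l \<alpha> x(1), where P = P and 'a = nat])
      fix n2
      assume light: "\<And>(V :: nat set) E (y :: nat \<Rightarrow> real) (B :: real). finite V \<Longrightarrow> n2 \<le> card V \<Longrightarrow> 0 < B \<Longrightarrow> (\<And>v. v \<in> V \<Longrightarrow> 0 \<le> y v) \<Longrightarrow>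
        \<alpha> * real (card V) ^ (2 * k - 2 * l) \<le> card {ts \<in> ytuples k l V E. sum_list (map y ts) \<le> B} \<Longrightarrow>
        \<exists>xs. hwalk k l E (2 * P) xs \<and> distinct xs \<and> set xs \<subseteq> V \<and> sum_list (map y xs) \<le> P * (B * (1 + x)) + B"
      have C0: "0 \<le> 5 * q * R\<^sup>2 / \<epsilon>0\<^sup>2" by simp
      obtain n3 where n3: "\<And>n. n3 \<le> n \<Longrightarrow> real d * ln (real n) + 5 * q * R\<^sup>2 / \<epsilon>0\<^sup>2 \<le> \<gamma>0 / 2 * sqrt (real n)"
        using root_dominates_ln[of "\<gamma>0 / 2" "5 * q * R\<^sup>2 / \<epsilon>0\<^sup>2" d] pos C0 by auto
      define n0 where "n0 = n3 + nat \<lceil>(real n1 + real n2 + real d + real q) / \<epsilon>0\<rceil> + nat \<lceil>(2 * q * R / \<epsilon>0)\<^sup>2\<rceil> + 1"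
      show ?thesis
      proof (rule that[of P n0])
        show "Pmin \<le> P" by (rule P)
        fix V :: "nat set" and E
        assume V: "finite V" and nn: "n0 \<le> card V" and E: "\<And>e. e \<in> E \<Longrightarrow> e \<subseteq> V \<and> card e = k"
          and deg: "\<And>S. S \<subseteq> V \<Longrightarrow> card S = d \<Longrightarrow> (\<rho> + \<gamma>0) * real (card V) ^ (k - d) \<le> ordered_degree (k - d) E V S"
        define n where "n = real (card V)"
        have "(real n1 + real n2 + real d + real q) / \<epsilon>0 \<le> n" "(2 * q * R / \<epsilon>0)\<^sup>2 \<le> n" "1 \<le> n" "n3 \<le> card V"
          using nn unfolding n0_def n_def by linarith+
        then have nb: "real n1 + real n2 + real d + real q \<le> \<epsilon>0 * n" "(2 * q * R / \<epsilon>0)\<^sup>2 \<le> n" "1 \<le> n" "n3 \<le> card V"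
          using pos by (auto simp: divide_le_eq mult.commute)
        define \<gamma> where "\<gamma> = sqrt n"
        have \<gamma>: "1 \<le> \<gamma>" "\<gamma>\<^sup>2 = n" using nb by (auto simp: \<gamma>_def)
        have \<gamma>q: "2 * q * R / \<epsilon>0 \<le> \<gamma>" using nb(2) by (simp add: \<gamma>_def real_le_rsqrt)
        \<comment> \<open>Bounds the quantity h of \<open>potential_step\<close> as long as more
          than \<epsilon>0 * n vertices are left.\<close>
        define H where "H = q * R / (\<epsilon>0 * n)"
        define A where "A = \<gamma> * \<tau> * H + 5 * \<gamma>\<^sup>2 * H\<^sup>2"
        have H0: "0 \<le> H" using pos R nb by (simp add: H_def)
        have A0: "0 \<le> A"
          unfolding A_def using \<gamma>(1) \<tau>(1) H0 by (intro add_nonneg_nonneg mult_nonneg_nonneg) auto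
        have total: "n / q * A + d * ln n \<le> \<gamma> * \<gamma>0"
        proof -
          have "n / q * A = \<gamma> * (\<tau> * R / \<epsilon>0) + 5 * q * R\<^sup>2 / \<epsilon>0\<^sup>2"
            using nb pos q unfolding A_def H_def \<gamma>(2) by (simp add: field_simps power2_eq_square)
          also have "\<gamma> * (\<tau> * R / \<epsilon>0) \<le> \<gamma> * (\<gamma>0 / 4)" using \<tau> \<gamma> by (intro mult_left_mono) auto
          finally have "n / q * A + d * ln n \<le> \<gamma> * (\<gamma>0 / 4) + (d * ln n + 5 * q * R\<^sup>2 / \<epsilon>0\<^sup>2)" by simp
          also have "d * ln n + 5 * q * R\<^sup>2 / \<epsilon>0\<^sup>2 \<le> \<gamma>0 / 2 * \<gamma>" using n3[OF nb(4)] by (simp add: n_def \<gamma>_def)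
          also have "\<gamma> * (\<gamma>0 / 4) + \<gamma>0 / 2 * \<gamma> \<le> \<gamma> * \<gamma>0" using \<gamma> pos by (simp add: field_simps)
          finally show ?thesis by simp
        qed
        define SS where "SS U = {S. S \<subseteq> U \<and> card S = d}" for U :: "nat set"
        have finS: "finite (SS U)" if "U \<subseteq> V" for U
          unfolding SS_def using finite_subset[OF that V] by (auto intro: finite_subset[of _ "Pow U"])
        have potV: "potential \<gamma> d r E V \<le> n ^ d * exp (- \<gamma> * (\<rho> + \<gamma>0))"
        proof -
          have "potential \<gamma> d r E V \<le> (\<Sum>S\<in>SS V. exp (- \<gamma> * (\<rho> + \<gamma>0)))"
            unfolding potential_def SS_def[symmetric]
          proof (rule sum_mono)
            fix S assume "S \<in> SS V"
            then have "(\<rho> + \<gamma>0) * n ^ r \<le> ordered_degree r E V S" using deg[of S] by (simp add: SS_def n_def r_def)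
            then have "\<rho> + \<gamma>0 \<le> ordered_degree r E V S / n ^ r" using nb by (simp add: pos_le_divide_eq)
            then have "\<gamma> * (\<rho> + \<gamma>0) \<le> \<gamma> * (ordered_degree r E V S / n ^ r)" using \<gamma> by (intro mult_left_mono) auto
            then show "exp (- \<gamma> * (ordered_degree r E V S / real (card V) ^ r)) \<le> exp (- \<gamma> * (\<rho> + \<gamma>0))" by (simp add: n_def)
          qed
          also have "\<dots> = real (card V choose d) * exp (- \<gamma> * (\<rho> + \<gamma>0))"
            using n_subsets[OF V, of d] by (simp add: SS_def)
          also have "\<dots> \<le> n ^ d * exp (- \<gamma> * (\<rho> + \<gamma>0))"
          proof (rule mult_right_mono)
            have "card V choose d \<le> card V ^ d"
            proof (cases "d \<le> card V")
              case False
              then show ?thesis by (simp add: binomial_eq_0)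
            qed (rule binomial_le_pow)
            then show "real (card V choose d) \<le> n ^ d" by (simp add: n_def flip: of_nat_power)
          qed simp
          finally show ?thesis .
        qed
        define good where "good ps \<longleftrightarrow> (\<forall>p\<in>set ps. hwalk k l E (2 * P) p) \<and> distinct (concat ps) \<and> set (concat ps) \<subseteq> V" for ps
        have goodq: "length (concat ps) = length ps * q" "length ps * q \<le> card V" "card (V - set (concat ps)) = card V - length ps * q"
          if "good ps" for ps
        proof -
          show e: "length (concat ps) = length ps * q"
            by (rule length_concat_const) (use that in \<open>auto simp: good_def hwalk_def q_def\<close>)
          have c: "card (set (concat ps)) = length ps * q" using that e distinct_card[of "concat ps"] by (simp add: good_def)
          have s: "set (concat ps) \<subseteq> V" using that by (simp add: good_def)
          show "length ps * q \<le> card V" using card_mono[OF V s] c by simp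
          show "card (V - set (concat ps)) = card V - length ps * q" using card_Diff_subset[OF _ s] c by simp
        qed
        have step: "\<exists>p. hwalk k l E (2 * P) p \<and> distinct p \<and> set p \<subseteq> U \<and> potential \<gamma> d r E (U - set p) \<le> potential \<gamma> d r E U * exp A"
          if U: "U \<subseteq> V" and big: "\<epsilon>0 * n < card U" and po: "potential \<gamma> d r E U \<le> n ^ d * exp (- \<gamma> * (\<rho> + \<gamma>0)) * exp (n / q * A)" for U
        proof -
          define u where "u = real (card U)"
          have finU: "finite U" using U V finite_subset by blast
          have ub: "real n1 + real n2 + real d + real q < u" using nb(1) big by (simp add: u_def)
          have u0: "u > 0" using ub by linarith
          define e where "e S = exp (- \<gamma> * (ordered_degree r E U S / u ^ r))" for S
          define y where "y v = (\<Sum>S\<in>SS U. e S * (ordered_degree_at r E U S v / u ^ r))" for v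
          \<comment> \<open>A single summand is at most the whole potential; comparing exponents
            recovers the degree of that one set.\<close>
          have degU: "\<rho> * u ^ r \<le> ordered_degree r E U S" if S: "S \<subseteq> U" "card S = d" for S
          proof -
            have "e S \<le> potential \<gamma> d r E U"
              unfolding potential_def e_def u_def by (rule member_le_sum) (use S finS[OF U] in \<open>auto simp: SS_def\<close>)
            also have "\<dots> \<le> n ^ d * exp (- \<gamma> * (\<rho> + \<gamma>0)) * exp (n / q * A)" by (rule po)
            also have "n ^ d = exp (d * ln n)" using nb by (simp add: exp_of_nat_mult)
            also have "exp (d * ln n) * exp (- \<gamma> * (\<rho> + \<gamma>0)) * exp (n / q * A) = exp (d * ln n + - \<gamma> * (\<rho> + \<gamma>0) + n / q * A)"
              by (simp only: exp_add)
            finally have "- \<gamma> * (ordered_degree r E U S / u ^ r) \<le> d * ln n + - \<gamma> * (\<rho> + \<gamma>0) + n / q * A" by (simp only: e_def exp_le_cancel_iff)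
            also have "\<dots> \<le> - \<gamma> * \<rho>" using total by (simp add: algebra_simps)
            finally have "\<gamma> * \<rho> \<le> \<gamma> * (ordered_degree r E U S / u ^ r)" by simp
            then have "\<rho> \<le> ordered_degree r E U S / u ^ r" using \<gamma> by (simp only: mult_le_cancel_left_pos)
            then show ?thesis using u0 by (simp add: pos_le_divide_eq)
          qed
          have y0: "0 \<le> y v" for v using u0 by (auto simp: y_def e_def intro!: sum_nonneg)
          define a where "a = (\<Sum>v\<in>U. y v) / u"
          have a: "0 < a"
          proof -
            have "d \<le> card U" using ub by (simp add: u_def)
            then obtain S where S: "S \<subseteq> U" "card S = d" using obtain_subset_with_card_n by metis
            have "0 < \<rho> * u ^ r" using \<sigma> u0 by simp
            then have "0 < real (ordered_degree r E U S)" using degU[OF S] by linarith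
            also have "real (ordered_degree r E U S) \<le> (\<Sum>v\<in>U. real (ordered_degree_at r E U S v))"
              using ordered_degree_at_sum_le(2)[OF finU r, of E S] by (simp flip: of_nat_sum)
            finally have "0 < e S * ((\<Sum>v\<in>U. real (ordered_degree_at r E U S v)) / u ^ r)" using u0 by (simp add: e_def)
            also have "\<dots> \<le> (\<Sum>S\<in>SS U. e S * ((\<Sum>v\<in>U. real (ordered_degree_at r E U S v)) / u ^ r))"
            proof (rule member_le_sum)
              fix S'
              have "0 \<le> e S'" by (simp add: e_def)
              then show "0 \<le> e S' * ((\<Sum>v\<in>U. real (ordered_degree_at r E U S' v)) / u ^ r)"
                using u0 by (intro mult_nonneg_nonneg divide_nonneg_nonneg sum_nonneg) auto
            qed (use S finS[OF U] in \<open>auto simp: SS_def\<close>)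
            also have "\<dots> = (\<Sum>v\<in>U. y v)"
              unfolding y_def by (subst sum.swap) (simp add: sum_distrib_left sum_divide_distrib)
            finally show ?thesis using u0 by (simp add: a_def)
          qed
          define EU where "EU = {e \<in> E. e \<subseteq> U}"
          define B where "B = real (2 * k - 2 * l) * a * (1 + x) / (1 - x)"
          have B: "0 < B" using a x l by (simp add: B_def)
          have n12: "n1 \<le> card U" "n2 \<le> card U" using ub by (auto simp: u_def)
          have "\<alpha> * real (card U) ^ (2 * k - 2 * l) \<le> card {ts \<in> ytuples k l U EU. sum_list (map y ts) \<le> B}"
            unfolding B_def
          proof (rule dense[OF finU n12(1)])
            show "e \<subseteq> U \<and> card e = k" if "e \<in> EU" for e using that E by (auto simp: EU_def)
            show "\<rho> * real (card U) ^ (k - d) \<le> card {ys \<in> tup U (k - d). S \<union> set ys \<in> EU}" if S: "S \<subseteq> U" "card S = d" for S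
            proof -
              have "{ys \<in> tup U (k - d). S \<union> set ys \<in> EU} = {ys \<in> tup U r. S \<union> set ys \<in> E}"
                using S by (auto simp: EU_def tup_def r_def)
              then show ?thesis using degU[OF S] by (simp add: ordered_degree_def u_def r_def)
            qed
            show "(\<Sum>v\<in>U. y v) = a * card U" using u0 by (simp add: a_def u_def)
          qed (use y0 a in auto)
          from light[OF finU n12(2) B y0 this] obtain p where p: "hwalk k l EU (2 * P) p" "distinct p" "set p \<subseteq> U"
            "sum_list (map y p) \<le> P * (B * (1 + x)) + B" by blast
          have pE: "hwalk k l E (2 * P) p" using p(1) by (auto simp: hwalk_def EU_def)
          have cp: "card (set p) = q" using p(1,2) by (simp add: distinct_card hwalk_def q_def)
          have wt: "P * (B * (1 + x)) + B \<le> (1 + \<tau>) * q * a"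
          proof -
            have "B * 1 \<le> B * (P * x)" using P B by (intro mult_left_mono) auto
            then have "P * (B * (1 + x)) + B \<le> P * B * (1 + 2 * x)" by (simp add: algebra_simps)
            also have "\<dots> = (P * real (2 * k - 2 * l)) * a * ((1 + x) * (1 + 2 * x) / (1 - x))" by (simp add: B_def)
            also have "\<dots> \<le> q * a * (1 + \<tau>)"
            proof (intro mult_mono)
              have "P * (2 * k - 2 * l) \<le> q" by (simp add: q_def algebra_simps diff_mult_distrib2)
              then show "P * real (2 * k - 2 * l) \<le> q" by (simp only: of_nat_le_iff flip: of_nat_mult)
              have "(1 + x) * (1 + 2 * x) \<le> (1 + 8 * x) * (1 - x)"
              proof -
                have "0 \<le> x * (4 - 10 * x)" using x by simp
                then show ?thesis by (simp add: algebra_simps)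
              qed
              then show "(1 + x) * (1 + 2 * x) / (1 - x) \<le> 1 + \<tau>" using x by (simp add: pos_divide_le_eq)
            qed (use a x in auto)
            finally show ?thesis by (simp add: mult_ac)
          qed
          have "potential \<gamma> d r E (U - set p) \<le> potential \<gamma> d r E U * exp (\<gamma> * \<tau> * (real (card (set p)) * real (r * (r + 1)) / card U) + 5 * \<gamma>\<^sup>2 * (real (card (set p)) * real (r * (r + 1)) / card U)\<^sup>2)"
          proof (rule potential_step[OF finU p(3) _ r \<gamma>(1)])
            show "card (set p) < card U" using cp ub by (simp add: u_def)
            have "real q * R / card U \<le> H"
              unfolding H_def using big nb pos R by (intro divide_left_mono) auto
            then have "2 * \<gamma> * (real q * R / card U) \<le> 2 * \<gamma> * H" using \<gamma> by (intro mult_left_mono) auto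
            also have "\<dots> = \<gamma> * (2 * q * R / \<epsilon>0) / \<gamma>\<^sup>2" unfolding \<gamma>(2) using pos by (simp add: H_def)
            also have "\<dots> \<le> \<gamma> * \<gamma> / \<gamma>\<^sup>2" using \<gamma>q \<gamma> by (intro divide_right_mono mult_left_mono) auto
            also have "\<dots> \<le> 1" using \<gamma> by (simp add: power2_eq_square)
            finally show "2 * \<gamma> * (real (card (set p)) * real (r * (r + 1)) / card U) \<le> 1" by (simp add: cp R_def)
            have "(\<Sum>v\<in>set p. y v) \<le> (1 + \<tau>) * q * a" using p(2,4) wt by (simp add: sum_list_distinct_conv_sum_set)
            then show "(\<Sum>v\<in>set p. \<Sum>S\<in>{S. S \<subseteq> U \<and> card S = d}. exp (- \<gamma> * (ordered_degree r E U S / real (card U) ^ r)) * (ordered_degree_at r E U S v / real (card U) ^ r))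
              \<le> (1 + \<tau>) * real (card (set p)) * ((\<Sum>v\<in>U. \<Sum>S\<in>{S. S \<subseteq> U \<and> card S = d}. exp (- \<gamma> * (ordered_degree r E U S / real (card U) ^ r)) * (ordered_degree_at r E U S v / real (card U) ^ r)) / real (card U))"
              by (simp add: cp a_def y_def e_def SS_def u_def)
          qed (use \<tau> in simp)
          also have "\<dots> \<le> potential \<gamma> d r E U * exp A"
          proof -
            have h: "real (card (set p)) * real (r * (r + 1)) / card U \<le> H" "0 \<le> real (card (set p)) * real (r * (r + 1)) / card U"
              unfolding H_def cp R_def[symmetric] using big nb pos R by (auto intro!: divide_left_mono)
            have "\<gamma> * \<tau> * (real (card (set p)) * real (r * (r + 1)) / card U) + 5 * \<gamma>\<^sup>2 * (real (card (set p)) * real (r * (r + 1)) / card U)\<^sup>2 \<le> A"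
              unfolding A_def using h \<gamma> \<tau> by (intro add_mono mult_left_mono power_mono) auto
            then show ?thesis by (intro mult_left_mono) (auto simp: potential_def intro!: sum_nonneg)
          qed
          finally show ?thesis using pE p(2,3) by blast
        qed
        \<comment> \<open>Either some family of paths already covers enough, or \<open>j\<close>
          paths can be deleted. The second alternative fails for j > \<open>card V\<close>, since a
          path is not empty.\<close>
        have main: "(\<exists>ps. good ps \<and> real (card (V - set (concat ps))) \<le> \<epsilon>0 * n) \<or>
          (\<exists>ps. good ps \<and> length ps = j \<and> potential \<gamma> d r E (V - set (concat ps)) \<le> potential \<gamma> d r E V * exp (j * A))" for j
        proof (induction j)
          case 0
          then show ?case by (intro disjI2 exI[of _ "[]"]) (simp add: good_def)
        next
          case (Suc j)
          show ?case
          proof (cases "\<exists>ps. good ps \<and> real (card (V - set (concat ps))) \<le> \<epsilon>0 * n")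
            case False
            then obtain ps where ps: "good ps" "length ps = j" "potential \<gamma> d r E (V - set (concat ps)) \<le> potential \<gamma> d r E V * exp (j * A)"
              using Suc by blast
            define U where "U = V - set (concat ps)"
            have big: "\<epsilon>0 * n < card U" using False ps(1) unfolding U_def by force
            have "j * q \<le> card V" using goodq(2)[OF ps(1)] ps(2) by simp
            then have "real j * real q \<le> n" by (simp add: n_def flip: of_nat_mult)
            then have "real j \<le> n / q" using q by (simp add: pos_le_divide_eq)
            then have "j * A \<le> n / q * A" using A0 by (rule mult_right_mono)
            then have "potential \<gamma> d r E V * exp (j * A) \<le> n ^ d * exp (- \<gamma> * (\<rho> + \<gamma>0)) * exp (n / q * A)"
              using potV nb by (intro mult_mono) (auto simp: potential_def)
            then obtain p where p: "hwalk k l E (2 * P) p" "distinct p" "set p \<subseteq> U" "potential \<gamma> d r E (U - set p) \<le> potential \<gamma> d r E U * exp A"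
              using step[of U] big ps(3) by (force simp: U_def)
            have "potential \<gamma> d r E (U - set p) \<le> potential \<gamma> d r E V * exp (j * A) * exp A"
              using p(4) ps(3) unfolding U_def[symmetric] by (meson exp_ge_zero mult_right_mono order.trans)
            also have "\<dots> = potential \<gamma> d r E V * exp (Suc j * A)" by (simp add: exp_add algebra_simps)
            finally have po: "potential \<gamma> d r E (U - set p) \<le> potential \<gamma> d r E V * exp (Suc j * A)" .
            have "V - set (concat (p # ps)) = U - set p" by (auto simp: U_def)
            moreover have "good (p # ps)" using ps(1) p by (auto simp: good_def U_def)
            ultimately show ?thesis using po ps(2) by (intro disjI2 exI[of _ "p # ps"]) simp
          qed blast
        qed
        have "\<not> (\<exists>ps. good ps \<and> length ps = Suc (card V))"
        proof
          assume "\<exists>ps. good ps \<and> length ps = Suc (card V)"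
          then have "Suc (card V) * q \<le> card V" using goodq(2) by force
          moreover have "Suc (card V) * 1 \<le> Suc (card V) * q" using q by (rule mult_le_mono2)
          ultimately show False by (metis Suc_n_not_le_n le_trans mult.right_neutral)
        qed
        with main[of "Suc (card V)"] show "\<exists>ps. (\<forall>p\<in>set ps. hwalk k l E (2 * P) p) \<and> distinct (concat ps) \<and> set (concat ps) \<subseteq> V \<and>
          real (card (V - set (concat ps))) \<le> \<epsilon>0 * card V"
          by (auto simp: good_def n_def)
      qed
    qed
  qed
qed

section \<open>Closing the cycle\<close>

text \<open>\<open>g\<close> records the state of every absorber, active for those in
  \<open>Ts'\<close> and idle for the others. Distinctness of \<open>Ts'\<close> prevents an
  absorber from being used twice.\<close>

lemma absorb_many:
  assumes "list_all2 (\<lambda>S T. T \<in> set Ts \<and> absorbs k l E off S T) Ss Ts'" "distinct Ts'"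
    and off: "\<And>T. T \<in> set Ts \<Longrightarrow> list_all (lpath k l E) (off T) \<and> mset (concat (off T)) = mset T"
  shows "\<exists>g. (\<forall>T\<in>set Ts. list_all2 (alike k l E) (off T) (g T)) \<and> (\<forall>T. T \<notin> set Ts' \<longrightarrow> g T = off T) \<and>
    (\<Sum>T\<in>set Ts. mset (concat (g T))) = (\<Sum>T\<in>set Ts. mset T) + mset (concat Ss)"
  using assms(1,2)
proof (induction rule: list_all2_induct)
  case Nil
  have "list_all2 (alike k l E) (off T) (off T)" if "T \<in> set Ts" for T
    using off[OF that] by (simp add: alike_def list_all2_same list_all_iff)
  then show ?case using off by (intro exI[of _ off]) simp
next
  case (Cons S Ss T Ts')
  then obtain g where g: "\<And>T. T \<in> set Ts \<Longrightarrow> list_all2 (alike k l E) (off T) (g T)" "\<And>T. T \<notin> set Ts' \<Longrightarrow> g T = off T"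
    "(\<Sum>T\<in>set Ts. mset (concat (g T))) = (\<Sum>T\<in>set Ts. mset T) + mset (concat Ss)" by auto
  have T: "T \<in> set Ts" "T \<notin> set Ts'" using Cons by auto
  obtain segs where segs: "list_all2 (alike k l E) (off T) segs" "mset (concat segs) = mset T + mset S"
    using Cons by (auto simp: absorbs_def)
  define g' where "g' = g(T := segs)"
  have "(\<Sum>T\<in>set Ts. mset (concat (g' T))) = mset T + mset S + (\<Sum>T\<in>set Ts - {T}. mset (concat (g' T)))"
    using T segs by (subst sum.remove[of _ T]) (auto simp: g'_def)
  also have "(\<Sum>T\<in>set Ts - {T}. mset (concat (g' T))) = (\<Sum>T\<in>set Ts - {T}. mset (concat (g T)))"
    by (rule sum.cong) (auto simp: g'_def)
  also have "mset T + mset S + \<dots> = mset S + (\<Sum>T\<in>set Ts. mset (concat (g T)))"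
    using T g(2)[OF T(2)] off[OF T(1)] by (subst (2) sum.remove[of _ T]) auto
  finally have "(\<Sum>T\<in>set Ts. mset (concat (g' T))) = (\<Sum>T\<in>set Ts. mset T) + mset (concat (S # Ss))"
    using g(3) by simp
  then show ?case using g segs by (intro exI[of _ g']) (auto simp: g'_def)
qed

lemma list_chunks:
  "length xs = q * w \<Longrightarrow> \<exists>Ss. concat Ss = xs \<and> length Ss = q \<and> (\<forall>S\<in>set Ss. length S = w)"
proof (induction q arbitrary: xs)
  case (Suc q)
  have "length (drop w xs) = q * w" using Suc.prems by simp
  from Suc.IH[OF this] obtain Ss where Ss: "concat Ss = drop w xs" "length Ss = q" "\<forall>S\<in>set Ss. length S = w" by blast
  then show ?case using Suc.prems by (intro exI[of _ "take w xs # Ss"]) auto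
qed simp

lemma sum_mset_concat: "distinct Ts \<Longrightarrow> mset (concat (concat (map g Ts))) = (\<Sum>T\<in>set Ts. mset (concat (g T)))"
  by (induction Ts) auto

text \<open>With all absorbers idle, the segments \<open>ss\<close> and connectors \<open>ys\<close>
  already form a closed walk, which misses a set U. This set is cut into (k - l)-sets, each is given
  an absorber of its own, and these absorbers are switched. The ends of the segments stay the same,
  so the connectors still fit and the closed walk now covers \<open>V\<close>.\<close>

lemma assemble_cycle:
  fixes V :: "'a set"
  assumes H: "k_graph k (V, E)" and l: "1 \<le> l" "2 * l < k" and n: "k - l dvd card V" "3 * (k - l) \<le> card V"
    and Ts: "distinct (concat Ts)" "[] \<notin> set Ts"
    and off: "\<And>T. T \<in> set Ts \<Longrightarrow> list_all (lpath k l E) (off T) \<and> mset (concat (off T)) = mset T"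
    and ps: "list_all (lpath k l E) ps" and ss: "ss = concat (map off Ts) @ ps" "ss \<noteq> []"
    and ys: "list_all2 (\<lambda>(A, B) y. \<exists>m\<ge>1. hwalk k l E m (A @ y @ B)) (needs l ss (take l (hd ss))) ys"
    and dist: "distinct (concat ss @ concat ys)" and sub: "set (concat ss @ concat ys) \<subseteq> V"
    and abs: "\<And>S. distinct S \<Longrightarrow> S \<in> tup (V - set (concat ss @ concat ys)) (k - l) \<Longrightarrow>
      card (V - set (concat ss @ concat ys)) \<le> length (filter (\<lambda>T. absorbs k l E off S T) Ts)"
  shows "has_hamilton_l_cycle k l (V, E)"
proof -
  define U where "U = V - set (concat ss @ concat ys)"
  define z where "z = take l (hd ss)"
  have V: "finite V" using H by (simp add: k_graph_def)
  have lp: "list_all (lpath k l E) ss" using ps off by (auto simp: ss list_all_iff)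
  have lenp: "l \<le> length s" if "lpath k l E s" for s using that by (auto simp: lpath_def hwalk_def)
  have lens: "length ss = length ys" using list_all2_lengthD[OF ys] by simp
  have lz: "length z = l" using lenp lp ss(2) by (cases ss) (auto simp: z_def)
  have linked: "linked k l E (zip ss ys) z" by (rule linked_needs[OF ys[folded z_def] lp])
  have dT: "distinct Ts" using Ts
  proof (induction Ts)
    case (Cons T Ts)
    have "T \<notin> set Ts"
    proof
      assume "T \<in> set Ts"
      then have "set T \<subseteq> set (concat Ts)" by auto
      then have "set T \<inter> set (concat Ts) = set T" by blast
      then show False using Cons.prems by simp
    qed
    then show ?case using Cons by simp
  qed simp
  have zipne: "zip us ys \<noteq> []" if "length us = length ys" for us :: "'a list list" using that lens ss(2) by (cases us; cases ys) auto
  have l_less: "l < k" using l by simp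
  \<comment> \<open>The idle closed walk yields divisibility: it covers a multiple of k - l
    vertices, so \<open>card U\<close> is a multiple of k - l as well.\<close>
  obtain m0 where m0: "hwalk k l E m0 (flatten (zip ss ys) @ z)"
    using linked_hwalk[OF l_less linked zipne[OF lens] lz] by blast
  have "length (flatten (zip ss ys)) = length (concat ss @ concat ys)"
    using mset_flatten_zip[OF lens] by (metis mset_append size_mset)
  then have len0: "length (concat ss @ concat ys) = m0 * (k - l)" using m0 lz by (simp add: hwalk_def)
  have cU: "card U = card V - m0 * (k - l)"
    using sub dist len0 by (simp add: U_def card_Diff_subset distinct_card del: set_append set_concat)
  then have "k - l dvd card U" using n by (auto intro!: dvd_diff_nat)
  then obtain q where q: "card U = q * (k - l)" by (metis dvd_def mult.commute)
  obtain xs where xs: "distinct xs" "set xs = U" using V finite_distinct_list[of U] by (auto simp: U_def)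
  have "length xs = q * (k - l)" using xs q distinct_card by metis
  then obtain Ss where Ss: "concat Ss = xs" "length Ss = q" "\<forall>S\<in>set Ss. length S = k - l" using list_chunks by blast
  have "\<exists>Ts'. list_all2 (\<lambda>B x. x \<in> B) (map (\<lambda>S. {T \<in> set Ts. absorbs k l E off S T}) Ss) Ts' \<and> distinct Ts'"
  proof (rule distinct_representatives)
    fix B assume "B \<in> set (map (\<lambda>S. {T \<in> set Ts. absorbs k l E off S T}) Ss)"
    then obtain S where S: "S \<in> set Ss" "B = {T \<in> set Ts. absorbs k l E off S T}" by auto
    have dS: "distinct S" using S(1) xs(1) Ss(1) by (auto simp: distinct_concat_iff)
    have tS: "S \<in> tup U (k - l)" using S(1) xs(2) Ss by (auto simp: tup_def)
    \<comment> \<open>There are \<open>q\<close> chunks, and every chunk has at least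
      \<open>card U\<close> \<ge> q absorbers, so a greedy assignment succeeds.\<close>
    have "q \<le> q * (k - l)" by (rule order_trans[OF _ mult_le_mono2[of 1]]) (use l in auto)
    also have "\<dots> = card U" by (simp add: q)
    also have "\<dots> \<le> length (filter (\<lambda>T. absorbs k l E off S T) Ts)" using abs[OF dS] tS by (simp add: U_def)
    also have "\<dots> = card B" using dT by (simp add: S(2) distinct_length_filter Int_def conj_commute)
    finally show "finite B \<and> length (map (\<lambda>S. {T \<in> set Ts. absorbs k l E off S T}) Ss) \<le> card B"
      using S(2) Ss(2) by simp
  qed
  then obtain Ts' where Ts': "list_all2 (\<lambda>S T. T \<in> set Ts \<and> absorbs k l E off S T) Ss Ts'" "distinct Ts'"
    by (auto simp: list_all2_map1)
  obtain g where g: "\<forall>T\<in>set Ts. list_all2 (alike k l E) (off T) (g T)"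
    "(\<Sum>T\<in>set Ts. mset (concat (g T))) = (\<Sum>T\<in>set Ts. mset T) + mset (concat Ss)"
    using absorb_many[OF Ts' off] by blast
  define ss' where "ss' = concat (map g Ts) @ ps"
  have al: "list_all2 (alike k l E) ss ss'"
    unfolding ss ss'_def
  proof (rule list_all2_appendI)
    have "list_all2 (alike k l E) (concat (map off Us)) (concat (map g Us))" if "set Us \<subseteq> set Ts" for Us
      using that by (induction Us) (use g in \<open>auto intro: list_all2_appendI\<close>)
    then show "list_all2 (alike k l E) (concat (map off Ts)) (concat (map g Ts))" by simp
    show "list_all2 (alike k l E) ps ps" using ps by (simp add: list_all2_same alike_def list_all_iff)
  qed
  have "(\<Sum>T\<in>set Ts. mset (concat (off T))) = (\<Sum>T\<in>set Ts. mset T)" using off by (intro sum.cong) auto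
  then have ms: "mset (concat ss') = mset (concat ss) + mset xs"
    using g(2) dT by (simp add: ss'_def ss sum_mset_concat Ss(1) del: mset_concat)
  have lens': "length ss' = length ys" using list_all2_lengthD[OF al] lens by simp
  have lp': "list_all (lpath k l E) ss'"
    using al by (auto simp: list_all2_conv_all_nth list_all_length alike_def)
  have linked': "linked k l E (zip ss' ys) z"
    by (rule linked_needs[OF ys[folded z_def, unfolded needs_alike[OF al]] lp'])
  obtain m where m: "hwalk k l E m (flatten (zip ss' ys) @ z)"
    using linked_hwalk[OF l_less linked' zipne[OF lens'] lz] by blast
  define vs where "vs = flatten (zip ss' ys)"
  have z: "z = take l vs"
  proof -
    obtain s r where s: "ss = s # r" using ss(2) by (cases ss) auto
    then obtain s' r' where s': "ss' = s' # r'" "alike k l E s s'" using al by (auto simp: list_all2_Cons1)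
    obtain y u where y: "ys = y # u" using lens s by (cases ys) auto
    have "l \<le> length s'" "take l s = take l s'" using s'(2) lenp by (auto simp: alike_def ends_def)
    then show ?thesis by (simp add: z_def vs_def s s' y flatten_def)
  qed
  have mv: "mset vs = mset (concat ss @ concat ys @ xs)"
    using mset_flatten_zip[OF lens'] ms by (simp add: vs_def del: mset_concat)
  have "distinct (concat ss @ concat ys @ xs)" using dist xs by (auto simp: U_def)
  then have dv: "distinct vs" using mv mset_eq_imp_distinct_iff by blast
  have "set vs = set (concat ss @ concat ys) \<union> set xs" using mset_eq_setD[OF mv] by auto
  also have "\<dots> = V" using xs(2) sub by (auto simp: U_def)
  finally have sv: "set vs = V" .
  have lv: "card V = m * (k - l)" using m lz dv sv distinct_card[OF dv] by (simp add: vs_def hwalk_def)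
  show ?thesis
  proof (rule hamilton_cycleI[OF H l dv sv])
    show "hwalk k l E m (vs @ take l vs)" using m z by (simp add: vs_def)
    show "3 \<le> m" using n(2) lv l by simp
  qed
qed

text \<open>At least half of the tuples of length d - i extend a given i-set to a d-set, whose
  ordered degree has density \<rho>; this is the origin of the factor 1 / 2.\<close>

lemma rich_of_ordered_degree:
  fixes \<rho> :: real
  assumes V: "finite V" "V \<noteq> {}" "4 * d * d \<le> card V" and E: "\<And>e. e \<in> E \<Longrightarrow> e \<subseteq> V \<and> card e = k"
    and d: "j \<le> d" "d < k" and \<rho>: "0 \<le> \<rho>"
    and deg: "\<And>S. S \<subseteq> V \<Longrightarrow> card S = d \<Longrightarrow> \<rho> * real (card V) ^ (k - d) \<le> ordered_degree (k - d) E V S"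
  shows "rich k j (\<rho> / 2) V E"
  unfolding rich_def
proof (intro conjI allI impI ballI)
  fix T assume T: "distinct T" "set T \<subseteq> V" "length T \<le> j"
  define i where "i = length T"
  define n where "n = real (card V)"
  have i: "i \<le> d" "k - i = (d - i) + (k - d)" using T(3) d by (auto simp: i_def)
  let ?P = "\<lambda>xs ys. set T \<union> (set xs \<union> set ys) \<in> E"
  let ?F = "{xs \<in> tup V (d - i). fresh (set T) xs}"
  have "(d - i) * i + (d - i) * (d - i) = (d - i) * d" using i(1) by (simp flip: add_mult_distrib2)
  also have "\<dots> \<le> d * d" by simp
  finally have "real ((d - i) * i + (d - i) * (d - i)) \<le> real (d * d)" by (simp only: of_nat_le_iff)
  moreover have "4 * real (d * d) \<le> n" using V(3) unfolding n_def by (metis (no_types, lifting) mult.assoc of_nat_le_iff of_nat_mult of_nat_numeral)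
  moreover have cT: "card (set T) = i" using T(1) by (simp add: i_def distinct_card)
  moreover have "0 \<le> real (d * d)" by (rule of_nat_0_le_iff)
  ultimately have small: "real ((d - i) * card (set T) + (d - i) * (d - i)) \<le> 1 / 2 * n" unfolding cT by linarith
  have F: "(1 - 1 / 2) * n ^ (d - i) \<le> card ?F"
    unfolding n_def
    by (rule card_fresh_ge[OF V(1) subset_refl]) (use V small card_tup[OF V(1)] in \<open>auto simp: n_def\<close>)
  have "\<rho> / 2 * n ^ (k - i) = ((1 - 1 / 2) * n ^ (d - i)) * (\<rho> * n ^ (k - d))" by (simp add: i(2) power_add)
  also have "\<dots> \<le> card ?F * (\<rho> * n ^ (k - d))" using F \<rho> by (intro mult_right_mono) (auto simp: n_def)
  also have "\<dots> = (\<Sum>xs\<in>?F. \<rho> * n ^ (k - d))" by simp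
  also have "\<dots> \<le> (\<Sum>xs\<in>?F. real (card {ys \<in> tup V (k - d). ?P xs ys}))"
  proof (rule sum_mono)
    fix xs assume xs: "xs \<in> ?F"
    then have "card (set T \<union> set xs) = i + (d - i)"
      using T(1) by (subst card_Un_disjoint) (auto simp: fresh_def i_def distinct_card tup_def)
    then have "\<rho> * n ^ (k - d) \<le> ordered_degree (k - d) E V (set T \<union> set xs)"
      unfolding n_def using deg[of "set T \<union> set xs"] xs T(2) i(1) by (auto simp: tup_def)
    then show "\<rho> * n ^ (k - d) \<le> real (card {ys \<in> tup V (k - d). ?P xs ys})" by (simp add: ordered_degree_def Un_assoc)
  qed
  also have "\<dots> \<le> (\<Sum>xs\<in>tup V (d - i). real (card {ys \<in> tup V (k - d). ?P xs ys}))"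
    by (rule sum_mono2) (auto simp: finite_tup V)
  also have "\<dots> = card {zs \<in> tup V ((d - i) + (k - d)). ?P (take (d - i) zs) (drop (d - i) zs)}"
    by (subst card_tup_append[OF V(1)]) simp
  also have "{zs \<in> tup V ((d - i) + (k - d)). ?P (take (d - i) zs) (drop (d - i) zs)} = {zs \<in> tup V (k - i). set T \<union> set zs \<in> E}"
    unfolding i(2) set_append[symmetric] append_take_drop_id ..
  finally show "\<rho> / 2 * real (card V) ^ (k - length T) \<le> card {ys \<in> tup V (k - length T). set T \<union> set ys \<in> E}"
    by (simp add: n_def i_def)
qed (use V E in auto)

text \<open>A single edge is already an l-path, so every exceptional vertex gets an edge of its own
  as a segment. \<open>F\<close> contains \<open>Q\<close>, hence the other vertices of these edges
  are not in \<open>Q\<close>.\<close>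

lemma cover_by_edges:
  assumes rich: "rich k j c V E" and j: "1 \<le> j" and c: "0 < c" and k: "1 \<le> l" "2 * l < k"
    and Q: "Q \<subseteq> V" "Q \<subseteq> F" and F: "finite F"
    and small: "real ((k - 1) * (card F + card Q * (k - 1)) + (k - 1) * (k - 1)) \<le> c / 2 * card V"
  obtains cs where "list_all (lpath k l E) cs" "distinct (concat cs)" "set (concat cs) \<subseteq> V"
    "Q \<subseteq> set (concat cs)" "set (concat cs) \<inter> F = Q" "length cs = card Q" "length (concat cs) = card Q * k"
proof -
  have V: "finite V" "V \<noteq> {}" using richD[OF rich] by auto
  obtain us where us: "set us = Q" "distinct us" using finite_distinct_list[of Q] finite_subset[OF Q(1) V(1)] by blast
  define N where "N u = {ys \<in> tup V (k - 1). {u} \<union> set ys \<in> E}" for u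
  have "length (map N us) \<le> card Q" using us distinct_card by fastforce
  moreover have "A \<subseteq> tup V (k - 1) \<and> c * real (card V) ^ (k - 1) \<le> card A" if A: "A \<in> set (map N us)" for A
  proof -
    obtain u where u: "u \<in> V" "A = N u" using A us Q(1) by auto
    then show ?thesis using richD(5)[OF rich, of "[u]"] j by (auto simp: N_def)
  qed
  ultimately obtain Ts where Ts: "list_all2 (\<lambda>A T. T \<in> A) (map N us) Ts" "distinct (concat Ts)" "set (concat Ts) \<inter> F = {}"
    using disjoint_representatives[OF V c F small, of "map N us"] by blast
  define cs where "cs = map2 (#) us Ts"
  have len: "length us = length Ts" using list_all2_lengthD[OF Ts(1)] by simp
  have el: "{us ! i} \<union> set (Ts ! i) \<in> E" "length (Ts ! i) = k - 1" "set (Ts ! i) \<subseteq> V" if "i < length us" for i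
    using list_all2_nthD2[OF Ts(1), of i] that len by (auto simp: N_def tup_def)
  have m: "mset (concat (map2 (#) xs ys)) = mset (xs @ concat ys)" if "length xs = length ys" for xs and ys :: "'a list list"
    using that by (induction xs ys rule: list_induct2) auto
  have dis: "distinct (us @ concat Ts)" using us Ts(2,3) Q(2) by auto
  then have dcs: "distinct (concat cs)" using m[OF len] mset_eq_imp_distinct_iff unfolding cs_def by blast
  have scs: "set (concat cs) = Q \<union> set (concat Ts)" using mset_eq_setD[OF m[OF len]] us(1) by (simp add: cs_def)
  have lcs: "length cs = card Q" using len us distinct_card[OF us(2)] by (simp add: cs_def)
  have lp: "list_all (lpath k l E) cs"
    unfolding list_all_length
  proof (intro allI impI)
    fix i assume i: "i < length cs"
    then have "cs ! i = us ! i # Ts ! i" using len by (simp add: cs_def)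
    moreover have "distinct (cs ! i)" using dcs i by (simp add: distinct_concat_iff)
    ultimately show "lpath k l E (cs ! i)"
      using el[of i] i k len hwalk_1[of l k E "cs ! i"] unfolding lpath_def by (auto simp: cs_def)
  qed
  show ?thesis
  proof (rule that[OF lp dcs])
    have "set T \<subseteq> V" if "T \<in> set Ts" for T using that el(3) len by (metis in_set_conv_nth)
    then have "set (concat Ts) \<subseteq> V" by auto
    then show "set (concat cs) \<subseteq> V" using scs Q(1) by auto
    have "length (concat cs) = length cs * k"
      by (rule length_concat_const) (use el(2) len k in \<open>auto simp: cs_def in_set_conv_nth\<close>)
    then show "length (concat cs) = card Q * k" by (simp add: lcs)
  qed (use scs Ts(3) Q(2) lcs in auto)
qed

lemma needs_tup:
  "(A, B) \<in> set (needs l ss z) \<Longrightarrow> (\<And>s. s \<in> set ss \<Longrightarrow> l \<le> length s \<and> distinct s \<and> set s \<subseteq> V) \<Longrightarrow> z \<in> tup V l \<Longrightarrow> distinct z \<Longrightarrow>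
   A \<in> tup V l \<and> B \<in> tup V l \<and> distinct A \<and> distinct B"
proof (induction ss)
  case (Cons s ss)
  show ?case
  proof (cases "(A, B) \<in> set (needs l ss z)")
    case True
    then show ?thesis using Cons by simp
  next
    case False
    then have AB: "A = drop (length s - l) s" "B = (case ss of [] \<Rightarrow> z | s' # _ \<Rightarrow> take l s')" using Cons.prems(1) by auto
    have s: "l \<le> length s" "distinct s" "set s \<subseteq> V" using Cons.prems(2)[of s] by auto
    have "B \<in> tup V l \<and> distinct B"
    proof (cases ss)
      case (Cons s' r)
      then have "l \<le> length s'" "distinct s'" "set s' \<subseteq> V" using Cons.prems(2)[of s'] by auto
      then show ?thesis using Cons by (auto simp: AB tup_def dest: in_set_takeD)
    qed (use Cons.prems AB in auto)
    moreover have "A \<in> tup V l \<and> distinct A" using s by (auto simp: AB tup_def dest: in_set_dropD)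
    ultimately show ?thesis by blast
  qed
qed simp

lemma power_le_exp:
  fixes a :: real
  assumes "0 < a"
  obtains n0 where "\<And>n. n0 \<le> n \<Longrightarrow> real n ^ j \<le> exp (a * n)"
proof -
  obtain n0 where n0: "\<And>n. n0 \<le> n \<Longrightarrow> real j * ln (real n) + 0 \<le> a * sqrt (real n)"
    using root_dominates_ln[OF assms order_refl, of j] by blast
  show ?thesis
  proof (rule that[of "max 1 n0"])
    fix n assume n: "max 1 n0 \<le> n"
    have "sqrt (real n) * 1 \<le> sqrt (real n) * sqrt (real n)" using n by (intro mult_left_mono) auto
    then have "sqrt (real n) \<le> real n" by simp
    then have "a * sqrt (real n) \<le> a * real n" using assms by (intro mult_left_mono) auto
    moreover have "j * ln (real n) \<le> a * sqrt (real n)" using n0[of n] n by simp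
    ultimately have "j * ln (real n) \<le> a * real n" by linarith
    then have "exp (j * ln (real n)) \<le> exp (a * real n)" by simp
    then show "real n ^ j \<le> exp (a * n)" using n by (simp add: exp_of_nat_mult)
  qed
qed

lemma length_le_concat: "[] \<notin> set ss \<Longrightarrow> length ss \<le> length (concat ss)"
proof (induction ss)
  case (Cons s ss)
  then show ?case by (cases s) auto
qed simp

lemma mset_concat_segments:
  "(\<And>T. T \<in> set Ts \<Longrightarrow> mset (concat (off T)) = mset T) \<Longrightarrow> mset (concat (concat (map off Ts))) = mset (concat Ts)"
proof (induction Ts)
  case (Cons T Ts)
  then have "mset (concat (off T)) = mset T" "mset (concat (concat (map off Ts))) = mset (concat Ts)" by auto
  then show ?case by (simp del: mset_concat)
qed simp

lemma conn_walk: "y \<in> conn k l V E m A B \<Longrightarrow> 1 \<le> m \<Longrightarrow> \<exists>m\<ge>1. hwalk k l E m (A @ y @ B)"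
  by (auto simp: conn_def)

text \<open>The idle segments of all absorbers and the edges through the exceptional vertices are
  linked into one chain. Its last segment \<open>s\<close> stays without a connector because its
  successor, a path of the covering, is not known yet. \<open>M\<close> bounds the lengths of edges
  and connectors and \<open>X\<close> the number of segments, which leads to the size 2 * M *
  X.\<close>

lemma absorbing_backbone:
  fixes c \<eta> :: real
  assumes rich: "rich k j c V E" and j: "1 \<le> j" and c: "0 < c" and l: "1 \<le> l" "2 * l < k" and m: "1 \<le> m" and \<eta>: "0 < \<eta>"
    and con: "\<And>A B. A \<in> tup V l \<Longrightarrow> B \<in> tup V l \<Longrightarrow> distinct A \<Longrightarrow> distinct B \<Longrightarrow>
      \<eta> * real (card V) ^ (m * (k - l) - l) \<le> card (conn k l V E m A B)"
    and Ts: "distinct (concat Ts)" "set (concat Ts) \<subseteq> V" "[] \<notin> set Ts" "Ts \<noteq> []"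
    and off: "\<And>T. T \<in> set Ts \<Longrightarrow> list_all (lpath k l E) (off T) \<and> mset (concat (off T)) = mset T"
    and Q: "Q \<subseteq> V" and X: "length (concat Ts) + card Q \<le> X" and M: "k \<le> M" "m * (k - l) - l \<le> M"
    and small: "real (2 * M * M * X + M * M) \<le> c / 2 * card V" "real (2 * M * M * X + M * M) \<le> \<eta> / 2 * card V"
  obtains cs us s ys where "concat (map off Ts) @ cs = us @ [s]" "list_all (lpath k l E) cs"
    "list_all2 (\<lambda>(A, B) y. \<exists>m\<ge>1. hwalk k l E m (A @ y @ B)) (needs l us (take l s)) ys"
    "distinct (concat (us @ [s]) @ concat ys)" "set (concat (us @ [s]) @ concat ys) \<subseteq> V"
    "Q \<subseteq> set (concat (us @ [s]))" "length (concat (us @ [s]) @ concat ys) \<le> 2 * M * X"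
proof -
  have V: "finite V" "V \<noteq> {}" using richD[OF rich] by auto
  have finQ: "finite Q" using finite_subset[OF Q V(1)] .
  define F where "F = Q \<union> set (concat Ts)"
  \<comment> \<open>Exceptional vertices that occur in an absorber are on the chain already.\<close>
  define Q' where "Q' = Q - set (concat Ts)"
  define x where "x = length (concat Ts) + card Q'"
  have Q': "Q' \<subseteq> V" "Q' \<subseteq> F" "finite F" "card Q' \<le> card Q" using Q finQ by (auto simp: Q'_def F_def intro: card_mono)
  have x: "x \<le> X" using X Q' by (simp add: x_def)
  have cF: "card F \<le> X"
  proof -
    have "card F \<le> card Q + card (set (concat Ts))" unfolding F_def by (rule card_Un_le)
    also have "card (set (concat Ts)) \<le> length (concat Ts)" by (rule card_length)
    finally show ?thesis using X by linarith
  qed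
  have M1: "1 \<le> M" using M l by simp
  have bnd: "real (a * (f + N * a) + a * a) \<le> e" if "a \<le> M" "f \<le> M * X" "N \<le> X" "real (2 * M * M * X + M * M) \<le> e" for a f N e
  proof -
    have "a * (f + N * a) + a * a \<le> M * (M * X + X * M) + M * M" using that by (intro add_mono mult_mono) auto
    also have "\<dots> = 2 * M * M * X + M * M" by (simp add: algebra_simps)
    finally have "real (a * (f + N * a) + a * a) \<le> real (2 * M * M * X + M * M)" by (simp only: of_nat_le_iff)
    then show ?thesis using that(4) by linarith
  qed
  have X1: "X \<le> M * X" using M1 by simp
  have small1: "real ((k - 1) * (card F + card Q' * (k - 1)) + (k - 1) * (k - 1)) \<le> c / 2 * card V"
    by (rule bnd) (use M order_trans[OF cF X1] Q'(4) X small(1) in auto)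
  obtain cs where cs: "list_all (lpath k l E) cs" "distinct (concat cs)" "set (concat cs) \<subseteq> V"
    "Q' \<subseteq> set (concat cs)" "set (concat cs) \<inter> F = Q'" "length cs = card Q'" "length (concat cs) = card Q' * k"
    by (rule cover_by_edges[OF rich j c l Q'(1-3) small1])
  define ss where "ss = concat (map off Ts) @ cs"
  have moff: "mset (concat (concat (map off Ts))) = mset (concat Ts)" by (rule mset_concat_segments) (use off in blast)
  have mss: "mset (concat ss) = mset (concat Ts @ concat cs)" using moff by (simp add: ss_def del: mset_concat)
  have sss: "set (concat ss) = set (concat Ts) \<union> set (concat cs)" using mset_eq_setD[OF mss] by simp
  have lp: "list_all (lpath k l E) ss" using off cs(1) by (auto simp: ss_def list_all_iff)
  have lps: "s \<noteq> [] \<and> l \<le> length s \<and> distinct s" if "s \<in> set ss" for s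
    using lp that l by (fastforce simp: list_all_iff lpath_def hwalk_def)
  have "set (concat Ts) \<inter> set (concat cs) = {}" using cs(5) by (auto simp: F_def Q'_def)
  then have "distinct (concat Ts @ concat cs)" using Ts(1) cs(2) by auto
  then have dss: "distinct (concat ss)" using mset_eq_imp_distinct_iff[OF mss] by blast
  have Vss: "set (concat ss) \<subseteq> V" using sss Ts(2) cs(3) by auto
  have len: "length (concat ss) = length (concat Ts) + card Q' * k"
    using mss cs(7) by (metis length_append size_mset)
  have "length (concat (map off Ts)) \<le> length (concat (concat (map off Ts)))"
    by (rule length_le_concat) (use lps in \<open>force simp: ss_def\<close>)
  also have "\<dots> = length (concat Ts)" using moff by (metis size_mset)
  finally have lss: "length ss \<le> x" by (simp add: ss_def x_def cs(6))
  have ne: "ss \<noteq> []"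
  proof -
    obtain T where "T \<in> set Ts" using Ts(4) by (cases Ts) auto
    then have "T \<noteq> []" "mset (concat (off T)) = mset T" "T \<in> set Ts" using Ts(3) off by auto
    then have "off T \<noteq> []" by force
    then show ?thesis using \<open>T \<in> set Ts\<close> by (auto simp: ss_def)
  qed
  then obtain us s where us: "ss = us @ [s]" by (metis append_butlast_last_id)
  define As where "As = map (\<lambda>(A, B). conn k l V E m A B) (needs l us (take l s))"
  define b where "b = m * (k - l) - l"
  have lus: "length us \<le> X" using lss x us by simp
  have "length (concat ss) \<le> x * k"
    using l mult_le_mono2[of 1 k "length (concat Ts)"] by (simp add: len x_def add_mult_distrib)
  also have "x * k \<le> X * M" by (rule mult_le_mono[OF x M(1)])
  finally have lcs: "length (concat ss) \<le> M * X" by (simp add: mult.commute)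
  have cs': "card (set (concat ss)) \<le> M * X" using card_length[of "concat ss"] lcs by linarith
  have small2: "real (b * (card (set (concat ss)) + X * b) + b * b) \<le> \<eta> / 2 * card V"
    by (rule bnd) (use M cs' small(2) in \<open>auto simp: b_def\<close>)
  have sV: "l \<le> length s' \<and> distinct s' \<and> set s' \<subseteq> V" if "s' \<in> set ss" for s'
    using lps[OF that] that Vss by auto
  have "A \<subseteq> tup V b \<and> \<eta> * real (card V) ^ b \<le> card A" if A: "A \<in> set As" for A
  proof -
    obtain A1 B1 where AB: "(A1, B1) \<in> set (needs l us (take l s))" "A = conn k l V E m A1 B1" using A by (auto simp: As_def)
    have "A1 \<in> tup V l \<and> B1 \<in> tup V l \<and> distinct A1 \<and> distinct B1"
      by (rule needs_tup[OF AB(1)]) (use sV us in \<open>auto simp: tup_def dest: in_set_takeD\<close>)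
    then show ?thesis using con[of A1 B1] by (simp add: AB(2) b_def conn_sub)
  qed
  then obtain ys where ys: "list_all2 (\<lambda>A T. T \<in> A) As ys" "distinct (concat ys)" "set (concat ys) \<inter> set (concat ss) = {}"
    using disjoint_representatives[OF V \<eta> _ small2, of As] lus by (auto simp: As_def)
  have lys: "length ys = length us" using list_all2_lengthD[OF ys(1)] by (simp add: As_def)
  have tys: "y \<in> tup V b" if y: "y \<in> set ys" for y
  proof -
    obtain i where i: "i < length ys" "y = ys ! i" using y by (auto simp: in_set_conv_nth)
    have "y \<in> As ! i" using list_all2_nthD2[OF ys(1) i(1)] i by simp
    moreover have "As ! i \<in> set As" using i lys by (simp add: As_def)
    ultimately show ?thesis using \<open>\<And>A. A \<in> set As \<Longrightarrow> A \<subseteq> tup V b \<and> \<eta> * real (card V) ^ b \<le> card A\<close> by blast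
  qed
  have "length (concat ys) = length ys * b" by (rule length_concat_const) (use tys in \<open>auto simp: tup_def\<close>)
  also have "\<dots> \<le> X * M" using lus lys M(2) by (intro mult_le_mono) (auto simp: b_def)
  finally have lcy: "length (concat ys) \<le> M * X" by (simp add: mult.commute)
  show ?thesis
  proof (rule that[of cs us s ys])
    show "concat (map off Ts) @ cs = us @ [s]" using us ss_def by simp
    show "list_all2 (\<lambda>(A, B) y. \<exists>m\<ge>1. hwalk k l E m (A @ y @ B)) (needs l us (take l s)) ys"
      using ys(1) unfolding As_def list_all2_map1 by (rule list_all2_mono) (use conn_walk m in fastforce)
    show "distinct (concat (us @ [s]) @ concat ys)" using dss ys us by auto
    show "set (concat (us @ [s]) @ concat ys) \<subseteq> V" 
    proof -
      have "set y \<subseteq> V" if "y \<in> set ys" for y using tys[OF that] by (simp add: tup_iff)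
      then show ?thesis using Vss unfolding us[symmetric] by auto
    qed
    show "Q \<subseteq> set (concat (us @ [s]))" unfolding us[symmetric] sss using cs(4) by (auto simp: Q'_def)
    show "length (concat (us @ [s]) @ concat ys) \<le> 2 * M * X" unfolding us[symmetric] using lcs lcy by simp
  qed (rule cs(1))
qed

lemma close_and_absorb:
  fixes V :: "'a set"
  assumes H: "k_graph k (V, E)" and l: "1 \<le> l" "2 * l < k" and n: "k - l dvd card V" "3 * (k - l) \<le> card V" and m: "1 \<le> m"
    and Ts: "distinct (concat Ts)" "[] \<notin> set Ts"
    and off: "\<And>T. T \<in> set Ts \<Longrightarrow> list_all (lpath k l E) (off T) \<and> mset (concat (off T)) = mset T"
    and cs: "concat (map off Ts) @ cs = us @ [s]" "list_all (lpath k l E) cs"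
    and ys: "list_all2 (\<lambda>(A, B) y. \<exists>m\<ge>1. hwalk k l E m (A @ y @ B)) (needs l us (take l s)) ys"
    and D: "D = set (concat (us @ [s]) @ concat ys)" "distinct (concat (us @ [s]) @ concat ys)" "D \<subseteq> V" "Q \<subseteq> D"
    and Rs: "distinct (concat Rs)" "set (concat Rs) \<inter> D = {}" "set (concat Rs) \<subseteq> V" "[] \<notin> set Rs"
    and con: "\<And>A B. A \<in> tup V l \<Longrightarrow> B \<in> tup V l \<Longrightarrow> distinct A \<Longrightarrow> distinct B \<Longrightarrow>
      Suc (length ps) \<le> length (filter (\<lambda>R. R \<in> conn k l V E m A B) Rs)"
    and ps: "list_all (lpath k l E) ps" "distinct (concat ps)" "set (concat ps) \<subseteq> V - D - set (concat Rs)"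
    and abs: "\<And>S. distinct S \<Longrightarrow> S \<in> tup (V - Q) (k - l) \<Longrightarrow>
      card (V - D - set (concat Rs) - set (concat ps)) + length (concat Rs) \<le> length (filter (\<lambda>T. absorbs k l E off S T) Ts)"
  shows "has_hamilton_l_cycle k l (V, E)"
proof -
  define ss where "ss = us @ s # ps"
  define z where "z = take l (hd ss)"
  have V: "finite V" using H by (simp add: k_graph_def)
  have ss: "ss = concat (map off Ts) @ (cs @ ps)" using cs(1) by (simp add: ss_def)
  have lp: "list_all (lpath k l E) ss" using ps cs(2) off by (auto simp: ss list_all_iff)
  have sV: "l \<le> length s' \<and> distinct s' \<and> set s' \<subseteq> V" if "s' \<in> set ss" for s'
  proof -
    have "lpath k l E s'" using lp that by (simp add: list_all_iff)
    then have "l \<le> length s' \<and> distinct s'" by (auto simp: lpath_def hwalk_def)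
    moreover have "set s' \<subseteq> V" using that D(1,3) ps(3) by (auto simp: ss_def)
    ultimately show ?thesis by blast
  qed
  have "hd ss \<in> set ss" by (rule hd_in_set) (simp add: ss_def)
  from sV[OF this] have z: "z \<in> tup V l" "distinct z" by (auto simp: z_def tup_def dest: in_set_takeD)
  have dR: "distinct Rs" using Rs(1,4) by (auto simp: distinct_concat_iff)
  define Bs where "Bs = map (\<lambda>(A, B). {R \<in> set Rs. R \<in> conn k l V E m A B}) (needs l (s # ps) z)"
  have "\<exists>ys2. list_all2 (\<lambda>B x. x \<in> B) Bs ys2 \<and> distinct ys2"
  proof (rule distinct_representatives)
    fix B assume "B \<in> set Bs"
    then obtain A1 B1 where AB: "(A1, B1) \<in> set (needs l (s # ps) z)" "B = {R \<in> set Rs. R \<in> conn k l V E m A1 B1}" by (auto simp: Bs_def)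
    have "A1 \<in> tup V l \<and> B1 \<in> tup V l \<and> distinct A1 \<and> distinct B1"
    proof (rule needs_tup[OF AB(1) _ z])
      show "l \<le> length s' \<and> distinct s' \<and> set s' \<subseteq> V" if "s' \<in> set (s # ps)" for s'
        by (rule sV) (use that in \<open>auto simp: ss_def\<close>)
    qed
    then have "Suc (length ps) \<le> card (set (filter (\<lambda>R. R \<in> conn k l V E m A1 B1) Rs))"
      using con[of A1 B1] dR by (simp add: distinct_card distinct_filter del: set_filter)
    then show "finite B \<and> length Bs \<le> card B" by (simp add: AB(2) Bs_def)
  qed
  then obtain ys2 where ys2: "list_all2 (\<lambda>B x. x \<in> B) Bs ys2" "distinct ys2" by blast
  have sub2: "set ys2 \<subseteq> set Rs"
  proof
    fix y assume "y \<in> set ys2"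
    then obtain i where i: "i < length ys2" "y = ys2 ! i" by (auto simp: in_set_conv_nth)
    have "y \<in> Bs ! i" "i < length Bs" using list_all2_nthD2[OF ys2(1) i(1)] list_all2_lengthD[OF ys2(1)] i by auto
    moreover have "B \<subseteq> set Rs" if "B \<in> set Bs" for B using that unfolding Bs_def by auto
    ultimately show "y \<in> set Rs" using nth_mem by blast
  qed
  then have subR: "set (concat ys2) \<subseteq> set (concat Rs)" by auto
  have d2: "distinct (concat ys2)"
    unfolding distinct_concat_iff
  proof (intro conjI allI ballI impI)
    show "distinct (removeAll [] ys2)" using ys2(2) by (simp add: distinct_removeAll)
    show "distinct y" if "y \<in> set ys2" for y using that sub2 Rs(1) by (auto simp: distinct_concat_iff)
    show "set y \<inter> set y' = {}" if "y \<in> set ys2 \<and> y' \<in> set ys2 \<and> y \<noteq> y'" for y y'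
    proof -
      have "y \<in> set Rs" "y' \<in> set Rs" "y \<noteq> y'" using that sub2 by auto
      then show ?thesis using Rs(1) unfolding distinct_concat_iff by blast
    qed
  qed
  have all: "set (concat ss @ concat (ys @ ys2)) = D \<union> set (concat ps) \<union> set (concat ys2)"
    unfolding D(1) ss_def by auto
  have QW: "V - set (concat ss @ concat (ys @ ys2)) \<subseteq> V - Q" unfolding all using D(4) by blast
  have W: "card (V - set (concat ss @ concat (ys @ ys2))) \<le> card (V - D - set (concat Rs) - set (concat ps)) + length (concat Rs)"
  proof -
    have "V - set (concat ss @ concat (ys @ ys2)) \<subseteq> (V - D - set (concat Rs) - set (concat ps)) \<union> set (concat Rs)"
      unfolding all by blast
    then have "card (V - set (concat ss @ concat (ys @ ys2))) \<le> card ((V - D - set (concat Rs) - set (concat ps)) \<union> set (concat Rs))"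
      by (rule card_mono[rotated]) (use V in simp)
    also have "\<dots> \<le> card (V - D - set (concat Rs) - set (concat ps)) + card (set (concat Rs))" by (rule card_Un_le)
    finally show ?thesis using card_length[of "concat Rs"] by linarith
  qed
  show ?thesis
  proof (rule assemble_cycle[OF H l n Ts off _ ss, where ys = "ys @ ys2"])
    show "list_all (lpath k l E) (cs @ ps)" using cs(2) ps(1) by simp
    show "ss \<noteq> []" by (simp add: ss_def)
    show "list_all2 (\<lambda>(A, B) y. \<exists>m\<ge>1. hwalk k l E m (A @ y @ B)) (needs l ss (take l (hd ss))) (ys @ ys2)"
      unfolding z_def[symmetric] unfolding ss_def needs_append
    proof (rule list_all2_appendI[OF ys])
      show "list_all2 (\<lambda>(A, B) y. \<exists>m\<ge>1. hwalk k l E m (A @ y @ B)) (needs l (s # ps) z) ys2"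
        using ys2(1) unfolding Bs_def list_all2_map1 by (rule list_all2_mono) (use conn_walk m in fastforce)
    qed
    define X where "X = concat (us @ [s]) @ concat ys"
    have "set (concat ps) \<inter> D = {}" "set (concat ps) \<inter> set (concat ys2) = {}" "set (concat ys2) \<inter> D = {}"
      using ps(3) subR Rs(2) by blast+
    then have "distinct (X @ concat ps @ concat ys2)"
      using D(2) ps(2) d2 unfolding X_def[symmetric] D(1)[folded X_def] distinct_append set_append by blast
    moreover have "mset (concat ss @ concat (ys @ ys2)) = mset (X @ concat ps @ concat ys2)"
      by (simp add: ss_def X_def del: mset_concat)
    ultimately show "distinct (concat ss @ concat (ys @ ys2))" using mset_eq_imp_distinct_iff by blast
    show "set (concat ss @ concat (ys @ ys2)) \<subseteq> V" unfolding all using D(3) ps(3) subR Rs(3) by blast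
    show "card (V - set (concat ss @ concat (ys @ ys2))) \<le> length (filter (\<lambda>T. absorbs k l E off S T) Ts)"
      if S: "distinct S" "S \<in> tup (V - set (concat ss @ concat (ys @ ys2))) (k - l)" for S
    proof -
      have "S \<in> tup (V - Q) (k - l)" using S(2) QW unfolding tup_iff by blast
      from abs[OF S(1) this] W show ?thesis by linarith
    qed
  qed
qed

lemma floor_half: "2 \<le> x \<Longrightarrow> x / 2 \<le> real (nat \<lfloor>x\<rfloor>) \<and> real (nat \<lfloor>x\<rfloor>) \<le> x" for x :: real
  by linarith

text \<open>Hierarchy of constants: every distinct (k - l)-tuple outside \<open>Q\<close> gets
  \<kappa>a * n absorbers. The reservoir has at most \<beta>c * n connectors and so at most half of
  \<kappa>a * n vertices; the path covering leaves at most the other half. Every pair of l-tuples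
  gets \<kappa>c * n connectors in the reservoir, and the paths are made so long that at most half
  as many are needed. Of the degree surplus 2 * \<gamma>0, one half is spent on deleting chain and
  reservoir, the other half is the surplus required by \<open>path_tiling\<close>.\<close>

lemma hamilton_ordered:
  fixes \<rho> \<sigma> \<gamma>0 :: real
  assumes l: "1 \<le> l" "2 * l < k" and d: "k - l \<le> d" "d < k" and \<sigma>: "0 < \<sigma>" "\<sigma> \<le> \<rho>" "\<rho> \<le> 1"
    and til: "\<And>\<epsilon> m0. 0 < \<epsilon> \<Longrightarrow> \<exists>m\<ge>m0. tilable k d l (\<rho> - 2 * \<sigma>) \<epsilon> m" and \<gamma>0: "0 < \<gamma>0"
  obtains n0 where "\<And>(V :: nat set) E. finite V \<Longrightarrow> n0 \<le> card V \<Longrightarrow> k - l dvd card V \<Longrightarrow> (\<And>e. e \<in> E \<Longrightarrow> e \<subseteq> V \<and> card e = k) \<Longrightarrow>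
      (\<And>S. S \<subseteq> V \<Longrightarrow> card S = d \<Longrightarrow> (\<rho> + 2 * \<gamma>0) * real (card V) ^ (k - d) \<le> ordered_degree (k - d) E V S) \<Longrightarrow>
      has_hamilton_l_cycle k l (V, E)"
proof -
  define r where "r = k - d"
  define w where "w = k - l"
  define c where "c = \<rho> / 2"
  have c: "0 < c" "c \<le> 1" using \<sigma> by (auto simp: c_def)
  obtain m nc \<eta> where m: "1 \<le> m" and \<eta>: "(\<eta>::real) > 0" and con:
    "\<And>(V::nat set) E A B. rich k w c V E \<Longrightarrow> nc \<le> card V \<Longrightarrow> A \<in> tup V l \<Longrightarrow> B \<in> tup V l \<Longrightarrow>
      distinct A \<Longrightarrow> distinct B \<Longrightarrow> \<eta> * real (card V) ^ (m * w - l) \<le> card (conn k l V E m A B)"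
    unfolding w_def using connecting[OF l c, where 'a = nat] by metis
  define b0 where "b0 = m * w - l"
  have b0: "1 \<le> b0"
  proof -
    have "1 * w \<le> m * w" using m by (rule mult_le_mono1)
    then show ?thesis using l unfolding b0_def w_def by linarith
  qed
  define M where "M = k + b0"
  define \<mu> where "\<mu> = min (min c \<eta>) \<gamma>0"
  \<comment> \<open>Chosen so that 3 * M * M * X \<le> \<mu> * n / 4, given X \<le> 3 * \<nu> *
    n.\<close>
  define \<nu> where "\<nu> = \<mu> / (36 * real (M * M))"
  have M: "1 \<le> M" "k \<le> M" "b0 \<le> M" "r \<le> M" using l by (auto simp: M_def r_def)
  have MM: "1 \<le> M * M" using M(1) by simp
  have \<mu>: "0 < \<mu>" "\<mu> \<le> 1" "\<mu> \<le> c" "\<mu> \<le> \<eta>" "\<mu> \<le> \<gamma>0" using c \<eta> \<gamma>0 by (auto simp: \<mu>_def)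
  have \<nu>: "0 < \<nu>" "36 * real (M * M) * \<nu> = \<mu>" using \<mu> M(1) by (auto simp: \<nu>_def)
  have \<nu>1: "\<nu> \<le> 1 / 36"
  proof -
    have "36 * 1 * \<nu> \<le> 36 * real (M * M) * \<nu>" using \<nu>(1) MM by (intro mult_right_mono mult_left_mono) (auto simp del: of_nat_mult)
    then show ?thesis using \<nu>(2) \<mu>(2) by linarith
  qed
  show ?thesis
  proof (rule absorbers[OF l c \<nu>(1), where 'a = nat])
    fix b na and \<eta>a :: real and off
    assume \<eta>a: "\<eta>a > 0" and b: "1 \<le> b" and abs:
      "\<And>(V::nat set) E. rich k (k - l) c V E \<Longrightarrow> na \<le> card V \<Longrightarrow>
        \<exists>Q\<subseteq>V. real (card Q) \<le> \<nu> * card V \<and>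
          (\<forall>S\<in>tup (V - Q) (k - l). distinct S \<longrightarrow> \<eta>a * real (card V) ^ b \<le> card {T \<in> tup V b. absorbs k l E off S T})"
    \<comment> \<open>The first bound limits the vertices in absorbers to \<nu> * n; the second is
      half of the smallness condition for the disjoint selection.\<close>
    define \<beta>a where "\<beta>a = min (\<nu> / b) (\<eta>a / (4 * real (b * b)))"
    define \<kappa>a where "\<kappa>a = \<eta>a * \<beta>a / 16"
    define \<beta>c where "\<beta>c = min \<nu> (\<kappa>a / (2 * M))"
    define \<kappa>c where "\<kappa>c = \<eta> * \<beta>c / 16"
    have \<beta>a: "0 < \<beta>a" "\<beta>a * b \<le> \<nu>" "\<beta>a * real (b * b) \<le> \<eta>a / 4"
    proof -
      show "0 < \<beta>a" using \<nu> \<eta>a b by (simp add: \<beta>a_def)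
      have "\<beta>a \<le> \<nu> / b" by (simp add: \<beta>a_def)
      then show "\<beta>a * b \<le> \<nu>" using b by (simp add: pos_le_divide_eq)
      have "\<beta>a \<le> \<eta>a / 4 / real (b * b)" by (simp add: \<beta>a_def)
      then show "\<beta>a * real (b * b) \<le> \<eta>a / 4" using b by (subst (asm) pos_le_divide_eq) auto
    qed
    have \<kappa>a: "0 < \<kappa>a" using \<eta>a \<beta>a by (simp add: \<kappa>a_def algebra_simps)
    have \<beta>c: "0 < \<beta>c" "\<beta>c \<le> \<nu>" "\<beta>c * M \<le> \<kappa>a / 2"
    proof -
      show "0 < \<beta>c" "\<beta>c \<le> \<nu>" using \<nu> \<kappa>a M by (auto simp: \<beta>c_def)
      have "\<beta>c \<le> \<kappa>a / 2 / M" by (simp add: \<beta>c_def)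
      then show "\<beta>c * M \<le> \<kappa>a / 2" using M(1) by (subst (asm) pos_le_divide_eq) auto
    qed
    have \<kappa>c: "0 < \<kappa>c" using \<eta> \<beta>c by (simp add: \<kappa>c_def algebra_simps)
    have \<epsilon>0: "0 < \<kappa>a / 2" using \<kappa>a by simp
    show ?thesis
    proof (rule path_tiling[OF l d(2) \<sigma> til \<gamma>0 \<epsilon>0, where Pmin = "nat \<lceil>1 / \<kappa>c\<rceil> + 1"])
      fix P np
      assume P: "nat \<lceil>1 / \<kappa>c\<rceil> + 1 \<le> P" and tiling:
        "\<And>(V :: nat set) E. finite V \<Longrightarrow> np \<le> card V \<Longrightarrow> (\<And>e. e \<in> E \<Longrightarrow> e \<subseteq> V \<and> card e = k) \<Longrightarrow>
          (\<And>S. S \<subseteq> V \<Longrightarrow> card S = d \<Longrightarrow> (\<rho> + \<gamma>0) * real (card V) ^ (k - d) \<le> ordered_degree (k - d) E V S) \<Longrightarrow>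
          \<exists>ps. (\<forall>p\<in>set ps. hwalk k l E (2 * P) p) \<and> distinct (concat ps) \<and> set (concat ps) \<subseteq> V \<and>
            real (card (V - set (concat ps))) \<le> \<kappa>a / 2 * card V"
      have P1: "1 \<le> P" "1 \<le> real P * \<kappa>c"
      proof -
        show "1 \<le> P" using P by simp
        have "1 / \<kappa>c \<le> P" using P by linarith
        then show "1 \<le> real P * \<kappa>c" using \<kappa>c by (simp add: divide_le_eq)
      qed
      obtain n1 where n1: "\<And>n. n1 \<le> n \<Longrightarrow> real n ^ w \<le> exp (\<kappa>a * n)" using power_le_exp[OF \<kappa>a] by blast
      obtain n2 where n2: "\<And>n. n2 \<le> n \<Longrightarrow> real n ^ (2 * l) \<le> exp (\<kappa>c * n)" using power_le_exp[OF \<kappa>c] by blast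
      define n0 where "n0 = nc + na + n1 + n2 + 2 * np + 4 * d * d + 3 * w + nat \<lceil>4 * real (M * M) / \<mu>\<rceil> + nat \<lceil>4 * real (b * b) / \<eta>a\<rceil> +
        nat \<lceil>2 / \<beta>a\<rceil> + nat \<lceil>2 / \<beta>c\<rceil> + nat \<lceil>2 / \<kappa>c\<rceil> + 1"
      show ?thesis
      proof (rule that[of n0])
        fix V :: "nat set" and E
        assume V: "finite V" and nn: "n0 \<le> card V" and dvd: "k - l dvd card V" and E: "\<And>e. e \<in> E \<Longrightarrow> e \<subseteq> V \<and> card e = k"
          and deg: "\<And>S. S \<subseteq> V \<Longrightarrow> card S = d \<Longrightarrow> (\<rho> + 2 * \<gamma>0) * real (card V) ^ (k - d) \<le> ordered_degree (k - d) E V S"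
        define n where "n = real (card V)"
        have "4 * real (M * M) / \<mu> \<le> n" "4 * real (b * b) / \<eta>a \<le> n" "2 / \<beta>a \<le> n" "2 / \<beta>c \<le> n" "2 / \<kappa>c \<le> n"
          using nn unfolding n0_def n_def by linarith+
        then have nb: "4 * real (M * M) \<le> \<mu> * n" "4 * real (b * b) \<le> \<eta>a * n" "2 \<le> \<beta>a * n" "2 \<le> \<beta>c * n" "2 \<le> \<kappa>c * n"
          using \<mu> \<eta>a \<beta>a \<beta>c \<kappa>c by (simp_all only: pos_divide_le_eq mult.commute)
        have nn': "nc \<le> card V" "na \<le> card V" "n1 \<le> card V" "n2 \<le> card V" "2 * np \<le> card V" "4 * d * d \<le> card V" "3 * w \<le> card V" "1 \<le> card V"
          using nn unfolding n0_def by linarith+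
        have n: "1 \<le> n" "0 \<le> n" using nn'(8) by (auto simp: n_def)
        have Vne: "V \<noteq> {}" using nn'(8) by auto
        have kg: "k_graph k (V, E)" using V E by (auto simp: k_graph_def)
        have rich: "rich k w c V E"
          unfolding c_def
        proof (rule rich_of_ordered_degree[OF V Vne nn'(6) E])
          show "\<rho> * real (card V) ^ (k - d) \<le> ordered_degree (k - d) E V S" if "S \<subseteq> V" "card S = d" for S
          proof -
            have "\<rho> * real (card V) ^ (k - d) \<le> (\<rho> + 2 * \<gamma>0) * real (card V) ^ (k - d)" using \<gamma>0 by (intro mult_right_mono) auto
            then show ?thesis using deg[OF that] by linarith
          qed
        qed (use d \<sigma> in \<open>auto simp: w_def\<close>)
        obtain Q where Q: "Q \<subseteq> V" "real (card Q) \<le> \<nu> * n"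
          "\<And>S. S \<in> tup (V - Q) w \<Longrightarrow> distinct S \<Longrightarrow> \<eta>a * n ^ b \<le> card {T \<in> tup V b. absorbs k l E off S T}"
          using abs[OF rich[unfolded w_def] nn'(2)] unfolding n_def w_def by blast
        define t where "t = nat \<lfloor>\<beta>a * n\<rfloor>"
        define tc where "tc = nat \<lfloor>\<beta>c * n\<rfloor>"
        have t: "\<beta>a * n / 2 \<le> t" "t \<le> \<beta>a * n" unfolding t_def using floor_half[OF nb(3)] by auto
        have tc: "\<beta>c * n / 2 \<le> tc" "tc \<le> \<beta>c * n" unfolding tc_def using floor_half[OF nb(4)] by auto
        have t1: "1 \<le> t"
        proof -
          have "1 \<le> real t" using t(1) nb(3) by linarith
          then show ?thesis by simp
        qed
        have \<kappa>at: "\<kappa>a * n \<le> \<eta>a * t / 8"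
        proof -
          have "\<eta>a * (\<beta>a * n / 2) \<le> \<eta>a * t" using t(1) \<eta>a by (intro mult_left_mono) auto
          then show ?thesis by (simp add: \<kappa>a_def algebra_simps)
        qed
        have \<kappa>ct: "\<kappa>c * n \<le> \<eta> * tc / 8"
        proof -
          have "\<eta> * (\<beta>c * n / 2) \<le> \<eta> * tc" using tc(1) \<eta> by (intro mult_left_mono) auto
          then show ?thesis by (simp add: \<kappa>c_def algebra_simps)
        qed
        have dist_list: "\<exists>S\<in>tup U j. distinct S" if U: "j \<le> card U" for U :: "nat set" and j
        proof -
          obtain U' where U': "U' \<subseteq> U" "card U' = j" "finite U'" using obtain_subset_with_card_n[OF U] by metis
          obtain S where "set S = U'" "distinct S" using finite_distinct_list[OF U'(3)] by blast
          then have "S \<in> tup U j" using U' distinct_card[of S] by (simp add: tup_iff)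
          then show ?thesis using \<open>distinct S\<close> by blast
        qed
        define I where "I = {S \<in> tup (V - Q) w. distinct S}"
        have finI: "finite I" unfolding I_def using finite_tup[of "V - Q" w] V by simp
        have Ine: "I \<noteq> {}"
        proof -
          have "real (card V) \<le> real (card (V - Q)) + real (card Q)" using card_Diff_subset[OF finite_subset[OF Q(1) V] Q(1)] by linarith
          moreover have "\<nu> * n \<le> 1 / 36 * n" using \<nu>1 n by (intro mult_right_mono) auto
          ultimately have "n \<le> real (card (V - Q)) + 1 / 36 * n" using Q(2) by (simp add: n_def)
          moreover have "3 * real w \<le> n" using nn'(7) unfolding n_def by linarith
          ultimately have "real w \<le> real (card (V - Q))" by linarith
          then have "w \<le> card (V - Q)" by linarith
          from dist_list[OF this] show ?thesis by (auto simp: I_def)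
        qed
        have cI: "real (card I) \<le> exp (\<eta>a * t / 8)"
        proof -
          have "card I \<le> card (tup V w)" using finite_tup[OF V] by (intro card_mono) (auto simp: I_def tup_iff)
          then have "real (card I) \<le> n ^ w" using card_tup[OF V] by (simp add: n_def flip: of_nat_power)
          also have "\<dots> \<le> exp (\<kappa>a * n)" unfolding n_def by (rule n1[OF nn'(3)])
          finally show ?thesis using \<kappa>at by (meson exp_le_cancel_iff order_trans)
        qed
        have smallA: "real (b * (card ({} :: nat set) + t * b) + b * b) \<le> \<eta>a / 2 * card V"
        proof -
          have "real (b * (t * b)) = t * real (b * b)" by (simp add: mult_ac)
          also have "\<dots> \<le> (\<beta>a * n) * real (b * b)" using t(2) by (intro mult_right_mono) auto
          also have "\<dots> = (\<beta>a * real (b * b)) * n" by (simp only: mult_ac)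
          also have "\<dots> \<le> \<eta>a / 4 * n" using \<beta>a(3) n by (intro mult_right_mono) auto
          finally have "real (b * (t * b)) + real (b * b) \<le> \<eta>a / 2 * n" using nb(2) by linarith
          then show ?thesis by (simp only: card.empty add_0 of_nat_add n_def)
        qed
        define Ab where "Ab S = {T \<in> tup V b. absorbs k l E off S T}" for S
        have Ab: "\<And>S. S \<in> I \<Longrightarrow> Ab S \<subseteq> tup V b" "\<And>S. S \<in> I \<Longrightarrow> \<eta>a * real (card V) ^ b \<le> card (Ab S)"
          using Q(3) by (auto simp: I_def Ab_def n_def)
        obtain Ts where Ts: "length Ts = t" "set Ts \<subseteq> (\<Union>S\<in>I. Ab S)" "distinct (concat Ts)"
          "\<And>S. S \<in> I \<Longrightarrow> \<eta>a * t / 8 \<le> length (filter (\<lambda>T. T \<in> Ab S) Ts)"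
          by (rule disjoint_selection[OF V Vne finI Ine \<eta>a Ab finite.emptyI smallA cI]) blast+
        have T: "T \<in> tup V b \<and> list_all (lpath k l E) (off T) \<and> mset (concat (off T)) = mset T" if T: "T \<in> set Ts" for T
        proof -
          obtain S where S: "T \<in> tup V b" "absorbs k l E off S T" using T Ts(2) by (auto simp: Ab_def)
          obtain segs where segs: "list_all2 (alike k l E) (off T) segs" using S(2) by (auto simp: absorbs_def)
          have "list_all (lpath k l E) (off T)" using segs by (auto simp: list_all2_conv_all_nth list_all_length alike_def)
          then show ?thesis using S by (auto simp: absorbs_def)
        qed
        have off: "list_all (lpath k l E) (off T) \<and> mset (concat (off T)) = mset T" if "T \<in> set Ts" for T using T[OF that] by blast
        have TsV: "set (concat Ts) \<subseteq> V"
        proof -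
          have "set T \<subseteq> V" if "T \<in> set Ts" for T using T[OF that] by (simp add: tup_iff)
          then show ?thesis by auto
        qed
        have Tsne: "[] \<notin> set Ts" "Ts \<noteq> []" using T[of "[]"] b Ts(1) t1 by (auto simp: tup_iff)
        have lTs: "length (concat Ts) = t * b" using length_concat_const[of Ts b] T Ts(1) by (simp add: tup_iff)
        define X where "X = t * b + card Q + tc"
        have X: "real X \<le> 3 * (\<nu> * n)"
        proof -
          have "t * real b \<le> \<beta>a * n * b" using t(2) by (intro mult_right_mono) auto
          also have "\<dots> = (\<beta>a * b) * n" by simp
          also have "\<dots> \<le> \<nu> * n" using \<beta>a(2) n by (intro mult_right_mono) auto
          finally have "real (t * b) \<le> \<nu> * n" by simp
          moreover have "real tc \<le> \<nu> * n" using tc(2) mult_right_mono[OF \<beta>c(2) n(2)] by linarith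
          ultimately show ?thesis using Q(2) by (simp only: X_def of_nat_add)
        qed
        have small: "real (3 * M * M * X + M * M) \<le> \<mu> / 2 * n"
        proof -
          have "real (3 * M * M * X) = 3 * real (M * M) * X" by simp
          also have "\<dots> \<le> 3 * real (M * M) * (3 * (\<nu> * n))" using X by (intro mult_left_mono) auto
          also have "\<dots> = (36 * real (M * M) * \<nu>) * n / 4" by (simp add: algebra_simps)
          also have "\<dots> = \<mu> * n / 4" by (simp only: \<nu>(2))
          finally show ?thesis using nb(1) by simp
        qed
        have lin: "a / 2 * n \<ge> \<mu> / 2 * n" if "\<mu> \<le> a" for a using that n by (intro mult_right_mono) auto
        have small2: "real (2 * M * M * X + M * M) \<le> a / 2 * card V" if "\<mu> \<le> a" for a
        proof -
          have "2 * M * M * X + M * M \<le> 3 * M * M * X + M * M" by simp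
          then have "real (2 * M * M * X + M * M) \<le> real (3 * M * M * X + M * M)" by (simp only: of_nat_le_iff)
          then show ?thesis using small lin[OF that] unfolding n_def by linarith
        qed
        have XX: "length (concat Ts) + card Q \<le> X" by (simp add: lTs X_def)
        have conV: "\<eta> * real (card V) ^ (m * (k - l) - l) \<le> card (conn k l V E m A B)"
          if "A \<in> tup V l" "B \<in> tup V l" "distinct A" "distinct B" for A B
          using con[OF rich nn'(1) that] by (simp add: w_def)
        have w1: "1 \<le> w" using l by (simp add: w_def)
        have Mb: "m * (k - l) - l \<le> M" using M(3) by (simp add: b0_def w_def)
        obtain cs us s ys where bb: "concat (map off Ts) @ cs = us @ [s]" "list_all (lpath k l E) cs"
          "list_all2 (\<lambda>(A, B) y. \<exists>m\<ge>1. hwalk k l E m (A @ y @ B)) (needs l us (take l s)) ys"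
          "distinct (concat (us @ [s]) @ concat ys)" "set (concat (us @ [s]) @ concat ys) \<subseteq> V"
          "Q \<subseteq> set (concat (us @ [s]))" "length (concat (us @ [s]) @ concat ys) \<le> 2 * M * X"
          by (rule absorbing_backbone[OF rich w1 c(1) l m \<eta> conV Ts(3) TsV Tsne off Q(1) XX M(2) Mb small2[OF \<mu>(3)] small2[OF \<mu>(4)]])
        define D where "D = set (concat (us @ [s]) @ concat ys)"
        have finD: "finite D" by (simp add: D_def)
        have cD: "card D \<le> 2 * M * X" unfolding D_def using card_length[of "concat (us @ [s]) @ concat ys"] bb(7) by linarith
        have tcX: "tc \<le> X" by (simp add: X_def)
        have usage: "real (a * (card D + tc * b0) + a * a) \<le> \<mu> / 2 * n" if "a \<le> M" for a
        proof -
          have "a * (card D + tc * b0) + a * a \<le> M * (2 * M * X + X * M) + M * M"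
            using that cD tcX M(3) by (intro add_mono mult_mono) auto
          also have "\<dots> = 3 * M * M * X + M * M" by (simp add: algebra_simps)
          finally have "real (a * (card D + tc * b0) + a * a) \<le> real (3 * M * M * X + M * M)" by (simp only: of_nat_le_iff)
          then show ?thesis using small by linarith
        qed
        define J where "J = {S \<in> tup V l. distinct S} \<times> {S \<in> tup V l. distinct S}"
        define An where "An p = conn k l V E m (fst p) (snd p)" for p
        have finJ: "finite J" by (simp add: J_def finite_tup V)
        have Jne: "J \<noteq> {}"
        proof -
          have "l \<le> w" using l by (simp add: w_def)
          then have "l \<le> card V" using nn'(7) by linarith
          from dist_list[OF this] show ?thesis by (auto simp: J_def)
        qed
        have cJ: "real (card J) \<le> exp (\<eta> * tc / 8)"
        proof -
          have "card {S \<in> tup V l. distinct S} \<le> card V ^ l" using card_mono[OF finite_tup[OF V], of "{S \<in> tup V l. distinct S}" l] card_tup[OF V] by auto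
          then have "card J \<le> card V ^ l * card V ^ l" unfolding J_def card_cartesian_product by (rule mult_le_mono) fact
          also have "\<dots> = card V ^ (2 * l)" by (simp add: mult_2 power_add)
          finally have "real (card J) \<le> real (card V ^ (2 * l))" by (simp only: of_nat_le_iff)
          also have "\<dots> \<le> exp (\<kappa>c * n)" using n2[OF nn'(4)] by (simp add: n_def)
          finally show ?thesis using \<kappa>ct by (meson exp_le_cancel_iff order_trans)
        qed
        have An: "\<And>p. p \<in> J \<Longrightarrow> An p \<subseteq> tup V b0" "\<And>p. p \<in> J \<Longrightarrow> \<eta> * real (card V) ^ b0 \<le> card (An p)"
          using conV conn_sub[of k l V E m] by (auto simp: An_def J_def b0_def w_def)
        have smallC: "real (b0 * (card D + tc * b0) + b0 * b0) \<le> \<eta> / 2 * card V"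
          using usage[OF M(3)] lin[OF \<mu>(4)] unfolding n_def by linarith
        obtain Rs where Rs: "length Rs = tc" "set Rs \<subseteq> (\<Union>p\<in>J. An p)" "distinct (concat Rs)" "set (concat Rs) \<inter> D = {}"
          "\<And>p. p \<in> J \<Longrightarrow> \<eta> * tc / 8 \<le> length (filter (\<lambda>R. R \<in> An p) Rs)"
          by (rule disjoint_selection[OF V Vne finJ Jne \<eta> An finD smallC cJ]) blast+
        have R: "R \<in> tup V b0" if "R \<in> set Rs" for R using that Rs(2) An(1) by blast
        have RsV: "set (concat Rs) \<subseteq> V"
        proof -
          have "set R \<subseteq> V" if "R \<in> set Rs" for R using R[OF that] by (simp add: tup_iff)
          then show ?thesis by auto
        qed
        have Rsne: "[] \<notin> set Rs" using R[of "[]"] b0 by (auto simp: tup_iff)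
        have lRs: "length (concat Rs) = tc * b0" using length_concat_const[of Rs b0] R Rs(1) by (simp add: tup_iff)
        define G where "G = D \<union> set (concat Rs)"
        define V' where "V' = V - D - set (concat Rs)"
        define E' where "E' = {e \<in> E. e \<subseteq> V'}"
        have G: "finite G" "G \<subseteq> V" "V' = V - G" using finD RsV bb(5) by (auto simp: G_def V'_def D_def)
        have cG: "card G \<le> card D + tc * b0"
          using card_Un_le[of D "set (concat Rs)"] card_length[of "concat Rs"] lRs unfolding G_def by linarith
        have bad: "r * card G + r * r \<le> r * (card D + tc * b0) + r * r" using cG by simp
        have half: "2 * card G \<le> card V"
        proof -
          have "real (1 * (card D + tc * b0) + 1 * 1) \<le> \<mu> / 2 * n" by (rule usage[OF M(1)])
          moreover have "\<mu> / 2 * n \<le> 1 / 2 * n" using \<mu>(2) n by (intro mult_right_mono) auto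
          moreover have "real (card G) \<le> real (card D + tc * b0)" using cG by (simp only: of_nat_le_iff)
          ultimately have "2 * real (card G) \<le> real (card V)" unfolding n_def mult_1 by linarith
          then show ?thesis by linarith
        qed
        have finV': "finite V'" "V' \<subseteq> V" using V G by auto
        have cV': "card V' = card V - card G" using card_Diff_subset[OF G(1,2)] by (simp add: G(3))
        have "np \<le> card V'" using cV' half nn'(5) by linarith
        have E'e: "e \<subseteq> V' \<and> card e = k" if "e \<in> E'" for e using that E by (auto simp: E'_def)
        \<comment> \<open>Deleting \<open>G\<close> destroys only tuples that are not fresh for
          \<open>G\<close>, a proportion of at most \<gamma>0 by the size of chain and
          reservoir.\<close>
        have deg': "(\<rho> + \<gamma>0) * real (card V') ^ r \<le> ordered_degree r E' V' S" if S: "S \<subseteq> V'" "card S = d" for S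
        proof -
          let ?B = "{ys \<in> tup V r. \<not> fresh G ys}"
          have "card V * card ?B \<le> (r * card G + r * r) * card V ^ r" by (rule card_not_fresh[OF V G(1)])
          then have "real (card V * card ?B) \<le> real ((r * card G + r * r) * card V ^ r)" by (simp only: of_nat_le_iff)
          then have "n * card ?B \<le> real (r * card G + r * r) * n ^ r" by (simp add: n_def)
          also have "\<dots> \<le> (\<gamma>0 * n) * n ^ r"
          proof (rule mult_right_mono)
            have "real (r * card G + r * r) \<le> real (r * (card D + tc * b0) + r * r)" using bad by (simp only: of_nat_le_iff)
            then have "real (r * card G + r * r) \<le> \<mu> / 2 * n" using usage[OF M(4)] by linarith
            moreover have "\<mu> / 2 * n \<le> \<gamma>0 * n" using \<mu>(1,5) n by (intro mult_right_mono) auto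
            ultimately show "real (r * card G + r * r) \<le> \<gamma>0 * n" by linarith
          qed (use n in simp)
          finally have "n * card ?B \<le> n * (\<gamma>0 * n ^ r)" by (simp only: mult_ac)
          then have B: "card ?B \<le> \<gamma>0 * n ^ r" using n by simp
          have "{ys \<in> tup V r. S \<union> set ys \<in> E} \<subseteq> {ys \<in> tup V' r. S \<union> set ys \<in> E'} \<union> ?B"
            using S(1) by (auto simp: fresh_def tup_iff E'_def G(3))
          then have "card {ys \<in> tup V r. S \<union> set ys \<in> E} \<le> card ({ys \<in> tup V' r. S \<union> set ys \<in> E'} \<union> ?B)"
            by (rule card_mono[rotated]) (simp add: finite_tup V finV')
          also have "\<dots> \<le> ordered_degree r E' V' S + card ?B" unfolding ordered_degree_def by (rule card_Un_le)
          finally have "real (ordered_degree r E V S) \<le> ordered_degree r E' V' S + real (card ?B)" by (simp add: ordered_degree_def flip: of_nat_add)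
          moreover have "(\<rho> + 2 * \<gamma>0) * n ^ r \<le> ordered_degree r E V S" unfolding n_def r_def by (rule deg) (use S finV' in auto)
          ultimately have "(\<rho> + \<gamma>0) * n ^ r \<le> ordered_degree r E' V' S" using B by (simp add: algebra_simps)
          moreover have "(\<rho> + \<gamma>0) * real (card V') ^ r \<le> (\<rho> + \<gamma>0) * n ^ r"
            using \<sigma> \<gamma>0 card_mono[OF V finV'(2)] by (intro mult_left_mono power_mono) (auto simp: n_def)
          ultimately show ?thesis by linarith
        qed
        obtain ps where ps: "\<forall>p\<in>set ps. hwalk k l E' (2 * P) p" "distinct (concat ps)" "set (concat ps) \<subseteq> V'"
          "real (card (V' - set (concat ps))) \<le> \<kappa>a / 2 * card V'"
          using tiling[OF finV'(1) \<open>np \<le> card V'\<close> E'e deg'[unfolded r_def]] by blast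
        have lps: "list_all (lpath k l E) ps"
          unfolding list_all_iff lpath_def
        proof (intro ballI conjI exI)
          fix p assume p: "p \<in> set ps"
          show "distinct p" using ps(2) p by (auto simp: distinct_concat_iff)
          show "1 \<le> 2 * P" using P1(1) by simp
          show "hwalk k l E (2 * P) p" using ps(1) p by (auto simp: hwalk_def E'_def)
        qed
        \<comment> \<open>A path with \<open>2 * P\<close> edges has at least \<open>2 * P\<close>
          vertices, so at most n / (2 * P) disjoint ones fit.\<close>
        have nps: "real (length ps) \<le> \<kappa>c / 2 * n"
        proof -
          have "length ps * (2 * P) \<le> length ps * (2 * P * w + l)" using w1 by (intro mult_le_mono2) (simp add: trans_le_add1)
          also have "\<dots> = length (concat ps)"
            by (rule length_concat_const[symmetric]) (use ps(1) in \<open>auto simp: hwalk_def w_def\<close>)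
          also have "\<dots> = card (set (concat ps))" using ps(2) by (simp only: distinct_card)
          also have "\<dots> \<le> card V" by (rule card_mono[OF V]) (use ps(3) finV' in blast)
          finally have "real (length ps * (2 * P)) \<le> n" unfolding n_def by (simp only: of_nat_le_iff)
          then have "(real (length ps) * (2 * P)) * \<kappa>c \<le> n * \<kappa>c" using \<kappa>c by (intro mult_right_mono) auto
          moreover have "real (length ps) * 2 * 1 \<le> real (length ps) * 2 * (P * \<kappa>c)" using P1(2) by (intro mult_left_mono) auto
          ultimately show ?thesis by (simp add: algebra_simps)
        qed
        show "has_hamilton_l_cycle k l (V, E)"
        proof (rule close_and_absorb[OF kg l dvd _ m Ts(3) Tsne(1) off bb(1,2,3) D_def bb(4) _ _ Rs(3,4) RsV Rsne _ lps ps(2)])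
          show "3 * (k - l) \<le> card V" using nn'(7) by (simp add: w_def)
          show "D \<subseteq> V" using bb(5) by (simp only: D_def)
          show "Q \<subseteq> D" using bb(6) by (auto simp: D_def)
          show "set (concat ps) \<subseteq> V - D - set (concat Rs)" using ps(3) by (simp only: V'_def)
          show "Suc (length ps) \<le> length (filter (\<lambda>R. R \<in> conn k l V E m A B) Rs)"
            if AB: "A \<in> tup V l" "B \<in> tup V l" "distinct A" "distinct B" for A B
          proof -
            have "(A, B) \<in> J" using AB by (simp add: J_def)
            from Rs(5)[OF this] have "\<eta> * tc / 8 \<le> length (filter (\<lambda>R. R \<in> conn k l V E m A B) Rs)" by (simp add: An_def)
            then have "1 + real (length ps) \<le> length (filter (\<lambda>R. R \<in> conn k l V E m A B) Rs)"
              using nps nb(5) \<kappa>ct by linarith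
            then show ?thesis by linarith
          qed
          show "card (V - D - set (concat Rs) - set (concat ps)) + length (concat Rs) \<le> length (filter (\<lambda>T. absorbs k l E off S T) Ts)"
            if S: "distinct S" "S \<in> tup (V - Q) (k - l)" for S
          proof -
            have "S \<in> I" using S by (simp add: I_def w_def)
            from Ts(4)[OF this] have "\<eta>a * t / 8 \<le> length (filter (\<lambda>T. T \<in> Ab S) Ts)" .
            also have "filter (\<lambda>T. T \<in> Ab S) Ts = filter (\<lambda>T. absorbs k l E off S T) Ts"
              by (rule filter_cong) (use T in \<open>auto simp: Ab_def\<close>)
            finally have f: "\<kappa>a * n \<le> length (filter (\<lambda>T. absorbs k l E off S T) Ts)" using \<kappa>at by linarith
            have "real tc * real b0 \<le> (\<beta>c * n) * M" using tc(2) M(3) \<beta>c(1) n by (intro mult_mono) auto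
            also have "\<dots> = (\<beta>c * M) * n" by simp
            also have "\<dots> \<le> \<kappa>a / 2 * n" using \<beta>c(3) n by (intro mult_right_mono) auto
            finally have "real (length (concat Rs)) \<le> \<kappa>a / 2 * n" by (simp add: lRs)
            moreover have "real (card V') \<le> n" using card_mono[OF V finV'(2)] by (simp add: n_def)
            then have "\<kappa>a / 2 * card V' \<le> \<kappa>a / 2 * n" using \<kappa>a by (intro mult_left_mono) auto
            ultimately have "real (card (V' - set (concat ps)) + length (concat Rs)) \<le> real (length (filter (\<lambda>T. absorbs k l E off S T) Ts))"
              using ps(4) f by linarith
            then show ?thesis unfolding V'_def by (simp only: of_nat_le_iff)
          qed
        qed
      qed
    qed
  qed
qed

section \<open>Comparison of the densities\<close>

lemma card_orderings:
  assumes "finite \<T>" "\<And>T. T \<in> \<T> \<Longrightarrow> finite T \<and> card T = r"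
  shows "card {ys. distinct ys \<and> set ys \<in> \<T>} = fact r * card \<T>"
proof -
  have c: "card {ys. distinct ys \<and> set ys = T} = fact r" and f: "finite {ys. distinct ys \<and> set ys = T}" if "T \<in> \<T>" for T
  proof -
    have T: "finite T" "card T = r" using assms(2)[OF that] by auto
    have "{ys. distinct ys \<and> set ys = T} = {ys. length ys = r \<and> distinct ys \<and> set ys \<subseteq> T}"
      using T by (auto simp: distinct_card) (metis card_subset_eq distinct_card subsetD)
    moreover have "card {ys. length ys = r \<and> distinct ys \<and> set ys \<subseteq> T} = fact r"
      using card_lists_distinct_length_eq[OF T(1), of r] T(2) by (simp add: fact_prod)
    ultimately show "card {ys. distinct ys \<and> set ys = T} = fact r" by simp
    then show "finite {ys. distinct ys \<and> set ys = T}" using card.infinite fact_nonzero by metis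
  qed
  have "{ys. distinct ys \<and> set ys \<in> \<T>} = (\<Union>T\<in>\<T>. {ys. distinct ys \<and> set ys = T})" by auto
  also have "card \<dots> = (\<Sum>T\<in>\<T>. card {ys. distinct ys \<and> set ys = T})"
    using assms(1) f by (intro card_UN_disjoint) auto
  finally show ?thesis using c by simp
qed

lemma hdegree_le: "finite (verts H) \<Longrightarrow> hdegree k d H S \<le> card (verts H) choose (k - d)"
  unfolding hdegree_def n_subsets[symmetric] by (rule card_mono) (auto intro: finite_subset[of _ "Pow (verts H)"])

text \<open>Change of normalisation from r-sets over binomial coefficients to r-tuples over powers:
  an r-set has \<open>fact r\<close> orderings, and distinct tuples make up a proportion of at least
  1 - \<theta> of all.\<close>

lemma ordered_degree_ge_hdegree:
  fixes \<theta> a :: real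
  assumes V: "finite V" and \<theta>: "real ((k - d) * (k - d)) \<le> \<theta> * card V" "V \<noteq> {}"
    and a: "0 \<le> a" "a * real (card V choose (k - d)) \<le> hdegree k d (V, E) S"
  shows "a * (1 - \<theta>) * real (card V) ^ (k - d) \<le> ordered_degree (k - d) E V S"
proof -
  define r where "r = k - d"
  let ?D = "{T. T \<subseteq> V \<and> card T = r}" and ?N = "{T. T \<subseteq> V \<and> card T = r \<and> T \<union> S \<in> E}"
  have fin: "finite ?D" "finite ?N" using V by (auto intro: finite_subset[of _ "Pow V"])
  have "(1 - \<theta>) * real (card V) ^ r \<le> card {xs \<in> tup V r. fresh {} xs}"
    by (rule card_fresh_ge[OF V subset_refl]) (use \<theta> card_tup[OF V] in \<open>auto simp: r_def\<close>)
  also have "{xs \<in> tup V r. fresh {} xs} = {ys. distinct ys \<and> set ys \<in> ?D}"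
    by (auto simp: tup_iff fresh_def distinct_card)
  also have "card \<dots> = fact r * card ?D" by (rule card_orderings) (use fin V in \<open>auto intro: finite_subset\<close>)
  also have "card ?D = card V choose r" by (rule n_subsets[OF V])
  finally have "a * ((1 - \<theta>) * real (card V) ^ r) \<le> a * real (fact r * (card V choose r))" by (rule mult_left_mono[OF _ a(1)])
  also have "\<dots> = fact r * (a * real (card V choose r))" by simp
  also have "\<dots> \<le> fact r * real (hdegree k d (V, E) S)" using a(2) by (intro mult_left_mono) (auto simp: r_def)
  also have "hdegree k d (V, E) S = card ?N" by (simp add: hdegree_def r_def)
  also have "fact r * real (card ?N) = real (card {ys. distinct ys \<and> set ys \<in> ?N})"
    by (subst card_orderings[of _ r]) (use fin V in \<open>auto intro: finite_subset\<close>)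
  also have "\<dots> \<le> ordered_degree r E V S"
    unfolding ordered_degree_def of_nat_le_iff
  proof (rule card_mono)
    show "finite {ys \<in> tup V r. S \<union> set ys \<in> E}" using finite_tup[OF V] by simp
  qed (auto simp: tup_iff distinct_card Un_commute)
  finally show ?thesis by (simp add: r_def mult.assoc)
qed

lemma t_density_nonneg: "0 \<le> t_density k d l"
  unfolding t_density_def by (intro le_Limsup always_eventually allI) auto

text \<open>The outer limit provides an error \<epsilon>' \<le> \<epsilon> for which the inner limit
  superior is below \<tau>, and a tiling with error \<epsilon>' also has error at most
  \<epsilon>.\<close>

lemma tilable_above_t_density:
  assumes \<tau>: "t_density k d l < ereal \<tau>" and \<epsilon>: "0 < \<epsilon>" and d: "d < k"
  shows "\<exists>m\<ge>m0. tilable k d l \<tau> \<epsilon> m"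
proof -
  have "eventually (\<lambda>\<epsilon>. limsup (\<lambda>n. ereal (real (t_threshold d l k n \<epsilon>) / real (n choose (k - d)))) < ereal \<tau>) (at_right 0)"
    using \<tau> unfolding t_density_def by (rule Limsup_lessD)
  then obtain b where b: "0 < b" "\<And>\<epsilon>. 0 < \<epsilon> \<Longrightarrow> \<epsilon> < b \<Longrightarrow> limsup (\<lambda>n. ereal (real (t_threshold d l k n \<epsilon>) / real (n choose (k - d)))) < ereal \<tau>"
    unfolding eventually_at_right_field by blast
  define \<epsilon>' where "\<epsilon>' = min \<epsilon> (b / 2)"
  have \<epsilon>': "0 < \<epsilon>'" "\<epsilon>' < b" "\<epsilon>' \<le> \<epsilon>" using \<epsilon> b by (auto simp: \<epsilon>'_def)
  obtain m1 where m1: "\<And>n. m1 \<le> n \<Longrightarrow> real (t_threshold d l k n \<epsilon>') / real (n choose (k - d)) < \<tau>"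
    using Limsup_lessD[OF b(2)[OF \<epsilon>'(1,2)]] unfolding eventually_sequentially by auto
  define m where "m = m0 + m1 + k"
  let ?P = "\<lambda>t. \<forall>H :: nat hypergraph. k_graph k H \<longrightarrow> card (verts H) = m \<longrightarrow> min_degree k d H \<ge> t \<longrightarrow>
        (\<exists>\<T>. Y_tiling k (2 * l) H \<T> \<and> real (card (verts H - (\<Union>F\<in>\<T>. verts F))) \<le> \<epsilon>' * real m)"
  \<comment> \<open>No hypergraph on m \<ge> k vertices has this minimum degree, so the set whose
    least element defines the threshold is nonempty and the threshold itself has the tiling
    property.\<close>
  have "?P (Suc (m choose (k - d)))"
  proof (intro allI impI)
    fix H :: "nat hypergraph"
    assume H: "k_graph k H" "card (verts H) = m" "min_degree k d H \<ge> Suc (m choose (k - d))"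
    have fin: "finite (verts H)" using H(1) by (simp add: k_graph_def)
    have "d \<le> card (verts H)" using d by (simp add: H(2) m_def)
    then obtain S where S: "S \<subseteq> verts H" "card S = d" using obtain_subset_with_card_n by metis
    show "\<exists>\<T>. Y_tiling k (2 * l) H \<T> \<and> real (card (verts H - (\<Union>F\<in>\<T>. verts F))) \<le> \<epsilon>' * real m"
      using min_degree_le[OF fin S, of k] hdegree_le[OF fin, of k d S] H(2,3) by simp
  qed
  then have thr: "?P (t_threshold d l k m \<epsilon>')" unfolding t_threshold_def by (rule LeastI)
  have "tilable k d l \<tau> \<epsilon> m"
    unfolding tilable_def
  proof (intro allI impI)
    fix H :: "nat hypergraph"
    assume H: "k_graph k H" "card (verts H) = m" "\<tau> * real (m choose (k - d)) \<le> real (min_degree k d H)"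
    have "0 < m choose (k - d)" by (simp add: m_def)
    then have "real (t_threshold d l k m \<epsilon>') < \<tau> * real (m choose (k - d))"
      using m1[of m] by (simp add: m_def pos_divide_less_eq)
    then have "t_threshold d l k m \<epsilon>' \<le> min_degree k d H" using H(3) by linarith
    then obtain \<T> where "Y_tiling k (2 * l) H \<T>" "real (card (verts H - (\<Union>F\<in>\<T>. verts F))) \<le> \<epsilon>' * real m"
      using thr H(1,2) by blast
    moreover have "\<epsilon>' * real m \<le> \<epsilon> * real m" using \<epsilon>'(3) by (rule mult_right_mono) simp
    ultimately show "\<exists>\<T>. Y_tiling k (2 * l) H \<T> \<and> real (card (verts H - (\<Union>F\<in>\<T>. verts F))) \<le> \<epsilon> * real m"
      using order_trans by blast
  qed
  then show ?thesis by (intro exI[of _ m]) (simp add: m_def)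
qed

text \<open>With \<rho> = \<tau> + 2 * g and \<sigma> = \<gamma>0 = g, tilability is required at
  density \<rho> - 2 * g = \<tau>, and ordered degrees of density \<tau> + 4 * g. The remaining 2 *
  g pays for the change of normalisation, which determines \<theta>.\<close>

lemma h_threshold_le:
  fixes \<tau> g :: real
  assumes l: "1 \<le> l" "2 * l < k" and d: "k - l \<le> d" "d < k" and g: "0 < g" "0 \<le> \<tau>"
    and \<tau>: "t_density k d l < ereal \<tau>"
  obtains n0 where "\<And>n. n0 \<le> n \<Longrightarrow> k - l dvd n \<Longrightarrow> h_threshold d l k n \<le> nat \<lceil>(\<tau> + 6 * g) * real (n choose (k - d))\<rceil>"
proof -
  define a where "a = \<tau> + 6 * g"
  have a: "0 < a" using g by (simp add: a_def)
  have "\<exists>n0. \<forall>n H. n0 \<le> n \<longrightarrow> k - l dvd n \<longrightarrow> k_graph k (H :: nat hypergraph) \<longrightarrow> card (verts H) = n \<longrightarrow>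
    nat \<lceil>a * real (n choose (k - d))\<rceil> \<le> min_degree k d H \<longrightarrow> has_hamilton_l_cycle k l H"
  proof (cases "\<tau> + 2 * g \<le> 1")
    case True
    define \<theta> where "\<theta> = 2 * g / a"
    have \<theta>: "0 < \<theta>" "a * (1 - \<theta>) = \<tau> + 2 * g + 2 * g" using g a by (auto simp: \<theta>_def a_def field_simps)
    have til: "\<exists>m\<ge>m0. tilable k d l (\<tau> + 2 * g - 2 * g) \<epsilon> m" if "0 < \<epsilon>" for \<epsilon> m0
      using tilable_above_t_density[OF \<tau> that d(2)] by simp
    have gt: "g \<le> \<tau> + 2 * g" using g by simp
    show ?thesis
    proof (rule hamilton_ordered[OF l d g(1) gt True til g(1)])
      fix n0 assume n0: "\<And>(V :: nat set) E. finite V \<Longrightarrow> n0 \<le> card V \<Longrightarrow> k - l dvd card V \<Longrightarrow> (\<And>e. e \<in> E \<Longrightarrow> e \<subseteq> V \<and> card e = k) \<Longrightarrow>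
        (\<And>S. S \<subseteq> V \<Longrightarrow> card S = d \<Longrightarrow> (\<tau> + 2 * g + 2 * g) * real (card V) ^ (k - d) \<le> ordered_degree (k - d) E V S) \<Longrightarrow>
        has_hamilton_l_cycle k l (V, E)"
      show ?thesis
      proof (intro exI[of _ "n0 + nat \<lceil>real ((k - d) * (k - d)) / \<theta>\<rceil> + 1"] allI impI)
        fix n and H :: "nat hypergraph"
        assume n: "n0 + nat \<lceil>real ((k - d) * (k - d)) / \<theta>\<rceil> + 1 \<le> n" "k - l dvd n"
          and H: "k_graph k H" "card (verts H) = n" "nat \<lceil>a * real (n choose (k - d))\<rceil> \<le> min_degree k d H"
        obtain V E where VE: "H = (V, E)" by (cases H)
        have V: "finite V" "card V = n" "\<And>e. e \<in> E \<Longrightarrow> e \<subseteq> V \<and> card e = k" using H by (auto simp: VE k_graph_def)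
        have "real ((k - d) * (k - d)) / \<theta> \<le> n" using n(1) by linarith
        then have small: "real ((k - d) * (k - d)) \<le> \<theta> * card V" using \<theta>(1) by (simp add: V(2) pos_divide_le_eq mult.commute)
        have Vne: "V \<noteq> {}" using n(1) V(2) by auto
        show "has_hamilton_l_cycle k l H"
          unfolding VE
        proof (rule n0[OF V(1) _ _ V(3)])
          show "n0 \<le> card V" "k - l dvd card V" using n by (auto simp: V(2))
          fix S assume S: "S \<subseteq> V" "card S = d"
          have "min_degree k d H \<le> hdegree k d H S" by (rule min_degree_le) (use S V(1) in \<open>auto simp: VE\<close>)
          then have "a * real (card V choose (k - d)) \<le> hdegree k d (V, E) S" using H(3) unfolding VE V(2) by linarith
          from ordered_degree_ge_hdegree[OF V(1) small Vne less_imp_le[OF a] this]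
          show "(\<tau> + 2 * g + 2 * g) * real (card V) ^ (k - d) \<le> ordered_degree (k - d) E V S" unfolding \<theta>(2) .
        qed
      qed
    qed
  next
    \<comment> \<open>Here a > 1, and no hypergraph on at least \<open>k\<close> vertices has such a
      minimum degree.\<close>
    case False
    show ?thesis
    proof (intro exI[of _ k] allI impI)
      fix n and H :: "nat hypergraph"
      assume n: "k \<le> n" and H: "k_graph k H" "card (verts H) = n" "nat \<lceil>a * real (n choose (k - d))\<rceil> \<le> min_degree k d H"
      have fin: "finite (verts H)" using H(1) by (simp add: k_graph_def)
      have "d \<le> card (verts H)" using n d by (simp add: H(2))
      then obtain S where S: "S \<subseteq> verts H" "card S = d" using obtain_subset_with_card_n by metis
      have C: "0 < n choose (k - d)" using n by simp
      have "a * real (n choose (k - d)) \<le> min_degree k d H" using H(3) by linarith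
      also have "min_degree k d H \<le> n choose (k - d)"
        using min_degree_le[OF fin S, of k] hdegree_le[OF fin, of k d S] H(2) by simp
      finally have "a * real (n choose (k - d)) \<le> 1 * real (n choose (k - d))" by simp
      then have "a \<le> 1" using C by (simp only: mult_le_cancel_right_pos of_nat_0_less_iff)
      then show "has_hamilton_l_cycle k l H" using False g by (simp add: a_def)
    qed
  qed
  then obtain n0 where n0: "\<And>n H. n0 \<le> n \<Longrightarrow> k - l dvd n \<Longrightarrow> k_graph k (H :: nat hypergraph) \<Longrightarrow> card (verts H) = n \<Longrightarrow>
    nat \<lceil>a * real (n choose (k - d))\<rceil> \<le> min_degree k d H \<Longrightarrow> has_hamilton_l_cycle k l H" by blast
  show ?thesis
  proof (rule that[of n0])
    fix n assume "n0 \<le> n" "k - l dvd n"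
    then show "h_threshold d l k n \<le> nat \<lceil>(\<tau> + 6 * g) * real (n choose (k - d))\<rceil>"
      unfolding h_threshold_def a_def[symmetric] by (intro Least_le allI impI) (rule n0)
  qed
qed

theorem theorem1p8:
  fixes k l d :: nat
  assumes "k \<ge> 3" and "1 \<le> l" and "real l < real k / 2"
    and "k - l \<le> d" and "d \<le> k - 1"
  shows "h_density d l k \<le> t_density k d l"
proof (rule dense_ge)
  have l: "2 * l < k" and d: "d < k" using assms by linarith+
  fix x assume x: "t_density k d l < x"
  show "h_density d l k \<le> x"
  proof (cases x)
    case (real \<tau>1)
    obtain y where y: "t_density k d l < y" "y < x" using dense[OF x] by blast
    have "0 \<le> y" "y \<noteq> \<infinity>" using y t_density_nonneg[of k d l] by auto
    then obtain \<tau> where \<tau>: "y = ereal \<tau>" "0 \<le> \<tau>" by (cases y) auto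
    \<comment> \<open>Six parts of the gap go into \<open>h_threshold_le\<close>; the seventh
      absorbs rounding up to an integer, once g * C \<ge> 1.\<close>
    define g where "g = (\<tau>1 - \<tau>) / 7"
    have "\<tau> < \<tau>1" using y(2) by (simp add: real \<tau>(1))
    then have g: "0 < g" "\<tau>1 = \<tau> + 7 * g" by (auto simp: g_def field_simps)
    obtain n0 where n0: "\<And>n. n0 \<le> n \<Longrightarrow> k - l dvd n \<Longrightarrow> h_threshold d l k n \<le> nat \<lceil>(\<tau> + 6 * g) * real (n choose (k - d))\<rceil>"
      using h_threshold_le[OF assms(2) l assms(4) d g(1) \<tau>(2) y(1)[unfolded \<tau>(1)]] by blast
    have "real (h_threshold d l k n) / real (n choose (k - d)) \<le> \<tau>1"
      if n: "n0 + k + nat \<lceil>k / g\<rceil> \<le> n" "k - l dvd n" for n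
    proof -
      define C where "C = real (n choose (k - d))"
      have r: "1 \<le> k - d" "k - d \<le> n" using d n(1) by auto
      have "k / g \<le> n" using n(1) by linarith
      \<comment> \<open>As k - d \<ge> 1, the binomial coefficient is at least n / k and hence
        eventually exceeds 1 / g.\<close>
      then have "1 / g \<le> n / k" using assms(1) g(1) by (simp add: field_simps)
      also have "n / k \<le> n / real (k - d)" using r by (intro divide_left_mono) auto
      also have "\<dots> = (n / real (k - d)) ^ 1" by simp
      also have "\<dots> \<le> (n / real (k - d)) ^ (k - d)" using r by (intro power_increasing) auto
      also have "\<dots> \<le> C" unfolding C_def by (rule binomial_ge_n_over_k_pow_k[OF r(2)])
      finally have C: "1 / g \<le> C" .
      then have C0: "0 < C" using g(1) by (meson divide_pos_pos less_le_trans zero_less_one)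
      have "1 \<le> g * C" using C g(1) by (simp add: pos_divide_le_eq mult.commute)
      have "h_threshold d l k n \<le> nat \<lceil>(\<tau> + 6 * g) * C\<rceil>" unfolding C_def by (rule n0) (use n in auto)
      moreover have "0 \<le> (\<tau> + 6 * g) * C" using \<tau>(2) g(1) C0 by simp
      ultimately have "real (h_threshold d l k n) \<le> (\<tau> + 6 * g) * C + 1" by linarith
      also have "\<dots> \<le> \<tau>1 * C" using \<open>1 \<le> g * C\<close> by (simp add: g(2) algebra_simps)
      finally show ?thesis using C0 by (simp add: C_def[symmetric] pos_divide_le_eq)
    qed
    then have "eventually (\<lambda>n. ereal (real (h_threshold d l k n) / real (n choose (k - d))) \<le> x) (inf sequentially (principal {n. (k - l) dvd n}))"
      unfolding eventually_inf_principal eventually_sequentially real by auto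
    then show ?thesis unfolding h_density_def by (rule Limsup_bounded)
  next
    case MInf
    then show ?thesis using x by simp
  qed simp
qed

end
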